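(* Let $\mathcal M=Q[1]\oplus B^*[2]$ be a split Lie $2$-algebroid over $M$ with homological vector field $\mathcal Q$, and let $\nabla$ and $\nabla'$ be two pairs of $TM$-connections on the vector bundles $Q$ and $B^*$, with corresponding adjoint representations $\mathrm{ad}_\nabla$ and $\mathrm{ad}_{\nabla'}$. Then the difference of the two pairs of connections induces an isomorphism of representations up to homotopy $\mu\colon\mathrm{ad}_\nabla\to\mathrm{ad}_{\nabla'}$, given by $\mu=\mathrm{id}\oplus(\nabla'-\nabla)$; that is, $\mu$ is the $\mathcal C^\infty(\mathcal M)$-linear map $\mu=\mu_0+\mu_1+\mu_0^b$ with $$\mu_0=\mathrm{id},\qquad \mu_1(q)X=\nabla'_Xq-\nabla_Xq,\qquad \mu_0^b(\beta)X=\nabla'_X\beta-\nabla_X\beta$$ for $X\in\mathfrak X(M)$, $q\in\Gamma(Q)$, $\beta\in\Gamma(B^* )$ (and $\mu_1,\mu_0^b$ vanish on $\Gamma(Q)\oplus\Gamma(B^* )$).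
   Context: A split Lie $2$-algebroid $Q[1]\oplus B^*[2]$ over $M$ consists of vector bundles $Q,B\to M$, a bundle map $\rho_Q\colon Q\to TM$, a bundle map $\ell\colon B^*\to Q$, a skew-symmetric dull bracket $[\cdot,\cdot]$ on $\Gamma(Q)$ (i.e. $\mathbb R$-bilinear, $[q_1,fq_2]=f[q_1,q_2]+(\rho_Q(q_1)f)q_2$, $\rho_Q[q_1,q_2]=[\rho_Q(q_1),\rho_Q(q_2)]$), a linear $Q$-connection $\nabla^B$ on $B$ (dual $\nabla^{B*}$ on $B^*$), and $\omega\in\Omega^3(Q,B^* )=\Gamma(\wedge^3Q^*\otimes B^* )$, such that: (i) $\nabla^{B*}_{\ell(\beta_1)}\beta_2+\nabla^{B*}_{\ell(\beta_2)}\beta_1=0$; (ii) $[q,\ell(\beta)]=\ell(\nabla^{B*}_q\beta)$; (iii) $[q_1,[q_2,q_3]]-[[q_1,q_2],q_3]-[q_2,[q_1,q_3]]=\ell(\omega(q_1,q_2,q_3))$; (iv) $R_{\nabla^{B*}}(q_1,q_2)\beta=-\omega(q_1,q_2,\ell(\beta))$; (v) $\mathrm d_{\nabla^{B*}}\omega=0$. Functions: $\mathcal C^\infty(\mathcal M)=\Gamma(\wedge^\bullet Q^*\otimes S^\bullet B)$, $Q^*$ in degree $1$, $B$ in degree $2$; homological vector field: $\mathcal Q(f)=\rho_Q^*\mathrm df$, $\mathcal Q(\tau)=\mathrm d_Q\tau+\ell^*\tau$, $\mathcal Q(b)=\mathrm d_{\nabla^B} b-\langle\omega,b\rangle$ for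 $f\in C^\infty(M)$, $\tau\in\Gamma(Q^* )$, $b\in\Gamma(B)$. A representation up to homotopy on a graded vector bundle $\underline E$ is a degree $1$ operator $\mathcal D$ on $\mathcal C^\infty(\mathcal M)\otimes_{C^\infty(M)}\Gamma(\underline E)$ with $\mathcal D^2=0$ and $\mathcal D(\xi\eta)=\mathcal Q(\xi)\eta+(-1)^{|\xi|}\xi\mathcal D(\eta)$; a morphism is a degree preserving $\mathcal C^\infty(\mathcal M)$-linear map commuting with the operators. Adjoint representation: given $TM$-connections $\nabla$ on $Q$ and $B^*$, let $\mu_\nabla\colon\mathcal C^\infty(\mathcal M)\otimes\Gamma(TM[0]\oplus Q[1]\oplus B^*[2])\to\mathfrak X(\mathcal M)$ be the isomorphism of $\mathcal C^\infty(\mathcal M)$-modules (sections of $E[k]$ have degree $-k$; $\mathfrak X(\mathcal M)$ is the module of graded derivations of $\mathcal C^\infty(\mathcal M)$) given by $\beta\mapsto\hat\beta$, $q\mapsto\hat q$, $X\mapsto\nabla_X$. Here $\hat\beta$ (degree $-2$) vanishes on $C^\infty(M)$ and $\Gamma(Q^* )$ with $\hat\beta(b)=\langle\beta,b\rangle$; $\hat q$ (degree $-1$) vanishes on $C^\infty(M)$ and $\Gamma(B)$ with $\hat q(\tau)=\langle\tau,q\rangle$; $\nabla_X$ (degree $0$) acts as $X$ on $C^\infty(M)$ and by the dual connections on $\Gamma(Q^* )$ and $\Gamma(B)$. Then $\mathrm{ad}_\nabla$ is $\mathcal C^\infty(\mathcal M)\otimes\Gamma(TM[0]\oplus Q[1]\oplus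 B^*[2])$ with operator $\mathcal D_{\mathrm{ad}_\nabla}=\mu_\nabla^{-1}\circ[\mathcal Q,\cdot]\circ\mu_\nabla$. In the claim, $\mu_1\in\Omega^1(Q,\mathrm{Hom}(TM,Q))$ and $\mu_0^b\in\Gamma(B\otimes\mathrm{Hom}(TM,B^* ))$; so $\mu(X)=X+\mu_1(\cdot)X+\mu_0^b(\cdot)X$.
   Formalization: With the printed sign in condition (iii), the given formulas for Q yield Q² ≠ 0 whenever ℓω ≠ 0; the formal statement therefore requires Q² = 0 explicitly and admits (iii) with either sign ±ℓ(ω(q1,q2,q3)), which covers the consistent convention. *)

theory Defs
  imports "HOL-Analysis.Analysis" "HOL-Library.Function_Algebras"
begin

text \<open>Functions with values in a real vector space form a real vector space. Together with
  the theory \<open>Function_Algebras\<close> this makes \<open>+\<close>, \<open>-\<close>, \<open>0\<close>, sums and real multiples of smooth functions,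
  sections, forms and operators pointwise operations.\<close>

instantiation "fun" :: (type, real_vector) real_vector
begin

definition scaleR_fun :: "real \<Rightarrow> ('a \<Rightarrow> 'b) \<Rightarrow> 'a \<Rightarrow> 'b"
  where "scaleR_fun r f = (\<lambda>x. r *\<^sub>R f x)"

instance
  by standard (auto simp: scaleR_fun_def fun_eq_iff scaleR_add_right scaleR_add_left)

end

definition fscale :: "('m \<Rightarrow> real) \<Rightarrow> ('m \<Rightarrow> 'e::real_vector) \<Rightarrow> 'm \<Rightarrow> 'e"  (infixr "\<odot>" 75)
  where "f \<odot> s = (\<lambda>x. f x *\<^sub>R s x)"


section \<open>Smooth manifolds\<close>

text \<open>The model space of dimension \<open>n\<close> consists of the real sequences vanishing from index \<open>n\<close> on, with
  the subspace topology of the product topology (which is the Euclidean one). Unlike the types of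
  class \<open>euclidean_space\<close>, this includes dimension \<open>0\<close>.\<close>

definition model_space :: "nat \<Rightarrow> (nat \<Rightarrow> real) set"
  where "model_space n = {v. \<forall>i\<ge>n. v i = 0}"

primrec Ck_on :: "nat \<Rightarrow> nat \<Rightarrow> (nat \<Rightarrow> real) set \<Rightarrow> ((nat \<Rightarrow> real) \<Rightarrow> real) \<Rightarrow> bool" where
  "Ck_on n 0 V g \<longleftrightarrow> continuous_on V g"
| "Ck_on n (Suc k) V g \<longleftrightarrow> continuous_on V g \<and>
     (\<forall>i<n. \<exists>h. Ck_on n k V h \<and>
        (\<forall>v\<in>V. ((\<lambda>t. g (v(i := t))) has_real_derivative h v) (at (v i))))"

definition Cinf_on :: "nat \<Rightarrow> (nat \<Rightarrow> real) set \<Rightarrow> ((nat \<Rightarrow> real) \<Rightarrow> real) \<Rightarrow> bool"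
  where "Cinf_on n V g \<longleftrightarrow> (\<forall>k. Ck_on n k V g)"

record 'm manifold =
  mdim :: nat
  atlas :: "('m set \<times> ('m \<Rightarrow> nat \<Rightarrow> real)) set"

text \<open>The Hausdorff property and second countability are imposed through the type class of the
  underlying space.\<close>

definition smooth_manifold ::
    "'m::{t2_space,second_countable_topology} manifold \<Rightarrow> bool" where
  "smooth_manifold M \<longleftrightarrow>
     (\<Union>(U, \<phi>)\<in>atlas M. U) = UNIV \<and>
     (\<forall>(U, \<phi>)\<in>atlas M.
        open U \<and> openin (top_of_set (model_space (mdim M))) (\<phi> ` U) \<and>
        homeomorphism U (\<phi> ` U) \<phi> (inv_into U \<phi>)) \<and>
     (\<forall>(U, \<phi>)\<in>atlas M. \<forall>(V, \<psi>)\<in>atlas M. \<forall>i<mdim M.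
        Cinf_on (mdim M) (\<psi> ` (U \<inter> V)) (\<lambda>v. \<phi> (inv_into V \<psi> v) i))"

definition smooth_on :: "'m manifold \<Rightarrow> 'm set \<Rightarrow> ('m \<Rightarrow> real) \<Rightarrow> bool" where
  "smooth_on M W f \<longleftrightarrow>
     (\<forall>(U, \<phi>)\<in>atlas M. Cinf_on (mdim M) (\<phi> ` (U \<inter> W)) (\<lambda>v. f (inv_into U \<phi> v)))"

definition smooth_functions :: "'m manifold \<Rightarrow> ('m \<Rightarrow> real) set"
  where "smooth_functions M = {f. smooth_on M UNIV f}"

text \<open>A tangent vector at \<open>x\<close> is a point derivation of the algebra of smooth functions (extended by
  \<open>0\<close> to all functions, so that it is determined by its values on smooth functions).\<close>

definition tangent_space :: "'m manifold \<Rightarrow> 'm \<Rightarrow> (('m \<Rightarrow> real) \<Rightarrow> real) set" where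
  "tangent_space M x = {v.
     (\<forall>f\<in>smooth_functions M. \<forall>g\<in>smooth_functions M.
        v (f + g) = v f + v g \<and> v (f * g) = f x * v g + v f * g x) \<and>
     (\<forall>f\<in>smooth_functions M. \<forall>c. v (c *\<^sub>R f) = c * v f) \<and>
     (\<forall>f. f \<notin> smooth_functions M \<longrightarrow> v f = 0)}"

type_synonym 'm vfield = "'m \<Rightarrow> ('m \<Rightarrow> real) \<Rightarrow> real"

definition lie_deriv :: "'m vfield \<Rightarrow> ('m \<Rightarrow> real) \<Rightarrow> 'm \<Rightarrow> real"
  where "lie_deriv X f = (\<lambda>x. X x f)"

definition vector_fields :: "'m manifold \<Rightarrow> 'm vfield set" where
  "vector_fields M = {X. (\<forall>x. X x \<in> tangent_space M x) \<and>
     (\<forall>f\<in>smooth_functions M. lie_deriv X f \<in> smooth_functions M)}"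

definition lie_bracket :: "'m vfield \<Rightarrow> 'm vfield \<Rightarrow> 'm vfield"
  where "lie_bracket X Y = (\<lambda>x f. X x (lie_deriv Y f) - Y x (lie_deriv X f))"


section \<open>Vector bundles\<close>

text \<open>The fibre over \<open>x\<close> is a subspace \<open>fibre E x\<close> of a common real vector space; the smooth structure
  of the total space is given by a family of local frames \<open>(U, r, e)\<close>, with \<open>e i x\<close> for \<open>i < r\<close> a
  basis of the fibre over \<open>x \<in> U\<close>, whose transition functions are smooth. The rank may be \<open>0\<close> and may
  vary between connected components.\<close>

record ('m, 'e) vbundle =
  fibre :: "'m \<Rightarrow> 'e set"
  frames :: "('m set \<times> nat \<times> (nat \<Rightarrow> 'm \<Rightarrow> 'e)) set"

definition vector_bundle ::
    "'m::topological_space manifold \<Rightarrow> ('m, 'e::real_vector) vbundle \<Rightarrow> bool" where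
  "vector_bundle M E \<longleftrightarrow>
     (\<forall>x. subspace (fibre E x)) \<and>
     (\<Union>(U, r, e)\<in>frames E. U) = UNIV \<and>
     (\<forall>(U, r, e)\<in>frames E. open U \<and>
        (\<forall>x\<in>U. inj_on (\<lambda>i. e i x) {..<r} \<and> independent ((\<lambda>i. e i x) ` {..<r}) \<and>
               span ((\<lambda>i. e i x) ` {..<r}) = fibre E x)) \<and>
     (\<forall>(U, r, e)\<in>frames E. \<forall>(V, s, e')\<in>frames E. \<forall>j<s.
        \<exists>c. (\<forall>i<r. smooth_on M (U \<inter> V) (c i)) \<and>
            (\<forall>x\<in>U \<inter> V. e' j x = (\<Sum>i<r. c i x *\<^sub>R e i x)))"

definition sections ::
    "'m manifold \<Rightarrow> ('m, 'e::real_vector) vbundle \<Rightarrow> ('m \<Rightarrow> 'e) set" where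
  "sections M E = {s. (\<forall>x. s x \<in> fibre E x) \<and>
     (\<forall>(U, r, e)\<in>frames E.
        \<exists>c. (\<forall>i<r. smooth_on M U (c i)) \<and> (\<forall>x\<in>U. s x = (\<Sum>i<r. c i x *\<^sub>R e i x)))}"

text \<open>The dual fibre consists of the linear functionals on the fibre, extended by \<open>0\<close>; the local
  frames of the dual bundle are the dual frames.\<close>

definition dual_fibre :: "'e::real_vector set \<Rightarrow> ('e \<Rightarrow> real) set" where
  "dual_fibre F = {\<phi>. (\<forall>v\<in>F. \<forall>w\<in>F. \<phi> (v + w) = \<phi> v + \<phi> w) \<and>
     (\<forall>v\<in>F. \<forall>c. \<phi> (c *\<^sub>R v) = c * \<phi> v) \<and> (\<forall>v. v \<notin> F \<longrightarrow> \<phi> v = 0)}"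

definition dual_bundle :: "('m, 'e::real_vector) vbundle \<Rightarrow> ('m, 'e \<Rightarrow> real) vbundle" where
  "dual_bundle E = \<lparr>
     fibre = (\<lambda>x. dual_fibre (fibre E x)),
     frames = {(U, r, \<epsilon>). \<exists>e. (U, r, e) \<in> frames E \<and>
       (\<forall>x\<in>U. \<forall>i<r. \<epsilon> i x \<in> dual_fibre (fibre E x) \<and>
          (\<forall>j<r. \<epsilon> i x (e j x) = (if i = j then 1 else 0)))} \<rparr>"

definition pairing :: "('m \<Rightarrow> 'e \<Rightarrow> real) \<Rightarrow> ('m \<Rightarrow> 'e) \<Rightarrow> 'm \<Rightarrow> real"  ("\<langle>_, _\<rangle>")
  where "\<langle>\<tau>, s\<rangle> = (\<lambda>x. \<tau> x (s x))"

text \<open>Bundle maps over the identity, between families of fibres \<open>F\<close>, \<open>F'\<close> with modules \<open>\<Gamma>\<close>, \<open>\<Gamma>'\<close> of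
  smooth sections.\<close>

definition bundle_map ::
    "('m \<Rightarrow> 'e::real_vector set) \<Rightarrow> ('m \<Rightarrow> 'e) set \<Rightarrow>
     ('m \<Rightarrow> 'f::real_vector set) \<Rightarrow> ('m \<Rightarrow> 'f) set \<Rightarrow> ('m \<Rightarrow> 'e \<Rightarrow> 'f) \<Rightarrow> bool" where
  "bundle_map F \<Gamma> F' \<Gamma>' L \<longleftrightarrow>
     (\<forall>x. \<forall>v\<in>F x. L x v \<in> F' x \<and>
        (\<forall>w\<in>F x. L x (v + w) = L x v + L x w) \<and> (\<forall>c. L x (c *\<^sub>R v) = c *\<^sub>R L x v)) \<and>
     (\<forall>s\<in>\<Gamma>. (\<lambda>x. L x (s x)) \<in> \<Gamma>')"


section \<open>Connections\<close>

text \<open>A linear connection on the module \<open>\<Gamma>\<close>, along the module \<open>\<A>\<close> whose elements act on smooth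
  functions by \<open>act\<close>: for \<open>TM\<close>-connections \<open>\<A>\<close> is the module of vector fields, for \<open>Q\<close>-connections it
  is the module of sections of \<open>Q\<close>, acting through the anchor.\<close>

definition connection ::
    "'m manifold \<Rightarrow> ('m \<Rightarrow> 'a::real_vector) set \<Rightarrow>
     (('m \<Rightarrow> 'a) \<Rightarrow> ('m \<Rightarrow> real) \<Rightarrow> 'm \<Rightarrow> real) \<Rightarrow> ('m \<Rightarrow> 'e::real_vector) set \<Rightarrow>
     (('m \<Rightarrow> 'a) \<Rightarrow> ('m \<Rightarrow> 'e) \<Rightarrow> 'm \<Rightarrow> 'e) \<Rightarrow> bool" where
  "connection M \<A> act \<Gamma> nab \<longleftrightarrow>
     (\<forall>a\<in>\<A>. \<forall>s\<in>\<Gamma>. nab a s \<in> \<Gamma> \<and>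
        (\<forall>b\<in>\<A>. nab (a + b) s = nab a s + nab b s) \<and>
        (\<forall>t\<in>\<Gamma>. nab a (s + t) = nab a s + nab a t) \<and>
        (\<forall>f\<in>smooth_functions M. nab (f \<odot> a) s = f \<odot> nab a s \<and>
           nab a (f \<odot> s) = f \<odot> nab a s + act a f \<odot> s))"

text \<open>The dual connection, on the module \<open>\<Gamma>'\<close> in duality with \<open>\<Gamma>\<close> through \<open>pr\<close>.\<close>

definition dual_connection ::
    "('a \<Rightarrow> ('m \<Rightarrow> real) \<Rightarrow> 'm \<Rightarrow> real) \<Rightarrow> 's set \<Rightarrow> 't set \<Rightarrow> ('t \<Rightarrow> 's \<Rightarrow> 'm \<Rightarrow> real) \<Rightarrow>
     ('a \<Rightarrow> 's \<Rightarrow> 's) \<Rightarrow> 'a \<Rightarrow> 't \<Rightarrow> 't" where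
  "dual_connection act \<Gamma> \<Gamma>' pr nab a t =
     (THE t'. t' \<in> \<Gamma>' \<and> (\<forall>s\<in>\<Gamma>. pr t' s = act a (pr t s) - pr t (nab a s)))"


section \<open>The data of a split Lie 2-algebroid and its graded functions\<close>

record ('m, 'q, 'b) split_data =
  base :: "'m manifold"
  bunQ :: "('m, 'q) vbundle"
  bunB :: "('m, 'b) vbundle"
  anchor :: "'m \<Rightarrow> 'q \<Rightarrow> ('m \<Rightarrow> real) \<Rightarrow> real"
  ell :: "'m \<Rightarrow> ('b \<Rightarrow> real) \<Rightarrow> 'q"
  dbracket :: "('m \<Rightarrow> 'q) \<Rightarrow> ('m \<Rightarrow> 'q) \<Rightarrow> 'm \<Rightarrow> 'q"
  nablaB :: "('m \<Rightarrow> 'q) \<Rightarrow> ('m \<Rightarrow> 'b) \<Rightarrow> 'm \<Rightarrow> 'b"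
  omega :: "('m \<Rightarrow> 'q) list \<Rightarrow> 'm \<Rightarrow> 'b \<Rightarrow> real"

abbreviation Cinf :: "('m, 'q, 'b) split_data \<Rightarrow> ('m \<Rightarrow> real) set"
  where "Cinf S \<equiv> smooth_functions (base S)"
abbreviation vfields :: "('m, 'q, 'b) split_data \<Rightarrow> 'm vfield set"
  where "vfields S \<equiv> vector_fields (base S)"
abbreviation secQ :: "('m, 'q::real_vector, 'b) split_data \<Rightarrow> ('m \<Rightarrow> 'q) set"
  where "secQ S \<equiv> sections (base S) (bunQ S)"
abbreviation secQd :: "('m, 'q::real_vector, 'b) split_data \<Rightarrow> ('m \<Rightarrow> 'q \<Rightarrow> real) set"
  where "secQd S \<equiv> sections (base S) (dual_bundle (bunQ S))"
abbreviation secB :: "('m, 'q, 'b::real_vector) split_data \<Rightarrow> ('m \<Rightarrow> 'b) set"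
  where "secB S \<equiv> sections (base S) (bunB S)"
abbreviation secBd :: "('m, 'q, 'b::real_vector) split_data \<Rightarrow> ('m \<Rightarrow> 'b \<Rightarrow> real) set"
  where "secBd S \<equiv> sections (base S) (dual_bundle (bunB S))"

text \<open>For a vector bundle \<open>E\<close>, the smooth sections of \<open>\<Lambda>Q\<^sup>* \<otimes> SB \<otimes> E\<close> are represented as finite sums of
  maps \<open>\<Phi> qs \<beta>s\<close> with values in \<open>\<Gamma>(E)\<close> that are multilinear over the smooth functions, alternating
  in the list \<open>qs\<close> of sections of \<open>Q\<close> and symmetric in the list \<open>\<beta>s\<close> of sections of \<open>B\<^sup>*\<close>. The
  component in \<open>\<Lambda>\<^sup>pQ\<^sup>* \<otimes> S\<^sup>kB \<otimes> E\<close> is the restriction of \<open>\<Phi>\<close> to lists of lengths \<open>p\<close> and \<open>k\<close>. The second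
  argument \<open>\<Gamma>\<close> is the module of sections of \<open>E\<close>.\<close>

type_synonym ('m, 'q, 'b, 'e) form =
  "('m \<Rightarrow> 'q) list \<Rightarrow> ('m \<Rightarrow> 'b \<Rightarrow> real) list \<Rightarrow> 'm \<Rightarrow> 'e"

definition args :: "('m, 'q::real_vector, 'b::real_vector) split_data \<Rightarrow>
    ('m \<Rightarrow> 'q) list \<Rightarrow> ('m \<Rightarrow> 'b \<Rightarrow> real) list \<Rightarrow> bool"
  where "args S qs \<beta>s \<longleftrightarrow> set qs \<subseteq> secQ S \<and> set \<beta>s \<subseteq> secBd S"

definition forms ::
    "('m, 'q::real_vector, 'b::real_vector) split_data \<Rightarrow> ('m \<Rightarrow> 'e::real_vector) set \<Rightarrow>
     ('m, 'q, 'b, 'e) form set" where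
  "forms S \<Gamma> = {\<Phi>.
     (\<forall>qs \<beta>s. \<not> args S qs \<beta>s \<longrightarrow> \<Phi> qs \<beta>s = 0) \<and>
     finite {(length qs, length \<beta>s) | qs \<beta>s. \<Phi> qs \<beta>s \<noteq> 0} \<and>
     (\<forall>qs \<beta>s. args S qs \<beta>s \<longrightarrow>
        \<Phi> qs \<beta>s \<in> \<Gamma> \<and>
        (\<forall>i<length qs. \<forall>u\<in>secQ S.
           (\<forall>v\<in>secQ S. \<Phi> (qs[i := u + v]) \<beta>s = \<Phi> (qs[i := u]) \<beta>s + \<Phi> (qs[i := v]) \<beta>s) \<and>
           (\<forall>f\<in>Cinf S. \<Phi> (qs[i := f \<odot> u]) \<beta>s = f \<odot> \<Phi> (qs[i := u]) \<beta>s)) \<and>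
        (\<forall>i<length \<beta>s. \<forall>u\<in>secBd S.
           (\<forall>v\<in>secBd S. \<Phi> qs (\<beta>s[i := u + v]) = \<Phi> qs (\<beta>s[i := u]) + \<Phi> qs (\<beta>s[i := v])) \<and>
           (\<forall>f\<in>Cinf S. \<Phi> qs (\<beta>s[i := f \<odot> u]) = f \<odot> \<Phi> qs (\<beta>s[i := u]))) \<and>
        (\<forall>i j. i < j \<and> j < length qs \<and> qs ! i = qs ! j \<longrightarrow> \<Phi> qs \<beta>s = 0) \<and>
        (\<forall>\<gamma>s. mset \<gamma>s = mset \<beta>s \<longrightarrow> \<Phi> qs \<gamma>s = \<Phi> qs \<beta>s))}"

text \<open>The form concentrated in bidegree \<open>(p, k)\<close> that is given there by \<open>g\<close>.\<close>

definition mk_form ::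
    "('m, 'q::real_vector, 'b::real_vector) split_data \<Rightarrow> nat \<Rightarrow> nat \<Rightarrow>
     ('m, 'q, 'b, 'e::real_vector) form \<Rightarrow> ('m, 'q, 'b, 'e) form" where
  "mk_form S p k g = (\<lambda>qs \<beta>s.
     if args S qs \<beta>s \<and> length qs = p \<and> length \<beta>s = k then g qs \<beta>s else 0)"

text \<open>\<open>Q\<^sup>*\<close> has degree \<open>1\<close> and \<open>B\<close> has degree \<open>2\<close>.\<close>

definition homogeneous :: "int \<Rightarrow> ('m, 'q, 'b, 'e::real_vector) form \<Rightarrow> bool" where
  "homogeneous d \<Phi> \<longleftrightarrow>
     (\<forall>qs \<beta>s. \<Phi> qs \<beta>s \<noteq> 0 \<longrightarrow> int (length qs) + 2 * int (length \<beta>s) = d)"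

definition Omega ::
    "('m, 'q::real_vector, 'b::real_vector) split_data \<Rightarrow> nat \<Rightarrow> ('m \<Rightarrow> 'e::real_vector) set \<Rightarrow>
     (('m \<Rightarrow> 'q) list \<Rightarrow> 'm \<Rightarrow> 'e) set" where
  "Omega S p \<Gamma> = {w. (\<forall>qs. length qs \<noteq> p \<longrightarrow> w qs = 0) \<and>
     (\<lambda>qs \<beta>s. if \<beta>s = [] then w qs else 0) \<in> forms S \<Gamma>}"

text \<open>The product \<open>\<xi> \<cdot> \<Phi>\<close>: shuffle product in the alternating and in the symmetric arguments. The
  index sets \<open>I\<close> and \<open>J\<close> select the arguments of \<open>\<xi>\<close>; the degree of \<open>B\<close> being even, only the
  arguments in \<open>qs\<close> contribute to the sign.\<close>

definition shuffle_sign :: "nat \<Rightarrow> nat set \<Rightarrow> real" where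
  "shuffle_sign n I = (-1) ^ card {(i, j). i < j \<and> j < n \<and> i \<notin> I \<and> j \<in> I}"

definition wedge ::
    "('m, 'q, 'b, real) form \<Rightarrow> ('m, 'q, 'b, 'e::real_vector) form \<Rightarrow> ('m, 'q, 'b, 'e) form"
    (infixr "\<cdot>" 75) where
  "\<xi> \<cdot> \<Phi> = (\<lambda>qs \<beta>s. \<Sum>I\<in>Pow {..<length qs}. \<Sum>J\<in>Pow {..<length \<beta>s}.
     shuffle_sign (length qs) I *\<^sub>R
       (\<xi> (nths qs I) (nths \<beta>s J) \<odot> \<Phi> (nths qs (- I)) (nths \<beta>s (- J))))"

definition graded_functions ::
    "('m, 'q::real_vector, 'b::real_vector) split_data \<Rightarrow> ('m, 'q, 'b, real) form set"
  where "graded_functions S = forms S (Cinf S)"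

definition deg0 ::
    "('m, 'q::real_vector, 'b::real_vector) split_data \<Rightarrow> ('m \<Rightarrow> 'e::real_vector) \<Rightarrow>
     ('m, 'q, 'b, 'e) form"
  where "deg0 S s = mk_form S 0 0 (\<lambda>_ _. s)"

definition genQ ::
    "('m, 'q::real_vector, 'b::real_vector) split_data \<Rightarrow> ('m \<Rightarrow> 'q \<Rightarrow> real) \<Rightarrow>
     ('m, 'q, 'b, real) form"
  where "genQ S \<tau> = mk_form S 1 0 (\<lambda>qs _. \<langle>\<tau>, qs ! 0\<rangle>)"

definition genB ::
    "('m, 'q::real_vector, 'b::real_vector) split_data \<Rightarrow> ('m \<Rightarrow> 'b) \<Rightarrow> ('m, 'q, 'b, real) form"
  where "genB S b = mk_form S 0 1 (\<lambda>_ \<beta>s. \<langle>\<beta>s ! 0, b\<rangle>)"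


section \<open>Split Lie 2-algebroids\<close>

definition rho ::
    "('m, 'q, 'b) split_data \<Rightarrow> ('m \<Rightarrow> 'q) \<Rightarrow> 'm vfield"
  where "rho S q = (\<lambda>x. anchor S x (q x))"

definition lmap ::
    "('m, 'q, 'b) split_data \<Rightarrow> ('m \<Rightarrow> 'b \<Rightarrow> real) \<Rightarrow> 'm \<Rightarrow> 'q"
  where "lmap S \<beta> = (\<lambda>x. ell S x (\<beta> x))"

definition rho_act :: "('m, 'q, 'b) split_data \<Rightarrow> ('m \<Rightarrow> 'q) \<Rightarrow> ('m \<Rightarrow> real) \<Rightarrow> 'm \<Rightarrow> real"
  where "rho_act S q = lie_deriv (rho S q)"

definition nablaBd ::
    "('m, 'q, 'b::real_vector) split_data \<Rightarrow> ('m \<Rightarrow> 'q) \<Rightarrow> ('m \<Rightarrow> 'b \<Rightarrow> real) \<Rightarrow> 'm \<Rightarrow> 'b \<Rightarrow> real"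
  where "nablaBd S = dual_connection (rho_act S) (secB S) (secBd S) pairing (nablaB S)"

text \<open>The Koszul formula for the exterior covariant derivative of a \<open>Q\<close>-connection \<open>nab\<close>.\<close>

definition omit :: "nat set \<Rightarrow> 'a list \<Rightarrow> 'a list"
  where "omit I xs = nths xs (- I)"

definition koszul ::
    "('m, 'q, 'b) split_data \<Rightarrow> (('m \<Rightarrow> 'q) \<Rightarrow> ('m \<Rightarrow> 'e) \<Rightarrow> 'm \<Rightarrow> 'e::real_vector) \<Rightarrow>
     (('m \<Rightarrow> 'q) list \<Rightarrow> 'm \<Rightarrow> 'e) \<Rightarrow> ('m \<Rightarrow> 'q) list \<Rightarrow> 'm \<Rightarrow> 'e" where
  "koszul S nab w qs =
     (\<Sum>i<length qs. (-1) ^ i *\<^sub>R nab (qs ! i) (w (omit {i} qs))) +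
     (\<Sum>(i, j)\<in>{(i, j). i < j \<and> j < length qs}.
        (-1) ^ (i + j) *\<^sub>R w (dbracket S (qs ! i) (qs ! j) # omit {i, j} qs))"

definition dull_bracket :: "('m, 'q::real_vector, 'b) split_data \<Rightarrow> bool" where
  "dull_bracket S \<longleftrightarrow>
     (\<forall>q\<in>secQ S. \<forall>r\<in>secQ S.
        dbracket S q r \<in> secQ S \<and>
        dbracket S q r = - dbracket S r q \<and>
        rho S (dbracket S q r) = lie_bracket (rho S q) (rho S r) \<and>
        (\<forall>s\<in>secQ S. dbracket S (q + s) r = dbracket S q r + dbracket S s r \<and>
                     dbracket S q (r + s) = dbracket S q r + dbracket S q s) \<and>
        (\<forall>c. dbracket S (c *\<^sub>R q) r = c *\<^sub>R dbracket S q r \<and>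
             dbracket S q (c *\<^sub>R r) = c *\<^sub>R dbracket S q r) \<and>
        (\<forall>f\<in>Cinf S. dbracket S q (f \<odot> r) = f \<odot> dbracket S q r + rho_act S q f \<odot> r))"

definition curvatureBd ::
    "('m, 'q, 'b::real_vector) split_data \<Rightarrow> ('m \<Rightarrow> 'q) \<Rightarrow> ('m \<Rightarrow> 'q) \<Rightarrow>
     ('m \<Rightarrow> 'b \<Rightarrow> real) \<Rightarrow> 'm \<Rightarrow> 'b \<Rightarrow> real" where
  "curvatureBd S q r \<beta> =
     nablaBd S q (nablaBd S r \<beta>) - nablaBd S r (nablaBd S q \<beta>) - nablaBd S (dbracket S q r) \<beta>"

text \<open>In the compatibility of the Jacobiator with \<open>omega\<close> both sign conventions are admitted: for
  \<open>s = 1\<close> it reads \<open>[q\<^sub>1,[q\<^sub>2,q\<^sub>3]] - [[q\<^sub>1,q\<^sub>2],q\<^sub>3] - [q\<^sub>2,[q\<^sub>1,q\<^sub>3]] = \<ell>(\<omega>(q\<^sub>1,q\<^sub>2,q\<^sub>3))\<close>, for \<open>s = -1\<close> the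
  cyclic sum \<open>[[q\<^sub>1,q\<^sub>2],q\<^sub>3] + [[q\<^sub>2,q\<^sub>3],q\<^sub>1] + [[q\<^sub>3,q\<^sub>1],q\<^sub>2]\<close> equals \<open>\<ell>(\<omega>(q\<^sub>1,q\<^sub>2,q\<^sub>3))\<close>. The second is the
  one for which the curvature condition below is compatible with \<open>[q, \<ell>(\<beta>)] = \<ell>(\<nabla>\<^sub>q\<beta>)\<close> when
  \<open>\<ell>(\<omega>(q\<^sub>1,q\<^sub>2,\<ell>(\<beta>)))\<close> is not zero.\<close>

definition split_lie_2_algebroid ::
    "('m::{t2_space,second_countable_topology}, 'q::real_vector, 'b::real_vector) split_data \<Rightarrow> bool"
    where
  "split_lie_2_algebroid S \<longleftrightarrow>
     smooth_manifold (base S) \<and>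
     vector_bundle (base S) (bunQ S) \<and>
     vector_bundle (base S) (bunB S) \<and>
     bundle_map (fibre (bunQ S)) (secQ S) (tangent_space (base S)) (vfields S) (anchor S) \<and>
     bundle_map (fibre (dual_bundle (bunB S))) (secBd S) (fibre (bunQ S)) (secQ S) (ell S) \<and>
     dull_bracket S \<and>
     connection (base S) (secQ S) (rho_act S) (secB S) (nablaB S) \<and>
     omega S \<in> Omega S 3 (secBd S) \<and>
     (\<forall>\<beta>\<^sub>1\<in>secBd S. \<forall>\<beta>\<^sub>2\<in>secBd S.
        nablaBd S (lmap S \<beta>\<^sub>1) \<beta>\<^sub>2 + nablaBd S (lmap S \<beta>\<^sub>2) \<beta>\<^sub>1 = 0) \<and>
     (\<forall>q\<in>secQ S. \<forall>\<beta>\<in>secBd S. dbracket S q (lmap S \<beta>) = lmap S (nablaBd S q \<beta>)) \<and>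
     (\<exists>s\<in>{1, - 1 :: real}. \<forall>q\<^sub>1\<in>secQ S. \<forall>q\<^sub>2\<in>secQ S. \<forall>q\<^sub>3\<in>secQ S.
        dbracket S q\<^sub>1 (dbracket S q\<^sub>2 q\<^sub>3) - dbracket S (dbracket S q\<^sub>1 q\<^sub>2) q\<^sub>3
          - dbracket S q\<^sub>2 (dbracket S q\<^sub>1 q\<^sub>3) = s *\<^sub>R lmap S (omega S [q\<^sub>1, q\<^sub>2, q\<^sub>3])) \<and>
     (\<forall>q\<^sub>1\<in>secQ S. \<forall>q\<^sub>2\<in>secQ S. \<forall>\<beta>\<in>secBd S.
        curvatureBd S q\<^sub>1 q\<^sub>2 \<beta> = - omega S [q\<^sub>1, q\<^sub>2, lmap S \<beta>]) \<and>
     (\<forall>qs. length qs = 4 \<and> set qs \<subseteq> secQ S \<longrightarrow> koszul S (nablaBd S) (omega S) qs = 0)"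


section \<open>Graded derivations and the homological vector field\<close>

type_synonym ('m, 'q, 'b) operator = "('m, 'q, 'b, real) form \<Rightarrow> ('m, 'q, 'b, real) form"

text \<open>Operators on graded functions are extended by \<open>0\<close> to all of their type.\<close>

definition derivations ::
    "('m, 'q::real_vector, 'b::real_vector) split_data \<Rightarrow> int \<Rightarrow> ('m, 'q, 'b) operator set" where
  "derivations S k = {D.
     (\<forall>\<xi>. \<xi> \<notin> graded_functions S \<longrightarrow> D \<xi> = 0) \<and>
     (\<forall>\<xi>\<in>graded_functions S. D \<xi> \<in> graded_functions S \<and>
        (\<forall>c. D (c *\<^sub>R \<xi>) = c *\<^sub>R D \<xi>) \<and>
        (\<forall>\<eta>\<in>graded_functions S. D (\<xi> + \<eta>) = D \<xi> + D \<eta>) \<and>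
        (\<forall>d. homogeneous d \<xi> \<longrightarrow> homogeneous (d + k) (D \<xi>) \<and>
           (\<forall>\<eta>\<in>graded_functions S.
              D (\<xi> \<cdot> \<eta>) = D \<xi> \<cdot> \<eta> + ((-1) powi (k * d)) *\<^sub>R (\<xi> \<cdot> D \<eta>))))}"

definition graded_vector_fields ::
    "('m, 'q::real_vector, 'b::real_vector) split_data \<Rightarrow> ('m, 'q, 'b) operator set" where
  "graded_vector_fields S =
     {D. \<exists>K F. finite K \<and> (\<forall>k\<in>K. F k \<in> derivations S k) \<and> D = (\<Sum>k\<in>K. F k)}"

definition parity :: "('m, 'q, 'b, real) form \<Rightarrow> ('m, 'q, 'b, real) form"
  where "parity \<xi> = (\<lambda>qs \<beta>s. (-1) ^ length qs *\<^sub>R \<xi> qs \<beta>s)"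

text \<open>The graded commutator \<open>[V, D]\<close> with a derivation \<open>V\<close> of degree \<open>1\<close>. For \<open>D\<close> of degree \<open>k\<close>,
  conjugation with \<open>parity\<close> multiplies \<open>D\<close> by \<open>(-1)\<^sup>k\<close>, so this is \<open>V \<circ> D - (-1)\<^sup>k D \<circ> V\<close>, extended
  additively to sums of homogeneous derivations.\<close>

definition commutator ::
    "('m, 'q, 'b) operator \<Rightarrow> ('m, 'q, 'b) operator \<Rightarrow> ('m, 'q, 'b) operator"
  where "commutator V D = (\<lambda>\<xi>. V (D \<xi>) - parity (D (parity (V \<xi>))))"

definition homological_vector_field ::
    "('m, 'q::real_vector, 'b::real_vector) split_data \<Rightarrow> ('m, 'q, 'b) operator \<Rightarrow> bool" where
  "homological_vector_field S V \<longleftrightarrow>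
     V \<in> derivations S 1 \<and> (\<forall>\<xi>\<in>graded_functions S. V (V \<xi>) = 0) \<and>
     (\<forall>f\<in>Cinf S. V (deg0 S f) = mk_form S 1 0 (\<lambda>qs _. rho_act S (qs ! 0) f)) \<and>
     (\<forall>\<tau>\<in>secQd S. V (genQ S \<tau>) =
        mk_form S 2 0 (\<lambda>qs _. koszul S (rho_act S) (\<lambda>rs. \<langle>\<tau>, rs ! 0\<rangle>) qs) +
        mk_form S 0 1 (\<lambda>_ \<beta>s. \<langle>\<tau>, lmap S (\<beta>s ! 0)\<rangle>)) \<and>
     (\<forall>b\<in>secB S. V (genB S b) =
        mk_form S 1 1 (\<lambda>qs \<beta>s. \<langle>\<beta>s ! 0, koszul S (nablaB S) (\<lambda>_. b) qs\<rangle>) -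
        mk_form S 3 0 (\<lambda>qs _. \<langle>omega S qs, b\<rangle>))"


section \<open>The adjoint representation\<close>

text \<open>The module of graded functions tensored with the sections of \<open>TM[0] \<oplus> Q[1] \<oplus> B\<^sup>*[2]\<close>, whose
  elements are triples of forms with values in \<open>TM\<close>, \<open>Q\<close> and \<open>B\<^sup>*\<close>.\<close>

type_synonym ('m, 'q, 'b) adj_elem =
  "('m, 'q, 'b, ('m \<Rightarrow> real) \<Rightarrow> real) form \<times> ('m, 'q, 'b, 'q) form \<times> ('m, 'q, 'b, 'b \<Rightarrow> real) form"

definition adj_module ::
    "('m, 'q::real_vector, 'b::real_vector) split_data \<Rightarrow> ('m, 'q, 'b) adj_elem set"
  where "adj_module S = forms S (vfields S) \<times> forms S (secQ S) \<times> forms S (secBd S)"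

definition adj_homogeneous ::
    "int \<Rightarrow> ('m, 'q::real_vector, 'b::real_vector) adj_elem \<Rightarrow> bool" where
  "adj_homogeneous d = (\<lambda>(\<Phi>T, \<Phi>Q, \<Phi>B).
     homogeneous d \<Phi>T \<and> homogeneous (d + 1) \<Phi>Q \<and> homogeneous (d + 2) \<Phi>B)"

definition adj_act ::
    "('m, 'q, 'b, real) form \<Rightarrow> ('m, 'q::real_vector, 'b::real_vector) adj_elem \<Rightarrow>
     ('m, 'q, 'b) adj_elem"
  where "adj_act \<xi> = (\<lambda>(\<Phi>T, \<Phi>Q, \<Phi>B). (\<xi> \<cdot> \<Phi>T, \<xi> \<cdot> \<Phi>Q, \<xi> \<cdot> \<Phi>B))"

definition vf_act ::
    "('m, 'q, 'b, real) form \<Rightarrow> ('m, 'q, 'b) operator \<Rightarrow> ('m, 'q, 'b) operator"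
  where "vf_act \<xi> D = (\<lambda>\<eta>. \<xi> \<cdot> D \<eta>)"

definition adjT :: "('m, 'q::real_vector, 'b::real_vector) split_data \<Rightarrow> 'm vfield \<Rightarrow>
    ('m, 'q, 'b) adj_elem"
  where "adjT S X = (deg0 S X, 0, 0)"

definition adjQ :: "('m, 'q::real_vector, 'b::real_vector) split_data \<Rightarrow> ('m \<Rightarrow> 'q) \<Rightarrow>
    ('m, 'q, 'b) adj_elem"
  where "adjQ S q = (0, deg0 S q, 0)"

definition adjB :: "('m, 'q::real_vector, 'b::real_vector) split_data \<Rightarrow> ('m \<Rightarrow> 'b \<Rightarrow> real) \<Rightarrow>
    ('m, 'q, 'b) adj_elem"
  where "adjB S \<beta> = (0, 0, deg0 S \<beta>)"

text \<open>Maps on \<open>adj_module\<close> that are linear over the graded functions, with values in the module \<open>N\<close>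
  with action \<open>act\<close>; and the one (extended by \<open>0\<close>) with prescribed values on the generators.\<close>

definition graded_linear ::
    "('m, 'q::real_vector, 'b::real_vector) split_data \<Rightarrow> 'n::plus set \<Rightarrow>
     (('m, 'q, 'b, real) form \<Rightarrow> 'n \<Rightarrow> 'n) \<Rightarrow> (('m, 'q, 'b) adj_elem \<Rightarrow> 'n) \<Rightarrow> bool" where
  "graded_linear S N act h \<longleftrightarrow>
     (\<forall>\<Phi>\<in>adj_module S. h \<Phi> \<in> N \<and>
        (\<forall>\<Psi>\<in>adj_module S. h (\<Phi> + \<Psi>) = h \<Phi> + h \<Psi>) \<and>
        (\<forall>\<xi>\<in>graded_functions S. h (adj_act \<xi> \<Phi>) = act \<xi> (h \<Phi>)))"

definition graded_extension ::
    "('m, 'q::real_vector, 'b::real_vector) split_data \<Rightarrow> 'n::{plus,zero} set \<Rightarrow>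
     (('m, 'q, 'b, real) form \<Rightarrow> 'n \<Rightarrow> 'n) \<Rightarrow> ('m vfield \<Rightarrow> 'n) \<Rightarrow> (('m \<Rightarrow> 'q) \<Rightarrow> 'n) \<Rightarrow>
     (('m \<Rightarrow> 'b \<Rightarrow> real) \<Rightarrow> 'n) \<Rightarrow> ('m, 'q, 'b) adj_elem \<Rightarrow> 'n" where
  "graded_extension S N act gT gQ gB =
     (THE h. graded_linear S N act h \<and> (\<forall>\<Phi>. \<Phi> \<notin> adj_module S \<longrightarrow> h \<Phi> = 0) \<and>
        (\<forall>X\<in>vfields S. h (adjT S X) = gT X) \<and>
        (\<forall>q\<in>secQ S. h (adjQ S q) = gQ q) \<and>
        (\<forall>\<beta>\<in>secBd S. h (adjB S \<beta>) = gB \<beta>))"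

text \<open>A pair of \<open>TM\<close>-connections, on \<open>Q\<close> and on \<open>B\<^sup>*\<close>.\<close>

type_synonym ('m, 'q, 'b) conn_pair =
  "('m vfield \<Rightarrow> ('m \<Rightarrow> 'q) \<Rightarrow> 'm \<Rightarrow> 'q) \<times>
   ('m vfield \<Rightarrow> ('m \<Rightarrow> 'b \<Rightarrow> real) \<Rightarrow> 'm \<Rightarrow> 'b \<Rightarrow> real)"

definition connection_pair ::
    "('m, 'q::real_vector, 'b::real_vector) split_data \<Rightarrow> ('m, 'q, 'b) conn_pair \<Rightarrow> bool" where
  "connection_pair S nab \<longleftrightarrow>
     connection (base S) (vfields S) lie_deriv (secQ S) (fst nab) \<and>
     connection (base S) (vfields S) lie_deriv (secBd S) (snd nab)"

definition hatB ::
    "('m, 'q::real_vector, 'b::real_vector) split_data \<Rightarrow> ('m \<Rightarrow> 'b \<Rightarrow> real) \<Rightarrow>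
     ('m, 'q, 'b) operator" where
  "hatB S \<beta> = (THE D. D \<in> derivations S (- 2) \<and>
     (\<forall>f\<in>Cinf S. D (deg0 S f) = 0) \<and>
     (\<forall>\<tau>\<in>secQd S. D (genQ S \<tau>) = 0) \<and>
     (\<forall>b\<in>secB S. D (genB S b) = deg0 S \<langle>\<beta>, b\<rangle>))"

definition hatQ ::
    "('m, 'q::real_vector, 'b::real_vector) split_data \<Rightarrow> ('m \<Rightarrow> 'q) \<Rightarrow> ('m, 'q, 'b) operator" where
  "hatQ S q = (THE D. D \<in> derivations S (- 1) \<and>
     (\<forall>f\<in>Cinf S. D (deg0 S f) = 0) \<and>
     (\<forall>\<tau>\<in>secQd S. D (genQ S \<tau>) = deg0 S \<langle>\<tau>, q\<rangle>) \<and>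
     (\<forall>b\<in>secB S. D (genB S b) = 0))"

definition hatT ::
    "('m, 'q::real_vector, 'b::real_vector) split_data \<Rightarrow> ('m, 'q, 'b) conn_pair \<Rightarrow> 'm vfield \<Rightarrow>
     ('m, 'q, 'b) operator" where
  "hatT S nab X = (THE D. D \<in> derivations S 0 \<and>
     (\<forall>f\<in>Cinf S. D (deg0 S f) = deg0 S (lie_deriv X f)) \<and>
     (\<forall>\<tau>\<in>secQd S. D (genQ S \<tau>) =
        genQ S (dual_connection lie_deriv (secQ S) (secQd S) pairing (fst nab) X \<tau>)) \<and>
     (\<forall>b\<in>secB S. D (genB S b) =
        genB S (dual_connection lie_deriv (secBd S) (secB S) (\<lambda>b \<beta>. \<langle>\<beta>, b\<rangle>) (snd nab) X b)))"

definition mu_nabla ::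
    "('m, 'q::real_vector, 'b::real_vector) split_data \<Rightarrow> ('m, 'q, 'b) conn_pair \<Rightarrow>
     ('m, 'q, 'b) adj_elem \<Rightarrow> ('m, 'q, 'b) operator" where
  "mu_nabla S nab =
     graded_extension S (graded_vector_fields S) vf_act (hatT S nab) (hatQ S) (hatB S)"

definition ad_operator ::
    "('m, 'q::real_vector, 'b::real_vector) split_data \<Rightarrow> ('m, 'q, 'b) operator \<Rightarrow>
     ('m, 'q, 'b) conn_pair \<Rightarrow> ('m, 'q, 'b) adj_elem \<Rightarrow> ('m, 'q, 'b) adj_elem" where
  "ad_operator S V nab =
     inv_into (adj_module S) (mu_nabla S nab) \<circ> commutator V \<circ> mu_nabla S nab"


section \<open>Representations up to homotopy on \<open>TM[0] \<oplus> Q[1] \<oplus> B\<^sup>*[2]\<close>\<close>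

definition rep_up_to_homotopy ::
    "('m, 'q::real_vector, 'b::real_vector) split_data \<Rightarrow> ('m, 'q, 'b) operator \<Rightarrow>
     (('m, 'q, 'b) adj_elem \<Rightarrow> ('m, 'q, 'b) adj_elem) \<Rightarrow> bool" where
  "rep_up_to_homotopy S V D \<longleftrightarrow>
     (\<forall>\<Phi>\<in>adj_module S. D \<Phi> \<in> adj_module S \<and> D (D \<Phi>) = 0 \<and>
        (\<forall>c. D (c *\<^sub>R \<Phi>) = c *\<^sub>R D \<Phi>) \<and>
        (\<forall>\<Psi>\<in>adj_module S. D (\<Phi> + \<Psi>) = D \<Phi> + D \<Psi>) \<and>
        (\<forall>d. adj_homogeneous d \<Phi> \<longrightarrow> adj_homogeneous (d + 1) (D \<Phi>)) \<and>
        (\<forall>\<xi>\<in>graded_functions S. \<forall>d. homogeneous d \<xi> \<longrightarrow>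
           D (adj_act \<xi> \<Phi>) = adj_act (V \<xi>) \<Phi> + ((-1) powi d) *\<^sub>R adj_act \<xi> (D \<Phi>)))"

definition rep_morphism ::
    "('m, 'q::real_vector, 'b::real_vector) split_data \<Rightarrow>
     (('m, 'q, 'b) adj_elem \<Rightarrow> ('m, 'q, 'b) adj_elem) \<Rightarrow>
     (('m, 'q, 'b) adj_elem \<Rightarrow> ('m, 'q, 'b) adj_elem) \<Rightarrow>
     (('m, 'q, 'b) adj_elem \<Rightarrow> ('m, 'q, 'b) adj_elem) \<Rightarrow> bool" where
  "rep_morphism S D D' h \<longleftrightarrow>
     graded_linear S (adj_module S) adj_act h \<and>
     (\<forall>\<Phi>\<in>adj_module S. h (D \<Phi>) = D' (h \<Phi>) \<and>
        (\<forall>d. adj_homogeneous d \<Phi> \<longrightarrow> adj_homogeneous d (h \<Phi>)))"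

definition rep_isomorphism ::
    "('m, 'q::real_vector, 'b::real_vector) split_data \<Rightarrow> ('m, 'q, 'b) operator \<Rightarrow>
     (('m, 'q, 'b) adj_elem \<Rightarrow> ('m, 'q, 'b) adj_elem) \<Rightarrow>
     (('m, 'q, 'b) adj_elem \<Rightarrow> ('m, 'q, 'b) adj_elem) \<Rightarrow>
     (('m, 'q, 'b) adj_elem \<Rightarrow> ('m, 'q, 'b) adj_elem) \<Rightarrow> bool" where
  "rep_isomorphism S V D D' h \<longleftrightarrow>
     rep_up_to_homotopy S V D \<and> rep_up_to_homotopy S V D' \<and> rep_morphism S D D' h \<and>
     (\<exists>k. rep_morphism S D' D k \<and> (\<forall>\<Phi>\<in>adj_module S. k (h \<Phi>) = \<Phi> \<and> h (k \<Phi>) = \<Phi>))"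

text \<open>The components of the difference of two pairs of connections, as forms of bidegrees \<open>(1,0)\<close> and
  \<open>(0,1)\<close>, and the induced map.\<close>

definition mu1 ::
    "('m, 'q::real_vector, 'b::real_vector) split_data \<Rightarrow> ('m, 'q, 'b) conn_pair \<Rightarrow>
     ('m, 'q, 'b) conn_pair \<Rightarrow> 'm vfield \<Rightarrow> ('m, 'q, 'b, 'q) form" where
  "mu1 S nab nab' X = mk_form S 1 0 (\<lambda>qs _. fst nab' X (qs ! 0) - fst nab X (qs ! 0))"

definition mu0b ::
    "('m, 'q::real_vector, 'b::real_vector) split_data \<Rightarrow> ('m, 'q, 'b) conn_pair \<Rightarrow>
     ('m, 'q, 'b) conn_pair \<Rightarrow> 'm vfield \<Rightarrow> ('m, 'q, 'b, 'b \<Rightarrow> real) form" where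
  "mu0b S nab nab' X = mk_form S 0 1 (\<lambda>_ \<beta>s. snd nab' X (\<beta>s ! 0) - snd nab X (\<beta>s ! 0))"

definition mu_change ::
    "('m, 'q::real_vector, 'b::real_vector) split_data \<Rightarrow> ('m, 'q, 'b) conn_pair \<Rightarrow>
     ('m, 'q, 'b) conn_pair \<Rightarrow> ('m, 'q, 'b) adj_elem \<Rightarrow> ('m, 'q, 'b) adj_elem" where
  "mu_change S nab nab' =
     graded_extension S (adj_module S) adj_act
       (\<lambda>X. (deg0 S X, mu1 S nab nab' X, mu0b S nab nab' X)) (adjQ S) (adjB S)"

end

theory Submission
  imports Defs
begin

text \<open>A form \<open>\<Phi>\<close> with values in \<open>TM\<close>, \<open>Q\<close> or \<open>B\<^sup>*\<close> acts on graded functions by shuffling its arguments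
  with those of the derivations \<open>\<nabla>\<^sub>X\<close>, \<open>\<iota>\<^sub>q\<close>, \<open>\<iota>\<^sub>\<beta>\<close> at the values of \<open>\<Phi>\<close>, which gives an explicit formula for
  \<open>mu_nabla\<close>. Derivations, and maps that are linear over the graded functions, are determined by their
  values on generators: by Euler's formula every form is locally a sum of products of generators.
  A derivation \<open>D\<close> is in the image of \<open>mu_nabla\<close>: its \<open>TM\<close>-component is \<open>f \<mapsto> D f\<close>, and once this is
  subtracted the remainder is linear over the smooth functions on \<open>Q\<^sup>*\<close> and \<open>B\<close>, hence given by duality.
  So \<open>mu_nabla\<close> is bijective onto the graded vector fields. The map \<open>\<mu>\<close> is the inverse of
  \<open>mu_nabla S nab'\<close> after \<open>mu_nabla S nab\<close>, since the lifts of \<open>X\<close> for the two pairs of connections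
  differ by the derivation induced by their difference; both operators being transported from the
  commutator with the homological vector field, \<open>\<mu>\<close> intertwines them.\<close>


section \<open>Smooth functions\<close>

text \<open>Forms, derivations and connections only see global sections and global functions, while
  frames are local. Local statements are therefore phrased globally: around every point some smooth
  function \<open>f\<close>, nonzero at that point, makes the statement true after multiplication by
  \<open>f\<close>. Bump functions turn a frame and its dual frame into global sections whose
  canonical tensor is \<open>f\<close> times the identity; these take the place of frames in Euler's
  formula and in duality. The maps in the claim are definite descriptions, so each of them needs an
  existence proof, given by an explicit formula, and a uniqueness proof, given by values on
  generators. Once triples of forms are identified with derivations, the rest is formal: vanishing
  square, Leibniz rule, degrees and compatibility are properties of the graded commutator, carried
  back by injectivity. The inverse of the isomorphism is the same construction with the two pairs of
  connections exchanged.\<close>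

abbreviation open_model :: "nat \<Rightarrow> (nat \<Rightarrow> real) set \<Rightarrow> bool"
  where "open_model n \<equiv> openin (top_of_set (model_space n))"

lemma has_real_derivative_transform_ev:
  fixes f g :: "real \<Rightarrow> real"
  assumes "(f has_real_derivative d) (at t)" "\<forall>\<^sub>F s in nhds t. f s = g s"
  shows "(g has_real_derivative d) (at t)"
  using DERIV_cong_ev[OF refl assms(2) refl, of d] assms(1) by simp

text \<open>\<open>Ck_on\<close> differentiates along lines of the full sequence space. A line in a
  direction \<open>i < n\<close> does not leave the model space, so near \<open>v i\<close> it runs
  inside \<open>V\<close> and the derivatives depend only on values on \<open>V\<close>.\<close>

lemma open_model_line:
  assumes "open_model n V" "v \<in> V" "i < n"
  shows "\<forall>\<^sub>F t in nhds (v i). v(i := t) \<in> V"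
proof -
  obtain T where T: "open T" "V = model_space n \<inter> T"
    using assms(1) by (auto simp: openin_open)
  have "continuous_on UNIV (\<lambda>t. v(i := t))"
  proof (rule continuous_on_coordinatewise_then_product)
    show "continuous_on UNIV (\<lambda>t. (v(i := t)) j)" for j
      by (cases "j = i") (auto intro: continuous_intros)
  qed
  then have "open ((\<lambda>t. v(i := t)) -` T)"
    using T(1) by (rule open_vimage[rotated])
  moreover have "v i \<in> (\<lambda>t. v(i := t)) -` T"
    using assms(2) T(2) by simp
  moreover have "v(i := t) \<in> V" if "v(i := t) \<in> T" for t
    using that assms(2,3) T(2) by (auto simp: model_space_def)
  ultimately show ?thesis
    unfolding eventually_nhds by blast
qed

text \<open>Only the outermost derivatives need attention: the functions \<open>h\<close> that
  witness them for \<open>g\<close> serve for \<open>g'\<close> as well, so a case distinction on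
  \<open>k\<close> is enough.\<close>

lemma Ck_on_cong:
  assumes "open_model n V" "\<And>v. v \<in> V \<Longrightarrow> g v = g' v" "Ck_on n k V g"
  shows "Ck_on n k V g'"
proof -
  have cont: "continuous_on V g'" if "continuous_on V g"
    using that assms(2) continuous_on_cong by metis
  have der: "((\<lambda>t. g' (v(i := t))) has_real_derivative d) (at (v i))"
    if "((\<lambda>t. g (v(i := t))) has_real_derivative d) (at (v i))" "v \<in> V" "i < n" for v i d
  proof -
    have "\<forall>\<^sub>F t in nhds (v i). g (v(i := t)) = g' (v(i := t))"
      using open_model_line[OF assms(1) that(2,3)] by eventually_elim (rule assms(2))
    then show ?thesis
      by (rule has_real_derivative_transform_ev[OF that(1)])
  qed
  show ?thesis
  proof (cases k)
    case 0
    then show ?thesis using assms(3) cont by simp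
  next
    case (Suc l)
    have "\<exists>h. Ck_on n l V h \<and>
        (\<forall>v\<in>V. ((\<lambda>t. g' (v(i := t))) has_real_derivative h v) (at (v i)))" if i: "i < n" for i
    proof -
      obtain h where h: "Ck_on n l V h"
        "\<And>v. v \<in> V \<Longrightarrow> ((\<lambda>t. g (v(i := t))) has_real_derivative h v) (at (v i))"
        using assms(3) Suc i by auto
      then show ?thesis
        using der[OF h(2) _ i] by blast
    qed
    then show ?thesis using Suc cont assms(3) by simp
  qed
qed

lemma Ck_on_continuous: "Ck_on n k V g \<Longrightarrow> continuous_on V g"
  by (cases k) auto

lemma Ck_on_SucI:
  assumes "continuous_on V g" "\<And>i. i < n \<Longrightarrow> Ck_on n k V (h i)"
    and "\<And>i v. i < n \<Longrightarrow> v \<in> V \<Longrightarrow>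
      ((\<lambda>t. g (v(i := t))) has_real_derivative h i v) (at (v i))"
  shows "Ck_on n (Suc k) V g"
  using assms by auto

text \<open>The separate existentials for the directions are bundled into one family
  \<open>h\<close>, the form in which the inductions on the order use them.\<close>

lemma Ck_on_SucE:
  assumes "Ck_on n (Suc k) V g"
  obtains h where "\<And>i. i < n \<Longrightarrow> Ck_on n k V (h i)"
    and "\<And>i v. i < n \<Longrightarrow> v \<in> V \<Longrightarrow>
      ((\<lambda>t. g (v(i := t))) has_real_derivative h i v) (at (v i))"
proof -
  have "\<forall>i. \<exists>h. i < n \<longrightarrow> Ck_on n k V h \<and>
      (\<forall>v\<in>V. ((\<lambda>t. g (v(i := t))) has_real_derivative h v) (at (v i)))"
    using assms by auto
  then obtain h where "\<forall>i. i < n \<longrightarrow> Ck_on n k V (h i) \<and>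
      (\<forall>v\<in>V. ((\<lambda>t. g (v(i := t))) has_real_derivative h i v) (at (v i)))"
    by (rule choice[THEN exE])
  then show ?thesis using that[of h] by blast
qed

declare Ck_on.simps(2) [simp del]

lemma Ck_on_subset: "Ck_on n k V g \<Longrightarrow> V' \<subseteq> V \<Longrightarrow> Ck_on n k V' g"
proof (induction k arbitrary: g)
  case 0
  then show ?case by (auto intro: continuous_on_subset)
next
  case (Suc k)
  obtain g' where g': "\<And>i. i < n \<Longrightarrow> Ck_on n k V (g' i)"
    "\<And>i v. i < n \<Longrightarrow> v \<in> V \<Longrightarrow> ((\<lambda>t. g (v(i := t))) has_real_derivative g' i v) (at (v i))"
    using Ck_on_SucE[OF Suc.prems(1)] by blast
  show ?case
    using Ck_on_continuous[OF Suc.prems(1)] Suc.prems(2) g' Suc.IH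
    by (intro Ck_on_SucI[where h=g']) (blast intro: continuous_on_subset)+
qed

lemma Ck_on_Suc: "Ck_on n (Suc k) V g \<Longrightarrow> Ck_on n k V g"
proof (induction k arbitrary: g)
  case 0
  then show ?case using Ck_on_continuous by auto
next
  case (Suc k)
  obtain g' where g': "\<And>i. i < n \<Longrightarrow> Ck_on n (Suc k) V (g' i)"
    "\<And>i v. i < n \<Longrightarrow> v \<in> V \<Longrightarrow> ((\<lambda>t. g (v(i := t))) has_real_derivative g' i v) (at (v i))"
    using Ck_on_SucE[OF Suc.prems(1)] by blast
  show ?case
    using Ck_on_continuous[OF Suc.prems(1)] g' Suc.IH
    by (intro Ck_on_SucI[where h=g']) blast+
qed

lemma Ck_on_const: "Ck_on n k V (\<lambda>_. c)"
  by (induction k arbitrary: c) (auto intro!: Ck_on_SucI[where h="\<lambda>_ _. 0"] derivative_eq_intros)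

lemma Ck_on_add: "Ck_on n k V g \<Longrightarrow> Ck_on n k V h \<Longrightarrow> Ck_on n k V (\<lambda>v. g v + h v)"
proof (induction k arbitrary: g h)
  case 0
  then show ?case by (auto intro: continuous_intros)
next
  case (Suc k)
  obtain g' where g': "\<And>i. i < n \<Longrightarrow> Ck_on n k V (g' i)"
    "\<And>i v. i < n \<Longrightarrow> v \<in> V \<Longrightarrow> ((\<lambda>t. g (v(i := t))) has_real_derivative g' i v) (at (v i))"
    using Ck_on_SucE[OF Suc.prems(1)] by blast
  obtain h' where h': "\<And>i. i < n \<Longrightarrow> Ck_on n k V (h' i)"
    "\<And>i v. i < n \<Longrightarrow> v \<in> V \<Longrightarrow> ((\<lambda>t. h (v(i := t))) has_real_derivative h' i v) (at (v i))"
    using Ck_on_SucE[OF Suc.prems(2)] by blast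
  show ?case
  proof (rule Ck_on_SucI[where h="\<lambda>i v. g' i v + h' i v"])
    show "continuous_on V (\<lambda>v. g v + h v)"
      using Suc.prems[THEN Ck_on_continuous] by (rule continuous_on_add)
    show "Ck_on n k V (\<lambda>v. g' i v + h' i v)" if "i < n" for i
      by (rule Suc.IH[OF g'(1)[OF that] h'(1)[OF that]])
    show "((\<lambda>t. g (v(i := t)) + h (v(i := t))) has_real_derivative g' i v + h' i v) (at (v i))"
      if "i < n" "v \<in> V" for i v
      by (rule DERIV_add[OF g'(2)[OF that] h'(2)[OF that]])
  qed
qed

lemma Ck_on_mult: "Ck_on n k V g \<Longrightarrow> Ck_on n k V h \<Longrightarrow> Ck_on n k V (\<lambda>v. g v * h v)"
proof (induction k arbitrary: g h)
  case 0
  then show ?case by (auto intro: continuous_intros)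
next
  case (Suc k)
  obtain g' where g': "\<And>i. i < n \<Longrightarrow> Ck_on n k V (g' i)"
    "\<And>i v. i < n \<Longrightarrow> v \<in> V \<Longrightarrow> ((\<lambda>t. g (v(i := t))) has_real_derivative g' i v) (at (v i))"
    using Ck_on_SucE[OF Suc.prems(1)] by blast
  obtain h' where h': "\<And>i. i < n \<Longrightarrow> Ck_on n k V (h' i)"
    "\<And>i v. i < n \<Longrightarrow> v \<in> V \<Longrightarrow> ((\<lambda>t. h (v(i := t))) has_real_derivative h' i v) (at (v i))"
    using Ck_on_SucE[OF Suc.prems(2)] by blast
  show ?case
  proof (rule Ck_on_SucI[where h="\<lambda>i v. g' i v * h v + h' i v * g v"])
    show "continuous_on V (\<lambda>v. g v * h v)"
      using Suc.prems[THEN Ck_on_continuous] by (rule continuous_on_mult)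
    show "Ck_on n k V (\<lambda>v. g' i v * h v + h' i v * g v)" if "i < n" for i
      using Suc.prems[THEN Ck_on_Suc] g'(1)[OF that] h'(1)[OF that] by (intro Ck_on_add Suc.IH)
    show "((\<lambda>t. g (v(i := t)) * h (v(i := t))) has_real_derivative g' i v * h v + h' i v * g v) (at (v i))"
      if "i < n" "v \<in> V" for i v
      using DERIV_mult[OF g'(2)[OF that] h'(2)[OF that]] by simp
  qed
qed

text \<open>The derivative of \<open>inverse g\<close> is a product of \<open>inverse g\<close> with
  itself and a derivative of \<open>g\<close>, so the induction on the order closes. Squares are
  written as products to suit \<open>Ck_on_mult\<close>.\<close>

lemma Ck_on_inverse:
  assumes "\<And>v. v \<in> V \<Longrightarrow> g v \<noteq> 0"
  shows "Ck_on n k V g \<Longrightarrow> Ck_on n k V (\<lambda>v. inverse (g v))"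
proof (induction k)
  case 0
  then show ?case using assms by (auto intro: continuous_intros)
next
  case (Suc k)
  obtain g' where *:
    "\<And>i. i < n \<Longrightarrow> Ck_on n k V (g' i)"
    "\<And>i v. i < n \<Longrightarrow> v \<in> V \<Longrightarrow> ((\<lambda>t. g (v(i := t))) has_real_derivative g' i v) (at (v i))"
    using Ck_on_SucE[OF Suc.prems] by blast
  have inv: "Ck_on n k V (\<lambda>v. inverse (g v))"
    using Suc.prems Suc.IH Ck_on_Suc by blast
  have "((\<lambda>t. inverse (g (v(i := t)))) has_real_derivative
      (- 1) * (g' i v * (inverse (g v) * inverse (g v)))) (at (v i))" if "i < n" "v \<in> V" for i v
    using DERIV_inverse_fun[OF *(2)[OF that]] assms[OF that(2)]
    by (simp add: field_simps power2_eq_square)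
  moreover have "Ck_on n k V (\<lambda>v. (- 1) * (g' i v * (inverse (g v) * inverse (g v))))"
    if "i < n" for i
    by (intro Ck_on_mult inv *(1)[OF that] Ck_on_const)
  ultimately show ?case
    by (rule Ck_on_SucI[OF Ck_on_continuous[OF inv], rotated])
qed

text \<open>The neighbourhoods come with unrelated derivative functions, which have to be glued to
  one function on \<open>V\<close>. Uniqueness of derivatives makes \<open>deriv\<close> a choice
  that agrees with all of them.\<close>

lemma Ck_on_local:
  assumes "open_model n V"
    and "\<And>v. v \<in> V \<Longrightarrow> \<exists>W. open_model n W \<and> v \<in> W \<and> W \<subseteq> V \<and> Ck_on n k W g"
  shows "Ck_on n k V g"
proof -
  have cont: "continuous_on V g"
    if loc: "\<And>v. v \<in> V \<Longrightarrow> \<exists>W. open_model n W \<and> v \<in> W \<and> W \<subseteq> V \<and> continuous_on W g" for g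
    unfolding continuous_on_eq_continuous_within
  proof
    fix v assume "v \<in> V"
    then obtain W where W: "open_model n W" "v \<in> W" "W \<subseteq> V" "continuous_on W g"
      using loc by blast
    obtain T where T: "open T" "W = model_space n \<inter> T"
      using W(1) by (auto simp: openin_open)
    have "V \<subseteq> model_space n"
      using assms(1) openin_imp_subset by blast
    \<comment> \<open>Inside the open set \<open>T\<close> the sets \<open>V\<close> and
      \<open>W\<close> coincide, because \<open>V\<close> lies in the model space and
      \<open>W\<close> is what \<open>T\<close> cuts out of it.\<close>
    then have "at v within V = at v within W"
      using T W(2,3) by (intro at_within_nhd[of _ T]) auto
    then show "continuous (at v within V) g"
      using W(2,4) by (simp add: continuous_on_eq_continuous_within)
  qed
  show ?thesis
    using assms(2)
  proof (induction k arbitrary: g)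
  case 0
  show ?case
    by (simp, intro cont) (use 0 in simp)
  next
  case (Suc k)
  define d where "d i v = deriv (\<lambda>t. g (v(i := t))) (v i)" for i v
  have loc: "\<exists>W. open_model n W \<and> v \<in> W \<and> W \<subseteq> V \<and> continuous_on W g \<and> (\<forall>i<n. Ck_on n k W (d i) \<and>
      (\<forall>w\<in>W. ((\<lambda>t. g (w(i := t))) has_real_derivative d i w) (at (w i))))"
    if v: "v \<in> V" for v
  proof -
    obtain W where W: "open_model n W" "v \<in> W" "W \<subseteq> V" "Ck_on n (Suc k) W g"
      using Suc.prems[OF v] by blast
    obtain h where h: "\<And>i. i < n \<Longrightarrow> Ck_on n k W (h i)"
      "\<And>i v. i < n \<Longrightarrow> v \<in> W \<Longrightarrow> ((\<lambda>t. g (v(i := t))) has_real_derivative h i v) (at (v i))"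
      using Ck_on_SucE[OF W(4)] by blast
    have eq: "h i w = d i w" if "i < n" "w \<in> W" for i w
      using h(2)[OF that] unfolding d_def by (simp add: DERIV_imp_deriv)
    have "Ck_on n k W (d i)" if "i < n" for i
      by (rule Ck_on_cong[OF W(1) eq[OF that] h(1)[OF that]])
    moreover have "((\<lambda>t. g (w(i := t))) has_real_derivative d i w) (at (w i))"
      if "i < n" "w \<in> W" for i w
      using h(2)[OF that] eq[OF that] by simp
    ultimately show ?thesis
      using W(1-3) Ck_on_continuous[OF W(4)] by blast
  qed
  show ?case
  proof (rule Ck_on_SucI[where h=d])
    show "continuous_on V g"
      by (rule cont) (meson loc)
    show "Ck_on n k V (d i)" if "i < n" for i
      by (rule Suc.IH) (meson loc that)
    show "((\<lambda>t. g (v(i := t))) has_real_derivative d i v) (at (v i))" if "i < n" "v \<in> V" for i v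
      using loc[OF that(2)] that by meson
  qed
qed
qed

text \<open>The functions \<open>t \<mapsto> p(1/t) exp(-1/t)\<close>, extended by \<open>0\<close> to \<open>t \<le> 0\<close>, form a family closed under
  differentiation; this makes \<open>exp(-1/t)\<close> smooth without iterated difference quotients.\<close>

definition flat_fun :: "real poly \<Rightarrow> real \<Rightarrow> real"
  where "flat_fun p t = (if t > 0 then poly p (1 / t) * exp (- (1 / t)) else 0)"

lemma poly_times_exp_minus_tendsto_0: "((\<lambda>x. poly p x * exp (- x)) \<longlongrightarrow> 0) (at_top :: real filter)"
proof -
  have "((\<lambda>x. \<Sum>i\<le>degree p. coeff p i * (x ^ i / exp x)) \<longlongrightarrow> (\<Sum>i\<le>degree p. coeff p i * 0)) (at_top :: real filter)"
    by (intro tendsto_intros tendsto_power_div_exp_0)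
  moreover have "(\<lambda>x. \<Sum>i\<le>degree p. coeff p i * (x ^ i / exp x)) = (\<lambda>x. poly p x * exp (- x))"
    by (auto simp: poly_altdef fun_eq_iff sum_distrib_right exp_minus divide_inverse mult.assoc)
  ultimately show ?thesis by simp
qed

text \<open>For t > 0 put s = 1/t, so that ds/dt = -s^2. Differentiating p(s) exp(-s) gives s^2
  (p(s) - p'(s)) exp(-s), and \<open>[:0, 0, 1:]\<close> is the polynomial s^2.\<close>

lemma flat_fun_has_derivative:
  "(flat_fun p has_real_derivative flat_fun ([:0, 0, 1:] * (p - pderiv p)) t) (at t)"
proof -
  consider "t > 0" | "t < 0" | "t = 0" by linarith
  then show ?thesis
  proof cases
    case 1
    have "((\<lambda>t. poly p (1 / t) * exp (- (1 / t))) has_real_derivative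
        flat_fun ([:0, 0, 1:] * (p - pderiv p)) t) (at t)"
      using 1 by (auto intro!: derivative_eq_intros DERIV_chain2[OF poly_DERIV]
          simp: flat_fun_def field_simps power2_eq_square)
    moreover have "\<forall>\<^sub>F t in nhds t. poly p (1 / t) * exp (- (1 / t)) = flat_fun p t"
      using eventually_nhds_in_open[of "{0<..}" t] 1
      by (auto simp: flat_fun_def elim: eventually_mono)
    ultimately show ?thesis
      by (rule has_real_derivative_transform_ev)
  next
    case 2
    have "((\<lambda>t. 0) has_real_derivative flat_fun ([:0, 0, 1:] * (p - pderiv p)) t) (at t)"
      using 2 by (auto simp: flat_fun_def)
    moreover have "\<forall>\<^sub>F t in nhds t. 0 = flat_fun p t"
      using eventually_nhds_in_open[of "{..<0}" t] 2
      by (auto simp: flat_fun_def elim: eventually_mono)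
    ultimately show ?thesis
      by (rule has_real_derivative_transform_ev)
  next
    case 3
    \<comment> \<open>From the right, the difference quotient at 0 is s p(s) exp(-s) with s = 1/h,
      hence of the same type with polynomial \<open>pCons 0 p\<close>.\<close>
    have "((\<lambda>h. poly (pCons 0 p) (inverse h) * exp (- inverse h)) \<longlongrightarrow> 0) (at_right 0)"
      using filterlim_compose[OF poly_times_exp_minus_tendsto_0 filterlim_inverse_at_top_right] .
    then have "((\<lambda>h. flat_fun p h / h) \<longlongrightarrow> 0) (at_right 0)"
      by (rule Lim_transform_eventually)
        (auto simp: eventually_at_right_field flat_fun_def field_simps intro!: exI[of _ 1])
    moreover have "((\<lambda>h. flat_fun p h / h) \<longlongrightarrow> 0) (at_left 0)"
      by (rule Lim_transform_eventually[of "\<lambda>_. 0"])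
        (auto simp: eventually_at_left_field flat_fun_def intro!: exI[of _ "-1"])
    ultimately have "((\<lambda>h. flat_fun p h / h) \<longlongrightarrow> 0) (at 0)"
      by (simp add: filterlim_at_split)
    then show ?thesis
      using 3 by (simp add: DERIV_def flat_fun_def)
  qed
qed

text \<open>The polynomial varies in the induction, since each differentiation replaces
  \<open>p\<close> by \<open>?p'\<close>.\<close>

lemma Ck_on_flat_fun: "Ck_on n k V u \<Longrightarrow> Ck_on n k V (\<lambda>v. flat_fun p (u v))"
proof (induction k arbitrary: p)
  case 0
  have "continuous_on UNIV (flat_fun p)"
    using flat_fun_has_derivative DERIV_isCont continuous_at_imp_continuous_on by blast
  then show ?case
    using 0 by (auto intro: continuous_on_compose2)
next
  case (Suc k)
  let ?p' = "[:0, 0, 1:] * (p - pderiv p)"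
  obtain u' where *:
    "\<And>i. i < n \<Longrightarrow> Ck_on n k V (u' i)"
    "\<And>i v. i < n \<Longrightarrow> v \<in> V \<Longrightarrow> ((\<lambda>t. u (v(i := t))) has_real_derivative u' i v) (at (v i))"
    using Ck_on_SucE[OF Suc.prems] by blast
  have u: "Ck_on n k V u"
    using Suc.prems Ck_on_Suc by blast
  have "((\<lambda>t. flat_fun p (u (v(i := t)))) has_real_derivative flat_fun ?p' (u v) * u' i v) (at (v i))"
    if "i < n" "v \<in> V" for i v
    using DERIV_chain2[OF flat_fun_has_derivative *(2)[OF that]] by simp
  moreover have "Ck_on n k V (\<lambda>v. flat_fun ?p' (u v) * u' i v)" if "i < n" for i
    by (intro Ck_on_mult Suc.IH u *(1)[OF that])
  ultimately show ?case
    by (rule Ck_on_SucI[OF Ck_on_continuous[OF Suc.IH[OF u]], rotated])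
qed

lemma Ck_on_sum: "(\<And>i. i \<in> I \<Longrightarrow> Ck_on n k V (g i)) \<Longrightarrow> Ck_on n k V (\<lambda>v. \<Sum>i\<in>I. g i v)"
  by (induction I rule: infinite_finite_induct) (auto intro: Ck_on_const Ck_on_add)

section \<open>Charts and smooth functions on a manifold\<close>

lemma smooth_manifold_chart:
  assumes "smooth_manifold M" "(U, \<phi>) \<in> atlas M"
  shows "open U" "openin (top_of_set (model_space (mdim M))) (\<phi> ` U)"
    "homeomorphism U (\<phi> ` U) \<phi> (inv_into U \<phi>)"
proof -
  have "\<forall>(U, \<phi>)\<in>atlas M. open U \<and> openin (top_of_set (model_space (mdim M))) (\<phi> ` U) \<and>
      homeomorphism U (\<phi> ` U) \<phi> (inv_into U \<phi>)"
    using assms(1) unfolding smooth_manifold_def by (elim conjE)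
  from bspec[OF this assms(2)]
  show "open U" "openin (top_of_set (model_space (mdim M))) (\<phi> ` U)"
    "homeomorphism U (\<phi> ` U) \<phi> (inv_into U \<phi>)"
    by simp_all
qed

lemma smooth_manifold_transition:
  assumes "smooth_manifold M" "(U, \<phi>) \<in> atlas M" "(V, \<psi>) \<in> atlas M" "i < mdim M"
  shows "Cinf_on (mdim M) (\<psi> ` (U \<inter> V)) (\<lambda>v. \<phi> (inv_into V \<psi> v) i)"
proof -
  have "\<forall>(U, \<phi>)\<in>atlas M. \<forall>(V, \<psi>)\<in>atlas M. \<forall>i<mdim M.
      Cinf_on (mdim M) (\<psi> ` (U \<inter> V)) (\<lambda>v. \<phi> (inv_into V \<psi> v) i)"
    using assms(1) unfolding smooth_manifold_def by (elim conjE)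
  from bspec[OF this assms(2)] have "\<forall>(V, \<psi>)\<in>atlas M. \<forall>i<mdim M.
      Cinf_on (mdim M) (\<psi> ` (U \<inter> V)) (\<lambda>v. \<phi> (inv_into V \<psi> v) i)"
    by simp
  from bspec[OF this assms(3)] show ?thesis using assms(4) by simp
qed

lemma smooth_manifold_cover:
  assumes "smooth_manifold M"
  obtains U \<phi> where "(U, \<phi>) \<in> atlas M" "x \<in> U"
proof -
  have "x \<in> (\<Union>(U, \<phi>)\<in>atlas M. U)"
    using assms by (simp add: smooth_manifold_def)
  then show ?thesis using that by blast
qed

lemma chart_image_open:
  assumes "smooth_manifold M" "(U, \<phi>) \<in> atlas M" "open W"
  shows "open_model (mdim M) (\<phi> ` (U \<inter> W))"
proof -
  note * = smooth_manifold_chart(2,3)[OF assms(1,2)]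
  have "openin (top_of_set (\<phi> ` U)) (\<phi> ` (U \<inter> W))"
    using homeomorphism_imp_open_map[OF *(2)] assms(3) by (simp add: openin_open_Int)
  then show ?thesis
    using *(1) openin_trans by blast
qed

lemma chart_inv:
  assumes "smooth_manifold M" "(U, \<phi>) \<in> atlas M"
  shows "y \<in> U \<Longrightarrow> inv_into U \<phi> (\<phi> y) = y"
  using smooth_manifold_chart(3)[OF assms] by (simp add: homeomorphism_def)

lemma smooth_on_iff:
  "smooth_on M W f \<longleftrightarrow> (\<forall>(U, \<phi>)\<in>atlas M. \<forall>k.
     Ck_on (mdim M) k (\<phi> ` (U \<inter> W)) (\<lambda>v. f (inv_into U \<phi> v)))"
  by (simp add: smooth_on_def Cinf_on_def)

lemma smooth_onI:
  assumes "\<And>U \<phi> k. (U, \<phi>) \<in> atlas M \<Longrightarrow>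
    Ck_on (mdim M) k (\<phi> ` (U \<inter> W)) (\<lambda>v. f (inv_into U \<phi> v))"
  shows "smooth_on M W f"
  using assms by (auto simp: smooth_on_iff)

lemma smooth_onD:
  assumes "smooth_on M W f" "(U, \<phi>) \<in> atlas M"
  shows "Ck_on (mdim M) k (\<phi> ` (U \<inter> W)) (\<lambda>v. f (inv_into U \<phi> v))"
  using assms by (auto simp: smooth_on_iff)

lemma smooth_on_cong:
  assumes "smooth_manifold M" "open W" "\<And>y. y \<in> W \<Longrightarrow> f y = g y" "smooth_on M W f"
  shows "smooth_on M W g"
proof (rule smooth_onI, rule Ck_on_cong)
  fix U \<phi> k assume U: "(U, \<phi>) \<in> atlas M"
  show "open_model (mdim M) (\<phi> ` (U \<inter> W))"
    by (rule chart_image_open[OF assms(1) U assms(2)])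
  show "Ck_on (mdim M) k (\<phi> ` (U \<inter> W)) (\<lambda>v. f (inv_into U \<phi> v))"
    by (rule smooth_onD[OF assms(4) U])
  show "f (inv_into U \<phi> v) = g (inv_into U \<phi> v)" if "v \<in> \<phi> ` (U \<inter> W)" for v
    using that chart_inv[OF assms(1) U] assms(3) by auto
qed

lemma smooth_on_subset: "smooth_on M W f \<Longrightarrow> W' \<subseteq> W \<Longrightarrow> smooth_on M W' f"
  by (rule smooth_onI, rule Ck_on_subset, erule (1) smooth_onD) auto

lemma smooth_on_const: "smooth_on M W (\<lambda>_. c)"
  by (intro smooth_onI Ck_on_const)

lemma smooth_on_add: "smooth_on M W f \<Longrightarrow> smooth_on M W g \<Longrightarrow> smooth_on M W (\<lambda>y. f y + g y)"
  by (rule smooth_onI, rule Ck_on_add; rule smooth_onD; assumption)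

lemma smooth_on_mult: "smooth_on M W f \<Longrightarrow> smooth_on M W g \<Longrightarrow> smooth_on M W (\<lambda>y. f y * g y)"
  by (rule smooth_onI, rule Ck_on_mult; rule smooth_onD; assumption)

lemma smooth_on_sum:
  "(\<And>i. i \<in> I \<Longrightarrow> smooth_on M W (f i)) \<Longrightarrow> smooth_on M W (\<lambda>y. \<Sum>i\<in>I. f i y)"
  by (induction I rule: infinite_finite_induct) (auto intro: smooth_on_const smooth_on_add)

lemma smooth_on_inverse:
  assumes "smooth_manifold M" "\<And>y. y \<in> W \<Longrightarrow> f y \<noteq> 0" "smooth_on M W f"
  shows "smooth_on M W (\<lambda>y. inverse (f y))"
proof (rule smooth_onI, rule Ck_on_inverse)
  fix U \<phi> k assume U: "(U, \<phi>) \<in> atlas M"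
  show "Ck_on (mdim M) k (\<phi> ` (U \<inter> W)) (\<lambda>v. f (inv_into U \<phi> v))"
    by (rule smooth_onD[OF assms(3) U])
  show "f (inv_into U \<phi> v) \<noteq> 0" if "v \<in> \<phi> ` (U \<inter> W)" for v
    using that chart_inv[OF assms(1) U] assms(2) by auto
qed

lemma smooth_on_local:
  assumes M: "smooth_manifold M" and "open W"
    and loc: "\<And>y. y \<in> W \<Longrightarrow> \<exists>W'. open W' \<and> y \<in> W' \<and> W' \<subseteq> W \<and> smooth_on M W' f"
  shows "smooth_on M W f"
proof (rule smooth_onI, rule Ck_on_local)
  fix U \<phi> k assume U: "(U, \<phi>) \<in> atlas M"
  show "open_model (mdim M) (\<phi> ` (U \<inter> W))"
    by (rule chart_image_open[OF M U \<open>open W\<close>])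
  fix v assume "v \<in> \<phi> ` (U \<inter> W)"
  then obtain y where y: "y \<in> U" "y \<in> W" "v = \<phi> y" by blast
  then obtain W' where W': "open W'" "y \<in> W'" "W' \<subseteq> W" "smooth_on M W' f"
    using loc by blast
  show "\<exists>V'. open_model (mdim M) V' \<and> v \<in> V' \<and> V' \<subseteq> \<phi> ` (U \<inter> W) \<and>
      Ck_on (mdim M) k V' (\<lambda>v. f (inv_into U \<phi> v))"
    using chart_image_open[OF M U W'(1)] y W'(2,3) smooth_onD[OF W'(4) U]
    by (intro exI[of _ "\<phi> ` (U \<inter> W')"]) blast
qed

section \<open>Bump functions\<close>

lemma open_model_box:
  assumes "open_model n V" "p \<in> V"
  obtains \<epsilon> where "\<epsilon> > 0" "{v \<in> model_space n. \<forall>i<n. \<bar>v i - p i\<bar> \<le> \<epsilon>} \<subseteq> V"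
proof -
  obtain T where T: "open T" "V = model_space n \<inter> T"
    using assms(1) by (auto simp: openin_open)
  then have "openin (product_topology (\<lambda>_. euclidean) UNIV) T" "p \<in> T"
    using assms(2) by (auto simp: euclidean_product_topology)
  then obtain X where X: "p \<in> Pi\<^sub>E UNIV X" "\<And>i. open (X i)" "Pi\<^sub>E UNIV X \<subseteq> T"
    using product_topology_open_contains_basis[of "\<lambda>_. euclidean" UNIV T p] by auto
  have p: "p i \<in> X i" for i using X(1) by auto
  have "\<forall>i. \<exists>e>0. cball (p i) e \<subseteq> X i"
    using p X(2) open_contains_cball by blast
  then obtain e where e: "\<And>i. e i > 0" "\<And>i. cball (p i) (e i) \<subseteq> X i"
    by metis
  \<comment> \<open>The extra element 1 keeps the minimum meaningful in dimension 0.\<close>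
  define \<epsilon> where "\<epsilon> = Min (insert 1 (e ` {..<n}))"
  have "\<epsilon> > 0" using e(1) by (auto simp: \<epsilon>_def)
  moreover have "v \<in> V" if v: "v \<in> model_space n" "\<forall>i<n. \<bar>v i - p i\<bar> \<le> \<epsilon>" for v
  proof -
    have "v i \<in> X i" for i
    proof (cases "i < n")
      case True
      then have "\<epsilon> \<le> e i" by (auto simp: \<epsilon>_def)
      then have "v i \<in> cball (p i) (e i)"
        using v(2) True by (force simp: dist_real_def)
      then show ?thesis using e(2) by blast
    next
      case False
      \<comment> \<open>From index \<open>n\<close> on, all points of the model space have
        coordinate 0, so the infinitely many remaining conditions hold automatically.\<close>
      then have "v i = p i"
        using v(1) assms T(2) by (auto simp: model_space_def)
      then show ?thesis using p by simp
    qed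
    then show ?thesis using X(3) v(1) T(2) by auto
  qed
  ultimately show ?thesis using that by blast
qed

text \<open>The box is a product of compact intervals and of copies of the point 0, so this is
  Tychonoff's theorem.\<close>

lemma compact_model_box: "compact {v \<in> model_space n. \<forall>i<n. \<bar>v i - p i\<bar> \<le> \<epsilon>}"
proof -
  have "{v \<in> model_space n. \<forall>i<n. \<bar>v i - p i\<bar> \<le> \<epsilon>} =
      Pi\<^sub>E UNIV (\<lambda>i. if i < n then {p i - \<epsilon>..p i + \<epsilon>} else {0})"
    by (force simp: model_space_def PiE_def Pi_def abs_le_iff split: if_splits)
  moreover have "compactin (product_topology (\<lambda>_. euclidean) UNIV)
      (Pi\<^sub>E UNIV (\<lambda>i. if i < n then {p i - \<epsilon>..p i + \<epsilon>} else {0}))"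
    by (simp add: compactin_PiE)
  ultimately show ?thesis
    by (simp add: euclidean_product_topology)
qed

text \<open>In a chart around \<open>x\<close> the function is exp(-1/u), extended by 0 to u \<le>
  0, with u the difference of \<epsilon>^2 and the squared distance from the centre
  \<open>p\<close>. It vanishes off the compact set \<open>K\<close>, so it is smooth on the chart
  domain and on the complement of \<open>K\<close>, and these two open sets cover the
  manifold.\<close>

lemma smooth_bump:
  fixes M :: "'m::{t2_space,second_countable_topology} manifold"
  assumes M: "smooth_manifold M" and "open W" "x \<in> W"
  obtains f K where "smooth_on M UNIV f" "f x \<noteq> 0" "closed K" "K \<subseteq> W" "\<And>y. y \<notin> K \<Longrightarrow> f y = 0"
proof -
  obtain U \<phi> where U: "(U, \<phi>) \<in> atlas M" "x \<in> U"
    using smooth_manifold_cover[OF M] by blast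
  note hom = smooth_manifold_chart(3,1)[OF M U(1)]
  have model: "\<phi> ` U \<subseteq> model_space (mdim M)"
    using smooth_manifold_chart(2)[OF M U(1)] by (rule openin_imp_subset)
  define n where "n = mdim M"
  define p where "p = \<phi> x"
  have "p \<in> \<phi> ` (U \<inter> W)" using U(2) assms(3) by (simp add: p_def)
  then obtain \<epsilon> where \<epsilon>: "\<epsilon> > 0" "{v \<in> model_space n. \<forall>i<n. \<bar>v i - p i\<bar> \<le> \<epsilon>} \<subseteq> \<phi> ` (U \<inter> W)"
    using open_model_box[OF chart_image_open[OF M U(1) \<open>open W\<close>]] unfolding n_def by blast
  define B where "B = {v \<in> model_space n. \<forall>i<n. \<bar>v i - p i\<bar> \<le> \<epsilon>}"
  define K where "K = inv_into U \<phi> ` B"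
  have "continuous_on B (inv_into U \<phi>)"
    by (rule continuous_on_subset[of "\<phi> ` U"])
      (use hom(1) \<epsilon>(2) in \<open>auto simp: homeomorphism_def B_def\<close>)
  then have "compact K"
    using compact_model_box unfolding K_def B_def by (intro compact_continuous_image)
  \<comment> \<open>Closed in the whole manifold and not merely in the chart domain: this is where
    the Hausdorff property enters.\<close>
  then have K: "closed K" by (rule compact_imp_closed)
  have KU: "K \<subseteq> U \<inter> W"
  proof
    fix y assume "y \<in> K"
    then obtain v where "v \<in> B" "y = inv_into U \<phi> v" unfolding K_def by blast
    moreover then obtain z where "z \<in> U \<inter> W" "v = \<phi> z" using \<epsilon>(2) unfolding B_def by blast
    ultimately show "y \<in> U \<inter> W" using chart_inv[OF M U(1)] by auto
  qed
  \<comment> \<open>Differences and squares are spelled out as sums and products so that the closure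
    rules for \<open>Ck_on\<close> apply.\<close>
  define u where "u y = \<epsilon>\<^sup>2 + (- 1) * (\<Sum>i<n. (\<phi> y i + - p i) * (\<phi> y i + - p i))" for y
  define f where "f y = (if y \<in> U then flat_fun 1 (u y) else 0)" for y
  have out: "f y = 0" if "y \<notin> K" for y
  proof (cases "y \<in> U")
    case True
    have "\<phi> y \<notin> B"
      using that chart_inv[OF M U(1) True] unfolding K_def by force
    then obtain i where i: "i < n" "\<bar>\<phi> y i - p i\<bar> > \<epsilon>"
      using model True unfolding B_def n_def by force
    have "\<epsilon>\<^sup>2 \<le> (\<phi> y i - p i)\<^sup>2"
      using i(2) \<epsilon>(1) by (simp add: abs_le_square_iff[symmetric])
    also have "\<dots> \<le> (\<Sum>i<n. (\<phi> y i - p i)\<^sup>2)"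
      using i(1) by (intro member_le_sum) auto
    finally have "u y \<le> 0" by (simp add: u_def power2_eq_square)
    then show ?thesis by (simp add: f_def flat_fun_def)
  qed (simp add: f_def)
  have "smooth_on M U f"
  proof (rule smooth_onI, rule Ck_on_cong)
    fix V \<psi> k assume V: "(V, \<psi>) \<in> atlas M"
    show "open_model (mdim M) (\<psi> ` (V \<inter> U))"
      by (rule chart_image_open[OF M V hom(2)])
    have "Ck_on (mdim M) k (\<psi> ` (V \<inter> U)) (\<lambda>v. \<phi> (inv_into V \<psi> v) i)" if "i < n" for i
    proof -
      have "Cinf_on (mdim M) (\<psi> ` (U \<inter> V)) (\<lambda>v. \<phi> (inv_into V \<psi> v) i)"
        using smooth_manifold_transition[OF M U(1) V] that unfolding n_def by blast
      then show ?thesis by (simp add: Cinf_on_def Int_commute)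
    qed
    then show "Ck_on (mdim M) k (\<psi> ` (V \<inter> U)) (\<lambda>v. flat_fun 1 (u (inv_into V \<psi> v)))"
      unfolding u_def
      by (intro Ck_on_flat_fun Ck_on_add Ck_on_const Ck_on_mult Ck_on_sum) auto
    show "flat_fun 1 (u (inv_into V \<psi> v)) = f (inv_into V \<psi> v)" if "v \<in> \<psi> ` (V \<inter> U)" for v
      using that chart_inv[OF M V] by (auto simp: f_def)
  qed
  moreover have "smooth_on M (- K) f"
    by (rule smooth_on_cong[OF M _ _ smooth_on_const[of _ _ 0]]) (use K out in auto)
  ultimately have "smooth_on M UNIV f"
    using K KU hom(2) by (intro smooth_on_local[OF M open_UNIV]) (meson ComplI IntD1 open_Compl subsetD subset_UNIV)
  moreover have "f x \<noteq> 0"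
    using U(2) \<epsilon>(1) by (simp add: f_def u_def p_def flat_fun_def)
  ultimately show ?thesis using that K KU out by blast
qed

lemma smooth_on_imp_continuous:
  assumes M: "smooth_manifold M" and f: "smooth_on M UNIV f"
  shows "continuous_on UNIV f"
  unfolding continuous_on_eq_continuous_at[OF open_UNIV]
proof
  fix x
  obtain U \<phi> where U: "(U, \<phi>) \<in> atlas M" "x \<in> U"
    using smooth_manifold_cover[OF M] by blast
  note hom = smooth_manifold_chart[OF M U(1)]
  have "continuous_on (\<phi> ` U) (\<lambda>v. f (inv_into U \<phi> v))"
    using Ck_on_continuous[OF smooth_onD[OF f U(1)]] by simp
  then have "continuous_on U (\<lambda>y. f (inv_into U \<phi> (\<phi> y)))"
    by (rule continuous_on_compose2) (use hom(3) in \<open>auto simp: homeomorphism_def\<close>)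
  moreover have "continuous_on U (\<lambda>y. f (inv_into U \<phi> (\<phi> y))) \<longleftrightarrow> continuous_on U f"
    by (rule continuous_on_cong[OF refl]) (simp add: chart_inv[OF M U(1)])
  ultimately have "continuous_on U f"
    by simp
  then show "continuous (at x) f"
    using continuous_on_eq_continuous_at[OF hom(1)] U(2) by blast
qed

section \<open>Modules of sections, described by global functions only\<close>

definition cmodule :: "('m \<Rightarrow> real) set \<Rightarrow> ('m \<Rightarrow> 'e::real_vector) set \<Rightarrow> bool" where
  "cmodule C \<Gamma> \<longleftrightarrow>
     0 \<in> \<Gamma> \<and> (\<forall>s\<in>\<Gamma>. \<forall>t\<in>\<Gamma>. s + t \<in> \<Gamma>) \<and> (\<forall>f\<in>C. \<forall>s\<in>\<Gamma>. f \<odot> s \<in> \<Gamma>)"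

text \<open>Global sections that behave like dual frames up to the factor \<open>f\<close>: the sum
  of the tensors of \<open>e i\<close> and \<open>e' i\<close> acts as multiplication by
  \<open>f\<close> on both families of fibres. Where \<open>f\<close> vanishes, nothing is asserted
  about spanning.\<close>

definition dual_bases ::
    "('m \<Rightarrow> 'e::real_vector set) \<Rightarrow> ('m \<Rightarrow> 'e) set \<Rightarrow> ('m \<Rightarrow> 'd::real_vector set) \<Rightarrow> ('m \<Rightarrow> 'd) set \<Rightarrow>
     ('e \<Rightarrow> 'd \<Rightarrow> real) \<Rightarrow> ('m \<Rightarrow> real) \<Rightarrow> nat \<Rightarrow> (nat \<Rightarrow> 'm \<Rightarrow> 'e) \<Rightarrow> (nat \<Rightarrow> 'm \<Rightarrow> 'd) \<Rightarrow> bool" where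
  "dual_bases F \<Gamma> F' \<Gamma>' pr f n e e' \<longleftrightarrow>
     (\<forall>i<n. e i \<in> \<Gamma> \<and> e' i \<in> \<Gamma>') \<and>
     (\<forall>y. (\<forall>v\<in>F y. f y *\<^sub>R v = (\<Sum>i<n. pr v (e' i y) *\<^sub>R e i y)) \<and>
          (\<forall>w\<in>F' y. f y *\<^sub>R w = (\<Sum>i<n. pr (e i y) w *\<^sub>R e' i y)))"

definition local_dual_bases ::
    "('m \<Rightarrow> real) set \<Rightarrow> ('m \<Rightarrow> 'e::real_vector set) \<Rightarrow> ('m \<Rightarrow> 'e) set \<Rightarrow>
     ('m \<Rightarrow> 'd::real_vector set) \<Rightarrow> ('m \<Rightarrow> 'd) set \<Rightarrow> ('e \<Rightarrow> 'd \<Rightarrow> real) \<Rightarrow> bool" where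
  "local_dual_bases C F \<Gamma> F' \<Gamma>' pr \<longleftrightarrow>
     (\<forall>x. \<exists>f\<in>C. f x \<noteq> 0 \<and> (\<exists>n e e'. dual_bases F \<Gamma> F' \<Gamma>' pr f n e e'))"

text \<open>The last clause is the sheaf property in terms of global functions: a choice of fibre
  elements is a section as soon as around every point it becomes one after multiplication by a
  function that is nonzero there.\<close>

definition local_module :: "('m \<Rightarrow> real) set \<Rightarrow> ('m \<Rightarrow> 'e::real_vector set) \<Rightarrow> ('m \<Rightarrow> 'e) set \<Rightarrow> bool" where
  "local_module C F \<Gamma> \<longleftrightarrow> cmodule C \<Gamma> \<and>
     (\<forall>x. subspace (F x)) \<and> (\<forall>s\<in>\<Gamma>. \<forall>x. s x \<in> F x) \<and>
     (\<forall>s. (\<forall>x. s x \<in> F x \<and> (\<exists>f\<in>C. f x \<noteq> 0 \<and> f \<odot> s \<in> \<Gamma>)) \<longrightarrow> s \<in> \<Gamma>)"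

section \<open>Vector bundles and duality\<close>

text \<open>All that is used of a vector bundle and its dual.\<close>

definition dual_pair ::
    "('m \<Rightarrow> real) set \<Rightarrow> ('m \<Rightarrow> 'e::real_vector set) \<Rightarrow> ('m \<Rightarrow> 'e) set \<Rightarrow>
     ('m \<Rightarrow> 'd::real_vector set) \<Rightarrow> ('m \<Rightarrow> 'd) set \<Rightarrow> ('e \<Rightarrow> 'd \<Rightarrow> real) \<Rightarrow> bool" where
  "dual_pair C F \<Gamma> F' \<Gamma>' pr \<longleftrightarrow>
     local_module C F \<Gamma> \<and> local_module C F' \<Gamma>' \<and> local_dual_bases C F \<Gamma> F' \<Gamma>' pr \<and>
     (\<forall>x. \<forall>w\<in>F' x. \<forall>v\<in>F x. (\<forall>v'\<in>F x. pr (v + v') w = pr v w + pr v' w) \<and>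
        (\<forall>c. pr (c *\<^sub>R v) w = c * pr v w) \<and>
        (\<forall>w'\<in>F' x. pr v (w + w') = pr v w + pr v w') \<and>
        (\<forall>c. pr v (c *\<^sub>R w) = c * pr v w)) \<and>
     (\<forall>s\<in>\<Gamma>. \<forall>t\<in>\<Gamma>'. (\<lambda>x. pr (s x) (t x)) \<in> C)"

lemma dual_bases_sym:
  "dual_bases F \<Gamma> F' \<Gamma>' pr f n e e' \<Longrightarrow> dual_bases F' \<Gamma>' F \<Gamma> (\<lambda>w v. pr v w) f n e' e"
  by (simp add: dual_bases_def)

lemma local_dual_bases_sym:
  "local_dual_bases C F \<Gamma> F' \<Gamma>' pr \<Longrightarrow> local_dual_bases C F' \<Gamma>' F \<Gamma> (\<lambda>w v. pr v w)"
  unfolding local_dual_bases_def using dual_bases_sym by blast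

text \<open>Results on the first module of a pair become available for the second. This replaces the
  identification of a bundle with its bidual.\<close>

lemma dual_pair_sym:
  assumes "dual_pair C F \<Gamma> F' \<Gamma>' pr"
  shows "dual_pair C F' \<Gamma>' F \<Gamma> (\<lambda>w v. pr v w)"
  using assms local_dual_bases_sym[of C F \<Gamma> F' \<Gamma>' pr] unfolding dual_pair_def by simp

section \<open>Frames and dual frames\<close>

lemma vector_bundle_frame:
  assumes "vector_bundle M E" "(U, r, e) \<in> frames E"
  shows "open U"
    and "x \<in> U \<Longrightarrow> inj_on (\<lambda>i. e i x) {..<r}"
    and "x \<in> U \<Longrightarrow> independent ((\<lambda>i. e i x) ` {..<r})"
    and "x \<in> U \<Longrightarrow> span ((\<lambda>i. e i x) ` {..<r}) = fibre E x"
proof -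
  have "\<forall>(U, r, e)\<in>frames E. open U \<and>
        (\<forall>x\<in>U. inj_on (\<lambda>i. e i x) {..<r} \<and> independent ((\<lambda>i. e i x) ` {..<r}) \<and>
               span ((\<lambda>i. e i x) ` {..<r}) = fibre E x)"
    using assms(1) unfolding vector_bundle_def by (elim conjE)
  from bspec[OF this assms(2)]
  show "open U"
    and "x \<in> U \<Longrightarrow> inj_on (\<lambda>i. e i x) {..<r}"
    and "x \<in> U \<Longrightarrow> independent ((\<lambda>i. e i x) ` {..<r})"
    and "x \<in> U \<Longrightarrow> span ((\<lambda>i. e i x) ` {..<r}) = fibre E x"
    by simp_all
qed

lemma vector_bundle_transition:
  assumes "vector_bundle M E" "(U, r, e) \<in> frames E" "(V, s, e') \<in> frames E" "j < s"
  obtains c where "\<And>i. i < r \<Longrightarrow> smooth_on M (U \<inter> V) (c i)"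
    and "\<And>x. x \<in> U \<Longrightarrow> x \<in> V \<Longrightarrow> e' j x = (\<Sum>i<r. c i x *\<^sub>R e i x)"
proof -
  have "\<forall>(U, r, e)\<in>frames E. \<forall>(V, s, e')\<in>frames E. \<forall>j<s.
        \<exists>c. (\<forall>i<r. smooth_on M (U \<inter> V) (c i)) \<and>
            (\<forall>x\<in>U \<inter> V. e' j x = (\<Sum>i<r. c i x *\<^sub>R e i x))"
    using assms(1) unfolding vector_bundle_def by (elim conjE)
  from bspec[OF this assms(2)] have "\<forall>(V, s, e')\<in>frames E. \<forall>j<s.
        \<exists>c. (\<forall>i<r. smooth_on M (U \<inter> V) (c i)) \<and>
            (\<forall>x\<in>U \<inter> V. e' j x = (\<Sum>i<r. c i x *\<^sub>R e i x))"
    by simp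
  from bspec[OF this assms(3)] assms(4) obtain c where "\<forall>i<r. smooth_on M (U \<inter> V) (c i)"
    "\<forall>x\<in>U \<inter> V. e' j x = (\<Sum>i<r. c i x *\<^sub>R e i x)"
    by auto
  then show ?thesis
    by (intro that[of c]) auto
qed

lemma vector_bundle_cover:
  assumes "vector_bundle M E"
  obtains U r e where "(U, r, e) \<in> frames E" "x \<in> U"
proof -
  have "x \<in> (\<Union>(U, r, e)\<in>frames E. U)"
    using assms by (simp add: vector_bundle_def)
  then show ?thesis using that by blast
qed

lemma vector_bundle_subspace: "vector_bundle M E \<Longrightarrow> subspace (fibre E x)"
  by (simp add: vector_bundle_def)

lemma frame_in_fibre:
  assumes "vector_bundle M E" "(U, r, e) \<in> frames E" "x \<in> U" "i < r"
  shows "e i x \<in> fibre E x"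
proof -
  have "e i x \<in> span ((\<lambda>i. e i x) ` {..<r})"
    using assms(4) by (intro span_base) simp
  then show ?thesis
    using vector_bundle_frame(4)[OF assms(1-3)] by simp
qed

lemma frame_coordinates_unique:
  assumes "vector_bundle M E" "(U, r, e) \<in> frames E" "x \<in> U"
    and "(\<Sum>i<r. c i *\<^sub>R e i x) = (\<Sum>i<r. d i *\<^sub>R e i x)" "i < r"
  shows "c i = d i"
proof -
  let ?B = "(\<lambda>i. e i x) ` {..<r}"
  \<comment> \<open>Independence is a property of the set of frame vectors; \<open>?h\<close>
    recovers the index from the vector.\<close>
  let ?h = "inv_into {..<r} (\<lambda>i. e i x)"
  note fr = vector_bundle_frame(2,3)[OF assms(1-3)]
  have h: "?h (e i x) = i" if "i < r" for i
    using inv_into_f_f[OF fr(1), of i] that by simp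
  have "(\<Sum>v\<in>?B. (c (?h v) - d (?h v)) *\<^sub>R v) = (\<Sum>i<r. (c i - d i) *\<^sub>R e i x)"
    using fr(1) h by (simp add: sum.reindex)
  also have "\<dots> = 0"
    using assms(4) by (simp add: scaleR_left_diff_distrib sum_subtractf)
  finally have "c (?h (e i x)) - d (?h (e i x)) = 0"
    using assms(5) by (intro independentD[OF fr(2) _ subset_refl]) auto
  then show ?thesis using h[OF assms(5)] by simp
qed

lemma frame_coordinates_exist:
  assumes "vector_bundle M E" "(U, r, e) \<in> frames E" "x \<in> U" "v \<in> fibre E x"
  shows "\<exists>c. v = (\<Sum>i<r. c i *\<^sub>R e i x)"
proof -
  note fr = vector_bundle_frame[OF assms(1,2)]
  have "v \<in> span ((\<lambda>i. e i x) ` {..<r})"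
    using fr(4)[OF assms(3)] assms(4) by simp
  then obtain u where "v = (\<Sum>w\<in>(\<lambda>i. e i x) ` {..<r}. u w *\<^sub>R w)"
    by (auto simp: span_finite)
  then have "v = (\<Sum>i<r. u (e i x) *\<^sub>R e i x)"
    using fr(2)[OF assms(3)] by (simp add: sum.reindex)
  then show ?thesis by (rule exI[of _ "\<lambda>i. u (e i x)"])
qed

text \<open>Functionals in \<open>dual_fibre F\<close> are linear on \<open>F\<close> only, so
  membership of the partial sums in \<open>F\<close> is carried along.\<close>

lemma dual_fibre_sum:
  assumes "\<phi> \<in> dual_fibre F" "subspace F" "\<And>i. i \<in> I \<Longrightarrow> v i \<in> F"
  shows "\<phi> (\<Sum>i\<in>I. c i *\<^sub>R v i) = (\<Sum>i\<in>I. c i * \<phi> (v i))"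
proof -
  have zero: "\<phi> 0 = 0"
    using assms(1) subspace_0[OF assms(2)] unfolding dual_fibre_def by force
  show ?thesis
    using assms(3)
  proof (induction I rule: infinite_finite_induct)
    case (insert i I)
    have *: "c i *\<^sub>R v i \<in> F" "(\<Sum>i\<in>I. c i *\<^sub>R v i) \<in> F"
      using insert.prems assms(2) by (auto intro: subspace_scale subspace_sum)
    have "\<phi> (\<Sum>j\<in>insert i I. c j *\<^sub>R v j) = \<phi> (c i *\<^sub>R v i) + \<phi> (\<Sum>i\<in>I. c i *\<^sub>R v i)"
      using insert.hyps * assms(1) by (simp add: dual_fibre_def)
    also have "\<dots> = (\<Sum>j\<in>insert i I. c j * \<phi> (v j))"
      using insert assms(1) by (simp add: dual_fibre_def)
    finally show ?case .
  qed (auto simp: zero)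
qed

lemma subspace_dual_fibre:
  assumes "subspace F"
  shows "subspace (dual_fibre F)"
proof (rule subspaceI)
  note F = subspace_add[OF assms] subspace_scale[OF assms]
  show "0 \<in> dual_fibre F" by (simp add: dual_fibre_def)
  show "\<phi> + \<psi> \<in> dual_fibre F" if "\<phi> \<in> dual_fibre F" "\<psi> \<in> dual_fibre F" for \<phi> \<psi>
    using that F by (simp add: dual_fibre_def distrib_left)
  show "c *\<^sub>R \<phi> \<in> dual_fibre F" if "\<phi> \<in> dual_fibre F" for c \<phi>
    using that F by (simp add: dual_fibre_def scaleR_fun_def distrib_left mult.left_commute)
qed

lemma sum_fun_apply: "(\<Sum>i\<in>I. f i) x = (\<Sum>i\<in>I. f i x)"
  by (induction I rule: infinite_finite_induct) auto

lemma dual_frames_iff: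
  "(U, r, \<epsilon>) \<in> frames (dual_bundle E) \<longleftrightarrow> (\<exists>e. (U, r, e) \<in> frames E \<and>
     (\<forall>x\<in>U. \<forall>i<r. \<epsilon> i x \<in> dual_fibre (fibre E x) \<and>
        (\<forall>j<r. \<epsilon> i x (e j x) = (if i = j then 1 else 0))))"
  by (simp add: dual_bundle_def)

lemma fibre_dual_bundle: "fibre (dual_bundle E) x = dual_fibre (fibre E x)"
  by (simp add: dual_bundle_def)

text \<open>The coordinate functions of a frame form the dual frame; uniqueness of coordinates makes
  the chosen ones linear. Existence matters because \<open>dual_bundle\<close> describes its frames
  by the duality relations alone, and without it they might fail to cover the base.\<close>

lemma dual_frame_exists:
  assumes E: "vector_bundle M E" and U: "(U, r, e) \<in> frames E"
  obtains \<epsilon> where "\<And>x i. x \<in> U \<Longrightarrow> i < r \<Longrightarrow> \<epsilon> i x \<in> dual_fibre (fibre E x)"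
    and "\<And>x i j. x \<in> U \<Longrightarrow> i < r \<Longrightarrow> j < r \<Longrightarrow> \<epsilon> i x (e j x) = (if i = j then 1 else 0)"
proof -
  define co where "co x v = (SOME c. v = (\<Sum>i<r. c i *\<^sub>R e i x))" for x v
  have co: "v = (\<Sum>i<r. co x v i *\<^sub>R e i x)" if "x \<in> U" "v \<in> fibre E x" for x v
    using someI_ex[OF frame_coordinates_exist[OF E U that]] by (simp add: co_def)
  have eq: "co x v i = c i" if "x \<in> U" "v \<in> fibre E x" "v = (\<Sum>i<r. c i *\<^sub>R e i x)" "i < r" for x v c i
    by (rule frame_coordinates_unique[OF E U that(1) _ that(4), where c="co x v" and d=c])
      (use co[OF that(1,2)] that(3) in simp)
  define \<epsilon> where "\<epsilon> i x v = (if v \<in> fibre E x then co x v i else 0)" for i x v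
  note sub = vector_bundle_subspace[OF E]
  have "\<epsilon> i x \<in> dual_fibre (fibre E x)" if x: "x \<in> U" "i < r" for x i
  proof -
    have "co x (v + w) i = co x v i + co x w i" if "v \<in> fibre E x" "w \<in> fibre E x" for v w
    proof (rule eq[OF x(1) subspace_add[OF sub that] _ x(2)])
      show "v + w = (\<Sum>i<r. (co x v i + co x w i) *\<^sub>R e i x)"
        using co[OF x(1) that(1)] co[OF x(1) that(2)]
        by (simp add: scaleR_left_distrib sum.distrib)
    qed
    moreover have "co x (c *\<^sub>R v) i = c * co x v i" if "v \<in> fibre E x" for v c
    proof (rule eq[OF x(1) subspace_scale[OF sub that] _ x(2)])
      have "c *\<^sub>R v = c *\<^sub>R (\<Sum>i<r. co x v i *\<^sub>R e i x)"
        using co[OF x(1) that] by simp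
      then show "c *\<^sub>R v = (\<Sum>i<r. (c * co x v i) *\<^sub>R e i x)"
        by (simp add: scaleR_sum_right)
    qed
    ultimately show ?thesis
      using sub by (simp add: dual_fibre_def \<epsilon>_def subspace_add subspace_scale)
  qed
  moreover have "\<epsilon> i x (e j x) = (if i = j then 1 else 0)" if "x \<in> U" "i < r" "j < r" for x i j
  proof -
    have "e j x = (\<Sum>i<r. (if i = j then 1 else 0) *\<^sub>R e i x)"
      using that(3) by (simp add: if_distrib[of "\<lambda>c. c *\<^sub>R _"] cong: if_cong)
    from eq[OF that(1) _ this that(2)] show ?thesis
      using frame_in_fibre[OF E U that(1,3)] by (simp add: \<epsilon>_def)
  qed
  ultimately show ?thesis using that by blast
qed

lemma dual_frame_expand:
  assumes E: "vector_bundle M E" and U: "(U, r, e) \<in> frames E" and x: "x \<in> U"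
    and \<epsilon>: "\<And>i. i < r \<Longrightarrow> \<epsilon> i x \<in> dual_fibre (fibre E x)"
    "\<And>i j. i < r \<Longrightarrow> j < r \<Longrightarrow> \<epsilon> i x (e j x) = (if i = j then 1 else (0::real))"
  shows "v \<in> fibre E x \<Longrightarrow> v = (\<Sum>i<r. \<epsilon> i x v *\<^sub>R e i x)"
    and "\<phi> \<in> dual_fibre (fibre E x) \<Longrightarrow> \<phi> = (\<Sum>i<r. \<phi> (e i x) *\<^sub>R \<epsilon> i x)"
proof -
  note sub = vector_bundle_subspace[OF E, of x]
  show exp: "v = (\<Sum>i<r. \<epsilon> i x v *\<^sub>R e i x)" if v: "v \<in> fibre E x" for v
  proof -
    obtain c where c: "v = (\<Sum>i<r. c i *\<^sub>R e i x)"
      using frame_coordinates_exist[OF E U x v] by (elim exE)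
    have "\<epsilon> i x v = c i" if "i < r" for i
    proof -
      have "\<epsilon> i x v = (\<Sum>j<r. c j * \<epsilon> i x (e j x))"
        unfolding c using frame_in_fibre[OF E U x]
        by (intro dual_fibre_sum[OF \<epsilon>(1)[OF that] sub]) auto
      also have "\<dots> = (\<Sum>j<r. if j = i then c j else 0)"
        by (rule sum.cong) (use \<epsilon>(2) that in auto)
      finally show ?thesis using that by simp
    qed
    then show ?thesis using c by simp
  qed
  show "\<phi> = (\<Sum>i<r. \<phi> (e i x) *\<^sub>R \<epsilon> i x)" if "\<phi> \<in> dual_fibre (fibre E x)"
  proof
    fix v
    have eval: "(\<Sum>i<r. \<phi> (e i x) *\<^sub>R \<epsilon> i x) v = (\<Sum>i<r. \<phi> (e i x) * \<epsilon> i x v)"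
      by (simp add: sum_fun_apply scaleR_fun_def)
    show "\<phi> v = (\<Sum>i<r. \<phi> (e i x) *\<^sub>R \<epsilon> i x) v"
    proof (cases "v \<in> fibre E x")
      case True
      have "\<phi> v = \<phi> (\<Sum>i<r. \<epsilon> i x v *\<^sub>R e i x)" using exp[OF True] by simp
      also have "\<dots> = (\<Sum>i<r. \<epsilon> i x v * \<phi> (e i x))"
        using frame_in_fibre[OF E U x] by (intro dual_fibre_sum[OF that sub]) auto
      finally show ?thesis using eval by (simp add: mult.commute)
    next
      \<comment> \<open>Elements of the dual fibre are 0 off the fibre, so the expansion holds as an
        equation between functions on the whole type.\<close>
      case False
      then have "\<phi> v = 0" "\<And>i. i < r \<Longrightarrow> \<epsilon> i x v = 0"
        using that \<epsilon>(1) by (auto simp: dual_fibre_def)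
      then show ?thesis using eval by simp
    qed
  qed
qed

text \<open>Dual frames are related by the transposed transition functions: the coefficient of
  \<open>\<epsilon> i\<close> in \<open>\<epsilon>' j\<close> is \<open>\<epsilon>' j (e i)\<close>,
  which is the \<open>j\<close>-th coordinate of \<open>e i\<close> in the frame \<open>e'\<close>
  and therefore smooth.\<close>

lemma vector_bundle_dual:
  assumes E: "vector_bundle M E"
  shows "vector_bundle M (dual_bundle E)"
  unfolding vector_bundle_def fibre_dual_bundle
proof (intro conjI)
  show "\<forall>x. subspace (dual_fibre (fibre E x))"
    using subspace_dual_fibre vector_bundle_subspace[OF E] by blast
  have "x \<in> (\<Union>(U, r, e)\<in>frames (dual_bundle E). U)" for x
  proof -
    obtain U r e where U: "(U, r, e) \<in> frames E" "x \<in> U"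
      using vector_bundle_cover[OF E] by blast
    obtain \<epsilon> where "\<And>x i. x \<in> U \<Longrightarrow> i < r \<Longrightarrow> \<epsilon> i x \<in> dual_fibre (fibre E x)"
      "\<And>x i j. x \<in> U \<Longrightarrow> i < r \<Longrightarrow> j < r \<Longrightarrow> \<epsilon> i x (e j x) = (if i = j then 1 else 0)"
      using dual_frame_exists[OF E U(1)] by blast
    then have "(U, r, \<epsilon>) \<in> frames (dual_bundle E)"
      unfolding dual_frames_iff using U(1) by (intro exI[of _ e]) simp
    then show ?thesis using U(2) by force
  qed
  then show "(\<Union>(U, r, e)\<in>frames (dual_bundle E). U) = UNIV" by blast
  show "\<forall>(U, r, e)\<in>frames (dual_bundle E). open U \<and> (\<forall>x\<in>U. inj_on (\<lambda>i. e i x) {..<r} \<and>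
      independent ((\<lambda>i. e i x) ` {..<r}) \<and> span ((\<lambda>i. e i x) ` {..<r}) = dual_fibre (fibre E x))"
  proof (clarify, intro conjI ballI)
    fix U r \<epsilon> assume "(U, r, \<epsilon>) \<in> frames (dual_bundle E)"
    then obtain e where e: "(U, r, e) \<in> frames E" and
      \<epsilon>: "\<forall>x\<in>U. \<forall>i<r. \<epsilon> i x \<in> dual_fibre (fibre E x) \<and> (\<forall>j<r. \<epsilon> i x (e j x) = (if i = j then 1 else 0))"
      unfolding dual_frames_iff by blast
    show "open U" by (rule vector_bundle_frame(1)[OF E e])
    fix x assume x: "x \<in> U"
    note sub = vector_bundle_subspace[OF E, of x]
    have delta: "\<epsilon> i x (e j x) = (if i = j then 1 else 0)" if "i < r" "j < r" for i j
      using \<epsilon> x that by simp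
    show inj: "inj_on (\<lambda>i. \<epsilon> i x) {..<r}"
    proof (rule inj_onI)
      fix i j assume "i \<in> {..<r}" "j \<in> {..<r}" "\<epsilon> i x = \<epsilon> j x"
      then have "(if i = j then 1 else 0) = (1::real)"
        using delta[of i j] delta[of j j] by simp
      then show "i = j" by (simp split: if_splits)
    qed
    show "independent ((\<lambda>i. \<epsilon> i x) ` {..<r})"
    proof (rule independent_if_scalars_zero)
      fix u \<phi> assume 0: "(\<Sum>\<phi>\<in>(\<lambda>i. \<epsilon> i x) ` {..<r}. u \<phi> *\<^sub>R \<phi>) = 0" and "\<phi> \<in> (\<lambda>i. \<epsilon> i x) ` {..<r}"
      then obtain j where j: "j < r" "\<phi> = \<epsilon> j x" by auto
      have "0 = (\<Sum>i<r. u (\<epsilon> i x) *\<^sub>R \<epsilon> i x) (e j x)"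
        using 0 inj by (simp add: sum.reindex)
      also have "\<dots> = (\<Sum>i<r. u (\<epsilon> i x) * \<epsilon> i x (e j x))"
        by (simp add: sum_fun_apply scaleR_fun_def)
      also have "\<dots> = (\<Sum>i<r. if i = j then u (\<epsilon> i x) else 0)"
        using j delta by (intro sum.cong) auto
      also have "\<dots> = u \<phi>" using j by simp
      finally show "u \<phi> = 0" by simp
    qed simp
    show "span ((\<lambda>i. \<epsilon> i x) ` {..<r}) = dual_fibre (fibre E x)"
    proof
      show "span ((\<lambda>i. \<epsilon> i x) ` {..<r}) \<subseteq> dual_fibre (fibre E x)"
        using \<epsilon> x by (intro span_minimal subspace_dual_fibre sub) auto
      show "dual_fibre (fibre E x) \<subseteq> span ((\<lambda>i. \<epsilon> i x) ` {..<r})"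
      proof
        fix \<phi> assume "\<phi> \<in> dual_fibre (fibre E x)"
        then have "\<phi> = (\<Sum>i<r. \<phi> (e i x) *\<^sub>R \<epsilon> i x)"
          using \<epsilon> x delta by (intro dual_frame_expand(2)[OF E e x]) auto
        moreover have "(\<Sum>i<r. \<phi> (e i x) *\<^sub>R \<epsilon> i x) \<in> span ((\<lambda>i. \<epsilon> i x) ` {..<r})"
          by (intro span_sum span_scale span_base) auto
        ultimately show "\<phi> \<in> span ((\<lambda>i. \<epsilon> i x) ` {..<r})" by simp
      qed
    qed
  qed
  show "\<forall>(U, r, e)\<in>frames (dual_bundle E). \<forall>(V, s, e')\<in>frames (dual_bundle E). \<forall>j<s.
      \<exists>c. (\<forall>i<r. smooth_on M (U \<inter> V) (c i)) \<and> (\<forall>x\<in>U \<inter> V. e' j x = (\<Sum>i<r. c i x *\<^sub>R e i x))"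
  proof (clarify)
    fix U r \<epsilon> V s \<epsilon>' j
    assume "(U, r, \<epsilon>) \<in> frames (dual_bundle E)" and "(V, s, \<epsilon>') \<in> frames (dual_bundle E)" and j: "j < s"
    then obtain e e' where e: "(U, r, e) \<in> frames E" and
      \<epsilon>: "\<forall>x\<in>U. \<forall>i<r. \<epsilon> i x \<in> dual_fibre (fibre E x) \<and> (\<forall>j<r. \<epsilon> i x (e j x) = (if i = j then 1 else 0))"
      and e': "(V, s, e') \<in> frames E" and
      \<epsilon>': "\<forall>x\<in>V. \<forall>i<s. \<epsilon>' i x \<in> dual_fibre (fibre E x) \<and> (\<forall>j<s. \<epsilon>' i x (e' j x) = (if i = j then 1 else 0))"
      unfolding dual_frames_iff by blast
    have "\<exists>d. smooth_on M (V \<inter> U) d \<and> (\<forall>x\<in>U \<inter> V. d x = \<epsilon>' j x (e i x))" if i: "i < r" for i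
    proof -
      obtain c where c: "\<And>k. k < s \<Longrightarrow> smooth_on M (V \<inter> U) (c k)"
        "\<And>x. x \<in> V \<Longrightarrow> x \<in> U \<Longrightarrow> e i x = (\<Sum>k<s. c k x *\<^sub>R e' k x)"
        using vector_bundle_transition[OF E e' e i] by blast
      have "c j x = \<epsilon>' j x (e i x)" if x: "x \<in> U" "x \<in> V" for x
      proof -
        have "\<epsilon>' j x (e i x) = (\<Sum>k<s. c k x * \<epsilon>' j x (e' k x))"
          unfolding c(2)[OF x(2,1)]
          using \<epsilon>' x(2) j frame_in_fibre[OF E e' x(2)]
          by (intro dual_fibre_sum[OF _ vector_bundle_subspace[OF E]]) auto
        also have "\<dots> = (\<Sum>k<s. if k = j then c k x else 0)"
          using \<epsilon>' x(2) j by (intro sum.cong) auto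
        finally show ?thesis using j by simp
      qed
      then show ?thesis using c(1)[OF j] by blast
    qed
    then have "\<forall>i. \<exists>d. i < r \<longrightarrow> smooth_on M (V \<inter> U) d \<and> (\<forall>x\<in>U \<inter> V. d x = \<epsilon>' j x (e i x))"
      by blast
    from choice[OF this] obtain d where
      d: "\<And>i. i < r \<Longrightarrow> smooth_on M (V \<inter> U) (d i)"
        "\<And>i x. i < r \<Longrightarrow> x \<in> U \<Longrightarrow> x \<in> V \<Longrightarrow> d i x = \<epsilon>' j x (e i x)"
      by blast
    have "\<epsilon>' j x = (\<Sum>i<r. d i x *\<^sub>R \<epsilon> i x)" if x: "x \<in> U" "x \<in> V" for x
    proof -
      have "\<epsilon>' j x = (\<Sum>i<r. \<epsilon>' j x (e i x) *\<^sub>R \<epsilon> i x)"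
        by (rule dual_frame_expand(2)[OF E e x(1)]) (use \<epsilon> \<epsilon>' x j in simp_all)
      then show ?thesis using d(2) x by simp
    qed
    then show "\<exists>c. (\<forall>i<r. smooth_on M (U \<inter> V) (c i)) \<and> (\<forall>x\<in>U \<inter> V. \<epsilon>' j x = (\<Sum>i<r. c i x *\<^sub>R \<epsilon> i x))"
      using d(1) by (intro exI[of _ d]) (simp add: Int_commute)
  qed
qed

section \<open>Modules of smooth sections\<close>

lemma sections_fibre: "s \<in> sections M E \<Longrightarrow> s x \<in> fibre E x"
  by (simp add: sections_def)

lemma sections_coordinates:
  assumes "s \<in> sections M E" "(U, r, e) \<in> frames E"
  obtains c where "\<And>i. i < r \<Longrightarrow> smooth_on M U (c i)" "\<And>x. x \<in> U \<Longrightarrow> s x = (\<Sum>i<r. c i x *\<^sub>R e i x)"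
proof -
  have "\<forall>(U, r, e)\<in>frames E.
        \<exists>c. (\<forall>i<r. smooth_on M U (c i)) \<and> (\<forall>x\<in>U. s x = (\<Sum>i<r. c i x *\<^sub>R e i x))"
    using assms(1) by (simp add: sections_def)
  from bspec[OF this assms(2)] obtain c where "\<forall>i<r. smooth_on M U (c i)"
    "\<forall>x\<in>U. s x = (\<Sum>i<r. c i x *\<^sub>R e i x)"
    by auto
  then show ?thesis by (intro that[of c]) auto
qed

lemma sectionsI:
  assumes "\<And>x. s x \<in> fibre E x"
    and "\<And>U r e. (U, r, e) \<in> frames E \<Longrightarrow>
      \<exists>c. (\<forall>i<r. smooth_on M U (c i)) \<and> (\<forall>x\<in>U. s x = (\<Sum>i<r. c i x *\<^sub>R e i x))"
  shows "s \<in> sections M E"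
  using assms by (auto simp: sections_def)

lemma cmodule_sections:
  assumes "vector_bundle M E"
  shows "cmodule (smooth_functions M) (sections M E)"
proof -
  note sub = vector_bundle_subspace[OF assms]
  have "0 \<in> sections M E"
    by (rule sectionsI) (auto simp: subspace_0[OF sub] intro!: exI[of _ "\<lambda>_ _. 0"] smooth_on_const)
  moreover have "s + t \<in> sections M E" if s: "s \<in> sections M E" and t: "t \<in> sections M E" for s t
  proof (rule sectionsI)
    show "(s + t) x \<in> fibre E x" for x
      using s t by (simp add: sections_fibre subspace_add[OF sub])
    fix U r e assume U: "(U, r, e) \<in> frames E"
    obtain c where c: "\<And>i. i < r \<Longrightarrow> smooth_on M U (c i)" "\<And>x. x \<in> U \<Longrightarrow> s x = (\<Sum>i<r. c i x *\<^sub>R e i x)"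
      using sections_coordinates[OF s U] by blast
    obtain d where d: "\<And>i. i < r \<Longrightarrow> smooth_on M U (d i)" "\<And>x. x \<in> U \<Longrightarrow> t x = (\<Sum>i<r. d i x *\<^sub>R e i x)"
      using sections_coordinates[OF t U] by blast
    show "\<exists>c. (\<forall>i<r. smooth_on M U (c i)) \<and> (\<forall>x\<in>U. (s + t) x = (\<Sum>i<r. c i x *\<^sub>R e i x))"
      using c d by (intro exI[of _ "\<lambda>i x. c i x + d i x"])
        (simp add: smooth_on_add scaleR_left_distrib sum.distrib)
  qed
  moreover have "f \<odot> s \<in> sections M E"
    if s: "s \<in> sections M E" and f: "f \<in> smooth_functions M" for s f
  proof (rule sectionsI)
    show "(f \<odot> s) x \<in> fibre E x" for x
      using s by (simp add: sections_fibre subspace_scale[OF sub] fscale_def)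
    fix U r e assume U: "(U, r, e) \<in> frames E"
    obtain c where c: "\<And>i. i < r \<Longrightarrow> smooth_on M U (c i)" "\<And>x. x \<in> U \<Longrightarrow> s x = (\<Sum>i<r. c i x *\<^sub>R e i x)"
      using sections_coordinates[OF s U] by blast
    have "smooth_on M U f"
      using f by (auto simp: smooth_functions_def intro: smooth_on_subset)
    then show "\<exists>c. (\<forall>i<r. smooth_on M U (c i)) \<and> (\<forall>x\<in>U. (f \<odot> s) x = (\<Sum>i<r. c i x *\<^sub>R e i x))"
      using c by (intro exI[of _ "\<lambda>i x. f x * c i x"])
        (simp add: smooth_on_mult fscale_def scaleR_sum_right)
  qed
  ultimately show ?thesis by (simp add: cmodule_def)
qed

text \<open>Smoothness of the coordinates \<open>c\<close> of \<open>s\<close> is tested near a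
  point where \<open>f\<close> is nonzero: there the coordinates \<open>d\<close> of the section
  \<open>f \<odot> s\<close> satisfy \<open>f * c = d\<close>, so \<open>c\<close> is a quotient of
  smooth functions.\<close>

lemma local_module_sections:
  assumes M: "smooth_manifold M" and E: "vector_bundle M E"
  shows "local_module (smooth_functions M) (fibre E) (sections M E)"
proof -
  have "s \<in> sections M E"
    if s: "\<forall>x. s x \<in> fibre E x \<and> (\<exists>f\<in>smooth_functions M. f x \<noteq> 0 \<and> f \<odot> s \<in> sections M E)" for s
  proof (rule sectionsI)
    show "s x \<in> fibre E x" for x using s by blast
    fix U r e assume U: "(U, r, e) \<in> frames E"
    have "\<forall>x. \<exists>c. x \<in> U \<longrightarrow> s x = (\<Sum>i<r. c i *\<^sub>R e i x)"
      using frame_coordinates_exist[OF E U] s by blast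
    from choice[OF this] obtain c where c: "\<And>x. x \<in> U \<Longrightarrow> s x = (\<Sum>i<r. c x i *\<^sub>R e i x)"
      by blast
    note openU = vector_bundle_frame(1)[OF E U]
    have "smooth_on M U (\<lambda>x. c x i)" if i: "i < r" for i
    proof (rule smooth_on_local[OF M openU])
      fix y assume y: "y \<in> U"
      obtain f where f: "smooth_on M UNIV f" "f y \<noteq> 0" "f \<odot> s \<in> sections M E"
        using s by (auto simp: smooth_functions_def)
      obtain d where d: "\<And>i. i < r \<Longrightarrow> smooth_on M U (d i)"
        "\<And>x. x \<in> U \<Longrightarrow> (f \<odot> s) x = (\<Sum>i<r. d i x *\<^sub>R e i x)"
        using sections_coordinates[OF f(3) U] by blast
      have fc: "f x * c x i = d i x" if x: "x \<in> U" for x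
      proof (rule frame_coordinates_unique[OF E U x _ i, where c="\<lambda>i. f x * c x i" and d="\<lambda>i. d i x"])
        show "(\<Sum>i<r. (f x * c x i) *\<^sub>R e i x) = (\<Sum>i<r. d i x *\<^sub>R e i x)"
          using d(2)[OF x] c[OF x] by (simp add: fscale_def scaleR_sum_right)
      qed
      define W where "W = U \<inter> {x. f x \<noteq> 0}"
      have "open {x. f x \<noteq> 0}"
        using smooth_on_imp_continuous[OF M f(1)] by (rule open_Collect_neq) (rule continuous_on_const)
      then have W: "open W" "y \<in> W" "W \<subseteq> U"
        using openU y f(2) by (auto simp: W_def)
      have "smooth_on M W (\<lambda>x. inverse (f x) * d i x)"
        by (intro smooth_on_mult smooth_on_inverse[OF M])
          (auto simp: W_def intro: smooth_on_subset[OF f(1)] smooth_on_subset[OF d(1)[OF i]])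
      then have "smooth_on M W (\<lambda>x. c x i)"
        by (rule smooth_on_cong[OF M W(1), rotated]) (auto simp: W_def fc[symmetric])
      then show "\<exists>W. open W \<and> y \<in> W \<and> W \<subseteq> U \<and> smooth_on M W (\<lambda>x. c x i)"
        using W by blast
    qed
    then show "\<exists>c. (\<forall>i<r. smooth_on M U (c i)) \<and> (\<forall>x\<in>U. s x = (\<Sum>i<r. c i x *\<^sub>R e i x))"
      using c by (intro exI[of _ "\<lambda>i x. c x i"]) simp
  qed
  then show ?thesis
    using cmodule_sections[OF E] vector_bundle_subspace[OF E]
    by (simp add: local_module_def sections_fibre)
qed

text \<open>In another frame over \<open>V\<close> there are two descriptions: on the intersection
  with \<open>U\<close> the coefficients are \<open>f\<close> times transition functions, on
  \<open>V - K\<close> they vanish. These sets cover \<open>V\<close> because \<open>K\<close> lies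
  in \<open>U\<close>, and the second is open because \<open>K\<close> is closed.\<close>

lemma bump_frame_section:
  assumes M: "smooth_manifold M" and E: "vector_bundle M E" and U: "(U, r, e) \<in> frames E" and "i < r"
    and f: "smooth_on M UNIV f" "closed K" "K \<subseteq> U" "\<And>y. y \<notin> K \<Longrightarrow> f y = 0"
  shows "(\<lambda>x. if x \<in> U then f x *\<^sub>R e i x else 0) \<in> sections M E"
proof (rule sectionsI)
  note sub = vector_bundle_subspace[OF E]
  show "(if x \<in> U then f x *\<^sub>R e i x else 0) \<in> fibre E x" for x
    using frame_in_fibre[OF E U _ \<open>i < r\<close>] by (simp add: subspace_0[OF sub] subspace_scale[OF sub])
  fix V t e' assume V: "(V, t, e') \<in> frames E"
  obtain c where c: "\<And>j. j < t \<Longrightarrow> smooth_on M (V \<inter> U) (c j)"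
    "\<And>x. x \<in> V \<Longrightarrow> x \<in> U \<Longrightarrow> e i x = (\<Sum>j<t. c j x *\<^sub>R e' j x)"
    using vector_bundle_transition[OF E V U \<open>i < r\<close>] by blast
  note openV = vector_bundle_frame(1)[OF E V] and openU = vector_bundle_frame(1)[OF E U]
  define d where "d j x = (if x \<in> U then f x * c j x else 0)" for j x
  have "smooth_on M V (d j)" if j: "j < t" for j
  proof (rule smooth_on_local[OF M openV])
    fix y assume y: "y \<in> V"
    have "smooth_on M (V \<inter> U) (\<lambda>x. f x * c j x)"
      by (intro smooth_on_mult c(1)[OF j] smooth_on_subset[OF f(1)]) simp
    then have 1: "smooth_on M (V \<inter> U) (d j)"
      by (rule smooth_on_cong[OF M _ _, rotated 2]) (auto simp: d_def openU openV)
    have 2: "smooth_on M (V - K) (d j)"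
      by (rule smooth_on_cong[OF M _ _ smooth_on_const[of _ _ 0]])
        (auto simp: d_def openV open_Diff f)
    show "\<exists>W'. open W' \<and> y \<in> W' \<and> W' \<subseteq> V \<and> smooth_on M W' (d j)"
    proof (cases "y \<in> U")
      case True
      then show ?thesis using 1 y openU openV by (intro exI[of _ "V \<inter> U"]) auto
    next
      case False
      then show ?thesis using 2 y openV f(2,3) by (intro exI[of _ "V - K"]) (auto intro: open_Diff)
    qed
  qed
  then show "\<exists>c. (\<forall>j<t. smooth_on M V (c j)) \<and>
      (\<forall>x\<in>V. (if x \<in> U then f x *\<^sub>R e i x else 0) = (\<Sum>j<t. c j x *\<^sub>R e' j x))"
    using c(2) by (intro exI[of _ d]) (auto simp: d_def scaleR_sum_right)
qed

lemma pairing_smooth: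
  assumes M: "smooth_manifold M" and E: "vector_bundle M E"
    and s: "s \<in> sections M E" and \<tau>: "\<tau> \<in> sections M (dual_bundle E)"
  shows "(\<lambda>x. \<tau> x (s x)) \<in> smooth_functions M"
  unfolding smooth_functions_def mem_Collect_eq
proof (rule smooth_on_local[OF M open_UNIV])
  fix y
  obtain U r e where U: "(U, r, e) \<in> frames E" "y \<in> U"
    using vector_bundle_cover[OF E] by blast
  obtain \<epsilon> where \<epsilon>: "\<And>x i. x \<in> U \<Longrightarrow> i < r \<Longrightarrow> \<epsilon> i x \<in> dual_fibre (fibre E x)"
    "\<And>x i j. x \<in> U \<Longrightarrow> i < r \<Longrightarrow> j < r \<Longrightarrow> \<epsilon> i x (e j x) = (if i = j then 1 else 0)"
    using dual_frame_exists[OF E U(1)] by blast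
  then have U': "(U, r, \<epsilon>) \<in> frames (dual_bundle E)"
    unfolding dual_frames_iff using U(1) by (intro exI[of _ e]) simp
  obtain c where c: "\<And>i. i < r \<Longrightarrow> smooth_on M U (c i)" "\<And>x. x \<in> U \<Longrightarrow> s x = (\<Sum>i<r. c i x *\<^sub>R e i x)"
    using sections_coordinates[OF s U(1)] by blast
  obtain d where d: "\<And>i. i < r \<Longrightarrow> smooth_on M U (d i)" "\<And>x. x \<in> U \<Longrightarrow> \<tau> x = (\<Sum>i<r. d i x *\<^sub>R \<epsilon> i x)"
    using sections_coordinates[OF \<tau> U'] by blast
  have "\<tau> x (s x) = (\<Sum>i<r. d i x * c i x)" if x: "x \<in> U" for x
  proof -
    have "\<tau> x (s x) = (\<Sum>i<r. d i x * \<epsilon> i x (s x))"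
      using d(2)[OF x] by (simp add: sum_fun_apply scaleR_fun_def)
    also have "\<dots> = (\<Sum>i<r. d i x * c i x)"
    proof (rule sum.cong[OF refl])
      fix i assume "i \<in> {..<r}"
      then have i: "i < r" by simp
      have "\<epsilon> i x (s x) = (\<Sum>j<r. c j x * \<epsilon> i x (e j x))"
        unfolding c(2)[OF x] using frame_in_fibre[OF E U(1) x]
        by (intro dual_fibre_sum[OF \<epsilon>(1)[OF x i] vector_bundle_subspace[OF E]]) auto
      also have "\<dots> = (\<Sum>j<r. if j = i then c j x else 0)"
        using \<epsilon>(2)[OF x i] by (intro sum.cong) auto
      finally show "d i x * \<epsilon> i x (s x) = d i x * c i x" using i by simp
    qed
    finally show ?thesis .
  qed
  moreover have "smooth_on M U (\<lambda>x. \<Sum>i<r. d i x * c i x)"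
    using c(1) d(1) by (intro smooth_on_sum smooth_on_mult) auto
  ultimately have "smooth_on M U (\<lambda>x. \<tau> x (s x))"
    by (intro smooth_on_cong[OF M vector_bundle_frame(1)[OF E U(1)], where g="\<lambda>x. \<tau> x (s x)"]) auto
  then show "\<exists>W'. open W' \<and> y \<in> W' \<and> W' \<subseteq> UNIV \<and> smooth_on M W' (\<lambda>x. \<tau> x (s x))"
    using vector_bundle_frame(1)[OF E U(1)] U(2) by blast
qed

theorem dual_pair_sections:
  fixes M :: "'m::{t2_space,second_countable_topology} manifold"
  assumes M: "smooth_manifold M" and E: "vector_bundle M E"
  shows "dual_pair (smooth_functions M) (fibre E) (sections M E)
    (fibre (dual_bundle E)) (sections M (dual_bundle E)) (\<lambda>v \<phi>. \<phi> v)"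
proof -
  have "local_dual_bases (smooth_functions M) (fibre E) (sections M E)
    (fibre (dual_bundle E)) (sections M (dual_bundle E)) (\<lambda>v \<phi>. \<phi> v)"
    unfolding local_dual_bases_def
  proof
    fix x
    obtain U r e where U: "(U, r, e) \<in> frames E" "x \<in> U"
      using vector_bundle_cover[OF E] by blast
    obtain \<epsilon> where \<epsilon>: "\<And>x i. x \<in> U \<Longrightarrow> i < r \<Longrightarrow> \<epsilon> i x \<in> dual_fibre (fibre E x)"
      "\<And>x i j. x \<in> U \<Longrightarrow> i < r \<Longrightarrow> j < r \<Longrightarrow> \<epsilon> i x (e j x) = (if i = j then 1 else 0)"
      using dual_frame_exists[OF E U(1)] by blast
    then have U': "(U, r, \<epsilon>) \<in> frames (dual_bundle E)"
      unfolding dual_frames_iff using U(1) by (intro exI[of _ e]) simp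
    obtain f K where f: "smooth_on M UNIV f" "f x \<noteq> 0" "closed K" "K \<subseteq> U" "\<And>y. y \<notin> K \<Longrightarrow> f y = 0"
      using smooth_bump[OF M vector_bundle_frame(1)[OF E U(1)] U(2)] by blast
    \<comment> \<open>Both the frame and the dual frame are multiplied by \<open>f\<close>, so
      together they represent the identity up to the factor \<open>f * f\<close>, which is the
      function used for the dual bases.\<close>
    define a where "a i y = (if y \<in> U then f y *\<^sub>R e i y else 0)" for i y
    define \<alpha> where "\<alpha> i y = (if y \<in> U then f y *\<^sub>R \<epsilon> i y else 0)" for i y
    have "a i \<in> sections M E" if "i < r" for i
      using bump_frame_section[OF M E U(1) that f(1,3,4,5)] unfolding a_def .
    moreover have "\<alpha> i \<in> sections M (dual_bundle E)" if "i < r" for i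
      using bump_frame_section[OF M vector_bundle_dual[OF E] U' that f(1,3,4,5)] unfolding \<alpha>_def .
    moreover have "(f y * f y) *\<^sub>R v = (\<Sum>i<r. \<alpha> i y v *\<^sub>R a i y)" if v: "v \<in> fibre E y" for y v
    proof (cases "y \<in> U")
      case True
      have "v = (\<Sum>i<r. \<epsilon> i y v *\<^sub>R e i y)"
        by (rule dual_frame_expand(1)[OF E U(1) True _ _ v]) (use \<epsilon> True in auto)
      then have "(f y * f y) *\<^sub>R v = (f y * f y) *\<^sub>R (\<Sum>i<r. \<epsilon> i y v *\<^sub>R e i y)"
        by simp
      then show ?thesis
        using True by (simp add: a_def \<alpha>_def scaleR_sum_right scaleR_fun_def ac_simps)
    next
      case False
      then have "f y = 0" using f(4,5) by blast
      then show ?thesis using False by (simp add: a_def)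
    qed
    moreover have "(f y * f y) *\<^sub>R \<phi> = (\<Sum>i<r. \<phi> (a i y) *\<^sub>R \<alpha> i y)"
      if \<phi>: "\<phi> \<in> fibre (dual_bundle E) y" for y \<phi>
    proof (cases "y \<in> U")
      case True
      have \<phi>': "\<phi> \<in> dual_fibre (fibre E y)" using \<phi> by (simp add: fibre_dual_bundle)
      have "\<phi> = (\<Sum>i<r. \<phi> (e i y) *\<^sub>R \<epsilon> i y)"
        by (rule dual_frame_expand(2)[OF E U(1) True _ _ \<phi>']) (use \<epsilon> True in auto)
      then have "(f y * f y) *\<^sub>R \<phi> = (f y * f y) *\<^sub>R (\<Sum>i<r. \<phi> (e i y) *\<^sub>R \<epsilon> i y)"
        by simp
      moreover have "\<phi> (f y *\<^sub>R e i y) = f y * \<phi> (e i y)" if "i < r" for i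
        using \<phi>' frame_in_fibre[OF E U(1) True that] by (simp add: dual_fibre_def)
      ultimately show ?thesis
        using True by (simp add: a_def \<alpha>_def scaleR_sum_right ac_simps)
    next
      case False
      then have "f y = 0" using f(4,5) by blast
      then show ?thesis using False by (simp add: \<alpha>_def)
    qed
    moreover have "(\<lambda>y. f y * f y) \<in> smooth_functions M"
      using f(1) by (simp add: smooth_functions_def smooth_on_mult)
    ultimately have "dual_bases (fibre E) (sections M E) (fibre (dual_bundle E))
        (sections M (dual_bundle E)) (\<lambda>v \<phi>. \<phi> v) (\<lambda>y. f y * f y) r a \<alpha>"
      and "(\<lambda>y. f y * f y) \<in> smooth_functions M"
      by (simp_all add: dual_bases_def)
    then show "\<exists>f\<in>smooth_functions M. f x \<noteq> 0 \<and> (\<exists>n e e'. dual_bases (fibre E) (sections M E)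
        (fibre (dual_bundle E)) (sections M (dual_bundle E)) (\<lambda>v \<phi>. \<phi> v) f n e e')"
      using f(2) by (intro bexI[of _ "\<lambda>y. f y * f y"]) auto
  qed
  moreover have "\<phi> (v + v') = \<phi> v + \<phi> v'" "\<phi> (c *\<^sub>R v) = c * \<phi> v"
    if "\<phi> \<in> fibre (dual_bundle E) x" "v \<in> fibre E x" "v' \<in> fibre E x" for \<phi> v v' c x
    using that by (simp_all add: fibre_dual_bundle dual_fibre_def)
  ultimately show ?thesis
    unfolding dual_pair_def
    using local_module_sections[OF M E] local_module_sections[OF M vector_bundle_dual[OF E]]
      pairing_smooth[OF M E]
    by (simp add: scaleR_fun_def)
qed

section \<open>Shuffle products\<close>

text \<open>The shuffle products are computed by recursion on the lists of arguments; this turns their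
  algebraic properties into list inductions.\<close>

fun alt_shuffle :: "('a list \<Rightarrow> 'a list \<Rightarrow> 'e::real_vector) \<Rightarrow> 'a list \<Rightarrow> 'e" where
  "alt_shuffle F [] = F [] []"
| "alt_shuffle F (q # qs) =
     alt_shuffle (\<lambda>a c. F (q # a) c) qs + alt_shuffle (\<lambda>a c. (-1) ^ length a *\<^sub>R F a (q # c)) qs"

fun sym_shuffle :: "('a list \<Rightarrow> 'a list \<Rightarrow> 'e::real_vector) \<Rightarrow> 'a list \<Rightarrow> 'e" where
  "sym_shuffle F [] = F [] []"
| "sym_shuffle F (q # qs) =
     sym_shuffle (\<lambda>a c. F (q # a) c) qs + sym_shuffle (\<lambda>a c. F a (q # c)) qs"

definition shuffle ::
    "('a list \<Rightarrow> 'b list \<Rightarrow> 'a list \<Rightarrow> 'b list \<Rightarrow> 'e::real_vector) \<Rightarrow> 'a list \<Rightarrow> 'b list \<Rightarrow> 'e" where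
  "shuffle F qs \<beta>s = alt_shuffle (\<lambda>a c. sym_shuffle (\<lambda>b d. F a b c d) \<beta>s) qs"

text \<open>Subsets are sorted by whether they contain 0, the index of the head of a list, so that
  what remains is a subset of the indices of the tail.\<close>

lemma sum_Pow_lessThan_Suc:
  fixes g :: "nat set \<Rightarrow> 'e::comm_monoid_add"
  shows "(\<Sum>I\<in>Pow {..<Suc n}. g I) =
    (\<Sum>I\<in>Pow {..<n}. g (insert 0 (Suc ` I))) + (\<Sum>I\<in>Pow {..<n}. g (Suc ` I))"
proof -
  have "Pow (Suc ` {..<n}) = (\<lambda>I. Suc ` I) ` Pow {..<n}"
    by (simp add: image_Pow_surj)
  then have P: "Pow {..<Suc n} = (\<lambda>I. insert 0 (Suc ` I)) ` Pow {..<n} \<union> (\<lambda>I. Suc ` I) ` Pow {..<n}"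
    by (simp add: lessThan_Suc_eq_insert_0 Pow_insert image_image Un_commute)
  have inj: "inj_on (\<lambda>I. Suc ` I) (Pow {..<n})"
    by (rule inj_onI) (simp add: inj_image_eq_iff)
  have inj0: "inj_on (\<lambda>I. insert 0 (Suc ` I)) (Pow {..<n})"
  proof (rule inj_onI)
    fix I J assume "insert 0 (Suc ` I) = insert 0 (Suc ` J)"
    then have "Suc ` I = Suc ` J" by (metis Diff_insert_absorb image_iff nat.distinct(1))
    then show "I = J" by (simp add: inj_image_eq_iff)
  qed
  have "(\<Sum>I\<in>Pow {..<Suc n}. g I) = (\<Sum>I\<in>(\<lambda>I. insert 0 (Suc ` I)) ` Pow {..<n}. g I) +
      (\<Sum>I\<in>(\<lambda>I. Suc ` I) ` Pow {..<n}. g I)"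
    unfolding P by (rule sum.union_disjoint) auto
  then show ?thesis
    using inj inj0 by (simp add: sum.reindex)
qed

lemma nths_Cons_image_Suc:
  "nths (q # qs) (insert 0 (Suc ` I)) = q # nths qs I"
  "nths (q # qs) (- insert 0 (Suc ` I)) = nths qs (- I)"
  "nths (q # qs) (Suc ` I) = nths qs I"
  "nths (q # qs) (- Suc ` I) = q # nths qs (- I)"
proof -
  have "{j. Suc j \<in> insert 0 (Suc ` I)} = I" "{j. Suc j \<in> - insert 0 (Suc ` I)} = - I"
    "{j. Suc j \<in> Suc ` I} = I" "{j. Suc j \<in> - Suc ` I} = - I"
    by auto
  then show "nths (q # qs) (insert 0 (Suc ` I)) = q # nths qs I"
    "nths (q # qs) (- insert 0 (Suc ` I)) = nths qs (- I)"
    "nths (q # qs) (Suc ` I) = nths qs I"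
    "nths (q # qs) (- Suc ` I) = q # nths qs (- I)"
    unfolding nths_Cons by auto
qed

text \<open>The head has the smallest index. If it is selected, it takes part in no inversion;
  otherwise it forms one with every selected index, which gives the sign
  \<open>(-1) ^ card I\<close>.\<close>

lemma shuffle_sign_Suc:
  assumes "I \<subseteq> {..<n}"
  shows "shuffle_sign (Suc n) (insert 0 (Suc ` I)) = shuffle_sign n I"
    and "shuffle_sign (Suc n) (Suc ` I) = (-1) ^ card I * shuffle_sign n I"
proof -
  define P where "P = {(i, j). i < j \<and> j < n \<and> i \<notin> I \<and> j \<in> I}"
  have fin: "finite P" by (rule finite_subset[of _ "{..<n} \<times> {..<n}"]) (auto simp: P_def)
  have inj: "inj_on (map_prod Suc Suc) P" by (rule inj_onI) auto
  have "{(i, j). i < j \<and> j < Suc n \<and> i \<notin> insert 0 (Suc ` I) \<and> j \<in> insert 0 (Suc ` I)} =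
      map_prod Suc Suc ` P"
  proof (intro set_eqI iffI)
    fix x assume "x \<in> {(i, j). i < j \<and> j < Suc n \<and> i \<notin> insert 0 (Suc ` I) \<and> j \<in> insert 0 (Suc ` I)}"
    then obtain i j where x: "x = (i, j)" "i < j" "j < Suc n" "i \<notin> insert 0 (Suc ` I)" "j \<in> insert 0 (Suc ` I)"
      by blast
    then obtain i' j' where "i = Suc i'" "j = Suc j'" by (metis insertI1 not_less0 not0_implies_Suc)
    then show "x \<in> map_prod Suc Suc ` P" using x by (auto simp: P_def intro!: image_eqI[of _ _ "(i', j')"])
  qed (auto simp: P_def)
  then show "shuffle_sign (Suc n) (insert 0 (Suc ` I)) = shuffle_sign n I"
    using card_image[OF inj] by (simp add: shuffle_sign_def P_def)
  have "{(i, j). i < j \<and> j < Suc n \<and> i \<notin> Suc ` I \<and> j \<in> Suc ` I} =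
      map_prod Suc Suc ` P \<union> Pair 0 ` Suc ` I"
  proof (intro set_eqI iffI)
    fix x assume "x \<in> {(i, j). i < j \<and> j < Suc n \<and> i \<notin> Suc ` I \<and> j \<in> Suc ` I}"
    then obtain i j where x: "x = (i, j)" "i < j" "j < Suc n" "i \<notin> Suc ` I" "j \<in> Suc ` I"
      by blast
    then show "x \<in> map_prod Suc Suc ` P \<union> Pair 0 ` Suc ` I"
    proof (cases i)
      case (Suc i')
      then show ?thesis using x by (auto simp: P_def intro!: image_eqI[of _ _ "(i', j - 1)"])
    qed auto
  qed (use assms in \<open>auto simp: P_def\<close>)
  moreover have "card (map_prod Suc Suc ` P \<union> Pair 0 ` Suc ` I) =
      card (map_prod Suc Suc ` P) + card (Pair (0::nat) ` Suc ` I)"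
    using fin finite_subset[OF assms] by (intro card_Un_disjoint) auto
  moreover have "card (Pair (0::nat) ` Suc ` I) = card I"
    by (simp add: card_image inj_on_def)
  ultimately show "shuffle_sign (Suc n) (Suc ` I) = (-1) ^ card I * shuffle_sign n I"
    using card_image[OF inj] by (simp add: shuffle_sign_def P_def power_add)
qed

text \<open>In the recursion, a head that goes to the second list has to pass all entries
  \<open>a\<close> of the first; \<open>(-1) ^ length a\<close> is the sign of this move.\<close>

lemma alt_shuffle_eq_sum:
  "alt_shuffle F qs = (\<Sum>I\<in>Pow {..<length qs}. shuffle_sign (length qs) I *\<^sub>R F (nths qs I) (nths qs (- I)))"
proof (induction qs arbitrary: F)
  case Nil
  then show ?case by (simp add: shuffle_sign_def)
next
  case (Cons q qs)
  have len: "length (nths qs I) = card I" if "I \<in> Pow {..<length qs}" for I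
  proof -
    have "{i. i < length qs \<and> i \<in> I} = I" using that by auto
    then show ?thesis by (simp add: length_nths)
  qed
  have "alt_shuffle F (q # qs) =
      (\<Sum>I\<in>Pow {..<length qs}. shuffle_sign (length qs) I *\<^sub>R F (q # nths qs I) (nths qs (- I))) +
      (\<Sum>I\<in>Pow {..<length qs}. shuffle_sign (length qs) I *\<^sub>R (-1) ^ length (nths qs I) *\<^sub>R
        F (nths qs I) (q # nths qs (- I)))"
    by (simp only: alt_shuffle.simps Cons.IH)
  also have "\<dots> = (\<Sum>I\<in>Pow {..<length (q # qs)}.
      shuffle_sign (length (q # qs)) I *\<^sub>R F (nths (q # qs) I) (nths (q # qs) (- I)))"
    unfolding length_Cons sum_Pow_lessThan_Suc nths_Cons_image_Suc
    by (intro arg_cong2[of _ _ _ _ "(+)"] sum.cong refl) (auto simp: shuffle_sign_Suc len)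
  finally show ?case .
qed

lemma sym_shuffle_eq_sum:
  "sym_shuffle F qs = (\<Sum>I\<in>Pow {..<length qs}. F (nths qs I) (nths qs (- I)))"
proof (induction qs arbitrary: F)
  case (Cons q qs)
  show ?case
    unfolding length_Cons sum_Pow_lessThan_Suc nths_Cons_image_Suc sym_shuffle.simps Cons.IH by simp
qed simp

lemma wedge_eq_shuffle: "\<xi> \<cdot> \<Phi> = shuffle (\<lambda>a b c d. \<xi> a b \<odot> \<Phi> c d)"
  by (intro ext) (simp add: wedge_def shuffle_def alt_shuffle_eq_sum sym_shuffle_eq_sum scaleR_sum_right)

lemma alt_shuffle_cong:
  "(\<And>a c. length a + length c = length qs \<Longrightarrow> set a \<union> set c = set qs \<Longrightarrow> F a c = G a c) \<Longrightarrow>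
    alt_shuffle F qs = alt_shuffle G qs"
proof (induction qs arbitrary: F G)
  case (Cons q qs)
  have "alt_shuffle (\<lambda>a c. F (q # a) c) qs = alt_shuffle (\<lambda>a c. G (q # a) c) qs"
    by (rule Cons.IH) (use Cons.prems in auto)
  moreover have "alt_shuffle (\<lambda>a c. (-1) ^ length a *\<^sub>R F a (q # c)) qs =
      alt_shuffle (\<lambda>a c. (-1) ^ length a *\<^sub>R G a (q # c)) qs"
    by (rule Cons.IH) (use Cons.prems in auto)
  ultimately show ?case by simp
qed simp

lemma sym_shuffle_cong:
  "(\<And>a c. length a + length c = length qs \<Longrightarrow> set a \<union> set c = set qs \<Longrightarrow> F a c = G a c) \<Longrightarrow>
    sym_shuffle F qs = sym_shuffle G qs"
proof (induction qs arbitrary: F G)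
  case (Cons q qs)
  have "sym_shuffle (\<lambda>a c. F (q # a) c) qs = sym_shuffle (\<lambda>a c. G (q # a) c) qs"
    by (rule Cons.IH) (use Cons.prems in auto)
  moreover have "sym_shuffle (\<lambda>a c. F a (q # c)) qs = sym_shuffle (\<lambda>a c. G a (q # c)) qs"
    by (rule Cons.IH) (use Cons.prems in auto)
  ultimately show ?case by simp
qed simp

lemma shuffle_cong:
  assumes "\<And>a b c d. length a + length c = length qs \<Longrightarrow> set a \<union> set c = set qs \<Longrightarrow>
    length b + length d = length \<beta>s \<Longrightarrow> set b \<union> set d = set \<beta>s \<Longrightarrow> F a b c d = G a b c d"
  shows "shuffle F qs \<beta>s = shuffle G qs \<beta>s"
  unfolding shuffle_def by (intro alt_shuffle_cong sym_shuffle_cong assms)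

text \<open>The lemmas on jointly linear \<open>P\<close> are applied to sums \<open>P x y = x + y\<close> and multiples
  \<open>P x y = f \<odot> x\<close>.\<close>

definition jointly_linear :: "('e::real_vector \<Rightarrow> 'e \<Rightarrow> 'f::real_vector) \<Rightarrow> bool" where
  "jointly_linear P \<longleftrightarrow> (\<forall>x y x' y'. P (x + x') (y + y') = P x y + P x' y') \<and>
     (\<forall>r x y. P (r *\<^sub>R x) (r *\<^sub>R y) = r *\<^sub>R P x y)"

lemma jointly_linear_addD: "jointly_linear P \<Longrightarrow> P (x + x') (y + y') = P x y + P x' y'"
  by (simp add: jointly_linear_def)

lemma jointly_linear_scaleRD: "jointly_linear P \<Longrightarrow> P (r *\<^sub>R x) (r *\<^sub>R y) = r *\<^sub>R P x y"
  by (simp add: jointly_linear_def)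

lemma jointly_linear_minusD: "jointly_linear P \<Longrightarrow> P (- x) (- y) = - P x y"
  using jointly_linear_scaleRD[of P "-1" x y] by simp

lemma alt_shuffle_jointly_linear:
  assumes "jointly_linear P"
  shows "alt_shuffle (\<lambda>a c. P (F a c) (G a c)) qs = P (alt_shuffle F qs) (alt_shuffle G qs)"
proof (induction qs arbitrary: F G)
  case (Cons q qs)
  have "alt_shuffle (\<lambda>a c. P (F a c) (G a c)) (q # qs) =
      alt_shuffle (\<lambda>a c. P (F (q # a) c) (G (q # a) c)) qs +
      alt_shuffle (\<lambda>a c. P ((-1) ^ length a *\<^sub>R F a (q # c)) ((-1) ^ length a *\<^sub>R G a (q # c))) qs"
    by (simp only: alt_shuffle.simps jointly_linear_scaleRD[OF assms])
  then show ?case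
    by (simp only: alt_shuffle.simps Cons.IH jointly_linear_addD[OF assms])
qed simp

lemma sym_shuffle_jointly_linear:
  assumes "jointly_linear P"
  shows "sym_shuffle (\<lambda>a c. P (F a c) (G a c)) qs = P (sym_shuffle F qs) (sym_shuffle G qs)"
  by (induction qs arbitrary: F G) (simp_all only: sym_shuffle.simps jointly_linear_addD[OF assms])

lemma shuffle_jointly_linear:
  assumes "jointly_linear P"
  shows "shuffle (\<lambda>a b c d. P (F a b c d) (G a b c d)) qs \<beta>s = P (shuffle F qs \<beta>s) (shuffle G qs \<beta>s)"
  by (simp only: shuffle_def sym_shuffle_jointly_linear[OF assms] alt_shuffle_jointly_linear[OF assms])

lemma jointly_linear_plus: "jointly_linear (+)"
  by (simp add: jointly_linear_def algebra_simps)

lemma jointly_linear_fscale: "jointly_linear (\<lambda>x _. f \<odot> x)"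
  by (simp add: jointly_linear_def fscale_def scaleR_fun_def fun_eq_iff scaleR_right_distrib)

lemma jointly_linear_scaleR: "jointly_linear (\<lambda>x _. r *\<^sub>R x)"
  by (simp add: jointly_linear_def scaleR_right_distrib)

lemmas alt_shuffle_add = alt_shuffle_jointly_linear[OF jointly_linear_plus]
  and sym_shuffle_add = sym_shuffle_jointly_linear[OF jointly_linear_plus]
  and shuffle_add = shuffle_jointly_linear[OF jointly_linear_plus]
lemmas alt_shuffle_scaleR = alt_shuffle_jointly_linear[OF jointly_linear_scaleR]
  and sym_shuffle_scaleR = sym_shuffle_jointly_linear[OF jointly_linear_scaleR]
  and shuffle_scaleR = shuffle_jointly_linear[OF jointly_linear_scaleR]
lemmas alt_shuffle_fscale = alt_shuffle_jointly_linear[OF jointly_linear_fscale]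
  and sym_shuffle_fscale = sym_shuffle_jointly_linear[OF jointly_linear_fscale]
  and shuffle_fscale = shuffle_jointly_linear[OF jointly_linear_fscale]

lemma alt_shuffle_zero [simp]: "alt_shuffle (\<lambda>_ _. 0) qs = 0"
  by (induction qs) auto

lemma sym_shuffle_zero [simp]: "sym_shuffle (\<lambda>_ _. 0) qs = 0"
  by (induction qs) auto

lemma shuffle_zero [simp]: "shuffle (\<lambda>_ _ _ _. 0) qs \<beta>s = 0"
  by (simp add: shuffle_def)

definition closed_linear :: "'e::real_vector set \<Rightarrow> bool" where
  "closed_linear X \<longleftrightarrow> (\<forall>x\<in>X. \<forall>y\<in>X. x + y \<in> X) \<and> (\<forall>r. \<forall>x\<in>X. r *\<^sub>R x \<in> X)"

text \<open>For maps such as \<open>lie_deriv X\<close> that are additive only on a subset, here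
  \<open>X\<close>. Membership of the shuffle in this set has to be proved in the same
  induction.\<close>

lemma alt_shuffle_closed_hom:
  assumes "closed_linear X"
    and "\<And>x y. x \<in> X \<Longrightarrow> y \<in> X \<Longrightarrow> L (x + y) = L x + L y"
    and "\<And>r x. x \<in> X \<Longrightarrow> L (r *\<^sub>R x) = r *\<^sub>R L x"
    and "\<And>a c. F a c \<in> X"
  shows "alt_shuffle F qs \<in> X \<and> L (alt_shuffle F qs) = alt_shuffle (\<lambda>a c. L (F a c)) qs"
  using assms(4)
proof (induction qs arbitrary: F)
  case (Cons q qs)
  note X = assms(1)[unfolded closed_linear_def]
  have 1: "alt_shuffle (\<lambda>a c. F (q # a) c) qs \<in> X \<and>
      L (alt_shuffle (\<lambda>a c. F (q # a) c) qs) = alt_shuffle (\<lambda>a c. L (F (q # a) c)) qs"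
    by (rule Cons.IH) (rule Cons.prems)
  have 2: "alt_shuffle (\<lambda>a c. (-1) ^ length a *\<^sub>R F a (q # c)) qs \<in> X \<and>
      L (alt_shuffle (\<lambda>a c. (-1) ^ length a *\<^sub>R F a (q # c)) qs) =
      alt_shuffle (\<lambda>a c. L ((-1) ^ length a *\<^sub>R F a (q # c))) qs"
    by (rule Cons.IH) (use X Cons.prems in blast)
  show ?case
    using 1 2 X by (simp add: assms(2,3) Cons.prems)
qed auto

lemma sym_shuffle_closed_hom:
  assumes "closed_linear X"
    and "\<And>x y. x \<in> X \<Longrightarrow> y \<in> X \<Longrightarrow> L (x + y) = L x + L y"
    and "\<And>a c. F a c \<in> X"
  shows "sym_shuffle F qs \<in> X \<and> L (sym_shuffle F qs) = sym_shuffle (\<lambda>a c. L (F a c)) qs"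
  using assms(3)
proof (induction qs arbitrary: F)
  case (Cons q qs)
  then show ?case
    using assms(1,2) by (simp add: closed_linear_def)
qed auto

lemma shuffle_closed_hom:
  assumes "closed_linear X"
    and "\<And>x y. x \<in> X \<Longrightarrow> y \<in> X \<Longrightarrow> L (x + y) = L x + L y"
    and "\<And>r x. x \<in> X \<Longrightarrow> L (r *\<^sub>R x) = r *\<^sub>R L x"
    and "\<And>a b c d. F a b c d \<in> X"
  shows "shuffle F qs \<beta>s \<in> X" "L (shuffle F qs \<beta>s) = shuffle (\<lambda>a b c d. L (F a b c d)) qs \<beta>s"
proof -
  note inner = sym_shuffle_closed_hom[of X L, OF assms(1,2,4)]
  have "alt_shuffle (\<lambda>a c. sym_shuffle (\<lambda>b d. F a b c d) \<beta>s) qs \<in> X \<and>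
    L (alt_shuffle (\<lambda>a c. sym_shuffle (\<lambda>b d. F a b c d) \<beta>s) qs) =
    alt_shuffle (\<lambda>a c. L (sym_shuffle (\<lambda>b d. F a b c d) \<beta>s)) qs"
    by (rule alt_shuffle_closed_hom[OF assms(1-3)]) (simp_all add: inner)
  then show "shuffle F qs \<beta>s \<in> X" "L (shuffle F qs \<beta>s) = shuffle (\<lambda>a b c d. L (F a b c d)) qs \<beta>s"
    by (simp_all add: shuffle_def inner)
qed

section \<open>Associativity, commutativity and unit laws\<close>

lemma alt_shuffle_sym_shuffle_commute:
  "alt_shuffle (\<lambda>a c. sym_shuffle (\<lambda>b d. F a b c d) \<beta>s) qs =
    sym_shuffle (\<lambda>b d. alt_shuffle (\<lambda>a c. F a b c d) qs) \<beta>s"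
  by (induction \<beta>s arbitrary: F) (simp_all add: alt_shuffle_add)

text \<open>Both sides distribute \<open>qs\<close> over three lists. The signs agree because
  passing a list \<open>x\<close> amounts to passing the two lists \<open>a\<close> and
  \<open>c\<close> into which \<open>x\<close> is itself shuffled.\<close>

lemma alt_shuffle_assoc:
  "alt_shuffle (\<lambda>x e. alt_shuffle (\<lambda>a c. G a c e) x) qs =
    alt_shuffle (\<lambda>a x. alt_shuffle (\<lambda>c e. G a c e) x) qs"
proof (induction qs arbitrary: G)
  case (Cons q qs)
  have "alt_shuffle (\<lambda>x e. (-1) ^ length x *\<^sub>R alt_shuffle (\<lambda>a c. G a c (q # e)) x) qs =
      alt_shuffle (\<lambda>x e. alt_shuffle (\<lambda>a c. (-1) ^ length a *\<^sub>R (-1) ^ length c *\<^sub>R G a c (q # e)) x) qs"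
  proof (rule alt_shuffle_cong)
    fix x e
    have "(-1) ^ length x *\<^sub>R alt_shuffle (\<lambda>a c. G a c (q # e)) x =
        alt_shuffle (\<lambda>a c. (-1) ^ length x *\<^sub>R G a c (q # e)) x"
      by (simp add: alt_shuffle_scaleR)
    also have "\<dots> = alt_shuffle (\<lambda>a c. (-1) ^ length a *\<^sub>R (-1) ^ length c *\<^sub>R G a c (q # e)) x"
      by (rule alt_shuffle_cong) (simp flip: power_add)
    finally show "(-1) ^ length x *\<^sub>R alt_shuffle (\<lambda>a c. G a c (q # e)) x =
        alt_shuffle (\<lambda>a c. (-1) ^ length a *\<^sub>R (-1) ^ length c *\<^sub>R G a c (q # e)) x" .
  qed
  then show ?case
    by (simp add: alt_shuffle_add Cons.IH alt_shuffle_scaleR[symmetric] scaleR_right_distrib)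
qed simp

lemma sym_shuffle_assoc:
  "sym_shuffle (\<lambda>x e. sym_shuffle (\<lambda>a c. G a c e) x) qs =
    sym_shuffle (\<lambda>a x. sym_shuffle (\<lambda>c e. G a c e) x) qs"
  by (induction qs arbitrary: G) (simp_all add: sym_shuffle_add)

lemma shuffle_assoc:
  "shuffle (\<lambda>x y e f. shuffle (\<lambda>a b c d. G a b c d e f) x y) qs \<beta>s =
    shuffle (\<lambda>a b x y. shuffle (\<lambda>c d e f. G a b c d e f) x y) qs \<beta>s"
proof -
  have "shuffle (\<lambda>x y e f. shuffle (\<lambda>a b c d. G a b c d e f) x y) qs \<beta>s =
      alt_shuffle (\<lambda>x e. alt_shuffle (\<lambda>a c. sym_shuffle (\<lambda>y f. sym_shuffle (\<lambda>b d. G a b c d e f) y) \<beta>s) x) qs"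
    by (simp add: shuffle_def alt_shuffle_sym_shuffle_commute)
  also have "\<dots> = alt_shuffle (\<lambda>a x. alt_shuffle (\<lambda>c e. sym_shuffle (\<lambda>b y. sym_shuffle (\<lambda>d f. G a b c d e f) y) \<beta>s) x) qs"
    by (simp add: alt_shuffle_assoc sym_shuffle_assoc)
  also have "\<dots> = shuffle (\<lambda>a b x y. shuffle (\<lambda>c d e f. G a b c d e f) x y) qs \<beta>s"
    by (simp add: shuffle_def alt_shuffle_sym_shuffle_commute)
  finally show ?thesis .
qed

text \<open>Graded commutativity: every entry of one list is moved past every entry of the
  other.\<close>

lemma alt_shuffle_flip:
  "alt_shuffle (\<lambda>a c. F c a) qs = alt_shuffle (\<lambda>a c. (-1) ^ (length a * length c) *\<^sub>R F a c) qs"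
proof (induction qs arbitrary: F)
  case (Cons q qs)
  have "alt_shuffle (\<lambda>a c. (-1) ^ length a *\<^sub>R F (q # c) a) qs =
      alt_shuffle (\<lambda>a c. (-1) ^ (length a * length c) *\<^sub>R (-1) ^ length c *\<^sub>R F (q # a) c) qs"
    by (rule Cons.IH)
  moreover have "alt_shuffle (\<lambda>a c. F c (q # a)) qs =
      alt_shuffle (\<lambda>a c. (-1) ^ (length a * length c) *\<^sub>R F a (q # c)) qs"
    by (rule Cons.IH)
  moreover have "(-1) ^ length a * ((-1) ^ (length a + length a * length c)) = ((-1) ^ (length a * length c) :: real)"
    for a c :: "'a list"
    by (simp add: power_add flip: mult.assoc power_mult_distrib)
  ultimately show ?case
    by (simp add: power_add add.commute mult.commute)
qed simp

lemma sym_shuffle_flip: "sym_shuffle (\<lambda>a c. F c a) qs = sym_shuffle (\<lambda>a c. F a c) qs"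
proof (induction qs arbitrary: F)
  case (Cons q qs)
  show ?case
    using Cons.IH[of "\<lambda>a c. F a (q # c)"] Cons.IH[of "\<lambda>a c. F (q # a) c"] by simp
qed simp

lemma shuffle_flip:
  "shuffle (\<lambda>a b c d. F c d a b) qs \<beta>s =
    shuffle (\<lambda>a b c d. (-1) ^ (length a * length c) *\<^sub>R F a b c d) qs \<beta>s"
proof -
  have "shuffle (\<lambda>a b c d. F c d a b) qs \<beta>s = alt_shuffle (\<lambda>a c. sym_shuffle (\<lambda>b d. F c b a d) \<beta>s) qs"
    by (simp add: shuffle_def sym_shuffle_flip[of "\<lambda>b d. F _ b _ d"])
  also have "\<dots> = alt_shuffle (\<lambda>a c. (-1) ^ (length a * length c) *\<^sub>R sym_shuffle (\<lambda>b d. F a b c d) \<beta>s) qs"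
    by (rule alt_shuffle_flip)
  finally show ?thesis
    by (simp add: shuffle_def sym_shuffle_scaleR)
qed

text \<open>Only one distribution survives and its sign is trivial. With its variants below, this
  evaluates products in which one factor has degree zero.\<close>

lemma alt_shuffle_left: "alt_shuffle (\<lambda>a c. if c = [] then F a else 0) qs = F qs"
proof (induction qs arbitrary: F)
  case (Cons q qs)
  then show ?case by (simp cong: if_cong)
qed simp

lemma alt_shuffle_right: "alt_shuffle (\<lambda>a c. if a = [] then F c else 0) qs = F qs"
proof (induction qs arbitrary: F)
  case (Cons q qs)
  have "alt_shuffle (\<lambda>a c. (-1) ^ length a *\<^sub>R (if a = [] then F (q # c) else 0)) qs =
      alt_shuffle (\<lambda>a c. if a = [] then F (q # c) else 0) qs"
    by (rule alt_shuffle_cong) simp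
  then show ?case using Cons by simp
qed simp

lemma sym_shuffle_left: "sym_shuffle (\<lambda>a c. if c = [] then F a else 0) qs = F qs"
  by (induction qs arbitrary: F) auto

lemma sym_shuffle_right: "sym_shuffle (\<lambda>a c. if a = [] then F c else 0) qs = F qs"
  by (induction qs arbitrary: F) auto

lemma shuffle_left: "shuffle (\<lambda>a b c d. if c = [] \<and> d = [] then F a b else 0) qs \<beta>s = F qs \<beta>s"
proof -
  have *: "sym_shuffle (\<lambda>b d. if c = [] \<and> d = [] then F a b else 0) \<beta>s =
      (if c = [] then F a \<beta>s else 0)" for a c
    using sym_shuffle_left[of "F a" \<beta>s] by simp
  show ?thesis unfolding shuffle_def by (simp only: * alt_shuffle_left)
qed

lemma shuffle_right: "shuffle (\<lambda>a b c d. if a = [] \<and> b = [] then F c d else 0) qs \<beta>s = F qs \<beta>s"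
proof -
  have *: "sym_shuffle (\<lambda>b d. if a = [] \<and> b = [] then F c d else 0) \<beta>s =
      (if a = [] then F c \<beta>s else 0)" for a c
    using sym_shuffle_right[of "F c" \<beta>s] by simp
  show ?thesis unfolding shuffle_def by (simp only: * alt_shuffle_right)
qed

section \<open>Linearity, alternation and symmetry of shuffles\<close>

lemma alt_shuffle_slot:
  assumes P: "jointly_linear P"
  shows "(\<And>a a' c. F (a @ w # a') c = P (F (a @ u # a') c) (F (a @ v # a') c)) \<Longrightarrow>
    (\<And>a c c'. F a (c @ w # c') = P (F a (c @ u # c')) (F a (c @ v # c'))) \<Longrightarrow>
    alt_shuffle F (xs @ w # ys) = P (alt_shuffle F (xs @ u # ys)) (alt_shuffle F (xs @ v # ys))"
proof (induction xs arbitrary: F)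
  case Nil
  have 1: "(\<lambda>a. F (w # a)) = (\<lambda>a c. P (F (u # a) c) (F (v # a) c))"
    using Nil(1)[of "[]"] by (simp add: fun_eq_iff)
  have 2: "(-1) ^ length a *\<^sub>R F a (w # c) = P ((-1) ^ length a *\<^sub>R F a (u # c)) ((-1) ^ length a *\<^sub>R F a (v # c))" for a c
    using Nil(2)[of a "[]"] by (simp add: jointly_linear_scaleRD[OF P])
  show ?case
    by (simp only: append_Nil alt_shuffle.simps 1 2 alt_shuffle_jointly_linear[OF P] jointly_linear_addD[OF P])
next
  case (Cons x xs)
  have 1: "alt_shuffle (\<lambda>a c. F (x # a) c) (xs @ w # ys) =
      P (alt_shuffle (\<lambda>a c. F (x # a) c) (xs @ u # ys)) (alt_shuffle (\<lambda>a c. F (x # a) c) (xs @ v # ys))"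
    by (rule Cons.IH) (use Cons.prems(1)[of "x # _"] Cons.prems(2) in auto)
  have 2: "alt_shuffle (\<lambda>a c. (-1) ^ length a *\<^sub>R F a (x # c)) (xs @ w # ys) =
      P (alt_shuffle (\<lambda>a c. (-1) ^ length a *\<^sub>R F a (x # c)) (xs @ u # ys))
        (alt_shuffle (\<lambda>a c. (-1) ^ length a *\<^sub>R F a (x # c)) (xs @ v # ys))"
    by (rule Cons.IH)
      (use Cons.prems(1) Cons.prems(2)[of _ "x # _"] in
        \<open>simp_all add: jointly_linear_scaleRD[OF P] jointly_linear_minusD[OF P]\<close>)
  show ?case
    by (simp only: append_Cons alt_shuffle.simps 1 2 jointly_linear_addD[OF P])
qed

lemma sym_shuffle_slot:
  assumes P: "jointly_linear P"
  shows "(\<And>a a' c. F (a @ w # a') c = P (F (a @ u # a') c) (F (a @ v # a') c)) \<Longrightarrow>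
    (\<And>a c c'. F a (c @ w # c') = P (F a (c @ u # c')) (F a (c @ v # c'))) \<Longrightarrow>
    sym_shuffle F (xs @ w # ys) = P (sym_shuffle F (xs @ u # ys)) (sym_shuffle F (xs @ v # ys))"
proof (induction xs arbitrary: F)
  case Nil
  have 1: "(\<lambda>a. F (w # a)) = (\<lambda>a c. P (F (u # a) c) (F (v # a) c))"
    using Nil(1)[of "[]"] by (simp add: fun_eq_iff)
  have 2: "F a (w # c) = P (F a (u # c)) (F a (v # c))" for a c
    using Nil(2)[of a "[]"] by (simp add: jointly_linear_scaleRD[OF P])
  show ?case
    by (simp only: append_Nil sym_shuffle.simps 1 2 sym_shuffle_jointly_linear[OF P] jointly_linear_addD[OF P])
next
  case (Cons x xs)
  have 1: "sym_shuffle (\<lambda>a c. F (x # a) c) (xs @ w # ys) =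
      P (sym_shuffle (\<lambda>a c. F (x # a) c) (xs @ u # ys)) (sym_shuffle (\<lambda>a c. F (x # a) c) (xs @ v # ys))"
    by (rule Cons.IH) (use Cons.prems(1)[of "x # _"] Cons.prems(2) in auto)
  have 2: "sym_shuffle (\<lambda>a c. F a (x # c)) (xs @ w # ys) =
      P (sym_shuffle (\<lambda>a c. F a (x # c)) (xs @ u # ys)) (sym_shuffle (\<lambda>a c. F a (x # c)) (xs @ v # ys))"
    by (rule Cons.IH) (use Cons.prems(1) Cons.prems(2)[of _ "x # _"] in auto)
  show ?case
    by (simp only: append_Cons sym_shuffle.simps 1 2 jointly_linear_addD[OF P])
qed

text \<open>Distributions with both copies of \<open>q\<close> in the same list vanish by
  hypothesis. The two ways to separate the copies give the same value with opposite signs.\<close>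

lemma alt_shuffle_alternating:
  "(\<And>a a' c. F (a @ q # q # a') c = 0) \<Longrightarrow> (\<And>a c c'. F a (c @ q # q # c') = 0) \<Longrightarrow>
    alt_shuffle F (xs @ q # q # ys) = 0"
proof (induction xs arbitrary: F)
  case Nil
  have 0: "(\<lambda>a. F (q # q # a)) = (\<lambda>_ _. 0)" "F a (q # q # c) = 0" for a c
    using Nil(1)[of "[]"] Nil(2)[of _ "[]"] by (auto simp: fun_eq_iff)
  have "alt_shuffle (\<lambda>a c. (-1) ^ length (q # a) *\<^sub>R F (q # a) (q # c)) ys =
      (-1) *\<^sub>R alt_shuffle (\<lambda>a c. (-1) ^ length a *\<^sub>R F (q # a) (q # c)) ys"
    by (subst alt_shuffle_scaleR[symmetric]) simp
  then show ?case
    by (simp only: append_Nil alt_shuffle.simps 0 scaleR_zero_right alt_shuffle_zero) simp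
next
  case (Cons x xs)
  have "alt_shuffle (\<lambda>a c. F (x # a) c) (xs @ q # q # ys) = 0"
    by (rule Cons.IH) (use Cons.prems(1)[of "x # _"] Cons.prems(2) in auto)
  moreover have "alt_shuffle (\<lambda>a c. (-1) ^ length a *\<^sub>R F a (x # c)) (xs @ q # q # ys) = 0"
    by (rule Cons.IH) (use Cons.prems(1) Cons.prems(2)[of _ "x # _"] in auto)
  ultimately show ?case by simp
qed

lemma sym_shuffle_symmetric:
  "(\<And>a a' c. F (a @ p # q # a') c = F (a @ q # p # a') c) \<Longrightarrow>
    (\<And>a c c'. F a (c @ p # q # c') = F a (c @ q # p # c')) \<Longrightarrow>
    sym_shuffle F (xs @ p # q # ys) = sym_shuffle F (xs @ q # p # ys)"
proof (induction xs arbitrary: F)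
  case Nil
  have 1: "(\<lambda>a c. F (p # q # a) c) = (\<lambda>a c. F (q # p # a) c)" "(\<lambda>a c. F a (p # q # c)) = (\<lambda>a c. F a (q # p # c))"
    using Nil(1)[of "[]"] Nil(2)[of _ "[]"] by (auto simp: fun_eq_iff)
  show ?case
    by (simp only: append_Nil sym_shuffle.simps 1 add.assoc add.left_commute)
next
  case (Cons x xs)
  have "sym_shuffle (\<lambda>a c. F (x # a) c) (xs @ p # q # ys) = sym_shuffle (\<lambda>a c. F (x # a) c) (xs @ q # p # ys)"
    by (rule Cons.IH) (use Cons.prems(1)[of "x # _"] Cons.prems(2) in auto)
  moreover have "sym_shuffle (\<lambda>a c. F a (x # c)) (xs @ p # q # ys) = sym_shuffle (\<lambda>a c. F a (x # c)) (xs @ q # p # ys)"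
    by (rule Cons.IH) (use Cons.prems(1) Cons.prems(2)[of _ "x # _"] in auto)
  ultimately show ?case by simp
qed

section \<open>Multilinear forms\<close>

text \<open>Alternation and symmetry are imposed on adjacent arguments only.\<close>

definition multilinear :: "('m \<Rightarrow> real) set \<Rightarrow> ('m \<Rightarrow> 'a::real_vector) set \<Rightarrow>
    (('m \<Rightarrow> 'a) list \<Rightarrow> 'm \<Rightarrow> 'e::real_vector) \<Rightarrow> bool" where
  "multilinear C \<Gamma> F \<longleftrightarrow>
     (\<forall>xs. \<not> set xs \<subseteq> \<Gamma> \<longrightarrow> F xs = 0) \<and>
     (\<forall>u\<in>\<Gamma>. \<forall>xs ys. (\<forall>v\<in>\<Gamma>. F (xs @ (u + v) # ys) = F (xs @ u # ys) + F (xs @ v # ys)) \<and>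
        (\<forall>f\<in>C. F (xs @ (f \<odot> u) # ys) = f \<odot> F (xs @ u # ys)))"

definition alternating :: "('a list \<Rightarrow> 'e::real_vector) \<Rightarrow> bool" where
  "alternating F \<longleftrightarrow> (\<forall>xs q ys. F (xs @ q # q # ys) = 0)"

definition symmetric :: "('a list \<Rightarrow> 'e) \<Rightarrow> bool" where
  "symmetric F \<longleftrightarrow> (\<forall>xs p q ys. F (xs @ p # q # ys) = F (xs @ q # p # ys))"

lemma multilinearD:
  assumes "multilinear C \<Gamma> F"
  shows "\<not> set xs \<subseteq> \<Gamma> \<Longrightarrow> F xs = 0"
    and "u \<in> \<Gamma> \<Longrightarrow> v \<in> \<Gamma> \<Longrightarrow> F (xs @ (u + v) # ys) = F (xs @ u # ys) + F (xs @ v # ys)"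
    and "u \<in> \<Gamma> \<Longrightarrow> f \<in> C \<Longrightarrow> F (xs @ (f \<odot> u) # ys) = f \<odot> F (xs @ u # ys)"
  using assms by (auto simp: multilinear_def)

lemma multilinear_alt_shuffle:
  assumes "\<And>c. multilinear C \<Gamma> (\<lambda>a. F a c)" "\<And>a. multilinear C \<Gamma> (\<lambda>c. F a c)"
  shows "multilinear C \<Gamma> (alt_shuffle F)"
proof -
  note D = multilinearD[OF assms(1)] and D' = multilinearD[OF assms(2)]
  have "alt_shuffle F xs = 0" if "\<not> set xs \<subseteq> \<Gamma>" for xs
  proof -
    have "alt_shuffle F xs = alt_shuffle (\<lambda>_ _. 0) xs"
      by (rule alt_shuffle_cong) (use that D(1) D'(1) in blast)
    then show ?thesis by simp
  qed
  moreover have "alt_shuffle F (xs @ (u + v) # ys) = alt_shuffle F (xs @ u # ys) + alt_shuffle F (xs @ v # ys)"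
    if "u \<in> \<Gamma>" "v \<in> \<Gamma>" for u v xs ys
    using that by (intro alt_shuffle_slot[OF jointly_linear_plus] D(2) D'(2))
  moreover have "alt_shuffle F (xs @ (f \<odot> u) # ys) = f \<odot> alt_shuffle F (xs @ u # ys)"
    if "u \<in> \<Gamma>" "f \<in> C" for u f xs ys
    using that by (intro alt_shuffle_slot[OF jointly_linear_fscale] D(3) D'(3))
  ultimately show ?thesis by (simp add: multilinear_def)
qed

lemma multilinear_sym_shuffle:
  assumes "\<And>c. multilinear C \<Gamma> (\<lambda>a. F a c)" "\<And>a. multilinear C \<Gamma> (\<lambda>c. F a c)"
  shows "multilinear C \<Gamma> (sym_shuffle F)"
proof -
  note D = multilinearD[OF assms(1)] and D' = multilinearD[OF assms(2)]
  have "sym_shuffle F xs = 0" if "\<not> set xs \<subseteq> \<Gamma>" for xs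
  proof -
    have "sym_shuffle F xs = sym_shuffle (\<lambda>_ _. 0) xs"
      by (rule sym_shuffle_cong) (use that D(1) D'(1) in blast)
    then show ?thesis by simp
  qed
  moreover have "sym_shuffle F (xs @ (u + v) # ys) = sym_shuffle F (xs @ u # ys) + sym_shuffle F (xs @ v # ys)"
    if "u \<in> \<Gamma>" "v \<in> \<Gamma>" for u v xs ys
    using that by (intro sym_shuffle_slot[OF jointly_linear_plus] D(2) D'(2))
  moreover have "sym_shuffle F (xs @ (f \<odot> u) # ys) = f \<odot> sym_shuffle F (xs @ u # ys)"
    if "u \<in> \<Gamma>" "f \<in> C" for u f xs ys
    using that by (intro sym_shuffle_slot[OF jointly_linear_fscale] D(3) D'(3))
  ultimately show ?thesis by (simp add: multilinear_def)
qed

text \<open>Here the shuffled list \<open>qs\<close> is fixed and linearity is in a parameter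
  \<open>xs\<close>. A form has two lists of arguments; while one of them is examined, the shuffle
  of the other is of this kind.\<close>

lemma multilinear_of_alt_shuffle:
  assumes "\<And>a c. multilinear C \<Gamma> (\<lambda>xs. F xs a c)"
  shows "multilinear C \<Gamma> (\<lambda>xs. alt_shuffle (F xs) qs)"
proof -
  note D = multilinearD[OF assms]
  show ?thesis
    unfolding multilinear_def
  proof (intro conjI allI impI ballI)
    show "alt_shuffle (F xs) qs = 0" if "\<not> set xs \<subseteq> \<Gamma>" for xs
      using D(1)[OF that] alt_shuffle_zero by (metis (no_types, lifting) alt_shuffle_cong)
  qed (simp_all add: D(2,3) alt_shuffle_add[symmetric] alt_shuffle_fscale[symmetric] cong: alt_shuffle_cong)
qed

lemma multilinear_of_sym_shuffle:
  assumes "\<And>a c. multilinear C \<Gamma> (\<lambda>xs. F xs a c)"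
  shows "multilinear C \<Gamma> (\<lambda>xs. sym_shuffle (F xs) qs)"
proof -
  note D = multilinearD[OF assms]
  show ?thesis
    unfolding multilinear_def
  proof (intro conjI allI impI ballI)
    show "sym_shuffle (F xs) qs = 0" if "\<not> set xs \<subseteq> \<Gamma>" for xs
      using D(1)[OF that] sym_shuffle_zero by (metis (no_types, lifting) sym_shuffle_cong)
  qed (simp_all add: D(2,3) sym_shuffle_add[symmetric] sym_shuffle_fscale[symmetric] cong: sym_shuffle_cong)
qed

lemma alternating_alt_shuffle:
  "(\<And>c. alternating (\<lambda>a. F a c)) \<Longrightarrow> (\<And>a. alternating (\<lambda>c. F a c)) \<Longrightarrow> alternating (alt_shuffle F)"
  unfolding alternating_def by (intro allI alt_shuffle_alternating) blast+

lemma symmetric_sym_shuffle: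
  "(\<And>c. symmetric (\<lambda>a. F a c)) \<Longrightarrow> (\<And>a. symmetric (\<lambda>c. F a c)) \<Longrightarrow> symmetric (sym_shuffle F)"
  unfolding symmetric_def by (intro allI sym_shuffle_symmetric) blast+

lemma alternating_of_sym_shuffle:
  "(\<And>b d. alternating (\<lambda>xs. F xs b d)) \<Longrightarrow> alternating (\<lambda>xs. sym_shuffle (F xs) \<beta>s)"
  unfolding alternating_def by (metis (no_types, lifting) sym_shuffle_cong sym_shuffle_zero)

lemma symmetric_of_alt_shuffle:
  "(\<And>a c. symmetric (\<lambda>xs. F xs a c)) \<Longrightarrow> symmetric (\<lambda>xs. alt_shuffle (F xs) qs)"
  unfolding symmetric_def by (metis (no_types, lifting) alt_shuffle_cong)

text \<open>The arguments of the operations below are themselves functions; evaluation at a point is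
  only wanted on demand.\<close>

lemmas fun_apply_simps = plus_fun_apply zero_fun_apply times_fun_apply minus_apply uminus_apply
declare fun_apply_simps [simp del]

lemma cmoduleD:
  assumes "cmodule C \<Gamma>"
  shows "0 \<in> \<Gamma>" "s \<in> \<Gamma> \<Longrightarrow> t \<in> \<Gamma> \<Longrightarrow> s + t \<in> \<Gamma>" "f \<in> C \<Longrightarrow> s \<in> \<Gamma> \<Longrightarrow> f \<odot> s \<in> \<Gamma>"
  using assms by (auto simp: cmodule_def)

lemma cmodule_sum: "cmodule C \<Gamma> \<Longrightarrow> (\<And>i. i \<in> I \<Longrightarrow> s i \<in> \<Gamma>) \<Longrightarrow> (\<Sum>i\<in>I. s i) \<in> \<Gamma>"
  by (induction I rule: infinite_finite_induct) (auto simp: cmodule_def)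

lemma fscale_simps [simp]:
  "f \<odot> (0 :: 'm \<Rightarrow> 'e::real_vector) = 0" "(0 :: 'm \<Rightarrow> real) \<odot> (s :: 'm \<Rightarrow> 'e::real_vector) = 0"
  by (simp_all add: fscale_def fun_eq_iff fun_apply_simps)

lemma fscale_add_right: "f \<odot> (s + t) = f \<odot> s + f \<odot> t"
  and fscale_add_left: "(f + g) \<odot> s = f \<odot> s + g \<odot> s"
  and fscale_fscale: "f \<odot> g \<odot> s = (f * g) \<odot> s"
  and fscale_scaleR: "f \<odot> (r *\<^sub>R s) = r *\<^sub>R (f \<odot> s)"
  and scaleR_fscale: "(r *\<^sub>R f) \<odot> s = r *\<^sub>R (f \<odot> s)"
  and fscale_const: "(\<lambda>_. r) \<odot> s = r *\<^sub>R s"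
  by (auto simp: fscale_def fun_eq_iff scaleR_fun_def scaleR_right_distrib scaleR_left_distrib fun_apply_simps)

lemma fscale_real: "f \<odot> (g :: 'm \<Rightarrow> real) = f * g"
  by (simp add: fscale_def fun_eq_iff fun_apply_simps)

lemma multilinear_zero:
  assumes "cmodule C \<Gamma>" "multilinear C \<Gamma> F"
  shows "F (xs @ 0 # ys) = 0"
  using multilinearD(2)[OF assms(2) cmoduleD(1)[OF assms(1)] cmoduleD(1)[OF assms(1)], of xs ys] by simp

lemma multilinear_sum:
  assumes "cmodule C \<Gamma>" "multilinear C \<Gamma> F" "\<And>i. i \<in> I \<Longrightarrow> u i \<in> \<Gamma>" "\<And>i. i \<in> I \<Longrightarrow> g i \<in> C"
  shows "F (xs @ (\<Sum>i\<in>I. g i \<odot> u i) # ys) = (\<Sum>i\<in>I. g i \<odot> F (xs @ u i # ys))"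
  using assms(3,4)
proof (induction I rule: infinite_finite_induct)
  case (insert i I)
  have "(\<Sum>i\<in>I. g i \<odot> u i) \<in> \<Gamma>" "g i \<odot> u i \<in> \<Gamma>"
    using insert.prems assms(1) by (auto intro!: cmodule_sum cmoduleD(3))
  then show ?case
    using insert multilinearD(2,3)[OF assms(2)] by simp
qed (simp_all add: multilinear_zero[OF assms(1,2)])

lemma multilinear_alternating_swap:
  assumes "cmodule C \<Gamma>" "multilinear C \<Gamma> F" "alternating F"
  shows "F (xs @ u # v # ys) = - F (xs @ v # u # ys)"
proof (cases "u \<in> \<Gamma> \<and> v \<in> \<Gamma>")
  case True
  note add = multilinearD(2)[OF assms(2)]
  have "0 = F (xs @ (u + v) # (u + v) # ys)"
    using assms(3) by (simp add: alternating_def)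
  also have "\<dots> = F (xs @ u # (u + v) # ys) + F (xs @ v # (u + v) # ys)"
    using True add by simp
  also have "F (xs @ u # (u + v) # ys) = F (xs @ u # u # ys) + F (xs @ u # v # ys)"
    using True add[of u v "xs @ [u]" ys] by simp
  also have "F (xs @ v # (u + v) # ys) = F (xs @ v # u # ys) + F (xs @ v # v # ys)"
    using True add[of u v "xs @ [v]" ys] by simp
  finally show ?thesis
    using assms(3) by (simp add: alternating_def eq_neg_iff_add_eq_0)
next
  case False
  then show ?thesis
    using multilinearD(1)[OF assms(2)] by auto
qed

text \<open>The first copy of \<open>u\<close> is moved to the second by transpositions of
  neighbours. This recovers the condition in \<open>forms\<close>, which concerns equal entries at
  arbitrary positions.\<close>

lemma multilinear_alternating_repeat:
  assumes "cmodule C \<Gamma>" "multilinear C \<Gamma> F" "alternating F"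
  shows "F (xs @ u # zs @ u # ys) = 0"
proof (induction zs arbitrary: xs)
  case Nil
  then show ?case using assms(3) by (simp add: alternating_def)
next
  case (Cons z zs)
  have "F (xs @ u # z # zs @ u # ys) = - F (xs @ z # u # zs @ u # ys)"
    by (rule multilinear_alternating_swap[OF assms])
  then show ?case using Cons[of "xs @ [z]"] by simp
qed

text \<open>The head of the first list is located in the second and moved to its front by exchanging
  neighbours; then the tails are compared.\<close>

lemma symmetric_mset:
  "symmetric F \<Longrightarrow> mset xs = mset ys \<Longrightarrow> F xs = F ys"
proof (induction xs arbitrary: F ys)
  case (Cons x xs)
  then have "x \<in> set ys" by (metis list.set_intros(1) set_mset_mset)
  then obtain us vs where ys: "ys = us @ x # vs" by (meson split_list)
  have move: "F (us @ x # vs) = F (x # us @ vs)" for us vs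
  proof (induction us arbitrary: vs rule: rev_induct)
    case (snoc u us)
    have "F (us @ u # x # vs) = F (us @ x # u # vs)"
      using Cons.prems(1) by (simp add: symmetric_def)
    then show ?case using snoc[of "u # vs"] by simp
  qed simp
  have "symmetric (\<lambda>l. F (x # l))"
    unfolding symmetric_def
  proof (intro allI)
    show "F (x # us @ p # q # vs) = F (x # us @ q # p # vs)" for us p q vs
      using Cons.prems(1)[unfolded symmetric_def, rule_format, of "x # us" p q vs] by simp
  qed
  moreover have "mset xs = mset (us @ vs)"
    using Cons.prems(2) ys by simp
  ultimately have "F (x # xs) = F (x # us @ vs)"
    using Cons.IH by blast
  then show ?case using move ys by simp
qed simp

text \<open>Extracting one argument and reinserting it in front restores \<open>F\<close>: the
  shuffle sign of the extraction and the sign of the reinsertion cancel. The sum therefore counts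
  the arguments.\<close>

lemma alternating_euler:
  assumes "\<And>xs p q ys. F (xs @ p # q # ys) = - F (xs @ q # p # ys)"
  shows "alt_shuffle (\<lambda>a c. if length a = 1 then F (hd a # c) else 0) qs = real (length qs) *\<^sub>R F qs"
  using assms
proof (induction qs arbitrary: F)
  case (Cons q qs)
  have "alt_shuffle (\<lambda>a c. if length (q # a) = 1 then F (hd (q # a) # c) else 0) qs =
      alt_shuffle (\<lambda>a c. if a = [] then F (q # c) else 0) qs"
    by (rule alt_shuffle_cong) simp
  also have "\<dots> = F (q # qs)" by (rule alt_shuffle_right)
  finally have 1: "alt_shuffle (\<lambda>a c. if length (q # a) = 1 then F (hd (q # a) # c) else 0) qs = F (q # qs)" .
  have "alt_shuffle (\<lambda>a c. (-1) ^ length a *\<^sub>R (if length a = 1 then F (hd a # q # c) else 0)) qs =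
      alt_shuffle (\<lambda>a c. if length a = 1 then F (q # hd a # c) else 0) qs"
  proof (rule alt_shuffle_cong)
    fix a c
    show "(-1) ^ length a *\<^sub>R (if length a = 1 then F (hd a # q # c) else 0) =
        (if length a = 1 then F (q # hd a # c) else 0)"
      using Cons.prems[of "[]" q "hd a" c] by simp
  qed
  also have "\<dots> = real (length qs) *\<^sub>R F (q # qs)"
  proof (rule Cons.IH)
    show "F (q # xs @ p # r # ys) = - F (q # xs @ r # p # ys)" for xs p r ys
      using Cons.prems[of "q # xs" p r ys] by simp
  qed
  finally show ?case
    using 1 by (simp only: alt_shuffle.simps) (simp add: scaleR_left_distrib)
qed simp

lemma symmetric_euler:
  assumes "symmetric F"
  shows "sym_shuffle (\<lambda>a c. if length a = 1 then F (hd a # c) else 0) qs = real (length qs) *\<^sub>R F qs"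
  using assms
proof (induction qs arbitrary: F)
  case (Cons q qs)
  have "sym_shuffle (\<lambda>a c. if length (q # a) = 1 then F (hd (q # a) # c) else 0) qs =
      sym_shuffle (\<lambda>a c. if a = [] then F (q # c) else 0) qs"
    by (rule sym_shuffle_cong) simp
  also have "\<dots> = F (q # qs)" by (rule sym_shuffle_right)
  finally have 1: "sym_shuffle (\<lambda>a c. if length (q # a) = 1 then F (hd (q # a) # c) else 0) qs = F (q # qs)" .
  have "F (p # q # c) = F (q # p # c)" for p c
    using Cons.prems[unfolded symmetric_def, rule_format, of "[]"] by simp
  then have "sym_shuffle (\<lambda>a c. if length a = 1 then F (hd a # q # c) else 0) qs =
      sym_shuffle (\<lambda>a c. if length a = 1 then F (q # hd a # c) else 0) qs"
    by (intro sym_shuffle_cong) simp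
  also have "\<dots> = real (length qs) *\<^sub>R F (q # qs)"
  proof (rule Cons.IH)
    show "symmetric (\<lambda>l. F (q # l))"
      unfolding symmetric_def
    proof (intro allI)
      show "F (q # xs @ p # r # ys) = F (q # xs @ r # p # ys)" for xs p r ys
        using Cons.prems[unfolded symmetric_def, rule_format, of "q # xs" p r ys] by simp
    qed
  qed
  finally show ?case
    using 1 by (simp only: sym_shuffle.simps) (simp add: scaleR_left_distrib)
qed simp

lemma shuffle_Cons_left:
  "shuffle F (q # qs) \<beta>s = shuffle (\<lambda>a b c d. F (q # a) b c d) qs \<beta>s +
     shuffle (\<lambda>a b c d. (-1) ^ length a *\<^sub>R F a b (q # c) d) qs \<beta>s"
  by (simp add: shuffle_def sym_shuffle_scaleR)

lemma shuffle_Cons_right: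
  "shuffle F qs (\<beta> # \<beta>s) = shuffle (\<lambda>a b c d. F a (\<beta> # b) c d) qs \<beta>s +
     shuffle (\<lambda>a b c d. F a b c (\<beta> # d)) qs \<beta>s"
  by (simp add: shuffle_def alt_shuffle_add)

lemma shuffle_nonzero:
  assumes "shuffle F qs \<beta>s \<noteq> 0"
  obtains a b c d where "length a + length c = length qs" "length b + length d = length \<beta>s"
    "set a \<union> set c = set qs" "set b \<union> set d = set \<beta>s" "F a b c d \<noteq> 0"
proof -
  have "\<exists>a b c d. length a + length c = length qs \<and> length b + length d = length \<beta>s \<and>
      set a \<union> set c = set qs \<and> set b \<union> set d = set \<beta>s \<and> F a b c d \<noteq> 0"
  proof (rule ccontr)
    assume "\<not> ?thesis"
    then have "shuffle F qs \<beta>s = shuffle (\<lambda>_ _ _ _. 0) qs \<beta>s"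
      by (intro shuffle_cong) blast
    then show False using assms by simp
  qed
  then show ?thesis using that by blast
qed

lemma shuffle_sum: "shuffle (\<lambda>a b c d. \<Sum>i\<in>I. F i a b c d) qs \<beta>s = (\<Sum>i\<in>I. shuffle (F i) qs \<beta>s)"
proof (induction I rule: infinite_finite_induct)
  case (insert i I)
  then show ?case
    using shuffle_add[of "F i" "\<lambda>a b c d. \<Sum>i\<in>I. F i a b c d" qs \<beta>s] by simp
qed simp_all

text \<open>The value 0 on inadmissible arguments is part of \<open>multilinear\<close>, so the
  conditions can be imposed on each list while the other one is arbitrary.\<close>

definition tensorial ::
    "('m, 'q::real_vector, 'b::real_vector) split_data \<Rightarrow> ('m, 'q, 'b, 'e::real_vector) form \<Rightarrow> bool" where
  "tensorial S \<Phi> \<longleftrightarrow>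
     (\<forall>\<beta>s. multilinear (Cinf S) (secQ S) (\<lambda>qs. \<Phi> qs \<beta>s) \<and> alternating (\<lambda>qs. \<Phi> qs \<beta>s)) \<and>
     (\<forall>qs. multilinear (Cinf S) (secBd S) (\<Phi> qs) \<and> symmetric (\<Phi> qs))"

text \<open>A bound on the total degree, with weight 2 for \<open>B\<close>, expresses that only
  finitely many bidegrees occur and is easier to propagate through products.\<close>

definition bounded_degree :: "nat \<Rightarrow> ('m, 'q, 'b, 'e::real_vector) form \<Rightarrow> bool" where
  "bounded_degree N \<Phi> \<longleftrightarrow> (\<forall>qs \<beta>s. \<Phi> qs \<beta>s \<noteq> 0 \<longrightarrow> length qs + 2 * length \<beta>s \<le> N)"

lemma tensorialD:
  assumes "tensorial S \<Phi>"
  shows "multilinear (Cinf S) (secQ S) (\<lambda>qs. \<Phi> qs \<beta>s)" "alternating (\<lambda>qs. \<Phi> qs \<beta>s)"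
    "multilinear (Cinf S) (secBd S) (\<Phi> qs)" "symmetric (\<Phi> qs)"
  using assms by (auto simp: tensorial_def)

lemma tensorial_compose:
  assumes "tensorial S \<Phi>" "\<And>qs \<beta>s. \<Phi> qs \<beta>s \<in> X" "L 0 = 0"
    and "\<And>s t. s \<in> X \<Longrightarrow> t \<in> X \<Longrightarrow> L (s + t) = L s + L t"
    and "\<And>f s. f \<in> Cinf S \<Longrightarrow> s \<in> X \<Longrightarrow> L (f \<odot> s) = f \<odot> L s"
  shows "tensorial S (\<lambda>qs \<beta>s. L (\<Phi> qs \<beta>s))"
proof -
  note T = assms(1)[unfolded tensorial_def multilinear_def alternating_def symmetric_def]
  show ?thesis
    unfolding tensorial_def multilinear_def alternating_def symmetric_def
    using T by (simp add: assms(2-5))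
qed

lemma tensorial_shuffle:
  assumes "\<And>c d. tensorial S (\<lambda>a b. F a b c d)" "\<And>a b. tensorial S (\<lambda>c d. F a b c d)"
  shows "tensorial S (shuffle F)"
  unfolding tensorial_def
proof (intro conjI allI)
  note D = tensorialD[OF assms(1)] and D' = tensorialD[OF assms(2)]
  show "multilinear (Cinf S) (secQ S) (\<lambda>qs. shuffle F qs \<beta>s)" for \<beta>s
    unfolding shuffle_def by (intro multilinear_alt_shuffle multilinear_of_sym_shuffle D D')
  show "alternating (\<lambda>qs. shuffle F qs \<beta>s)" for \<beta>s
    unfolding shuffle_def by (intro alternating_alt_shuffle alternating_of_sym_shuffle D D')
  have eq: "shuffle F qs = (\<lambda>\<beta>s. alt_shuffle (\<lambda>a c. sym_shuffle (\<lambda>b d. F a b c d) \<beta>s) qs)" for qs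
    by (simp add: shuffle_def fun_eq_iff)
  show "multilinear (Cinf S) (secBd S) (shuffle F qs)" for qs
    unfolding eq by (intro multilinear_of_alt_shuffle multilinear_sym_shuffle D D')
  show "symmetric (shuffle F qs)" for qs
    unfolding eq by (intro symmetric_of_alt_shuffle symmetric_sym_shuffle D D')
qed

lemma bounded_degree_shuffle:
  assumes "\<And>a b c d. F a b c d \<noteq> 0 \<Longrightarrow> length a + 2 * length b \<le> N \<and> length c + 2 * length d \<le> K"
  shows "bounded_degree (N + K) (shuffle F)"
  unfolding bounded_degree_def
proof (intro allI impI)
  fix qs \<beta>s assume "shuffle F qs \<beta>s \<noteq> 0"
  then obtain a b c d where "length a + length c = length qs" "length b + length d = length \<beta>s"
    "F a b c d \<noteq> 0"
    by (rule shuffle_nonzero)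
  then show "length qs + 2 * length \<beta>s \<le> N + K"
    using assms[of a b c d] by linarith
qed

section \<open>Forms over the manifold and the two bundles\<close>

locale lie_data =
  fixes S :: "('m::{t2_space,second_countable_topology}, 'q::real_vector, 'b::real_vector) split_data"
  assumes manifold: "smooth_manifold (base S)"
    and bundleQ: "vector_bundle (base S) (bunQ S)"
    and bundleB: "vector_bundle (base S) (bunB S)"
begin

abbreviation smod :: "('m \<Rightarrow> 'e::real_vector) set \<Rightarrow> bool"
  where "smod \<equiv> cmodule (Cinf S)"

lemma const_smooth: "(\<lambda>_. c) \<in> Cinf S"
  by (simp add: smooth_functions_def smooth_on_const)

lemma add_smooth: "f \<in> Cinf S \<Longrightarrow> g \<in> Cinf S \<Longrightarrow> f + g \<in> Cinf S"
  using smooth_on_add[of "base S" UNIV f g] by (simp add: smooth_functions_def plus_fun_def)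

lemma mult_smooth: "f \<in> Cinf S \<Longrightarrow> g \<in> Cinf S \<Longrightarrow> f * g \<in> Cinf S"
  using smooth_on_mult[of "base S" UNIV f g] by (simp add: smooth_functions_def times_fun_def)

lemma smod_Cinf: "smod (Cinf S)"
  using const_smooth[of 0] by (simp add: cmodule_def add_smooth mult_smooth fscale_real zero_fun_def)

lemmas smod_secQ = cmodule_sections[OF bundleQ]
  and smod_secBd = cmodule_sections[OF vector_bundle_dual[OF bundleB]]
lemmas dual_pairQ = dual_pair_sections[OF manifold bundleQ]
  and dual_pairB = dual_pair_sections[OF manifold bundleB]

lemma smod_scaleR: "smod \<Gamma> \<Longrightarrow> s \<in> \<Gamma> \<Longrightarrow> r *\<^sub>R s \<in> \<Gamma>"
  using cmoduleD(3)[of "Cinf S" \<Gamma> "\<lambda>_. r" s] const_smooth by (simp add: fscale_const)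

lemma smod_minus: "smod \<Gamma> \<Longrightarrow> s \<in> \<Gamma> \<Longrightarrow> - s \<in> \<Gamma>"
  using smod_scaleR[of \<Gamma> s "-1"] by simp

lemma smod_diff: "smod \<Gamma> \<Longrightarrow> s \<in> \<Gamma> \<Longrightarrow> t \<in> \<Gamma> \<Longrightarrow> s - t \<in> \<Gamma>"
  using cmoduleD(2)[of "Cinf S" \<Gamma> s "- t"] smod_minus[of \<Gamma> t] by simp

lemma closed_linear_smod: "smod \<Gamma> \<Longrightarrow> closed_linear \<Gamma>"
  using smod_scaleR cmoduleD(2) unfolding closed_linear_def by blast

lemma smod_vfields: "smod (vfields S)"
proof -
  have "f \<odot> X \<in> vfields S" if f: "f \<in> Cinf S" and X: "X \<in> vfields S" for f X
  proof -
    have "(f \<odot> X) x \<in> tangent_space (base S) x" for x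
      using X by (simp add: vector_fields_def tangent_space_def fscale_def scaleR_fun_def algebra_simps fun_apply_simps)
    moreover have "lie_deriv (f \<odot> X) g \<in> Cinf S" if "g \<in> Cinf S" for g
    proof -
      have "lie_deriv (f \<odot> X) g = f * lie_deriv X g"
        by (simp add: lie_deriv_def fscale_def scaleR_fun_def fun_eq_iff fun_apply_simps)
      then show ?thesis using f X that by (simp add: mult_smooth vector_fields_def)
    qed
    ultimately show ?thesis by (simp add: vector_fields_def)
  qed
  moreover have "X + Y \<in> vfields S" if X: "X \<in> vfields S" and Y: "Y \<in> vfields S" for X Y
  proof -
    have "(X + Y) x \<in> tangent_space (base S) x" for x
      using X Y by (simp add: vector_fields_def tangent_space_def algebra_simps fun_apply_simps)
    moreover have "lie_deriv (X + Y) g \<in> Cinf S" if "g \<in> Cinf S" for g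
    proof -
      have "lie_deriv (X + Y) g = lie_deriv X g + lie_deriv Y g"
        by (simp add: lie_deriv_def fun_eq_iff fun_apply_simps)
      then show ?thesis using X Y that by (simp add: add_smooth vector_fields_def)
    qed
    ultimately show ?thesis by (simp add: vector_fields_def)
  qed
  moreover have "0 \<in> vfields S"
    using const_smooth[of 0] by (simp add: vector_fields_def tangent_space_def lie_deriv_def fun_apply_simps)
  ultimately show ?thesis by (simp add: cmodule_def)
qed

lemma vfieldD:
  assumes X: "X \<in> vfields S"
  shows "f \<in> Cinf S \<Longrightarrow> lie_deriv X f \<in> Cinf S"
    and "f \<in> Cinf S \<Longrightarrow> g \<in> Cinf S \<Longrightarrow> lie_deriv X (f + g) = lie_deriv X f + lie_deriv X g"
    and "f \<in> Cinf S \<Longrightarrow> g \<in> Cinf S \<Longrightarrow> lie_deriv X (f * g) = lie_deriv X f * g + f * lie_deriv X g"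
    and "f \<in> Cinf S \<Longrightarrow> lie_deriv X (c *\<^sub>R f) = c *\<^sub>R lie_deriv X f"
    and "f \<notin> Cinf S \<Longrightarrow> lie_deriv X f = 0"
proof -
  have "X x \<in> tangent_space (base S) x" for x
    using X by (simp add: vector_fields_def)
  then have T: "f \<in> Cinf S \<Longrightarrow> g \<in> Cinf S \<Longrightarrow> X x (f + g) = X x f + X x g"
    "f \<in> Cinf S \<Longrightarrow> g \<in> Cinf S \<Longrightarrow> X x (f * g) = f x * X x g + X x f * g x"
    "f \<in> Cinf S \<Longrightarrow> X x (c *\<^sub>R f) = c * X x f" "f \<notin> Cinf S \<Longrightarrow> X x f = 0" for x f g c
    by (simp_all add: tangent_space_def)
  show "f \<in> Cinf S \<Longrightarrow> lie_deriv X f \<in> Cinf S"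
    using X by (simp add: vector_fields_def)
  show "f \<in> Cinf S \<Longrightarrow> g \<in> Cinf S \<Longrightarrow> lie_deriv X (f + g) = lie_deriv X f + lie_deriv X g"
    "f \<in> Cinf S \<Longrightarrow> g \<in> Cinf S \<Longrightarrow> lie_deriv X (f * g) = lie_deriv X f * g + f * lie_deriv X g"
    "f \<notin> Cinf S \<Longrightarrow> lie_deriv X f = 0"
    by (simp_all add: lie_deriv_def fun_eq_iff T fun_apply_simps)
  show "f \<in> Cinf S \<Longrightarrow> lie_deriv X (c *\<^sub>R f) = c *\<^sub>R lie_deriv X f"
    by (simp add: lie_deriv_def T scaleR_fun_def[of _ "\<lambda>x. X x f"])
qed

lemma lie_deriv_linear:
  "lie_deriv (X + Y) f = lie_deriv X f + lie_deriv Y f"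
  "lie_deriv (g \<odot> X) f = g \<odot> lie_deriv X f"
  "lie_deriv 0 f = 0"
  by (simp_all add: lie_deriv_def fun_eq_iff fscale_def scaleR_fun_def fun_apply_simps)

text \<open>From here on slots are described by splittings \<open>xs @ u # ys\<close>, which suit
  list induction, instead of positions and updates. Replacing a slot by another admissible section
  does not change whether the arguments are admissible, so in the inadmissible cases all terms
  vanish together.\<close>

lemma forms_iff:
  assumes \<Gamma>: "smod \<Gamma>"
  shows "\<Phi> \<in> forms S \<Gamma> \<longleftrightarrow>
    tensorial S \<Phi> \<and> (\<forall>qs \<beta>s. \<Phi> qs \<beta>s \<in> \<Gamma>) \<and> (\<exists>N. bounded_degree N \<Phi>)"
proof
  assume L: "\<Phi> \<in> forms S \<Gamma>"
  note forms = L[unfolded forms_def mem_Collect_eq]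
  note no = forms[THEN conjunct1, rule_format]
  note fin = forms[THEN conjunct2, THEN conjunct1]
  note inner = forms[THEN conjunct2, THEN conjunct2, rule_format]
  note val = inner[THEN conjunct1]
  note linQ = inner[THEN conjunct2, THEN conjunct1, rule_format]
  note linB = inner[THEN conjunct2, THEN conjunct2, THEN conjunct1, rule_format]
  note alt = inner[THEN conjunct2, THEN conjunct2, THEN conjunct2, THEN conjunct1, rule_format]
  note sym = inner[THEN conjunct2, THEN conjunct2, THEN conjunct2, THEN conjunct2, rule_format]
  have "tensorial S \<Phi>"
    unfolding tensorial_def multilinear_def
  proof (intro conjI allI ballI impI)
    fix qs \<beta>s
    show "\<Phi> qs \<beta>s = 0" if "\<not> set qs \<subseteq> secQ S"
      using that by (intro no) (simp add: args_def)
    show "\<Phi> qs \<beta>s = 0" if "\<not> set \<beta>s \<subseteq> secBd S"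
      using that by (intro no) (simp add: args_def)
    show "alternating (\<lambda>qs. \<Phi> qs \<beta>s)"
      unfolding alternating_def
    proof (intro allI)
      fix xs q ys
      show "\<Phi> (xs @ q # q # ys) \<beta>s = 0"
        using alt[of "xs @ q # q # ys" \<beta>s "length xs" "Suc (length xs)"] no[of "xs @ q # q # ys" \<beta>s]
        by (cases "args S (xs @ q # q # ys) \<beta>s") (simp_all add: nth_append)
    qed
    show "symmetric (\<Phi> qs)"
      unfolding symmetric_def
    proof (intro allI)
      fix xs p q ys
      show "\<Phi> qs (xs @ p # q # ys) = \<Phi> qs (xs @ q # p # ys)"
      proof (cases "args S qs (xs @ p # q # ys)")
        case True
        then show ?thesis using sym[OF True, of "xs @ q # p # ys"] by simp
      next
        case False
        moreover from False have "\<not> args S qs (xs @ q # p # ys)" by (auto simp: args_def)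
        ultimately show ?thesis using no by simp
      qed
    qed
  next
    fix u v xs ys \<beta>s assume uv: "u \<in> secQ S" "v \<in> secQ S"
    show "\<Phi> (xs @ (u + v) # ys) \<beta>s = \<Phi> (xs @ u # ys) \<beta>s + \<Phi> (xs @ v # ys) \<beta>s"
    proof (cases "args S (xs @ u # ys) \<beta>s")
      case True
      then show ?thesis using linQ[OF True, of "length xs" u] uv by simp
    next
      case False
      then have "\<not> args S (xs @ v # ys) \<beta>s" "\<not> args S (xs @ (u + v) # ys) \<beta>s"
        using uv by (auto simp: args_def)
      then show ?thesis using no False by simp
    qed
  next
    fix u f xs ys \<beta>s assume uf: "u \<in> secQ S" "f \<in> Cinf S"
    show "\<Phi> (xs @ (f \<odot> u) # ys) \<beta>s = f \<odot> \<Phi> (xs @ u # ys) \<beta>s"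
    proof (cases "args S (xs @ u # ys) \<beta>s")
      case True
      then show ?thesis using linQ[OF True, of "length xs" u] uf by simp
    next
      case False
      then have "\<not> args S (xs @ (f \<odot> u) # ys) \<beta>s"
        using uf by (auto simp: args_def)
      then show ?thesis using no False by simp
    qed
  next
    fix u v xs ys qs assume uv: "u \<in> secBd S" "v \<in> secBd S"
    show "\<Phi> qs (xs @ (u + v) # ys) = \<Phi> qs (xs @ u # ys) + \<Phi> qs (xs @ v # ys)"
    proof (cases "args S qs (xs @ u # ys)")
      case True
      then show ?thesis using linB[OF True, of "length xs" u] uv by simp
    next
      case False
      then have "\<not> args S qs (xs @ v # ys)" "\<not> args S qs (xs @ (u + v) # ys)"
        using uv by (auto simp: args_def)
      then show ?thesis using no False by simp
    qed
  next
    fix u f xs ys qs assume uf: "u \<in> secBd S" "f \<in> Cinf S"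
    show "\<Phi> qs (xs @ (f \<odot> u) # ys) = f \<odot> \<Phi> qs (xs @ u # ys)"
    proof (cases "args S qs (xs @ u # ys)")
      case True
      then show ?thesis using linB[OF True, of "length xs" u] uf by simp
    next
      case False
      then have "\<not> args S qs (xs @ (f \<odot> u) # ys)"
        using uf by (auto simp: args_def)
      then show ?thesis using no False by simp
    qed
  qed
  moreover have "\<Phi> qs \<beta>s \<in> \<Gamma>" for qs \<beta>s
    by (cases "args S qs \<beta>s") (simp_all add: val no cmoduleD(1)[OF \<Gamma>])
  moreover have "\<exists>N. bounded_degree N \<Phi>"
  proof -
    let ?A = "(\<lambda>(p, k). p + 2 * k) ` {(length qs, length \<beta>s) | qs \<beta>s. \<Phi> qs \<beta>s \<noteq> 0}"
    have fin': "finite ?A" using fin by (rule finite_imageI)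
    have "length qs + 2 * length \<beta>s \<le> Max ?A" if "\<Phi> qs \<beta>s \<noteq> 0" for qs \<beta>s
    proof (rule Max_ge[OF fin'])
      have "(length qs, length \<beta>s) \<in> {(length qs, length \<beta>s) | qs \<beta>s. \<Phi> qs \<beta>s \<noteq> 0}"
        using that by blast
      then show "length qs + 2 * length \<beta>s \<in> ?A"
        by (rule rev_image_eqI) simp
    qed
    then show ?thesis unfolding bounded_degree_def by blast
  qed
  ultimately show "tensorial S \<Phi> \<and> (\<forall>qs \<beta>s. \<Phi> qs \<beta>s \<in> \<Gamma>) \<and> (\<exists>N. bounded_degree N \<Phi>)" by blast
next
  assume R: "tensorial S \<Phi> \<and> (\<forall>qs \<beta>s. \<Phi> qs \<beta>s \<in> \<Gamma>) \<and> (\<exists>N. bounded_degree N \<Phi>)"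
  then obtain N where N: "\<And>qs \<beta>s. \<Phi> qs \<beta>s \<noteq> 0 \<Longrightarrow> length qs + 2 * length \<beta>s \<le> N"
    by (auto simp: bounded_degree_def)
  have T: "tensorial S \<Phi>" using R by blast
  note D = tensorialD[OF T] and Q = multilinearD[OF tensorialD(1)[OF T]] and B = multilinearD[OF tensorialD(3)[OF T]]
  have "{(length qs, length \<beta>s) | qs \<beta>s. \<Phi> qs \<beta>s \<noteq> 0} \<subseteq> {..N} \<times> {..N}"
  proof (rule subsetI)
    fix x assume "x \<in> {(length qs, length \<beta>s) | qs \<beta>s. \<Phi> qs \<beta>s \<noteq> 0}"
    then obtain qs \<beta>s where "x = (length qs, length \<beta>s)" "\<Phi> qs \<beta>s \<noteq> 0" by blast
    then show "x \<in> {..N} \<times> {..N}" using N[of qs \<beta>s] by simp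
  qed
  then have fin: "finite {(length qs, length \<beta>s) | qs \<beta>s. \<Phi> qs \<beta>s \<noteq> 0}"
    by (rule finite_subset) simp
  have zero: "\<Phi> qs \<beta>s = 0" if "\<not> args S qs \<beta>s" for qs \<beta>s
    using that by (cases "set qs \<subseteq> secQ S") (simp_all add: Q(1) B(1) args_def)
  have rep: "\<Phi> qs \<beta>s = 0" if "i < j" "j < length qs" "qs ! i = qs ! j" for i j qs \<beta>s
  proof -
    \<comment> \<open>Splitting \<open>qs\<close> at position \<open>i\<close> and the rest at
      position \<open>j\<close> exhibits the two equal entries in the shape required for
      transpositions.\<close>
    define ds k where "ds = drop (Suc i) qs" and "k = j - Suc i"
    have 1: "qs = take i qs @ qs ! i # ds"
      unfolding ds_def using that by (intro id_take_nth_drop) simp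
    have 2: "ds = take k ds @ ds ! k # drop (Suc k) ds"
      using that by (intro id_take_nth_drop) (simp add: k_def ds_def)
    have 3: "ds ! k = qs ! i"
      using that by (simp add: k_def ds_def)
    have "qs = take i qs @ qs ! i # take k ds @ qs ! i # drop (Suc k) ds"
      by (rule trans[OF 1 arg_cong[OF 2[unfolded 3], of "\<lambda>l. take i qs @ qs ! i # l"]])
    then have "\<Phi> qs \<beta>s = \<Phi> (take i qs @ qs ! i # take k ds @ qs ! i # drop (Suc k) ds) \<beta>s"
      by (rule arg_cong[of _ _ "\<lambda>qs. \<Phi> qs \<beta>s"])
    also have "\<dots> = 0"
      by (rule multilinear_alternating_repeat[OF smod_secQ D(1,2)])
    finally show ?thesis .
  qed
  have sym: "\<Phi> qs \<gamma>s = \<Phi> qs \<beta>s" if "mset \<gamma>s = mset \<beta>s" for qs \<beta>s \<gamma>s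
    using symmetric_mset[OF D(4) that] .
  have addQ: "\<Phi> (qs[i := u + v]) \<beta>s = \<Phi> (qs[i := u]) \<beta>s + \<Phi> (qs[i := v]) \<beta>s"
    if "i < length qs" "u \<in> secQ S" "v \<in> secQ S" for i qs \<beta>s u v
    using that by (simp add: upd_conv_take_nth_drop Q(2))
  have scQ: "\<Phi> (qs[i := f \<odot> u]) \<beta>s = f \<odot> \<Phi> (qs[i := u]) \<beta>s"
    if "i < length qs" "u \<in> secQ S" "f \<in> Cinf S" for i qs \<beta>s u f
    using that by (simp add: upd_conv_take_nth_drop Q(3))
  have addB: "\<Phi> qs (\<beta>s[i := u + v]) = \<Phi> qs (\<beta>s[i := u]) + \<Phi> qs (\<beta>s[i := v])"
    if "i < length \<beta>s" "u \<in> secBd S" "v \<in> secBd S" for i qs \<beta>s u v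
    using that by (simp add: upd_conv_take_nth_drop B(2))
  have scB: "\<Phi> qs (\<beta>s[i := f \<odot> u]) = f \<odot> \<Phi> qs (\<beta>s[i := u])"
    if "i < length \<beta>s" "u \<in> secBd S" "f \<in> Cinf S" for i qs \<beta>s u f
    using that by (simp add: upd_conv_take_nth_drop B(3))
  have val: "\<Phi> qs \<beta>s \<in> \<Gamma>" for qs \<beta>s
    using R by blast
  show "\<Phi> \<in> forms S \<Gamma>"
    unfolding forms_def mem_Collect_eq
    by (intro conjI allI impI ballI; (elim conjE)?)
      (rule zero, assumption | rule fin | rule val | rule addQ, assumption+ | rule scQ, assumption+
        | rule addB, assumption+ | rule scB, assumption+ | rule rep, assumption+ | rule sym, assumption)+
qed

end

section \<open>Contractions and products of forms\<close>

definition iQ :: "('m \<Rightarrow> 'q) \<Rightarrow> ('m, 'q, 'b, 'e) form \<Rightarrow> ('m, 'q, 'b, 'e) form"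
  where "iQ q \<Phi> = (\<lambda>qs. \<Phi> (q # qs))"

definition iB :: "('m \<Rightarrow> 'b \<Rightarrow> real) \<Rightarrow> ('m, 'q, 'b, 'e) form \<Rightarrow> ('m, 'q, 'b, 'e) form"
  where "iB \<beta> \<Phi> = (\<lambda>qs \<beta>s. \<Phi> qs (\<beta> # \<beta>s))"

lemma form_apply:
  fixes \<Phi> \<Psi> :: "('m, 'q, 'b, 'e::real_vector) form"
  shows "(\<Phi> + \<Psi>) qs \<beta>s = \<Phi> qs \<beta>s + \<Psi> qs \<beta>s" "(0 :: ('m, 'q, 'b, 'e) form) qs \<beta>s = 0"
    "(r *\<^sub>R \<Phi>) qs \<beta>s = r *\<^sub>R \<Phi> qs \<beta>s" "(\<Phi> - \<Psi>) qs \<beta>s = \<Phi> qs \<beta>s - \<Psi> qs \<beta>s" "(- \<Phi>) qs \<beta>s = - \<Phi> qs \<beta>s"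
  by (simp_all add: fun_apply_simps scaleR_fun_def)

lemma form_sum_apply: "(\<Sum>i\<in>I. \<Phi> i) qs \<beta>s = (\<Sum>i\<in>I. \<Phi> i qs \<beta>s)"
  by (simp add: sum_fun_apply)

lemma form_eqI: "(\<And>qs \<beta>s. \<Phi> qs \<beta>s = \<Psi> qs \<beta>s) \<Longrightarrow> \<Phi> = \<Psi>"
  by (intro ext) (simp add: fun_eq_iff)

lemma form_zero_iff: "(\<Phi> :: ('m, 'q, 'b, 'e::real_vector) form) = 0 \<longleftrightarrow> (\<forall>qs \<beta>s. \<Phi> qs \<beta>s = 0)"
  by (auto intro: form_eqI simp: form_apply)

lemma wedge_apply: "(\<xi> \<cdot> \<Phi>) qs \<beta>s = shuffle (\<lambda>a b c d. \<xi> a b \<odot> \<Phi> c d) qs \<beta>s"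
  by (simp add: wedge_eq_shuffle)

lemma wedge_add_left: "(\<xi> + \<eta>) \<cdot> \<Phi> = \<xi> \<cdot> \<Phi> + \<eta> \<cdot> \<Phi>"
  by (rule form_eqI) (simp add: wedge_apply form_apply fscale_add_left shuffle_add)

lemma wedge_add_right: "\<xi> \<cdot> (\<Phi> + \<Psi>) = \<xi> \<cdot> \<Phi> + \<xi> \<cdot> \<Psi>"
  by (rule form_eqI) (simp add: wedge_apply form_apply fscale_add_right shuffle_add)

lemma wedge_scaleR_left: "(r *\<^sub>R \<xi>) \<cdot> \<Phi> = r *\<^sub>R (\<xi> \<cdot> \<Phi>)"
  by (rule form_eqI) (simp add: wedge_apply form_apply scaleR_fscale shuffle_scaleR)

lemma wedge_scaleR_right: "\<xi> \<cdot> (r *\<^sub>R \<Phi>) = r *\<^sub>R (\<xi> \<cdot> \<Phi>)"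
  by (rule form_eqI) (simp add: wedge_apply form_apply fscale_scaleR shuffle_scaleR)

lemma wedge_zero_left: "0 \<cdot> \<Phi> = 0"
  and wedge_zero_right: "\<xi> \<cdot> 0 = 0"
  by (simp_all add: form_zero_iff wedge_apply form_apply)

lemma wedge_minus_right: "\<xi> \<cdot> (- \<Phi>) = - (\<xi> \<cdot> \<Phi>)"
  using wedge_scaleR_right[of \<xi> "-1" \<Phi>] by simp

lemma wedge_minus_left: "(- \<xi>) \<cdot> \<Phi> = - (\<xi> \<cdot> \<Phi>)"
  using wedge_scaleR_left[of "-1" \<xi> \<Phi>] by simp

lemma wedge_diff_left: "(\<xi> - \<eta>) \<cdot> \<Phi> = \<xi> \<cdot> \<Phi> - \<eta> \<cdot> \<Phi>"
  using wedge_add_left[of \<xi> "- \<eta>" \<Phi>] by (simp add: wedge_minus_left)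

lemma wedge_diff_right: "\<xi> \<cdot> (\<Phi> - \<Psi>) = \<xi> \<cdot> \<Phi> - \<xi> \<cdot> \<Psi>"
  using wedge_add_right[of \<xi> \<Phi> "- \<Psi>"] by (simp add: wedge_minus_right)

lemma shuffle_hom:
  assumes "\<And>x y. L (x + y) = L x + L y" "\<And>r x. L (r *\<^sub>R x) = r *\<^sub>R L x"
  shows "L (shuffle F qs \<beta>s) = shuffle (\<lambda>a b c d. L (F a b c d)) qs \<beta>s"
  by (rule shuffle_closed_hom(2)[of UNIV]) (simp_all add: assms closed_linear_def)

text \<open>Contraction fills the first argument, so its Leibniz rule is the recursion of the
  shuffle. The new argument of the second factor has passed the arguments of \<open>\<xi>\<close>,
  hence \<open>parity\<close>.\<close>

lemma iQ_wedge: "iQ q (\<xi> \<cdot> \<Phi>) = iQ q \<xi> \<cdot> \<Phi> + parity \<xi> \<cdot> iQ q \<Phi>"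
  by (rule form_eqI) (simp add: iQ_def parity_def wedge_apply form_apply shuffle_Cons_left scaleR_fscale)

lemma iB_wedge: "iB \<beta> (\<xi> \<cdot> \<Phi>) = iB \<beta> \<xi> \<cdot> \<Phi> + \<xi> \<cdot> iB \<beta> \<Phi>"
  by (rule form_eqI) (simp add: iB_def wedge_apply form_apply shuffle_Cons_right)

lemma multilinear_Cons: "multilinear C \<Gamma> F \<Longrightarrow> multilinear C \<Gamma> (\<lambda>xs. F (x # xs))"
  unfolding multilinear_def by (metis append_Cons insert_subset list.simps(15))

lemma alternating_Cons: "alternating F \<Longrightarrow> alternating (\<lambda>xs. F (x # xs))"
  unfolding alternating_def by (metis append_Cons)

lemma symmetric_Cons: "symmetric F \<Longrightarrow> symmetric (\<lambda>xs. F (x # xs))"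
  unfolding symmetric_def by (metis append_Cons)

lemma tensorial_iQ: "tensorial S \<Phi> \<Longrightarrow> tensorial S (iQ q \<Phi>)"
  unfolding tensorial_def iQ_def
  using multilinear_Cons[of _ _ "\<lambda>qs. \<Phi> qs _"] alternating_Cons[of "\<lambda>qs. \<Phi> qs _"] by blast

lemma tensorial_iB: "tensorial S \<Phi> \<Longrightarrow> tensorial S (iB \<beta> \<Phi>)"
  unfolding tensorial_def iB_def by (simp add: multilinear_Cons symmetric_Cons)

lemma multilinear_add:
  "multilinear C \<Gamma> F \<Longrightarrow> multilinear C \<Gamma> G \<Longrightarrow> multilinear C \<Gamma> (\<lambda>xs. F xs + G xs)"
  unfolding multilinear_def by (simp add: fscale_add_right)

lemma tensorial_add: "tensorial S \<Phi> \<Longrightarrow> tensorial S \<Psi> \<Longrightarrow> tensorial S (\<lambda>qs \<beta>s. \<Phi> qs \<beta>s + \<Psi> qs \<beta>s)"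
  unfolding tensorial_def alternating_def symmetric_def by (simp add: multilinear_add)

lemma mk_form_10:
  "mk_form S (Suc 0) 0 (\<lambda>qs _. g (qs ! 0)) qs \<beta>s =
    (if \<beta>s = [] \<and> length qs = 1 \<and> hd qs \<in> secQ S then g (hd qs) else 0)"
  by (cases qs) (auto simp: mk_form_def args_def)

lemma mk_form_01:
  "mk_form S 0 (Suc 0) (\<lambda>_ \<beta>s. g (\<beta>s ! 0)) qs \<beta>s =
    (if qs = [] \<and> length \<beta>s = 1 \<and> hd \<beta>s \<in> secBd S then g (hd \<beta>s) else 0)"
  by (cases \<beta>s) (auto simp: mk_form_def args_def)

lemma genQ_apply: "genQ S \<tau> qs \<beta>s =
    (if \<beta>s = [] \<and> length qs = 1 \<and> hd qs \<in> secQ S then \<langle>\<tau>, hd qs\<rangle> else 0)"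
  unfolding genQ_def using mk_form_10[of S "\<lambda>q. \<langle>\<tau>, q\<rangle>"] by simp

lemma genB_apply: "genB S b qs \<beta>s =
    (if qs = [] \<and> length \<beta>s = 1 \<and> hd \<beta>s \<in> secBd S then \<langle>hd \<beta>s, b\<rangle> else 0)"
  unfolding genB_def using mk_form_01[of S "\<lambda>\<beta>. \<langle>\<beta>, b\<rangle>"] by simp

lemma deg0_apply: "deg0 S s qs \<beta>s = (if qs = [] \<and> \<beta>s = [] then s else 0)"
  by (auto simp: deg0_def mk_form_def args_def)

lemma deg0_wedge: "deg0 S f \<cdot> \<Phi> = (\<lambda>qs \<beta>s. f \<odot> \<Phi> qs \<beta>s)"
proof (rule form_eqI)
  fix qs \<beta>s
  have "(deg0 S f \<cdot> \<Phi>) qs \<beta>s = shuffle (\<lambda>a b c d. if a = [] \<and> b = [] then f \<odot> \<Phi> c d else 0) qs \<beta>s"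
    unfolding wedge_apply by (rule shuffle_cong) (simp add: deg0_apply)
  then show "(deg0 S f \<cdot> \<Phi>) qs \<beta>s = f \<odot> \<Phi> qs \<beta>s"
    by (simp only: shuffle_right)
qed

lemma wedge_deg0: "\<xi> \<cdot> deg0 S s = (\<lambda>qs \<beta>s. \<xi> qs \<beta>s \<odot> s)"
proof (rule form_eqI)
  fix qs \<beta>s
  have "(\<xi> \<cdot> deg0 S s) qs \<beta>s = shuffle (\<lambda>a b c d. if c = [] \<and> d = [] then \<xi> a b \<odot> s else 0) qs \<beta>s"
    unfolding wedge_apply by (rule shuffle_cong) (simp add: deg0_apply)
  then show "(\<xi> \<cdot> deg0 S s) qs \<beta>s = \<xi> qs \<beta>s \<odot> s"
    by (simp only: shuffle_left)
qed

lemma deg0_simps: "deg0 S (s + t) = deg0 S s + deg0 S t" "deg0 S 0 = 0" "deg0 S (r *\<^sub>R s) = r *\<^sub>R deg0 S s"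
  "deg0 S (f \<odot> s) = deg0 S f \<cdot> deg0 S s" "deg0 S (- s) = - deg0 S s" "deg0 S (s - t) = deg0 S s - deg0 S t"
  by (rule form_eqI, simp add: deg0_apply form_apply deg0_wedge)+

context lie_data
begin

lemma formsD:
  assumes "\<Phi> \<in> forms S \<Gamma>" "smod \<Gamma>"
  shows "tensorial S \<Phi>" "\<Phi> qs \<beta>s \<in> \<Gamma>" "\<exists>N. bounded_degree N \<Phi>"
  using assms forms_iff by blast+

lemma formsI:
  assumes "smod \<Gamma>" "tensorial S \<Phi>" "\<And>qs \<beta>s. \<Phi> qs \<beta>s \<in> \<Gamma>" "bounded_degree N \<Phi>"
  shows "\<Phi> \<in> forms S \<Gamma>"
  using assms forms_iff by blast

lemma forms_args: "\<Phi> \<in> forms S \<Gamma> \<Longrightarrow> \<not> args S qs \<beta>s \<Longrightarrow> \<Phi> qs \<beta>s = 0"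
  by (simp add: forms_def)

lemma forms_add:
  assumes \<Gamma>: "smod \<Gamma>" and "\<Phi> \<in> forms S \<Gamma>" "\<Psi> \<in> forms S \<Gamma>"
  shows "\<Phi> + \<Psi> \<in> forms S \<Gamma>"
proof -
  note D = formsD[OF assms(2) \<Gamma>] formsD[OF assms(3) \<Gamma>]
  obtain N K where NK: "bounded_degree N \<Phi>" "bounded_degree K \<Psi>" using D by blast
  have eq: "\<Phi> + \<Psi> = (\<lambda>qs \<beta>s. \<Phi> qs \<beta>s + \<Psi> qs \<beta>s)"
    by (rule form_eqI) (simp add: form_apply)
  have "bounded_degree (max N K) (\<Phi> + \<Psi>)"
    unfolding bounded_degree_def form_apply
  proof (intro allI impI)
    fix qs \<beta>s assume "\<Phi> qs \<beta>s + \<Psi> qs \<beta>s \<noteq> 0"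
    then have "\<Phi> qs \<beta>s \<noteq> 0 \<or> \<Psi> qs \<beta>s \<noteq> 0" by auto
    then show "length qs + 2 * length \<beta>s \<le> max N K"
      using NK unfolding bounded_degree_def by (meson le_max_iff_disj)
  qed
  moreover have "tensorial S (\<Phi> + \<Psi>)"
    unfolding eq by (rule tensorial_add[OF D(1) D(4)])
  ultimately show ?thesis
    by (rule formsI[OF \<Gamma>, rotated 2]) (simp add: form_apply cmoduleD(2)[OF \<Gamma>] D(2,5))
qed

lemma forms_compose:
  assumes "smod \<Gamma>" "smod \<Gamma>'" "\<Phi> \<in> forms S \<Gamma>" "L 0 = 0" "\<And>s. s \<in> \<Gamma> \<Longrightarrow> L s \<in> \<Gamma>'"
    and "\<And>s t. s \<in> \<Gamma> \<Longrightarrow> t \<in> \<Gamma> \<Longrightarrow> L (s + t) = L s + L t"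
    and "\<And>f s. f \<in> Cinf S \<Longrightarrow> s \<in> \<Gamma> \<Longrightarrow> L (f \<odot> s) = f \<odot> L s"
  shows "(\<lambda>qs \<beta>s. L (\<Phi> qs \<beta>s)) \<in> forms S \<Gamma>'"
proof -
  note D = formsD[OF assms(3,1)]
  obtain N where "bounded_degree N \<Phi>" using D(3) by blast
  then have "bounded_degree N (\<lambda>qs \<beta>s. L (\<Phi> qs \<beta>s))"
    unfolding bounded_degree_def using assms(4) by metis
  then show ?thesis
    using assms(5) D(2) by (intro formsI[OF assms(2) tensorial_compose[OF D(1,2) assms(4,6,7)]]) auto
qed

lemma forms_fscale:
  assumes "smod \<Gamma>" "\<Phi> \<in> forms S \<Gamma>" "f \<in> Cinf S"
  shows "(\<lambda>qs \<beta>s. f \<odot> \<Phi> qs \<beta>s) \<in> forms S \<Gamma>"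
  using assms
  by (intro forms_compose[OF assms(1,1,2)])
    (auto simp: cmoduleD(3) fscale_add_right fscale_fscale mult.commute)

lemma forms_scaleR:
  assumes "smod \<Gamma>" "\<Phi> \<in> forms S \<Gamma>"
  shows "r *\<^sub>R \<Phi> \<in> forms S \<Gamma>"
proof -
  have "r *\<^sub>R \<Phi> = (\<lambda>qs \<beta>s. (\<lambda>_. r) \<odot> \<Phi> qs \<beta>s)"
    by (rule form_eqI) (simp add: form_apply fscale_const)
  then show ?thesis using forms_fscale[OF assms const_smooth] by simp
qed

lemma forms_zero: "smod \<Gamma> \<Longrightarrow> 0 \<in> forms S \<Gamma>"
  by (rule formsI[of _ _ 0])
    (auto simp: tensorial_def multilinear_def alternating_def symmetric_def bounded_degree_def form_apply cmoduleD(1))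

lemma forms_sum: "smod \<Gamma> \<Longrightarrow> (\<And>i. i \<in> I \<Longrightarrow> \<Phi> i \<in> forms S \<Gamma>) \<Longrightarrow> (\<Sum>i\<in>I. \<Phi> i) \<in> forms S \<Gamma>"
  by (induction I rule: infinite_finite_induct) (auto simp: forms_zero forms_add)

lemma forms_minus: "smod \<Gamma> \<Longrightarrow> \<Phi> \<in> forms S \<Gamma> \<Longrightarrow> - \<Phi> \<in> forms S \<Gamma>"
  using forms_scaleR[of \<Gamma> \<Phi> "-1"] by simp

lemma forms_diff: "smod \<Gamma> \<Longrightarrow> \<Phi> \<in> forms S \<Gamma> \<Longrightarrow> \<Psi> \<in> forms S \<Gamma> \<Longrightarrow> \<Phi> - \<Psi> \<in> forms S \<Gamma>"
  using forms_add[of \<Gamma> \<Phi> "- \<Psi>"] forms_minus[of \<Gamma> \<Psi>] by simp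

lemma forms_iQ:
  assumes "smod \<Gamma>" "\<Phi> \<in> forms S \<Gamma>"
  shows "iQ q \<Phi> \<in> forms S \<Gamma>"
proof -
  note D = formsD[OF assms(2,1)]
  obtain N where "bounded_degree N \<Phi>" using D(3) by blast
  then have "bounded_degree N (iQ q \<Phi>)"
    unfolding bounded_degree_def iQ_def using Suc_leD by fastforce
  then show ?thesis
    by (rule formsI[OF assms(1) tensorial_iQ[OF D(1)], rotated]) (simp add: iQ_def D(2))
qed

lemma forms_iB:
  assumes "smod \<Gamma>" "\<Phi> \<in> forms S \<Gamma>"
  shows "iB \<beta> \<Phi> \<in> forms S \<Gamma>"
proof -
  note D = formsD[OF assms(2,1)]
  obtain N where N: "bounded_degree N \<Phi>" using D(3) by blast
  have "bounded_degree N (iB \<beta> \<Phi>)"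
    unfolding bounded_degree_def iB_def
  proof (intro allI impI)
    fix qs \<beta>s assume "\<Phi> qs (\<beta> # \<beta>s) \<noteq> 0"
    then have "length qs + 2 * length (\<beta> # \<beta>s) \<le> N" using N unfolding bounded_degree_def by blast
    then show "length qs + 2 * length \<beta>s \<le> N" by simp
  qed
  then show ?thesis
    by (rule formsI[OF assms(1) tensorial_iB[OF D(1)], rotated]) (simp add: iB_def D(2))
qed

lemma forms_wedge:
  assumes \<xi>: "\<xi> \<in> graded_functions S" and \<Gamma>: "smod \<Gamma>" and \<Phi>: "\<Phi> \<in> forms S \<Gamma>"
  shows "\<xi> \<cdot> \<Phi> \<in> forms S \<Gamma>"
proof -
  note X = formsD[OF \<xi>[unfolded graded_functions_def] smod_Cinf] and D = formsD[OF \<Phi> \<Gamma>]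
  obtain N K where NK: "bounded_degree N \<xi>" "bounded_degree K \<Phi>" using X(3) D(3) by blast
  have "tensorial S (shuffle (\<lambda>a b c d. \<xi> a b \<odot> \<Phi> c d))"
  proof (rule tensorial_shuffle)
    show "tensorial S (\<lambda>a b. \<xi> a b \<odot> \<Phi> c d)" for c d
      by (rule tensorial_compose[OF X(1), of UNIV]) (simp_all add: fscale_add_left fscale_real fscale_fscale)
    show "tensorial S (\<lambda>c d. \<xi> a b \<odot> \<Phi> c d)" for a b
      by (rule tensorial_compose[OF D(1), of UNIV]) (simp_all add: fscale_add_right fscale_fscale mult.commute)
  qed
  moreover have "bounded_degree (N + K) (shuffle (\<lambda>a b c d. \<xi> a b \<odot> \<Phi> c d))"
  proof (rule bounded_degree_shuffle)
    fix a b c d assume "\<xi> a b \<odot> \<Phi> c d \<noteq> 0"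
    then have "\<xi> a b \<noteq> 0" "\<Phi> c d \<noteq> 0" by auto
    then show "length a + 2 * length b \<le> N \<and> length c + 2 * length d \<le> K"
      using NK unfolding bounded_degree_def by blast
  qed
  moreover have "shuffle (\<lambda>a b c d. \<xi> a b \<odot> \<Phi> c d) qs \<beta>s \<in> \<Gamma>" for qs \<beta>s
    by (rule shuffle_closed_hom(1)[of \<Gamma> id]) (simp_all add: closed_linear_smod[OF \<Gamma>] cmoduleD(3)[OF \<Gamma>] X(2) D(2))
  ultimately show ?thesis
    unfolding wedge_eq_shuffle by (intro formsI[OF \<Gamma>])
qed

lemma forms_deg0: "smod \<Gamma> \<Longrightarrow> s \<in> \<Gamma> \<Longrightarrow> deg0 S s \<in> forms S \<Gamma>"
  by (rule formsI[of _ _ 0])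
    (auto simp: tensorial_def multilinear_def alternating_def symmetric_def bounded_degree_def deg0_apply cmoduleD(1))

lemma forms_mk_form_10:
  assumes "smod \<Gamma>" "\<And>u. u \<in> secQ S \<Longrightarrow> g u \<in> \<Gamma>"
    and "\<And>u v. u \<in> secQ S \<Longrightarrow> v \<in> secQ S \<Longrightarrow> g (u + v) = g u + g v"
    and "\<And>f u. f \<in> Cinf S \<Longrightarrow> u \<in> secQ S \<Longrightarrow> g (f \<odot> u) = f \<odot> g u"
  shows "mk_form S (Suc 0) 0 (\<lambda>qs _. g (qs ! 0)) \<in> forms S \<Gamma>"
proof (rule formsI[OF assms(1), of _ 1])
  note Q = cmoduleD[OF smod_secQ]
  have sing: "length (xs @ u # ys) = 1 \<longleftrightarrow> xs = [] \<and> ys = []" for xs ys :: "('m \<Rightarrow> 'q) list" and u by auto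
  have sing2: "length (xs @ u # v # ys) \<noteq> 1" for xs ys :: "('m \<Rightarrow> 'q) list" and u v by auto
  show "tensorial S (mk_form S (Suc 0) 0 (\<lambda>qs _. g (qs ! 0)))"
    unfolding tensorial_def multilinear_def alternating_def symmetric_def mk_form_10 sing
    using sing2 by (auto simp: assms(3,4) Q hd_append length_Suc_conv)
  show "mk_form S (Suc 0) 0 (\<lambda>qs _. g (qs ! 0)) qs \<beta>s \<in> \<Gamma>" for qs \<beta>s
    by (simp add: mk_form_10 assms(2) cmoduleD(1)[OF assms(1)])
  show "bounded_degree 1 (mk_form S (Suc 0) 0 (\<lambda>qs _. g (qs ! 0)))"
    by (simp add: bounded_degree_def mk_form_10)
qed

lemma forms_mk_form_01:
  assumes "smod \<Gamma>" "\<And>u. u \<in> secBd S \<Longrightarrow> g u \<in> \<Gamma>"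
    and "\<And>u v. u \<in> secBd S \<Longrightarrow> v \<in> secBd S \<Longrightarrow> g (u + v) = g u + g v"
    and "\<And>f u. f \<in> Cinf S \<Longrightarrow> u \<in> secBd S \<Longrightarrow> g (f \<odot> u) = f \<odot> g u"
  shows "mk_form S 0 (Suc 0) (\<lambda>_ \<beta>s. g (\<beta>s ! 0)) \<in> forms S \<Gamma>"
proof (rule formsI[OF assms(1), of _ 2])
  note B = cmoduleD[OF smod_secBd]
  have sing: "length (xs @ u # ys) = 1 \<longleftrightarrow> xs = [] \<and> ys = []" for xs ys :: "('m \<Rightarrow> 'b \<Rightarrow> real) list" and u by auto
  have sing2: "length (xs @ u # v # ys) \<noteq> 1" for xs ys :: "('m \<Rightarrow> 'b \<Rightarrow> real) list" and u v by auto
  show "tensorial S (mk_form S 0 (Suc 0) (\<lambda>_ \<beta>s. g (\<beta>s ! 0)))"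
    unfolding tensorial_def multilinear_def alternating_def symmetric_def mk_form_01 sing
    using sing2 by (auto simp: assms(3,4) B hd_append length_Suc_conv)
  show "mk_form S 0 (Suc 0) (\<lambda>_ \<beta>s. g (\<beta>s ! 0)) qs \<beta>s \<in> \<Gamma>" for qs \<beta>s
    by (simp add: mk_form_01 assms(2) cmoduleD(1)[OF assms(1)])
  show "bounded_degree 2 (mk_form S 0 (Suc 0) (\<lambda>_ \<beta>s. g (\<beta>s ! 0)))"
    by (simp add: bounded_degree_def mk_form_01)
qed

end

section \<open>Duality between modules of sections\<close>

lemma local_moduleD:
  assumes "local_module C F \<Gamma>"
  shows "cmodule C \<Gamma>" "subspace (F x)" "s \<in> \<Gamma> \<Longrightarrow> s x \<in> F x"
    and "(\<And>x. s x \<in> F x) \<Longrightarrow> (\<And>x. \<exists>f\<in>C. f x \<noteq> 0 \<and> f \<odot> s \<in> \<Gamma>) \<Longrightarrow> s \<in> \<Gamma>"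
  using assms unfolding local_module_def by (blast, blast, blast, meson)

lemma dual_pairD:
  assumes "dual_pair C F \<Gamma> F' \<Gamma>' pr"
  shows "local_module C F \<Gamma>" "local_module C F' \<Gamma>'" "local_dual_bases C F \<Gamma> F' \<Gamma>' pr"
    and "s \<in> \<Gamma> \<Longrightarrow> t \<in> \<Gamma>' \<Longrightarrow> (\<lambda>x. pr (s x) (t x)) \<in> C"
    and "v \<in> F x \<Longrightarrow> v' \<in> F x \<Longrightarrow> w \<in> F' x \<Longrightarrow> pr (v + v') w = pr v w + pr v' w"
    and "v \<in> F x \<Longrightarrow> w \<in> F' x \<Longrightarrow> pr (c *\<^sub>R v) w = c * pr v w"
    and "v \<in> F x \<Longrightarrow> w \<in> F' x \<Longrightarrow> w' \<in> F' x \<Longrightarrow> pr v (w + w') = pr v w + pr v w'"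
    and "v \<in> F x \<Longrightarrow> w \<in> F' x \<Longrightarrow> pr v (c *\<^sub>R w) = c * pr v w"
proof -
  note P = assms[unfolded dual_pair_def]
  show "local_module C F \<Gamma>" "local_module C F' \<Gamma>'" "local_dual_bases C F \<Gamma> F' \<Gamma>' pr"
    using P by simp_all
  show "s \<in> \<Gamma> \<Longrightarrow> t \<in> \<Gamma>' \<Longrightarrow> (\<lambda>x. pr (s x) (t x)) \<in> C"
    using P by blast
  note Q = P[THEN conjunct2, THEN conjunct2, THEN conjunct2, THEN conjunct1, rule_format]
  show "v \<in> F x \<Longrightarrow> v' \<in> F x \<Longrightarrow> w \<in> F' x \<Longrightarrow> pr (v + v') w = pr v w + pr v' w"
    "v \<in> F x \<Longrightarrow> w \<in> F' x \<Longrightarrow> pr (c *\<^sub>R v) w = c * pr v w"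
    "v \<in> F x \<Longrightarrow> w \<in> F' x \<Longrightarrow> w' \<in> F' x \<Longrightarrow> pr v (w + w') = pr v w + pr v w'"
    "v \<in> F x \<Longrightarrow> w \<in> F' x \<Longrightarrow> pr v (c *\<^sub>R w) = c * pr v w"
    using Q[of w x v] by simp_all
qed

lemma dual_basesD:
  assumes "dual_bases F \<Gamma> F' \<Gamma>' pr f n e e'"
  shows "i < n \<Longrightarrow> e i \<in> \<Gamma>" "i < n \<Longrightarrow> e' i \<in> \<Gamma>'"
    and "v \<in> F y \<Longrightarrow> f y *\<^sub>R v = (\<Sum>i<n. pr v (e' i y) *\<^sub>R e i y)"
    and "w \<in> F' y \<Longrightarrow> f y *\<^sub>R w = (\<Sum>i<n. pr (e i y) w *\<^sub>R e' i y)"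
  using assms by (simp_all add: dual_bases_def)

lemma dual_pair_bases:
  assumes "dual_pair C F \<Gamma> F' \<Gamma>' pr"
  obtains f n e e' where "f \<in> C" "f x \<noteq> 0" "dual_bases F \<Gamma> F' \<Gamma>' pr f n e e'"
  using dual_pairD(3)[OF assms] unfolding local_dual_bases_def by blast

lemma dual_bases_expand:
  assumes "dual_pair C F \<Gamma> F' \<Gamma>' pr" "dual_bases F \<Gamma> F' \<Gamma>' pr f n e e'"
  shows "s \<in> \<Gamma> \<Longrightarrow> f \<odot> s = (\<Sum>i<n. (\<lambda>y. pr (s y) (e' i y)) \<odot> e i)"
    and "t \<in> \<Gamma>' \<Longrightarrow> f \<odot> t = (\<Sum>i<n. (\<lambda>y. pr (e i y) (t y)) \<odot> e' i)"
  using local_moduleD(3)[OF dual_pairD(1)[OF assms(1)]] local_moduleD(3)[OF dual_pairD(2)[OF assms(1)]]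
    dual_basesD(3,4)[OF assms(2)]
  by (simp_all add: fun_eq_iff fscale_def sum_fun_apply)

lemma dual_pair_separation:
  assumes P: "dual_pair C F \<Gamma> F' \<Gamma>' pr" and "v \<in> F x" "w \<in> F x"
    and eq: "\<And>t. t \<in> \<Gamma>' \<Longrightarrow> pr v (t x) = pr w (t x)"
  shows "v = w"
proof -
  obtain f n e e' where f: "f \<in> C" "f x \<noteq> 0" "dual_bases F \<Gamma> F' \<Gamma>' pr f n e e'"
    using dual_pair_bases[OF P] by blast
  have "f x *\<^sub>R v = f x *\<^sub>R w"
    using dual_basesD(3)[OF f(3) assms(2)] dual_basesD(3)[OF f(3) assms(3)]
      eq[OF dual_basesD(2)[OF f(3)]] by simp
  then show ?thesis using f(2) by simp
qed

lemma dual_pair_eqI: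
  assumes P: "dual_pair C F \<Gamma> F' \<Gamma>' pr" and "s \<in> \<Gamma>" "s' \<in> \<Gamma>"
    and eq: "\<And>t. t \<in> \<Gamma>' \<Longrightarrow> (\<lambda>x. pr (s x) (t x)) = (\<lambda>x. pr (s' x) (t x))"
  shows "s = s'"
proof
  fix x
  show "s x = s' x"
    by (rule dual_pair_separation[OF P, where x=x])
      (use assms(2,3) local_moduleD(3)[OF dual_pairD(1)[OF P]] fun_cong[OF eq] in simp_all)
qed

lemma dual_pair_sum:
  assumes P: "dual_pair C F \<Gamma> F' \<Gamma>' pr" and "w \<in> F' x" "\<And>i. i \<in> I \<Longrightarrow> v i \<in> F x"
  shows "pr (\<Sum>i\<in>I. c i *\<^sub>R v i) w = (\<Sum>i\<in>I. c i * pr (v i) w)"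
  using assms(3)
proof (induction I rule: infinite_finite_induct)
  note sub = local_moduleD(2)[OF dual_pairD(1)[OF P], of x]
  have zero: "pr 0 w = 0"
    using dual_pairD(6)[OF P subspace_0[OF sub] assms(2), of 0] by simp
  {
    case (infinite I)
    then show ?case by (simp add: zero)
  next
    case empty
    then show ?case by (simp add: zero)
  next
    case (insert i I)
    have "c i *\<^sub>R v i \<in> F x" "(\<Sum>i\<in>I. c i *\<^sub>R v i) \<in> F x"
      using insert.prems sub by (auto intro: subspace_scale subspace_sum)
    then show ?case
      using insert dual_pairD(5)[OF P _ _ assms(2)] dual_pairD(6)[OF P _ assms(2)] by simp
  }
qed

text \<open>A functional that is linear over the functions is given pointwise: near a point with
  dual bases the representing section is the sum of the \<open>L (e' i) \<odot> e i\<close>, divided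
  by \<open>f\<close>. Its value at a point is determined by the pairings with all sections, so the
  choice of dual bases does not matter.\<close>

lemma dual_pair_representation:
  assumes P: "dual_pair C F \<Gamma> F' \<Gamma>' pr"
    and L: "\<And>t. t \<in> \<Gamma>' \<Longrightarrow> L t \<in> C"
    and add: "\<And>t t'. t \<in> \<Gamma>' \<Longrightarrow> t' \<in> \<Gamma>' \<Longrightarrow> L (t + t') = L t + L t'"
    and scale: "\<And>f t. f \<in> C \<Longrightarrow> t \<in> \<Gamma>' \<Longrightarrow> L (f \<odot> t) = f * L t"
  obtains s where "s \<in> \<Gamma>" "\<And>t. t \<in> \<Gamma>' \<Longrightarrow> (\<lambda>x. pr (s x) (t x)) = L t"
proof -
  note P1 = local_moduleD[OF dual_pairD(1)[OF P]] and P2 = local_moduleD[OF dual_pairD(2)[OF P]]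
  have "L (0 + 0) = L 0 + L 0"
    by (rule add[OF cmoduleD(1)[OF P2(1)] cmoduleD(1)[OF P2(1)]])
  then have zero: "L 0 = 0" by simp
  have sum: "L (\<Sum>i<n. g i \<odot> u i) = (\<Sum>i<n. g i * L (u i)) \<and> (\<Sum>i<n. g i \<odot> u i) \<in> \<Gamma>'"
    if "\<And>i. i < n \<Longrightarrow> g i \<in> C" "\<And>i. i < n \<Longrightarrow> u i \<in> \<Gamma>'" for n :: nat and g u
    using that
  proof (induction n)
    case 0
    then show ?case by (simp add: zero cmoduleD(1)[OF P2(1)])
  next
    case (Suc n)
    then show ?case
      by (simp add: add scale cmoduleD(2,3)[OF P2(1)])
  qed
  \<comment> \<open>Dual bases are chosen separately for every point, so smoothness cannot be read
    off from this definition.\<close>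
  define B where "B x = (SOME (f, n, e, e'). f \<in> C \<and> f x \<noteq> 0 \<and> dual_bases F \<Gamma> F' \<Gamma>' pr f n e e')" for x
  define s where "s x = (case B x of (f, n, e, e') \<Rightarrow> inverse (f x) *\<^sub>R (\<Sum>i<n. L (e' i) x *\<^sub>R e i x))" for x
  have loc: "\<exists>f n e e'. f \<in> C \<and> f x \<noteq> 0 \<and> dual_bases F \<Gamma> F' \<Gamma>' pr f n e e' \<and>
      s x = inverse (f x) *\<^sub>R (\<Sum>i<n. L (e' i) x *\<^sub>R e i x)" for x
  proof -
    obtain f n e e' where "f \<in> C" "f x \<noteq> 0" "dual_bases F \<Gamma> F' \<Gamma>' pr f n e e'"
      using dual_pair_bases[OF P] by blast
    then have "\<exists>b. case b of (f, n, e, e') \<Rightarrow> f \<in> C \<and> f x \<noteq> 0 \<and> dual_bases F \<Gamma> F' \<Gamma>' pr f n e e'"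
      by (intro exI[of _ "(f, n, e, e')"]) simp
    then have B: "case B x of (f, n, e, e') \<Rightarrow> f \<in> C \<and> f x \<noteq> 0 \<and> dual_bases F \<Gamma> F' \<Gamma>' pr f n e e'"
      unfolding B_def by (rule someI_ex)
    obtain g m a a' where "B x = (g, m, a, a')" by (cases "B x")
    then show ?thesis
      using B by (intro exI[of _ g] exI[of _ m] exI[of _ a] exI[of _ a']) (simp add: s_def)
  qed
  have fib: "(\<Sum>i<n. c i *\<^sub>R e i x) \<in> F x" if "dual_bases F \<Gamma> F' \<Gamma>' pr f n e e'" for f n e e' c x
    using dual_basesD(1)[OF that] by (intro subspace_sum subspace_scale P1(2,3)) simp
  have pair: "pr (\<Sum>i<n. L (e' i) x *\<^sub>R e i x) (t x) = f x * L t x"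
    if b: "dual_bases F \<Gamma> F' \<Gamma>' pr f n e e'" and f: "f \<in> C" and t: "t \<in> \<Gamma>'" for f n e e' t x
  proof -
    have "f * L t = L (f \<odot> t)" using scale[OF f t] by simp
    also have "\<dots> = L (\<Sum>i<n. (\<lambda>y. pr (e i y) (t y)) \<odot> e' i)"
      using dual_bases_expand(2)[OF P b t] by simp
    also have "\<dots> = (\<Sum>i<n. (\<lambda>y. pr (e i y) (t y)) * L (e' i))"
      using sum[of n "\<lambda>i y. pr (e i y) (t y)" e'] dual_basesD(1,2)[OF b] dual_pairD(4)[OF P _ t] by simp
    finally have "f x * L t x = (\<Sum>i<n. pr (e i x) (t x) * L (e' i) x)"
      by (simp add: fun_eq_iff sum_fun_apply times_fun_apply)
    moreover have "pr (\<Sum>i<n. L (e' i) x *\<^sub>R e i x) (t x) = (\<Sum>i<n. L (e' i) x * pr (e i x) (t x))"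
      by (rule dual_pair_sum[OF P]) (use dual_basesD(1)[OF b] P1(3) P2(3) t in auto)
    ultimately show ?thesis by (simp add: mult.commute)
  qed
  have s_fib: "s x \<in> F x" for x
  proof -
    obtain f n e e' where b: "dual_bases F \<Gamma> F' \<Gamma>' pr f n e e'"
      and s: "s x = inverse (f x) *\<^sub>R (\<Sum>i<n. L (e' i) x *\<^sub>R e i x)"
      using loc by blast
    show ?thesis unfolding s by (intro subspace_scale[OF P1(2)] fib[OF b])
  qed
  have s_pair: "pr (s x) (t x) = L t x" if t: "t \<in> \<Gamma>'" for x t
  proof -
    obtain f n e e' where f: "f \<in> C" "f x \<noteq> 0" "dual_bases F \<Gamma> F' \<Gamma>' pr f n e e'"
      and s: "s x = inverse (f x) *\<^sub>R (\<Sum>i<n. L (e' i) x *\<^sub>R e i x)"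
      using loc by blast
    show ?thesis
      using dual_pairD(6)[OF P fib[OF f(3)] P2(3)[OF t]] pair[OF f(3,1) t] f(2) s by simp
  qed
  have "s \<in> \<Gamma>"
  proof (rule P1(4)[OF s_fib])
    fix x
    obtain f n e e' where f: "f \<in> C" "f x \<noteq> 0" "dual_bases F \<Gamma> F' \<Gamma>' pr f n e e'"
      using dual_pair_bases[OF P] by blast
    \<comment> \<open>Both sides have the same pairings at every point \<open>y\<close>. Thus a
      single choice of dual bases describes \<open>f \<odot> s\<close> everywhere, and the
      right-hand side is visibly a section.\<close>
    have "f \<odot> s = (\<Sum>i<n. L (e' i) \<odot> e i)"
    proof
      fix y
      have "pr (f y *\<^sub>R s y) (t y) = f y * L t y" if t: "t \<in> \<Gamma>'" for t
        using dual_pairD(6)[OF P s_fib P2(3)[OF t]] s_pair[OF t] by simp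
      then have "f y *\<^sub>R s y = (\<Sum>i<n. L (e' i) y *\<^sub>R e i y)"
        using pair[OF f(3,1)]
        by (intro dual_pair_separation[OF P subspace_scale[OF P1(2) s_fib] fib[OF f(3)]]) simp
      then show "(f \<odot> s) y = (\<Sum>i<n. L (e' i) \<odot> e i) y"
        by (simp add: fscale_def sum_fun_apply)
    qed
    moreover have "(\<Sum>i<n. L (e' i) \<odot> e i) \<in> \<Gamma>"
      using dual_basesD(1,2)[OF f(3)] by (intro cmodule_sum[OF P1(1)] cmoduleD(3)[OF P1(1)] L) auto
    ultimately show "\<exists>f\<in>C. f x \<noteq> 0 \<and> f \<odot> s \<in> \<Gamma>"
      using f(1,2) by auto
  qed
  then show ?thesis
    using that s_pair by blast
qed

section \<open>Local generation of forms\<close>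

definition restrict_degree :: "(nat \<Rightarrow> nat \<Rightarrow> bool) \<Rightarrow> ('m, 'q, 'b, 'e::zero) form \<Rightarrow> ('m, 'q, 'b, 'e) form"
  where "restrict_degree R \<Phi> = (\<lambda>qs \<beta>s. if R (length qs) (length \<beta>s) then \<Phi> qs \<beta>s else 0)"

definition bihomogeneous :: "nat \<Rightarrow> nat \<Rightarrow> ('m, 'q, 'b, 'e::zero) form \<Rightarrow> bool" where
  "bihomogeneous p k \<Phi> \<longleftrightarrow> (\<forall>qs \<beta>s. \<Phi> qs \<beta>s \<noteq> 0 \<longrightarrow> length qs = p \<and> length \<beta>s = k)"

context lie_data
begin

lemma forms_restrict_degree:
  assumes "smod \<Gamma>" "\<Phi> \<in> forms S \<Gamma>"
  shows "restrict_degree R \<Phi> \<in> forms S \<Gamma>"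
proof -
  note D = formsD[OF assms(2,1)]
  obtain N where "bounded_degree N \<Phi>" using D(3) by blast
  then have "bounded_degree N (restrict_degree R \<Phi>)"
    by (simp add: bounded_degree_def restrict_degree_def)
  moreover have "tensorial S (restrict_degree R \<Phi>)"
    using D(1) unfolding tensorial_def multilinear_def alternating_def symmetric_def restrict_degree_def
    by simp
  ultimately show ?thesis
    by (intro formsI[OF assms(1)]) (auto simp: restrict_degree_def D(2) cmoduleD(1)[OF assms(1)])
qed

lemma pairing_smoothQ: "\<tau> \<in> secQd S \<Longrightarrow> q \<in> secQ S \<Longrightarrow> \<langle>\<tau>, q\<rangle> \<in> Cinf S"
  and pairing_smoothB: "\<beta> \<in> secBd S \<Longrightarrow> b \<in> secB S \<Longrightarrow> \<langle>\<beta>, b\<rangle> \<in> Cinf S"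
  using dual_pairD(4)[OF dual_pairQ, of q \<tau>] dual_pairD(4)[OF dual_pairB, of b \<beta>] by (simp_all add: pairing_def)

lemma pairing_addQ: "\<tau> \<in> secQd S \<Longrightarrow> q \<in> secQ S \<Longrightarrow> q' \<in> secQ S \<Longrightarrow> \<langle>\<tau>, q + q'\<rangle> = \<langle>\<tau>, q\<rangle> + \<langle>\<tau>, q'\<rangle>"
  and pairing_scaleQ: "\<tau> \<in> secQd S \<Longrightarrow> q \<in> secQ S \<Longrightarrow> \<langle>\<tau>, f \<odot> q\<rangle> = f \<odot> \<langle>\<tau>, q\<rangle>"
  and pairing_addB: "\<beta> \<in> secBd S \<Longrightarrow> b \<in> secB S \<Longrightarrow> b' \<in> secB S \<Longrightarrow> \<langle>\<beta>, b + b'\<rangle> = \<langle>\<beta>, b\<rangle> + \<langle>\<beta>, b'\<rangle>"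
  and pairing_scaleB: "\<beta> \<in> secBd S \<Longrightarrow> b \<in> secB S \<Longrightarrow> \<langle>\<beta>, f \<odot> b\<rangle> = f \<odot> \<langle>\<beta>, b\<rangle>"
  using sections_fibre[of \<tau> "base S" "dual_bundle (bunQ S)"] sections_fibre[of q "base S" "bunQ S"]
    sections_fibre[of q' "base S" "bunQ S"] sections_fibre[of \<beta> "base S" "dual_bundle (bunB S)"]
    sections_fibre[of b "base S" "bunB S"] sections_fibre[of b' "base S" "bunB S"]
  by (simp_all add: pairing_def fun_eq_iff fun_apply_simps fscale_def fibre_dual_bundle dual_fibre_def)

lemma pairing_add_left: "\<langle>\<tau> + \<tau>', q\<rangle> = \<langle>\<tau>, q\<rangle> + \<langle>\<tau>', q\<rangle>"
  and pairing_scale_left: "\<langle>f \<odot> \<tau>, q\<rangle> = f \<odot> \<langle>\<tau>, q\<rangle>"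
  by (simp_all add: pairing_def fun_eq_iff fun_apply_simps fscale_def scaleR_fun_def)

lemma forms_genQ:
  assumes "\<tau> \<in> secQd S"
  shows "genQ S \<tau> \<in> graded_functions S"
  using forms_mk_form_10[OF smod_Cinf, of "\<lambda>q. \<langle>\<tau>, q\<rangle>"] assms
  by (simp add: genQ_def graded_functions_def pairing_smoothQ pairing_addQ pairing_scaleQ)

lemma forms_genB:
  assumes "b \<in> secB S"
  shows "genB S b \<in> graded_functions S"
  using forms_mk_form_01[OF smod_Cinf, of "\<lambda>\<beta>. \<langle>\<beta>, b\<rangle>"] assms
  by (simp add: genB_def graded_functions_def pairing_smoothB pairing_add_left pairing_scale_left)

text \<open>The sum over the dual bases of \<open>\<langle>e' i, u\<rangle> \<odot> e i\<close> is
  \<open>f \<odot> u\<close>. Multilinearity thus turns the sum over \<open>i\<close> into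
  extracting an argument \<open>u\<close> and putting it back in front, times \<open>f\<close>, and
  \<open>alternating_euler\<close> applies.\<close>

lemma eulerQ:
  assumes \<Gamma>: "smod \<Gamma>" and \<Phi>: "\<Phi> \<in> forms S \<Gamma>"
    and b: "dual_bases (fibre (bunQ S)) (secQ S) (fibre (dual_bundle (bunQ S))) (secQd S) (\<lambda>v \<phi>. \<phi> v) f n e e'"
    and f: "f \<in> Cinf S"
  shows "(\<Sum>i<n. genQ S (e' i) \<cdot> iQ (e i) \<Phi>) = (\<lambda>qs \<beta>s. real (length qs) *\<^sub>R (f \<odot> \<Phi> qs \<beta>s))"
proof (rule form_eqI)
  fix qs \<beta>s
  note T = tensorialD[OF formsD(1)[OF \<Phi> \<Gamma>]]
  note exp = dual_bases_expand(1)[OF dual_pairQ b]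
  have pr: "\<langle>e' i, u\<rangle> \<in> Cinf S" if "i < n" "u \<in> secQ S" for i u
    using dual_pairD(4)[OF dual_pairQ that(2) dual_basesD(2)[OF b that(1)]] by (simp add: pairing_def)
  have inner: "(\<Sum>i<n. genQ S (e' i) a b \<odot> \<Phi> (e i # c) d) =
      (if a = [] \<and> b = [] then 0 else if b = [] then (if length a = 1 then f \<odot> \<Phi> (hd a # c) d else 0) else 0)" for a b c d
  proof (cases "b = [] \<and> length a = 1")
    case True
    then obtain u where a: "a = [u]" by (cases a) auto
    show ?thesis
    proof (cases "u \<in> secQ S")
      case u: True
      have "(\<Sum>i<n. \<langle>e' i, u\<rangle> \<odot> \<Phi> (e i # c) d) = \<Phi> ([] @ (\<Sum>i<n. \<langle>e' i, u\<rangle> \<odot> e i) # c) d"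
        by (subst multilinear_sum[OF smod_secQ T(1)]) (auto simp: pr u dual_basesD(1)[OF b])
      also have "(\<Sum>i<n. \<langle>e' i, u\<rangle> \<odot> e i) = f \<odot> u"
        using exp[OF u] by (simp add: pairing_def)
      also have "\<Phi> ([] @ (f \<odot> u) # c) d = f \<odot> \<Phi> ([] @ u # c) d"
        by (rule multilinearD(3)[OF T(1) u f])
      finally show ?thesis using True a u by (simp add: genQ_apply)
    next
      case False
      then have "\<Phi> (u # c) d = 0" using multilinearD(1)[OF T(1), of "u # c" d] by simp
      then show ?thesis using True a False by (simp add: genQ_apply)
    qed
  next
    case False
    then show ?thesis by (auto simp: genQ_apply)
  qed
  have inner': "(\<Sum>i<n. genQ S (e' i) a b \<odot> \<Phi> (e i # c) d) =
      (if b = [] then (if length a = 1 then f \<odot> \<Phi> (hd a # c) d else 0) else 0)" for a b c d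
    using inner[of a b c d] by (cases a) auto
  have "(\<Sum>i<n. genQ S (e' i) \<cdot> iQ (e i) \<Phi>) qs \<beta>s =
      shuffle (\<lambda>a b c d. \<Sum>i<n. genQ S (e' i) a b \<odot> \<Phi> (e i # c) d) qs \<beta>s"
    by (simp add: form_sum_apply wedge_apply iQ_def shuffle_sum)
  also have "\<dots> = alt_shuffle (\<lambda>a c. if length a = 1 then f \<odot> \<Phi> (hd a # c) \<beta>s else 0) qs"
    unfolding inner' shuffle_def sym_shuffle_right ..
  also have "\<dots> = real (length qs) *\<^sub>R (f \<odot> \<Phi> qs \<beta>s)"
  proof (rule alternating_euler)
    show "f \<odot> \<Phi> (xs @ p # q # ys) \<beta>s = - (f \<odot> \<Phi> (xs @ q # p # ys) \<beta>s)" for xs p q ys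
      using multilinear_alternating_swap[OF smod_secQ T(1,2), of xs p q ys \<beta>s] fscale_scaleR[of f "-1"] by simp
  qed
  finally show "(\<Sum>i<n. genQ S (e' i) \<cdot> iQ (e i) \<Phi>) qs \<beta>s = real (length qs) *\<^sub>R (f \<odot> \<Phi> qs \<beta>s)" .
qed

lemma eulerB:
  assumes \<Gamma>: "smod \<Gamma>" and \<Phi>: "\<Phi> \<in> forms S \<Gamma>"
    and b: "dual_bases (fibre (bunB S)) (secB S) (fibre (dual_bundle (bunB S))) (secBd S) (\<lambda>v \<phi>. \<phi> v) f n e e'"
    and f: "f \<in> Cinf S"
  shows "(\<Sum>i<n. genB S (e i) \<cdot> iB (e' i) \<Phi>) = (\<lambda>qs \<beta>s. real (length \<beta>s) *\<^sub>R (f \<odot> \<Phi> qs \<beta>s))"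
proof (rule form_eqI)
  fix qs \<beta>s
  note T = tensorialD[OF formsD(1)[OF \<Phi> \<Gamma>]]
  note exp = dual_bases_expand(2)[OF dual_pairB b]
  have pr: "\<langle>u, e i\<rangle> \<in> Cinf S" if "i < n" "u \<in> secBd S" for i u
    using dual_pairD(4)[OF dual_pairB dual_basesD(1)[OF b that(1)] that(2)] by (simp add: pairing_def)
  have inner: "(\<Sum>i<n. genB S (e i) a b \<odot> \<Phi> c (e' i # d)) =
      (if a = [] then (if length b = 1 then f \<odot> \<Phi> c (hd b # d) else 0) else 0)" for a b c d
  proof (cases "a = [] \<and> length b = 1")
    case True
    then obtain u where a: "b = [u]" by (cases b) auto
    show ?thesis
    proof (cases "u \<in> secBd S")
      case u: True
      have "(\<Sum>i<n. \<langle>u, e i\<rangle> \<odot> \<Phi> c (e' i # d)) = \<Phi> c ([] @ (\<Sum>i<n. \<langle>u, e i\<rangle> \<odot> e' i) # d)"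
        by (subst multilinear_sum[OF smod_secBd T(3)]) (auto simp: pr u dual_basesD(2)[OF b])
      also have "(\<Sum>i<n. \<langle>u, e i\<rangle> \<odot> e' i) = f \<odot> u"
        using exp[OF u] by (simp add: pairing_def)
      also have "\<Phi> c ([] @ (f \<odot> u) # d) = f \<odot> \<Phi> c ([] @ u # d)"
        by (rule multilinearD(3)[OF T(3) u f])
      finally show ?thesis using True a u by (simp add: genB_apply)
    next
      case False
      then have "\<Phi> c (u # d) = 0" using multilinearD(1)[OF T(3), of "u # d" c] by simp
      then show ?thesis using True a False by (simp add: genB_apply)
    qed
  next
    case False
    then show ?thesis by (auto simp: genB_apply)
  qed
  have "(\<Sum>i<n. genB S (e i) \<cdot> iB (e' i) \<Phi>) qs \<beta>s =
      shuffle (\<lambda>a b c d. \<Sum>i<n. genB S (e i) a b \<odot> \<Phi> c (e' i # d)) qs \<beta>s"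
    by (simp add: form_sum_apply wedge_apply iB_def shuffle_sum)
  also have "\<dots> = sym_shuffle (\<lambda>b d. alt_shuffle (\<lambda>a c. if a = [] then (if length b = 1 then f \<odot> \<Phi> c (hd b # d) else 0) else 0) qs) \<beta>s"
    unfolding inner shuffle_def alt_shuffle_sym_shuffle_commute ..
  also have "\<dots> = sym_shuffle (\<lambda>b d. if length b = 1 then f \<odot> \<Phi> qs (hd b # d) else 0) \<beta>s"
    unfolding alt_shuffle_right ..
  also have "\<dots> = real (length \<beta>s) *\<^sub>R (f \<odot> \<Phi> qs \<beta>s)"
  proof (rule symmetric_euler)
    show "symmetric (\<lambda>\<beta>s. f \<odot> \<Phi> qs \<beta>s)"
      using T(4)[of qs] by (simp add: symmetric_def)
  qed
  finally show "(\<Sum>i<n. genB S (e i) \<cdot> iB (e' i) \<Phi>) qs \<beta>s = real (length \<beta>s) *\<^sub>R (f \<odot> \<Phi> qs \<beta>s)" .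
qed

text \<open>By Euler's formula every form is locally built from sections of the coefficient module and the
  generators of degrees 1 and 2. No local frame of the coefficient module is needed.\<close>

lemma forms_induct [consumes 2, case_names add deg0 genQ genB local]:
  assumes \<Gamma>: "smod \<Gamma>" and "\<Phi> \<in> forms S \<Gamma>"
    and add: "\<And>\<Phi> \<Psi>. \<Phi> \<in> forms S \<Gamma> \<Longrightarrow> \<Psi> \<in> forms S \<Gamma> \<Longrightarrow> P \<Phi> \<Longrightarrow> P \<Psi> \<Longrightarrow> P (\<Phi> + \<Psi>)"
    and deg0: "\<And>s. s \<in> \<Gamma> \<Longrightarrow> P (deg0 S s)"
    and genQ: "\<And>\<tau> \<Phi>. \<tau> \<in> secQd S \<Longrightarrow> \<Phi> \<in> forms S \<Gamma> \<Longrightarrow> P \<Phi> \<Longrightarrow> P (genQ S \<tau> \<cdot> \<Phi>)"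
    and genB: "\<And>b \<Phi>. b \<in> secB S \<Longrightarrow> \<Phi> \<in> forms S \<Gamma> \<Longrightarrow> P \<Phi> \<Longrightarrow> P (genB S b \<cdot> \<Phi>)"
    and local: "\<And>\<Phi>. \<Phi> \<in> forms S \<Gamma> \<Longrightarrow> (\<And>x. \<exists>f\<in>Cinf S. f x \<noteq> 0 \<and> P (deg0 S f \<cdot> \<Phi>)) \<Longrightarrow> P \<Phi>"
  shows "P \<Phi>"
proof -
  have zero: "P 0"
    using deg0[OF cmoduleD(1)[OF \<Gamma>]] by (simp add: deg0_simps)
  have sum: "P (\<Sum>i\<in>I. \<Phi> i)" if "\<And>i. i \<in> I \<Longrightarrow> \<Phi> i \<in> forms S \<Gamma> \<and> P (\<Phi> i)" for I :: "'i set" and \<Phi>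
    using that
  proof (induction I rule: infinite_finite_induct)
    case (insert i I)
    then have "(\<Sum>i\<in>I. \<Phi> i) \<in> forms S \<Gamma>" by (intro forms_sum[OF \<Gamma>]) blast
    then show ?case using insert by (simp add: add)
  qed (simp_all add: zero)
  \<comment> \<open>Contraction lowers the bidegree, first in \<open>Q\<close> and, when no such
    arguments are left, in \<open>B\<close>. Since Euler's formula only recovers \<open>f\<close>
    times the form, every step ends with the local case.\<close>
  have bi: "P \<Phi>" if "\<Phi> \<in> forms S \<Gamma>" "bihomogeneous p k \<Phi>" for p k \<Phi>
    using that
  proof (induction p arbitrary: \<Phi>)
    case 0
    then show ?case
    proof (induction k arbitrary: \<Phi>)
      case 0
      have "\<Phi> = deg0 S (\<Phi> [] [])"
        using 0(2) by (intro form_eqI) (auto simp: deg0_apply bihomogeneous_def)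
      then show ?case using deg0 formsD(2)[OF 0(1) \<Gamma>] by metis
    next
      case (Suc k)
      show ?case
      proof (rule local[OF Suc.prems(1)])
        fix x
        obtain f n e e' where f: "f \<in> Cinf S" "f x \<noteq> 0" and b: "dual_bases (fibre (bunB S)) (secB S)
            (fibre (dual_bundle (bunB S))) (secBd S) (\<lambda>v \<phi>. \<phi> v) f n e e'"
          using dual_pair_bases[OF dual_pairB] by blast
        \<comment> \<open>The factor cancels the number of arguments that Euler's formula produces;
          the factor \<open>1 / real (Suc p)\<close> below does the same.\<close>
        define \<Psi> where "\<Psi> i = (1 / real (Suc k)) *\<^sub>R iB (e' i) \<Phi>" for i
        have \<Psi>: "\<Psi> i \<in> forms S \<Gamma>" for i
          unfolding \<Psi>_def by (intro forms_scaleR forms_iB \<Gamma> Suc.prems(1))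
        have "bihomogeneous 0 k (\<Psi> i)" for i
          using Suc.prems(2) by (fastforce simp: bihomogeneous_def \<Psi>_def form_apply iB_def)
        then have "P (\<Psi> i)" for i
          by (rule Suc.IH[OF \<Psi>])
        then have "P (\<Sum>i<n. genB S (e i) \<cdot> \<Psi> i)"
          using dual_basesD(1)[OF b] \<Psi> by (intro sum) (auto intro!: genB forms_wedge[OF _ \<Gamma>] forms_genB)
        also have "(\<Sum>i<n. genB S (e i) \<cdot> \<Psi> i) = (1 / real (Suc k)) *\<^sub>R (\<Sum>i<n. genB S (e i) \<cdot> iB (e' i) \<Phi>)"
          by (simp add: \<Psi>_def wedge_scaleR_right scaleR_sum_right)
        also have "\<dots> = deg0 S f \<cdot> \<Phi>"
          unfolding eulerB[OF \<Gamma> Suc.prems(1) b f(1)] deg0_wedge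
        proof (rule form_eqI, unfold form_apply)
          fix qs \<beta>s
          show "(1 / real (Suc k)) *\<^sub>R real (length \<beta>s) *\<^sub>R (f \<odot> \<Phi> qs \<beta>s) = f \<odot> \<Phi> qs \<beta>s"
            using Suc.prems(2) by (cases "\<Phi> qs \<beta>s = 0") (simp_all add: bihomogeneous_def)
        qed
        finally show "\<exists>f\<in>Cinf S. f x \<noteq> 0 \<and> P (deg0 S f \<cdot> \<Phi>)"
          using f by blast
      qed
    qed
  next
    case (Suc p)
    show ?case
    proof (rule local[OF Suc.prems(1)])
      fix x
      obtain f n e e' where f: "f \<in> Cinf S" "f x \<noteq> 0" and b: "dual_bases (fibre (bunQ S)) (secQ S)
          (fibre (dual_bundle (bunQ S))) (secQd S) (\<lambda>v \<phi>. \<phi> v) f n e e'"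
        using dual_pair_bases[OF dual_pairQ] by blast
      define \<Psi> where "\<Psi> i = (1 / real (Suc p)) *\<^sub>R iQ (e i) \<Phi>" for i
      have \<Psi>: "\<Psi> i \<in> forms S \<Gamma>" for i
        unfolding \<Psi>_def by (intro forms_scaleR forms_iQ \<Gamma> Suc.prems(1))
      have "bihomogeneous p k (\<Psi> i)" for i
        using Suc.prems(2) by (fastforce simp: bihomogeneous_def \<Psi>_def form_apply iQ_def)
      then have "P (\<Psi> i)" for i
        by (rule Suc.IH[OF \<Psi>])
      then have "P (\<Sum>i<n. genQ S (e' i) \<cdot> \<Psi> i)"
        using dual_basesD(2)[OF b] \<Psi> by (intro sum) (auto intro!: genQ forms_wedge[OF _ \<Gamma>] forms_genQ)
      also have "(\<Sum>i<n. genQ S (e' i) \<cdot> \<Psi> i) = (1 / real (Suc p)) *\<^sub>R (\<Sum>i<n. genQ S (e' i) \<cdot> iQ (e i) \<Phi>)"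
        by (simp add: \<Psi>_def wedge_scaleR_right scaleR_sum_right)
      also have "\<dots> = deg0 S f \<cdot> \<Phi>"
        unfolding eulerQ[OF \<Gamma> Suc.prems(1) b f(1)] deg0_wedge
      proof (rule form_eqI, unfold form_apply)
        fix qs \<beta>s
        show "(1 / real (Suc p)) *\<^sub>R real (length qs) *\<^sub>R (f \<odot> \<Phi> qs \<beta>s) = f \<odot> \<Phi> qs \<beta>s"
          using Suc.prems(2) by (cases "\<Phi> qs \<beta>s = 0") (simp_all add: bihomogeneous_def)
      qed
      finally show "\<exists>f\<in>Cinf S. f x \<noteq> 0 \<and> P (deg0 S f \<cdot> \<Phi>)"
        using f by blast
    qed
  qed
  obtain N where N: "bounded_degree N \<Phi>"
    using formsD(3)[OF assms(2) \<Gamma>] by blast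
  define \<Psi> where "\<Psi> pk = restrict_degree (\<lambda>p k. (p, k) = pk) \<Phi>" for pk
  have "\<Phi> = (\<Sum>pk\<in>{..N} \<times> {..N}. \<Psi> pk)"
  proof (rule form_eqI)
    fix qs \<beta>s
    have "(\<Sum>pk\<in>{..N} \<times> {..N}. \<Psi> pk) qs \<beta>s =
        (\<Sum>pk\<in>{..N} \<times> {..N}. if (length qs, length \<beta>s) = pk then \<Phi> qs \<beta>s else 0)"
      by (simp add: form_sum_apply \<Psi>_def restrict_degree_def)
    also have "\<dots> = (if (length qs, length \<beta>s) \<in> {..N} \<times> {..N} then \<Phi> qs \<beta>s else 0)"
      by (rule sum.delta') simp
    also have "\<dots> = \<Phi> qs \<beta>s"
      using N unfolding bounded_degree_def by fastforce
    finally show "\<Phi> qs \<beta>s = (\<Sum>pk\<in>{..N} \<times> {..N}. \<Psi> pk) qs \<beta>s" by simp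
  qed
  moreover have "\<Psi> pk \<in> forms S \<Gamma>" for pk
    unfolding \<Psi>_def by (rule forms_restrict_degree[OF \<Gamma> assms(2)])
  moreover have "P (\<Psi> pk)" for pk
  proof (rule bi[of _ "fst pk" "snd pk"])
    show "\<Psi> pk \<in> forms S \<Gamma>"
      unfolding \<Psi>_def by (rule forms_restrict_degree[OF \<Gamma> assms(2)])
  qed (auto simp: bihomogeneous_def \<Psi>_def restrict_degree_def)
  ultimately show ?thesis using sum[of "{..N} \<times> {..N}" \<Psi>] by simp
qed

end

section \<open>Graded derivations\<close>

abbreviation sgn_pow :: "int \<Rightarrow> real"
  where "sgn_pow d \<equiv> (-1) powi d"

lemma sgn_pow_add: "sgn_pow (d + e) = sgn_pow d * sgn_pow e"
  by (simp add: power_int_add)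

lemma sgn_pow_even: "sgn_pow (2 * d) = 1"
  by (simp add: power_int_mult)

lemma sgn_pow_square: "sgn_pow d * sgn_pow d = 1"
  using sgn_pow_add[of d d] sgn_pow_even[of d] by simp

lemma sgn_pow_nat: "sgn_pow (int n) = (-1) ^ n"
  by simp

lemma sgn_pow_degree: "sgn_pow (int p + 2 * k) = (-1) ^ p"
  by (simp only: sgn_pow_add sgn_pow_even sgn_pow_nat mult_1_right)

text \<open>Since \<open>B\<close> has even degree, the sign for exchanging two homogeneous elements
  only depends on their numbers of arguments from \<open>Q\<close>, as in the shuffle sign.\<close>

lemma sgn_pow_degree_mult: "sgn_pow ((int p + 2 * k) * (int q + 2 * l)) = (-1) ^ (p * q)"
proof -
  have "(int p + 2 * k) * (int q + 2 * l) = int (p * q) + 2 * (int p * l + k * int q + 2 * k * l)"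
    by (simp add: algebra_simps)
  then show ?thesis by (simp only: sgn_pow_degree)
qed

lemma homogeneousD: "homogeneous d \<Phi> \<Longrightarrow> \<Phi> qs \<beta>s \<noteq> 0 \<Longrightarrow> int (length qs) + 2 * int (length \<beta>s) = d"
  by (simp add: homogeneous_def)

lemma homogeneous_zero: "homogeneous d 0"
  by (simp add: homogeneous_def form_apply)

lemma homogeneous_add: "homogeneous d \<Phi> \<Longrightarrow> homogeneous d \<Psi> \<Longrightarrow> homogeneous d (\<Phi> + \<Psi>)"
  unfolding homogeneous_def form_apply by (metis add_0)

lemma homogeneous_scaleR: "homogeneous d \<Phi> \<Longrightarrow> homogeneous d (r *\<^sub>R \<Phi>)"
  by (simp add: homogeneous_def form_apply)

lemma homogeneous_minus: "homogeneous d \<Phi> \<Longrightarrow> homogeneous d (- \<Phi>)"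
  by (simp add: homogeneous_def form_apply)

lemma homogeneous_diff: "homogeneous d \<Phi> \<Longrightarrow> homogeneous d \<Psi> \<Longrightarrow> homogeneous d (\<Phi> - \<Psi>)"
  using homogeneous_add[of d \<Phi> "- \<Psi>"] homogeneous_minus by fastforce

lemma homogeneous_deg0: "homogeneous 0 (deg0 S s)"
  by (simp add: homogeneous_def deg0_apply)

lemma homogeneous_genQ: "homogeneous 1 (genQ S \<tau>)"
  by (simp add: homogeneous_def genQ_apply)

lemma homogeneous_genB: "homogeneous 2 (genB S b)"
  by (simp add: homogeneous_def genB_apply)

lemma homogeneous_shuffle:
  assumes "\<And>a b c d. F a b c d \<noteq> 0 \<Longrightarrow>
    int (length a) + 2 * int (length b) + (int (length c) + 2 * int (length d)) = e"
  shows "homogeneous e (shuffle F)"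
  unfolding homogeneous_def
proof (intro allI impI)
  fix qs \<beta>s assume "shuffle F qs \<beta>s \<noteq> 0"
  then obtain a b c d where "length a + length c = length qs" "length b + length d = length \<beta>s"
    "F a b c d \<noteq> 0"
    by (rule shuffle_nonzero)
  then show "int (length qs) + 2 * int (length \<beta>s) = e"
    using assms[of a b c d] by linarith
qed

definition degree_part :: "int \<Rightarrow> ('m, 'q, 'b, 'e::zero) form \<Rightarrow> ('m, 'q, 'b, 'e) form"
  where "degree_part d = restrict_degree (\<lambda>p k. int p + 2 * int k = d)"

lemma homogeneous_degree_part: "homogeneous d (degree_part d \<Phi>)"
  by (simp add: homogeneous_def degree_part_def restrict_degree_def)

lemma sum_degree_part:
  assumes "bounded_degree N \<Phi>"
  shows "(\<Sum>d\<in>{0..int N}. degree_part d \<Phi>) = \<Phi>"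
proof (rule form_eqI)
  fix qs \<beta>s
  have "(\<Sum>d\<in>{0..int N}. degree_part d \<Phi>) qs \<beta>s =
      (\<Sum>d\<in>{0..int N}. if int (length qs) + 2 * int (length \<beta>s) = d then \<Phi> qs \<beta>s else 0)"
    by (simp add: form_sum_apply degree_part_def restrict_degree_def)
  also have "\<dots> = (if int (length qs) + 2 * int (length \<beta>s) \<in> {0..int N} then \<Phi> qs \<beta>s else 0)"
    by (rule sum.delta') simp
  also have "\<dots> = \<Phi> qs \<beta>s"
    using assms unfolding bounded_degree_def by fastforce
  finally show "(\<Sum>d\<in>{0..int N}. degree_part d \<Phi>) qs \<beta>s = \<Phi> qs \<beta>s" .
qed

lemma parity_homogeneous:
  assumes "homogeneous d \<xi>"
  shows "parity \<xi> = sgn_pow d *\<^sub>R \<xi>"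
proof (rule form_eqI)
  fix qs \<beta>s
  show "parity \<xi> qs \<beta>s = (sgn_pow d *\<^sub>R \<xi>) qs \<beta>s"
  proof (cases "\<xi> qs \<beta>s = 0")
    case False
    then show ?thesis
      using homogeneousD[OF assms False] sgn_pow_degree[of "length qs" "int (length \<beta>s)"]
      by (simp only: parity_def form_apply)
  qed (simp add: parity_def form_apply)
qed

lemma parity_linear: "parity (\<xi> + \<eta>) = parity \<xi> + parity \<eta>" "parity (r *\<^sub>R \<xi>) = r *\<^sub>R parity \<xi>"
  "parity 0 = 0" "parity (parity \<xi>) = \<xi>" "parity (- \<xi>) = - parity \<xi>" "parity (\<xi> - \<eta>) = parity \<xi> - parity \<eta>"
  by (rule form_eqI, simp add: parity_def form_apply scaleR_right_distrib scaleR_right_diff_distrib)+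

lemma parity_wedge: "parity (\<xi> \<cdot> \<eta>) = parity \<xi> \<cdot> parity \<eta>"
proof (rule form_eqI)
  fix qs \<beta>s
  have "parity (\<xi> \<cdot> \<eta>) qs \<beta>s = shuffle (\<lambda>a b c d. (-1) ^ length qs *\<^sub>R (\<xi> a b \<odot> \<eta> c d)) qs \<beta>s"
    by (simp add: parity_def wedge_apply shuffle_scaleR)
  also have "\<dots> = (parity \<xi> \<cdot> parity \<eta>) qs \<beta>s"
    unfolding wedge_apply
  proof (rule shuffle_cong, goal_cases)
    case (1 a b c d)
    from 1(1) have "(-1 :: real) ^ length qs = (-1) ^ length a * (-1) ^ length c"
      by (metis power_add)
    then show ?case
      by (simp add: parity_def fscale_scaleR scaleR_fscale mult.commute)
  qed
  finally show "parity (\<xi> \<cdot> \<eta>) qs \<beta>s = (parity \<xi> \<cdot> parity \<eta>) qs \<beta>s" .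
qed

lemma derivationsD:
  assumes "D \<in> derivations S k"
  shows "\<xi> \<notin> graded_functions S \<Longrightarrow> D \<xi> = 0"
    and "\<xi> \<in> graded_functions S \<Longrightarrow> D \<xi> \<in> graded_functions S"
    and "\<xi> \<in> graded_functions S \<Longrightarrow> D (c *\<^sub>R \<xi>) = c *\<^sub>R D \<xi>"
    and "\<xi> \<in> graded_functions S \<Longrightarrow> \<eta> \<in> graded_functions S \<Longrightarrow> D (\<xi> + \<eta>) = D \<xi> + D \<eta>"
    and "\<xi> \<in> graded_functions S \<Longrightarrow> homogeneous d \<xi> \<Longrightarrow> homogeneous (d + k) (D \<xi>)"
    and "\<xi> \<in> graded_functions S \<Longrightarrow> homogeneous d \<xi> \<Longrightarrow> \<eta> \<in> graded_functions S \<Longrightarrow>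
      D (\<xi> \<cdot> \<eta>) = D \<xi> \<cdot> \<eta> + sgn_pow (k * d) *\<^sub>R (\<xi> \<cdot> D \<eta>)"
  using assms unfolding derivations_def by blast+

lemma derivationsI:
  assumes "\<And>\<xi>. \<xi> \<notin> graded_functions S \<Longrightarrow> D \<xi> = 0"
    and "\<And>\<xi>. \<xi> \<in> graded_functions S \<Longrightarrow> D \<xi> \<in> graded_functions S"
    and "\<And>c \<xi>. \<xi> \<in> graded_functions S \<Longrightarrow> D (c *\<^sub>R \<xi>) = c *\<^sub>R D \<xi>"
    and "\<And>\<xi> \<eta>. \<xi> \<in> graded_functions S \<Longrightarrow> \<eta> \<in> graded_functions S \<Longrightarrow> D (\<xi> + \<eta>) = D \<xi> + D \<eta>"
    and "\<And>\<xi> d. \<xi> \<in> graded_functions S \<Longrightarrow> homogeneous d \<xi> \<Longrightarrow> homogeneous (d + k) (D \<xi>)"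
    and "\<And>\<xi> \<eta> d. \<xi> \<in> graded_functions S \<Longrightarrow> homogeneous d \<xi> \<Longrightarrow> \<eta> \<in> graded_functions S \<Longrightarrow>
      D (\<xi> \<cdot> \<eta>) = D \<xi> \<cdot> \<eta> + sgn_pow (k * d) *\<^sub>R (\<xi> \<cdot> D \<eta>)"
  shows "D \<in> derivations S k"
  using assms unfolding derivations_def by blast

text \<open>Common abstraction of the lifts of vector fields, sections of \<open>Q\<close> and
  sections of the dual of \<open>B\<close>, with \<open>j\<close> equal to 0, -1 and -2. Linearity
  over the functions is what allows such a family to be evaluated on form-valued
  coefficients.\<close>

definition hat_family :: "('m, 'q::real_vector, 'b::real_vector) split_data \<Rightarrow> ('m \<Rightarrow> 'e::real_vector) set \<Rightarrow>
    int \<Rightarrow> (('m \<Rightarrow> 'e) \<Rightarrow> ('m, 'q, 'b) operator) \<Rightarrow> bool" where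
  "hat_family S \<Gamma> j H \<longleftrightarrow> cmodule (Cinf S) \<Gamma> \<and> (\<forall>s\<in>\<Gamma>. H s \<in> derivations S j \<and>
     (\<forall>t\<in>\<Gamma>. H (s + t) = H s + H t) \<and> (\<forall>f\<in>Cinf S. H (f \<odot> s) = vf_act (deg0 S f) (H s)))"

text \<open>One of the three summands of \<open>mu_nabla\<close>, for \<open>H\<close> the family of derivations attached to the
  sections of \<open>TM\<close>, \<open>Q\<close> or \<open>B\<^sup>*\<close>.\<close>

definition ext_hat :: "(('m \<Rightarrow> 'e) \<Rightarrow> ('m, 'q, 'b) operator) \<Rightarrow> ('m, 'q, 'b, 'e) form \<Rightarrow> ('m, 'q, 'b) operator"
  where "ext_hat H \<Phi> \<eta> = shuffle (\<lambda>a b c d. H (\<Phi> a b) \<eta> c d)"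

lemma operator_apply:
  fixes D D' :: "('m, 'q, 'b) operator"
  shows "(D + D') \<xi> = D \<xi> + D' \<xi>" "(0 :: ('m, 'q, 'b) operator) \<xi> = 0" "(D - D') \<xi> = D \<xi> - D' \<xi>"
    "(- D) \<xi> = - D \<xi>"
  by (simp_all add: fun_apply_simps)

lemma hat_familyD:
  assumes "hat_family S \<Gamma> j H"
  shows "cmodule (Cinf S) \<Gamma>" "s \<in> \<Gamma> \<Longrightarrow> H s \<in> derivations S j"
    and "s \<in> \<Gamma> \<Longrightarrow> t \<in> \<Gamma> \<Longrightarrow> H (s + t) \<eta> = H s \<eta> + H t \<eta>"
    and "s \<in> \<Gamma> \<Longrightarrow> f \<in> Cinf S \<Longrightarrow> H (f \<odot> s) \<eta> c d = f \<odot> H s \<eta> c d"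
    and "H 0 \<eta> = 0"
proof -
  note A = assms[unfolded hat_family_def]
  show \<Gamma>: "cmodule (Cinf S) \<Gamma>" using A by blast
  show "s \<in> \<Gamma> \<Longrightarrow> H s \<in> derivations S j" using A by blast
  show add: "H (s + t) \<eta> = H s \<eta> + H t \<eta>" if "s \<in> \<Gamma>" "t \<in> \<Gamma>" for s t
    using A that by (simp add: operator_apply)
  show "s \<in> \<Gamma> \<Longrightarrow> f \<in> Cinf S \<Longrightarrow> H (f \<odot> s) \<eta> c d = f \<odot> H s \<eta> c d"
    using A by (simp add: vf_act_def deg0_wedge)
  show "H 0 \<eta> = 0"
    using add[OF cmoduleD(1)[OF \<Gamma>] cmoduleD(1)[OF \<Gamma>]] by simp
qed

context lie_data
begin

abbreviation GF where "GF \<equiv> graded_functions S"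

lemma GF_forms: "GF = forms S (Cinf S)"
  by (simp add: graded_functions_def)

lemmas GF_add = forms_add[OF smod_Cinf, folded GF_forms]
  and GF_scaleR = forms_scaleR[OF smod_Cinf, folded GF_forms]
  and GF_zero = forms_zero[OF smod_Cinf, folded GF_forms]
  and GF_sum = forms_sum[OF smod_Cinf, folded GF_forms]
  and GF_minus = forms_minus[OF smod_Cinf, folded GF_forms]
  and GF_diff = forms_diff[OF smod_Cinf, folded GF_forms]
  and GF_wedge = forms_wedge[OF _ smod_Cinf, folded GF_forms]
  and GF_deg0 = forms_deg0[OF smod_Cinf, folded GF_forms]
  and GF_restrict = forms_restrict_degree[OF smod_Cinf, folded GF_forms]

lemma forms_homogeneous_sum:
  assumes "smod \<Gamma>" "\<Phi> \<in> forms S \<Gamma>"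
  obtains N where "\<Phi> = (\<Sum>d\<in>{0..int N}. degree_part d \<Phi>)" "\<And>d. degree_part d \<Phi> \<in> forms S \<Gamma>"
proof -
  obtain N where "bounded_degree N \<Phi>" using formsD(3)[OF assms(2,1)] by blast
  then show ?thesis
    using that[of N] sum_degree_part[of N \<Phi>] forms_restrict_degree[OF assms] by (simp add: degree_part_def)
qed

lemma parity_GF: "\<xi> \<in> GF \<Longrightarrow> parity \<xi> \<in> GF"
proof -
  assume "\<xi> \<in> GF"
  then have \<xi>: "\<xi> \<in> forms S (Cinf S)" by (simp add: GF_forms)
  obtain N where N: "\<xi> = (\<Sum>d\<in>{0..int N}. degree_part d \<xi>)" "\<And>d. degree_part d \<xi> \<in> forms S (Cinf S)"
    using forms_homogeneous_sum[OF smod_Cinf \<xi>] by blast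
  have sum: "parity (\<Sum>d\<in>I. f d) = (\<Sum>d\<in>I. parity (f d))" for I :: "int set" and f
    by (induction I rule: infinite_finite_induct) (simp_all add: parity_linear)
  have "parity \<xi> = (\<Sum>d\<in>{0..int N}. sgn_pow d *\<^sub>R degree_part d \<xi>)"
    by (subst N(1)) (simp only: sum parity_homogeneous[OF homogeneous_degree_part])
  then show ?thesis
    using N(2) by (auto simp: GF_forms intro!: forms_sum forms_scaleR smod_Cinf)
qed

lemma derivation_sum:
  assumes "D \<in> derivations S k" "\<And>i. i \<in> I \<Longrightarrow> \<xi> i \<in> GF"
  shows "D (\<Sum>i\<in>I. \<xi> i) = (\<Sum>i\<in>I. D (\<xi> i))"
  using assms(2)
proof (induction I rule: infinite_finite_induct)
  case (insert i I)
  then show ?case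
    using derivationsD(4)[OF assms(1), of "\<xi> i" "\<Sum>i\<in>I. \<xi> i"] by (simp add: GF_sum)
qed (use derivationsD(3)[OF assms(1) GF_zero, of 0] in simp_all)

lemma derivation_zero: "D \<in> derivations S k \<Longrightarrow> D 0 = 0"
  using derivationsD(3)[OF _ GF_zero, of D k 0] by simp

text \<open>This justifies the definition of \<open>commutator\<close>: conjugation with
  \<open>parity\<close> produces the sign belonging to the degree of the derivation without
  mentioning that degree.\<close>

lemma derivation_parity:
  assumes D: "D \<in> derivations S k" and "\<xi> \<in> GF"
  shows "D (parity \<xi>) = sgn_pow k *\<^sub>R parity (D \<xi>)"
proof -
  obtain N where N: "\<xi> = (\<Sum>d\<in>{0..int N}. degree_part d \<xi>)" "\<And>d. degree_part d \<xi> \<in> GF"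
    using forms_homogeneous_sum[OF smod_Cinf] assms(2) GF_forms by metis
  have sum: "parity (\<Sum>d\<in>I. f d) = (\<Sum>d\<in>I. parity (f d))" for I :: "int set" and f
    by (induction I rule: infinite_finite_induct) (simp_all add: parity_linear)
  have "D (parity (degree_part d \<xi>)) = sgn_pow k *\<^sub>R parity (D (degree_part d \<xi>))" for d
  proof -
    have "sgn_pow k * sgn_pow (d + k) = sgn_pow d"
      using sgn_pow_square[of k] by (simp add: sgn_pow_add mult.left_commute)
    then show ?thesis
      using parity_homogeneous[OF derivationsD(5)[OF D N(2) homogeneous_degree_part], of d]
        derivationsD(3)[OF D N(2)]
      by (simp add: parity_homogeneous[OF homogeneous_degree_part])
  qed
  then show ?thesis
    by (subst (1 2) N(1)) (simp only: sum derivation_sum[OF D] N(2) parity_GF scaleR_sum_right)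
qed

text \<open>Derivations are local operators: once they agree on functions, the Leibniz rule turns
  agreement on \<open>f\<close> times a form into agreement of the values multiplied by
  \<open>f\<close>, which suffices where \<open>f\<close> is nonzero.\<close>

lemma derivation_eqI:
  assumes D: "D \<in> derivations S k" and D': "D' \<in> derivations S k"
    and "\<And>f. f \<in> Cinf S \<Longrightarrow> D (deg0 S f) = D' (deg0 S f)"
    and "\<And>\<tau>. \<tau> \<in> secQd S \<Longrightarrow> D (genQ S \<tau>) = D' (genQ S \<tau>)"
    and "\<And>b. b \<in> secB S \<Longrightarrow> D (genB S b) = D' (genB S b)"
  shows "D = D'"
proof
  fix \<xi>
  show "D \<xi> = D' \<xi>"
  proof (cases "\<xi> \<in> GF")
    case True
    from smod_Cinf True[unfolded GF_forms] show ?thesis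
    proof (induction rule: forms_induct)
      case (add \<Phi> \<Psi>)
      then show ?case by (simp add: derivationsD(4)[OF D] derivationsD(4)[OF D'] GF_forms)
    next
      case (deg0 f)
      then show ?case by (rule assms(3))
    next
      case (genQ \<tau> \<Phi>)
      then show ?case
        by (simp add: derivationsD(6)[OF D forms_genQ homogeneous_genQ]
            derivationsD(6)[OF D' forms_genQ homogeneous_genQ] assms(4) GF_forms)
    next
      case (genB b \<Phi>)
      then show ?case
        by (simp add: derivationsD(6)[OF D forms_genB homogeneous_genB]
            derivationsD(6)[OF D' forms_genB homogeneous_genB] assms(5) GF_forms)
    next
      case (local \<Phi>)
      have \<Phi>: "\<Phi> \<in> GF" using local by (simp add: GF_forms)
      show ?case
      proof (rule form_eqI, rule ext)
        fix qs \<beta>s x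
        obtain f where f: "f \<in> Cinf S" "f x \<noteq> 0" and eq: "D (deg0 S f \<cdot> \<Phi>) = D' (deg0 S f \<cdot> \<Phi>)"
          using local by blast
        have "deg0 S f \<cdot> D \<Phi> = deg0 S f \<cdot> D' \<Phi>"
          using eq derivationsD(6)[OF D GF_deg0[OF f(1)] homogeneous_deg0 \<Phi>]
            derivationsD(6)[OF D' GF_deg0[OF f(1)] homogeneous_deg0 \<Phi>] assms(3)[OF f(1)] by simp
        then have "(f \<odot> D \<Phi> qs \<beta>s) x = (f \<odot> D' \<Phi> qs \<beta>s) x"
          by (simp add: deg0_wedge fun_eq_iff)
        then show "D \<Phi> qs \<beta>s x = D' \<Phi> qs \<beta>s x"
          using f(2) by (simp add: fscale_def)
      qed
    qed
  next
    case False
    then show ?thesis using derivationsD(1)[OF D] derivationsD(1)[OF D'] by simp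
  qed
qed

lemma derivation_add: "D \<in> derivations S k \<Longrightarrow> D' \<in> derivations S k \<Longrightarrow> D + D' \<in> derivations S k"
  by (rule derivationsI)
    (simp_all add: operator_apply derivationsD GF_add scaleR_right_distrib homogeneous_add wedge_add_left wedge_add_right add_ac)

lemma derivation_zero_op: "0 \<in> derivations S k"
  by (rule derivationsI)
    (simp_all add: operator_apply GF_zero homogeneous_zero wedge_zero_left wedge_zero_right)

lemma derivation_minus: "D \<in> derivations S k \<Longrightarrow> - D \<in> derivations S k"
  by (rule derivationsI)
    (simp_all add: operator_apply derivationsD GF_minus homogeneous_minus wedge_minus_left wedge_minus_right)

lemma derivation_diff: "D \<in> derivations S k \<Longrightarrow> D' \<in> derivations S k \<Longrightarrow> D - D' \<in> derivations S k"
  using derivation_add[of D k "- D'"] derivation_minus[of D' k] by simp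

lemma ext_hat_GF:
  assumes H: "hat_family S \<Gamma> j H" and \<Phi>: "\<Phi> \<in> forms S \<Gamma>" and \<eta>: "\<eta> \<in> GF"
  shows "ext_hat H \<Phi> \<eta> \<in> GF"
  unfolding GF_forms
proof -
  note Hd = hat_familyD[OF H] and \<Gamma> = hat_familyD(1)[OF H]
  note P = formsD[OF \<Phi> \<Gamma>]
  have He: "H (\<Phi> a b) \<eta> \<in> forms S (Cinf S)" for a b
    using derivationsD(2)[OF Hd(2)[OF P(2)] \<eta>] by (simp add: GF_forms)
  note E = formsD[OF He smod_Cinf]
  obtain N where N: "bounded_degree N \<Phi>" using P(3) by blast
  obtain M where M: "bounded_degree M \<eta>" using formsD(3)[OF \<eta>[unfolded GF_forms] smod_Cinf] by blast
  \<comment> \<open>The bound has to be uniform over all derivations \<open>H (\<Phi> a b)\<close>;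
    they share the degree \<open>j\<close>, and \<open>nat j\<close> replaces a negative shift by
    0.\<close>
  have bound: "length c + 2 * length d \<le> M + nat j" if nz: "H (\<Phi> a b) \<eta> c d \<noteq> 0" for a b c d
  proof -
    have part: "degree_part e \<eta> \<in> GF" for e
      unfolding degree_part_def by (rule GF_restrict[OF \<eta>])
    note D = Hd(2)[OF P(2)[of a b]]
    have "H (\<Phi> a b) \<eta> = (\<Sum>e\<in>{0..int M}. H (\<Phi> a b) (degree_part e \<eta>))"
      by (subst sum_degree_part[OF M, symmetric]) (rule derivation_sum[OF D part])
    then have "(\<Sum>e\<in>{0..int M}. H (\<Phi> a b) (degree_part e \<eta>) c d) \<noteq> 0"
      using nz by (simp add: form_sum_apply)
    then obtain e where e: "e \<in> {0..int M}" "H (\<Phi> a b) (degree_part e \<eta>) c d \<noteq> 0"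
      by (meson sum.neutral)
    then have "int (length c) + 2 * int (length d) = e + j"
      using homogeneousD[OF derivationsD(5)[OF D part homogeneous_degree_part]] by blast
    then show ?thesis using e(1) by auto
  qed
  show "ext_hat H \<Phi> \<eta> \<in> forms S (Cinf S)"
    unfolding ext_hat_def
  proof (rule formsI[OF smod_Cinf, rotated 2])
    show "bounded_degree (N + (M + nat j)) (shuffle (\<lambda>a b c d. H (\<Phi> a b) \<eta> c d))"
    proof (rule bounded_degree_shuffle)
      fix a b c d assume nz: "H (\<Phi> a b) \<eta> c d \<noteq> 0"
      then have "\<Phi> a b \<noteq> 0" using Hd(5) by (auto simp: form_apply)
      then show "length a + 2 * length b \<le> N \<and> length c + 2 * length d \<le> M + nat j"
        using N bound[OF nz] unfolding bounded_degree_def by blast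
    qed
    show "shuffle (\<lambda>a b c d. H (\<Phi> a b) \<eta> c d) qs \<beta>s \<in> Cinf S" for qs \<beta>s
      by (rule shuffle_closed_hom(1)[of _ id]) (simp_all add: closed_linear_smod[OF smod_Cinf] E(2))
    show "tensorial S (shuffle (\<lambda>a b c d. H (\<Phi> a b) \<eta> c d))"
    proof (rule tensorial_shuffle)
      show "tensorial S (\<lambda>a b. H (\<Phi> a b) \<eta> c d)" for c d
        by (rule tensorial_compose[OF P(1,2)]) (simp_all add: Hd(3,4,5) form_apply)
      show "tensorial S (\<lambda>c d. H (\<Phi> a b) \<eta> c d)" for a b
        using E(1) by simp
    qed
  qed
qed

text \<open>The Leibniz rule holds for each \<open>H (\<Phi> a b)\<close> and is summed over the
  shuffles. The first term is reassociated; in the second, \<open>\<xi>\<close> is moved past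
  \<open>\<Phi>\<close>, which contributes the sign \<open>sgn_pow (e * d)\<close> and completes the
  degree \<open>e + j\<close>.\<close>

lemma ext_hat_derivation:
  assumes H: "hat_family S \<Gamma> j H" and \<Phi>: "\<Phi> \<in> forms S \<Gamma>" and hom: "homogeneous e \<Phi>"
  shows "ext_hat H \<Phi> \<in> derivations S (e + j)"
proof (rule derivationsI)
  note Hd = hat_familyD[OF H] and \<Gamma> = hat_familyD(1)[OF H]
  note P = formsD[OF \<Phi> \<Gamma>]
  note D = derivationsD[OF Hd(2)[OF P(2)]]
  show "ext_hat H \<Phi> \<xi> = 0" if "\<xi> \<notin> GF" for \<xi>
    by (rule form_eqI) (simp add: ext_hat_def D(1)[OF that] form_apply)
  show "ext_hat H \<Phi> \<xi> \<in> GF" if "\<xi> \<in> GF" for \<xi>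
    by (rule ext_hat_GF[OF H \<Phi> that])
  show "ext_hat H \<Phi> (c *\<^sub>R \<xi>) = c *\<^sub>R ext_hat H \<Phi> \<xi>" if "\<xi> \<in> GF" for c \<xi>
    by (rule form_eqI) (simp add: ext_hat_def D(3)[OF that] form_apply shuffle_scaleR)
  show "ext_hat H \<Phi> (\<xi> + \<eta>) = ext_hat H \<Phi> \<xi> + ext_hat H \<Phi> \<eta>" if "\<xi> \<in> GF" "\<eta> \<in> GF" for \<xi> \<eta>
    by (rule form_eqI) (simp add: ext_hat_def D(4)[OF that] form_apply shuffle_add)
  show "homogeneous (d + (e + j)) (ext_hat H \<Phi> \<xi>)" if \<xi>: "\<xi> \<in> GF" "homogeneous d \<xi>" for \<xi> d
    unfolding ext_hat_def
  proof (rule homogeneous_shuffle)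
    fix a b c d' assume nz: "H (\<Phi> a b) \<xi> c d' \<noteq> 0"
    then have "\<Phi> a b \<noteq> 0" using Hd(5) by (auto simp: form_apply)
    then show "int (length a) + 2 * int (length b) + (int (length c) + 2 * int (length d')) = d + (e + j)"
      using homogeneousD[OF hom] homogeneousD[OF D(5)[OF \<xi>] nz] by simp
  qed
  fix \<xi> \<eta> d assume \<xi>: "\<xi> \<in> GF" "homogeneous d \<xi>" and \<eta>: "\<eta> \<in> GF"
  show "ext_hat H \<Phi> (\<xi> \<cdot> \<eta>) = ext_hat H \<Phi> \<xi> \<cdot> \<eta> + sgn_pow ((e + j) * d) *\<^sub>R (\<xi> \<cdot> ext_hat H \<Phi> \<eta>)"
  proof (rule form_eqI)
    fix qs \<beta>s
    have left: "shuffle (\<lambda>a b c1 d1. H (\<Phi> a b) \<xi> c1 d1) x y \<odot> \<eta> c d =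
        shuffle (\<lambda>a b c1 d1. H (\<Phi> a b) \<xi> c1 d1 \<odot> \<eta> c d) x y" for x y c d
      by (rule shuffle_hom[of "\<lambda>g. g \<odot> \<eta> c d"]) (simp_all add: fscale_add_left scaleR_fscale)
    have 1: "shuffle (\<lambda>a b. H (\<Phi> a b) \<xi> \<cdot> \<eta>) qs \<beta>s = (ext_hat H \<Phi> \<xi> \<cdot> \<eta>) qs \<beta>s"
      unfolding wedge_eq_shuffle ext_hat_def left by (rule shuffle_assoc[symmetric])
    \<comment> \<open>The sign of \<open>shuffle_flip\<close> depends on lengths of lists. It may be
      replaced by a constant because \<open>\<xi>\<close> and \<open>\<Phi>\<close> are homogeneous
      and only nonzero terms count.\<close>
    have flip: "shuffle (\<lambda>a b c d. \<xi> c d \<odot> H (\<Phi> a b) \<eta> e' f) x y =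
        sgn_pow (e * d) *\<^sub>R shuffle (\<lambda>a b c d. \<xi> a b \<odot> H (\<Phi> c d) \<eta> e' f) x y" for x y e' f
    proof -
      have "shuffle (\<lambda>a b c d. \<xi> c d \<odot> H (\<Phi> a b) \<eta> e' f) x y =
          shuffle (\<lambda>a b c d. (-1) ^ (length a * length c) *\<^sub>R (\<xi> a b \<odot> H (\<Phi> c d) \<eta> e' f)) x y"
        by (rule shuffle_flip)
      also have "\<dots> = shuffle (\<lambda>a b c d'. sgn_pow (e * d) *\<^sub>R (\<xi> a b \<odot> H (\<Phi> c d') \<eta> e' f)) x y"
      proof (rule shuffle_cong)
        fix a b c d'
        show "(-1) ^ (length a * length c) *\<^sub>R (\<xi> a b \<odot> H (\<Phi> c d') \<eta> e' f) =
            sgn_pow (e * d) *\<^sub>R (\<xi> a b \<odot> H (\<Phi> c d') \<eta> e' f)"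
        proof (cases "\<xi> a b = 0 \<or> \<Phi> c d' = 0")
          case True
          then show ?thesis by (auto simp: Hd(5) form_apply)
        next
          case False
          then have "sgn_pow (e * d) = (-1) ^ (length a * length c)"
            using homogeneousD[OF hom, of c d'] homogeneousD[OF \<xi>(2), of a b] sgn_pow_degree_mult
            by (metis mult.commute)
          then show ?thesis by simp
        qed
      qed
      finally show ?thesis by (simp add: shuffle_scaleR)
    qed
    have "shuffle (\<lambda>a b. \<xi> \<cdot> H (\<Phi> a b) \<eta>) qs \<beta>s =
        shuffle (\<lambda>x y e f. shuffle (\<lambda>a b c d. \<xi> c d \<odot> H (\<Phi> a b) \<eta> e f) x y) qs \<beta>s"
      unfolding wedge_eq_shuffle by (rule shuffle_assoc[symmetric])
    also have "\<dots> = sgn_pow (e * d) *\<^sub>R shuffle (\<lambda>x y e f. shuffle (\<lambda>a b c d. \<xi> a b \<odot> H (\<Phi> c d) \<eta> e f) x y) qs \<beta>s"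
      unfolding flip by (rule shuffle_scaleR)
    also have "shuffle (\<lambda>x y e f. shuffle (\<lambda>a b c d. \<xi> a b \<odot> H (\<Phi> c d) \<eta> e f) x y) qs \<beta>s =
        shuffle (\<lambda>a b x y. shuffle (\<lambda>c d e f. \<xi> a b \<odot> H (\<Phi> c d) \<eta> e f) x y) qs \<beta>s"
      by (rule shuffle_assoc)
    also have "\<dots> = (\<xi> \<cdot> ext_hat H \<Phi> \<eta>) qs \<beta>s"
      unfolding wedge_eq_shuffle ext_hat_def shuffle_fscale ..
    finally have 2: "shuffle (\<lambda>a b. \<xi> \<cdot> H (\<Phi> a b) \<eta>) qs \<beta>s = sgn_pow (e * d) *\<^sub>R (\<xi> \<cdot> ext_hat H \<Phi> \<eta>) qs \<beta>s" .
    have "ext_hat H \<Phi> (\<xi> \<cdot> \<eta>) qs \<beta>s =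
        shuffle (\<lambda>a b c d'. (H (\<Phi> a b) \<xi> \<cdot> \<eta>) c d' + sgn_pow (j * d) *\<^sub>R (\<xi> \<cdot> H (\<Phi> a b) \<eta>) c d') qs \<beta>s"
      by (simp add: ext_hat_def D(6)[OF \<xi> \<eta>] form_apply)
    also have "\<dots> = shuffle (\<lambda>a b. H (\<Phi> a b) \<xi> \<cdot> \<eta>) qs \<beta>s +
        sgn_pow (j * d) *\<^sub>R shuffle (\<lambda>a b. \<xi> \<cdot> H (\<Phi> a b) \<eta>) qs \<beta>s"
      by (simp add: shuffle_add shuffle_scaleR)
    moreover have "sgn_pow ((e + j) * d) = sgn_pow (j * d) * sgn_pow (e * d)"
      by (simp only: distrib_right sgn_pow_add) (rule mult.commute)
    ultimately show "ext_hat H \<Phi> (\<xi> \<cdot> \<eta>) qs \<beta>s =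
        (ext_hat H \<Phi> \<xi> \<cdot> \<eta> + sgn_pow ((e + j) * d) *\<^sub>R (\<xi> \<cdot> ext_hat H \<Phi> \<eta>)) qs \<beta>s"
      by (simp only: 1 2 form_apply scaleR_scaleR)
  qed
qed

lemma ext_hat_add:
  assumes "hat_family S \<Gamma> j H" "\<Phi> \<in> forms S \<Gamma>" "\<Psi> \<in> forms S \<Gamma>"
  shows "ext_hat H (\<Phi> + \<Psi>) \<eta> = ext_hat H \<Phi> \<eta> + ext_hat H \<Psi> \<eta>"
proof (rule form_eqI)
  fix qs \<beta>s
  note Hd = hat_familyD[OF assms(1)]
  show "ext_hat H (\<Phi> + \<Psi>) \<eta> qs \<beta>s = (ext_hat H \<Phi> \<eta> + ext_hat H \<Psi> \<eta>) qs \<beta>s"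
    using formsD(2)[OF assms(2) Hd(1)] formsD(2)[OF assms(3) Hd(1)]
    by (simp add: ext_hat_def form_apply Hd(3) shuffle_add)
qed

text \<open>The shuffle in the coefficient is pulled through \<open>H\<close>, which is linear only
  on \<open>\<Gamma>\<close>; the rest is associativity.\<close>

lemma ext_hat_wedge:
  assumes "hat_family S \<Gamma> j H" "\<Phi> \<in> forms S \<Gamma>" "\<xi> \<in> GF"
  shows "ext_hat H (\<xi> \<cdot> \<Phi>) \<eta> = \<xi> \<cdot> ext_hat H \<Phi> \<eta>"
proof (rule form_eqI)
  fix qs \<beta>s
  note Hd = hat_familyD[OF assms(1)]
  note P = formsD(2)[OF assms(2) Hd(1)] and X = formsD(2)[OF assms(3)[unfolded GF_forms] smod_Cinf]
  have scale: "H (r *\<^sub>R s) \<eta> e f = r *\<^sub>R H s \<eta> e f" if "s \<in> \<Gamma>" for r s e f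
    using Hd(4)[OF that const_smooth, of r] by (simp add: fscale_const)
  have "H (shuffle (\<lambda>a b c d. \<xi> a b \<odot> \<Phi> c d) x y) \<eta> e f =
      shuffle (\<lambda>a b c d. H (\<xi> a b \<odot> \<Phi> c d) \<eta> e f) x y" for x y e f
    by (rule shuffle_closed_hom(2)[of \<Gamma> "\<lambda>s. H s \<eta> e f"])
      (simp_all add: closed_linear_smod Hd(1,3) form_apply scale cmoduleD(3)[OF Hd(1)] X P)
  then have "ext_hat H (\<xi> \<cdot> \<Phi>) \<eta> qs \<beta>s =
      shuffle (\<lambda>x y e f. shuffle (\<lambda>a b c d. \<xi> a b \<odot> H (\<Phi> c d) \<eta> e f) x y) qs \<beta>s"
    by (simp add: ext_hat_def wedge_apply Hd(4) X P)
  also have "\<dots> = shuffle (\<lambda>a b x y. shuffle (\<lambda>c d e f. \<xi> a b \<odot> H (\<Phi> c d) \<eta> e f) x y) qs \<beta>s"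
    by (rule shuffle_assoc)
  also have "\<dots> = (\<xi> \<cdot> ext_hat H \<Phi> \<eta>) qs \<beta>s"
    unfolding wedge_eq_shuffle ext_hat_def shuffle_fscale ..
  finally show "ext_hat H (\<xi> \<cdot> \<Phi>) \<eta> qs \<beta>s = (\<xi> \<cdot> ext_hat H \<Phi> \<eta>) qs \<beta>s" .
qed

lemma ext_hat_deg0:
  assumes "hat_family S \<Gamma> j H"
  shows "ext_hat H (deg0 S s) = H s"
proof (rule ext, rule form_eqI)
  fix \<eta> qs \<beta>s
  have "ext_hat H (deg0 S s) \<eta> qs \<beta>s = shuffle (\<lambda>a b c d. if a = [] \<and> b = [] then H s \<eta> c d else 0) qs \<beta>s"
    unfolding ext_hat_def
    by (rule shuffle_cong) (simp add: deg0_apply hat_familyD(5)[OF assms] form_apply)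
  then show "ext_hat H (deg0 S s) \<eta> qs \<beta>s = H s \<eta> qs \<beta>s"
    by (simp only: shuffle_right)
qed

text \<open>When the derivations send \<open>\<eta>\<close> to functions, nothing is left for the
  second factor of the shuffle, so the value is computed argument by argument. This reads off the
  components of a triple from values on generators.\<close>

lemma ext_hat_eval:
  assumes "\<And>s. s \<in> \<Gamma> \<Longrightarrow> H s \<eta> = deg0 S (g s)" "smod \<Gamma>" "\<Phi> \<in> forms S \<Gamma>"
  shows "ext_hat H \<Phi> \<eta> qs \<beta>s = g (\<Phi> qs \<beta>s)"
proof -
  have "ext_hat H \<Phi> \<eta> qs \<beta>s = shuffle (\<lambda>a b c d. if c = [] \<and> d = [] then g (\<Phi> a b) else 0) qs \<beta>s"
    unfolding ext_hat_def
    by (rule shuffle_cong) (simp add: assms(1) formsD(2)[OF assms(3,2)] deg0_apply)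
  then show ?thesis by (simp only: shuffle_left)
qed

end

text \<open>The correction terms of a covariant derivative, with \<open>g\<close> applied to one
  argument at a time. The recursion on the head runs parallel to that of the shuffles.\<close>

fun list_deriv :: "('a \<Rightarrow> 'a) \<Rightarrow> ('a list \<Rightarrow> 'e::real_vector) \<Rightarrow> 'a list \<Rightarrow> 'e" where
  "list_deriv g F [] = 0"
| "list_deriv g F (q # qs) = F (g q # qs) + list_deriv g (\<lambda>l. F (q # l)) qs"

lemma jointly_linear_zero: "jointly_linear P \<Longrightarrow> P 0 0 = 0"
  using jointly_linear_scaleRD[of P 0 0 0] by simp

lemma fscale_diff_right: "f \<odot> (s - t) = f \<odot> s - f \<odot> t"
  using fscale_add_right[of f s "- t"] fscale_scaleR[of f "-1" t] by simp

lemma form_apply_partial: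
  fixes \<Phi> \<Psi> :: "('m, 'q, 'b, 'e::real_vector) form"
  shows "(\<Phi> + \<Psi>) qs = (\<lambda>\<beta>s. \<Phi> qs \<beta>s + \<Psi> qs \<beta>s)" "(r *\<^sub>R \<Phi>) qs = (\<lambda>\<beta>s. r *\<^sub>R \<Phi> qs \<beta>s)"
  by (simp_all add: fun_apply_simps scaleR_fun_def fun_eq_iff)

lemma list_deriv_append:
  "list_deriv g F (xs @ u # ys) =
    list_deriv g (\<lambda>l. F (l @ u # ys)) xs + F (xs @ g u # ys) + list_deriv g (\<lambda>l. F (xs @ u # l)) ys"
  by (induction xs arbitrary: F) (simp_all add: add.assoc)

lemma list_deriv_jointly_linear:
  assumes "jointly_linear P"
  shows "list_deriv g (\<lambda>l. P (F l) (G l)) qs = P (list_deriv g F qs) (list_deriv g G qs)"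
  by (induction qs arbitrary: F G) (simp_all add: jointly_linear_zero[OF assms] jointly_linear_addD[OF assms])

lemmas list_deriv_add = list_deriv_jointly_linear[OF jointly_linear_plus]
  and list_deriv_scaleR = list_deriv_jointly_linear[OF jointly_linear_scaleR]
  and list_deriv_fscale = list_deriv_jointly_linear[OF jointly_linear_fscale]

lemma list_deriv_zero: "list_deriv g (\<lambda>_. 0) qs = 0"
  by (induction qs) simp_all

lemma list_deriv_cong:
  "(\<And>l. length l = length qs \<Longrightarrow> F l = G l) \<Longrightarrow> list_deriv g F qs = list_deriv g G qs"
proof (induction qs arbitrary: F G)
  case (Cons q qs)
  have "list_deriv g (\<lambda>l. F (q # l)) qs = list_deriv g (\<lambda>l. G (q # l)) qs"
    by (rule Cons.IH) (simp add: Cons.prems)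
  then show ?case by (simp add: Cons.prems)
qed simp

lemma list_deriv_eq_zero:
  assumes "\<And>l. length l = length qs \<Longrightarrow> F l = 0"
  shows "list_deriv g F qs = 0"
proof -
  have "list_deriv g F qs = list_deriv g (\<lambda>_. 0) qs"
    by (rule list_deriv_cong) (rule assms)
  then show ?thesis by (simp only: list_deriv_zero)
qed

lemma list_deriv_sign: "list_deriv g (\<lambda>l. (-1) ^ length l *\<^sub>R F l) qs = (-1) ^ length qs *\<^sub>R list_deriv g F qs"
proof -
  have "list_deriv g (\<lambda>l. (-1) ^ length l *\<^sub>R F l) qs = list_deriv g (\<lambda>l. (-1) ^ length qs *\<^sub>R F l) qs"
    by (rule list_deriv_cong) simp
  then show ?thesis by (simp only: list_deriv_scaleR)
qed

lemma list_deriv_closed: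
  assumes "cmodule C \<Gamma>" "\<And>l. F l \<in> \<Gamma>"
  shows "list_deriv g F qs \<in> \<Gamma>"
  using assms(2) by (induction qs arbitrary: F) (simp_all add: cmoduleD[OF assms(1)])

lemma list_deriv_hom:
  assumes "L 0 = 0" "\<And>x y. L (x + y) = L x + L y"
  shows "L (list_deriv g F qs) = list_deriv g (\<lambda>l. L (F l)) qs"
  by (induction qs arbitrary: F) (simp_all add: assms)

text \<open>The modified argument lies in one of the two lists. Modification preserves lengths, so
  the shuffle signs are unaffected.\<close>

lemma list_deriv_alt_shuffle:
  "list_deriv g (alt_shuffle F) qs =
    alt_shuffle (\<lambda>a c. list_deriv g (\<lambda>l. F l c) a + list_deriv g (\<lambda>l. F a l) c) qs"
proof (induction qs arbitrary: F)
  case (Cons q qs)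
  have "list_deriv g (alt_shuffle F) (q # qs) =
      alt_shuffle (\<lambda>a c. F (g q # a) c) qs + alt_shuffle (\<lambda>a c. (-1) ^ length a *\<^sub>R F a (g q # c)) qs +
      (list_deriv g (alt_shuffle (\<lambda>a c. F (q # a) c)) qs +
       list_deriv g (alt_shuffle (\<lambda>a c. (-1) ^ length a *\<^sub>R F a (q # c))) qs)"
    by (simp only: list_deriv.simps alt_shuffle.simps list_deriv_add)
  also have "\<dots> = alt_shuffle (\<lambda>a c. list_deriv g (\<lambda>l. F l c) (q # a) + list_deriv g (\<lambda>l. F (q # a) l) c) qs +
      alt_shuffle (\<lambda>a c. (-1) ^ length a *\<^sub>R
        (list_deriv g (\<lambda>l. F l (q # c)) a + list_deriv g (\<lambda>l. F a l) (q # c))) qs"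
    by (simp only: Cons.IH list_deriv_sign list_deriv_scaleR list_deriv.simps scaleR_right_distrib
        alt_shuffle_add add.assoc add.left_commute add.commute)
  finally show ?case by (simp only: alt_shuffle.simps)
qed simp

lemma list_deriv_sym_shuffle:
  "list_deriv g (sym_shuffle F) qs =
    sym_shuffle (\<lambda>a c. list_deriv g (\<lambda>l. F l c) a + list_deriv g (\<lambda>l. F a l) c) qs"
proof (induction qs arbitrary: F)
  case (Cons q qs)
  have "list_deriv g (sym_shuffle F) (q # qs) =
      sym_shuffle (\<lambda>a c. F (g q # a) c) qs + sym_shuffle (\<lambda>a c. F a (g q # c)) qs +
      (list_deriv g (sym_shuffle (\<lambda>a c. F (q # a) c)) qs + list_deriv g (sym_shuffle (\<lambda>a c. F a (q # c))) qs)"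
    by (simp only: list_deriv.simps sym_shuffle.simps list_deriv_add)
  also have "\<dots> = sym_shuffle (\<lambda>a c. list_deriv g (\<lambda>l. F l c) (q # a) + list_deriv g (\<lambda>l. F (q # a) l) c) qs +
      sym_shuffle (\<lambda>a c. list_deriv g (\<lambda>l. F l (q # c)) a + list_deriv g (\<lambda>l. F a l) (q # c)) qs"
    by (simp only: Cons.IH list_deriv.simps sym_shuffle_add add.assoc add.left_commute add.commute)
  finally show ?case by (simp only: sym_shuffle.simps)
qed simp

lemma list_deriv_of_alt_shuffle:
  "list_deriv g (\<lambda>l. alt_shuffle (F l) qs) xs = alt_shuffle (\<lambda>a c. list_deriv g (\<lambda>l. F l a c) xs) qs"
  by (induction xs arbitrary: F) (simp_all add: alt_shuffle_add)

lemma list_deriv_of_sym_shuffle: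
  "list_deriv g (\<lambda>l. sym_shuffle (F l) qs) xs = sym_shuffle (\<lambda>a c. list_deriv g (\<lambda>l. F l a c) xs) qs"
  by (induction xs arbitrary: F) (simp_all add: sym_shuffle_add)

lemma list_deriv_shuffle_left:
  "list_deriv g (\<lambda>l. shuffle F l \<beta>s) qs =
    shuffle (\<lambda>a b c d. list_deriv g (\<lambda>l. F l b c d) a + list_deriv g (\<lambda>l. F a b l d) c) qs \<beta>s"
  unfolding shuffle_def
  by (simp only: list_deriv_alt_shuffle list_deriv_of_sym_shuffle sym_shuffle_add)

lemma list_deriv_shuffle_right:
  "list_deriv g (\<lambda>l. shuffle F qs l) \<beta>s =
    shuffle (\<lambda>a b c d. list_deriv g (\<lambda>l. F a l c d) b + list_deriv g (\<lambda>l. F a b c l) d) qs \<beta>s"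
  unfolding shuffle_def
  by (simp only: list_deriv_of_alt_shuffle list_deriv_sym_shuffle)

lemma multilinear_of_list_deriv:
  "(\<And>l. multilinear C \<Gamma> (\<lambda>xs. F xs l)) \<Longrightarrow> multilinear C \<Gamma> (\<lambda>xs. list_deriv g (F xs) ys)"
proof (induction ys arbitrary: F)
  case Nil
  then show ?case by (simp add: multilinear_def)
next
  case (Cons y ys)
  then show ?case by (simp add: multilinear_add)
qed

lemma alternating_of_list_deriv:
  "(\<And>l. alternating (\<lambda>xs. F xs l)) \<Longrightarrow> alternating (\<lambda>xs. list_deriv g (F xs) ys)"
  by (induction ys arbitrary: F) (simp_all add: alternating_def list_deriv_zero)

lemma symmetric_of_list_deriv:
  "(\<And>l. symmetric (\<lambda>xs. F xs l)) \<Longrightarrow> symmetric (\<lambda>xs. list_deriv g (F xs) ys)"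
proof -
  assume F: "\<And>l. symmetric (\<lambda>xs. F xs l)"
  have "F (xs @ p # q # zs) = F (xs @ q # p # zs)" for xs p q zs
    using F by (simp add: symmetric_def fun_eq_iff)
  then show "symmetric (\<lambda>xs. list_deriv g (F xs) ys)"
    unfolding symmetric_def by metis
qed

text \<open>Covariant differentiation of a multilinear function of sections: the derivative \<open>\<delta>\<close> of the
  value is corrected by the derivatives \<open>g\<close> of the arguments.\<close>

lemma multilinear_covariant:
  assumes \<Gamma>: "cmodule C \<Gamma>" and F: "multilinear C \<Gamma> F" "\<And>xs. F xs \<in> X"
    and \<delta>: "\<delta> 0 = 0" "\<And>s t. s \<in> X \<Longrightarrow> t \<in> X \<Longrightarrow> \<delta> (s + t) = \<delta> s + \<delta> t"
      "\<And>f s. f \<in> C \<Longrightarrow> s \<in> X \<Longrightarrow> \<delta> (f \<odot> s) = f \<odot> \<delta> s + d f \<odot> s" "\<And>f. f \<in> C \<Longrightarrow> d f \<in> C"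
    and g: "\<And>u. u \<in> \<Gamma> \<Longrightarrow> g u \<in> \<Gamma>" "\<And>u v. u \<in> \<Gamma> \<Longrightarrow> v \<in> \<Gamma> \<Longrightarrow> g (u + v) = g u + g v"
      "\<And>f u. f \<in> C \<Longrightarrow> u \<in> \<Gamma> \<Longrightarrow> g (f \<odot> u) = f \<odot> g u + d f \<odot> u"
  shows "multilinear C \<Gamma> (\<lambda>xs. if set xs \<subseteq> \<Gamma> then \<delta> (F xs) - list_deriv g F xs else 0)"
proof -
  note G = cmoduleD[OF \<Gamma>] and D = multilinearD[OF F(1)]
  have add: "\<delta> (F (xs @ (u + v) # ys)) - list_deriv g F (xs @ (u + v) # ys) =
      \<delta> (F (xs @ u # ys)) - list_deriv g F (xs @ u # ys) + (\<delta> (F (xs @ v # ys)) - list_deriv g F (xs @ v # ys))"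
    if "u \<in> \<Gamma>" "v \<in> \<Gamma>" for u v xs ys
    using that by (simp add: list_deriv_append D(2) g \<delta>(2) F(2) list_deriv_add)
  \<comment> \<open>The term with \<open>d f\<close> from differentiating the value cancels the one
    that \<open>g\<close> produces in the slot of \<open>u\<close>; the corrections in the other
    slots are linear over the functions.\<close>
  have scale: "\<delta> (F (xs @ (f \<odot> u) # ys)) - list_deriv g F (xs @ (f \<odot> u) # ys) =
      f \<odot> (\<delta> (F (xs @ u # ys)) - list_deriv g F (xs @ u # ys))"
    if "u \<in> \<Gamma>" "f \<in> C" for u f xs ys
    using that by (simp add: list_deriv_append D(2,3) g \<delta>(3,4) F(2) G(3) list_deriv_fscale
        fscale_add_right fscale_diff_right)
  show ?thesis
    unfolding multilinear_def using add scale by (auto simp: G)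
qed

lemma alternating_covariant:
  assumes \<Gamma>: "cmodule C \<Gamma>" and F: "multilinear C \<Gamma> F" "alternating F" and \<delta>: "\<delta> 0 = 0"
  shows "alternating (\<lambda>xs. if set xs \<subseteq> \<Gamma> then \<delta> (F xs) - list_deriv g F xs else 0)"
proof -
  have alt: "F (xs @ q # q # ys) = 0" for xs q ys
    using F(2) by (simp add: alternating_def)
  \<comment> \<open>Corrections in other slots keep the repeated \<open>q\<close>. Those in the two
    slots of \<open>q\<close> differ by a transposition and cancel.\<close>
  have "list_deriv g F (xs @ q # q # ys) = 0" for xs q ys
    using multilinear_alternating_swap[OF \<Gamma> F, of xs "g q" q ys] alt
    by (simp add: list_deriv_append list_deriv_zero)
  then show ?thesis
    by (simp add: alternating_def alt \<delta>)
qed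

lemma symmetric_covariant:
  assumes F: "symmetric F"
  shows "symmetric (\<lambda>xs. if set xs \<subseteq> \<Gamma> then \<delta> (F xs) - list_deriv g F xs else 0)"
proof -
  have sym: "F (xs @ p # q # ys) = F (xs @ q # p # ys)" for xs p q ys
    using F by (simp add: symmetric_def)
  have "list_deriv g F (xs @ p # q # ys) = list_deriv g F (xs @ q # p # ys)" for xs p q ys
  proof -
    have "(\<lambda>l. F (l @ p # q # ys)) = (\<lambda>l. F (l @ q # p # ys))" "(\<lambda>l. F (xs @ p # q # l)) = (\<lambda>l. F (xs @ q # p # l))"
      using sym by auto
    then show ?thesis
      using sym[of xs "g p" q ys] sym[of xs p "g q" ys] by (simp add: list_deriv_append add.commute add.left_commute)
  qed
  then show ?thesis
    unfolding symmetric_def by (auto simp: sym)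
qed

lemma list_deriv_add_arg:
  "multilinear C \<Gamma> F \<Longrightarrow> set qs \<subseteq> \<Gamma> \<Longrightarrow> (\<And>q. q \<in> \<Gamma> \<Longrightarrow> g q \<in> \<Gamma> \<and> h q \<in> \<Gamma> \<and> k q = g q + h q) \<Longrightarrow>
    list_deriv k F qs = list_deriv g F qs + list_deriv h F qs"
proof (induction qs arbitrary: F)
  case (Cons q qs)
  then have "list_deriv k (\<lambda>l. F (q # l)) qs = list_deriv g (\<lambda>l. F (q # l)) qs + list_deriv h (\<lambda>l. F (q # l)) qs"
    by (intro Cons.IH multilinear_Cons) auto
  moreover have "F (k q # qs) = F (g q # qs) + F (h q # qs)"
    using multilinearD(2)[OF Cons.prems(1), of "g q" "h q" "[]" qs] Cons.prems(2,3) by simp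
  ultimately show ?case by simp
qed simp

lemma list_deriv_fscale_arg:
  "multilinear C \<Gamma> F \<Longrightarrow> set qs \<subseteq> \<Gamma> \<Longrightarrow> f \<in> C \<Longrightarrow> (\<And>q. q \<in> \<Gamma> \<Longrightarrow> g q \<in> \<Gamma> \<and> k q = f \<odot> g q) \<Longrightarrow>
    list_deriv k F qs = f \<odot> list_deriv g F qs"
proof (induction qs arbitrary: F)
  case (Cons q qs)
  then have "list_deriv k (\<lambda>l. F (q # l)) qs = f \<odot> list_deriv g (\<lambda>l. F (q # l)) qs"
    by (intro Cons.IH multilinear_Cons) auto
  moreover have "F (k q # qs) = f \<odot> F (g q # qs)"
    using multilinearD(3)[OF Cons.prems(1), of "g q" f "[]" qs] Cons.prems(2-4) by simp
  ultimately show ?case by (simp add: fscale_add_right)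
qed simp

lemma connectionD:
  assumes "connection M \<A> act \<Gamma> nab" "a \<in> \<A>" "s \<in> \<Gamma>"
  shows "nab a s \<in> \<Gamma>" "a' \<in> \<A> \<Longrightarrow> nab (a + a') s = nab a s + nab a' s"
    "t \<in> \<Gamma> \<Longrightarrow> nab a (s + t) = nab a s + nab a t"
    "f \<in> smooth_functions M \<Longrightarrow> nab (f \<odot> a) s = f \<odot> nab a s"
    "f \<in> smooth_functions M \<Longrightarrow> nab a (f \<odot> s) = f \<odot> nab a s + act a f \<odot> s"
  using assms unfolding connection_def by blast+

section \<open>Derivations attached to sections and vector fields\<close>

context lie_data
begin

definition HB :: "('m \<Rightarrow> 'b \<Rightarrow> real) \<Rightarrow> ('m, 'q, 'b) operator"
  where "HB \<beta> \<eta> = (if \<eta> \<in> GF then iB \<beta> \<eta> else 0)"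

definition HQ :: "('m \<Rightarrow> 'q) \<Rightarrow> ('m, 'q, 'b) operator"
  where "HQ q \<eta> = (if \<eta> \<in> GF then iQ q \<eta> else 0)"

text \<open>The covariant derivative of a form along \<open>X\<close>: the derivative of its value,
  corrected in the arguments from \<open>Q\<close> and from the dual of \<open>B\<close>. On
  generators this is the dual connection, so it provides the derivation described by
  \<open>hatT\<close>.\<close>

definition HT :: "('m, 'q, 'b) conn_pair \<Rightarrow> 'm vfield \<Rightarrow> ('m, 'q, 'b) operator" where
  "HT nab X \<eta> = (if \<eta> \<in> GF then (\<lambda>qs \<beta>s. if args S qs \<beta>s then lie_deriv X (\<eta> qs \<beta>s) -
     list_deriv (fst nab X) (\<lambda>l. \<eta> l \<beta>s) qs - list_deriv (snd nab X) (\<lambda>l. \<eta> qs l) \<beta>s else 0) else 0)"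

lemma sgn_pow_minus: "sgn_pow (- d) = sgn_pow d"
  by (rule power_int_minus_one_minus)

lemma GF_iB: "\<eta> \<in> GF \<Longrightarrow> iB \<beta> \<eta> \<in> GF" and GF_iQ: "\<eta> \<in> GF \<Longrightarrow> iQ q \<eta> \<in> GF"
  unfolding GF_forms by (rule forms_iB[OF smod_Cinf], assumption, rule forms_iQ[OF smod_Cinf], assumption)

lemma iB_linear: "iB \<beta> (r *\<^sub>R \<Phi>) = r *\<^sub>R iB \<beta> \<Phi>" "iB \<beta> (\<Phi> + \<Psi>) = iB \<beta> \<Phi> + iB \<beta> \<Psi>"
  and iQ_linear: "iQ q (r *\<^sub>R \<Phi>) = r *\<^sub>R iQ q \<Phi>" "iQ q (\<Phi> + \<Psi>) = iQ q \<Phi> + iQ q \<Psi>"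
  by (rule form_eqI, simp add: iB_def iQ_def form_apply)+

lemma HB_derivation: "HB \<beta> \<in> derivations S (- 2)"
proof (rule derivationsI)
  fix \<xi> \<eta> d assume \<xi>: "\<xi> \<in> GF" "homogeneous d \<xi>"
  show "homogeneous (d + - 2) (HB \<beta> \<xi>)"
    unfolding homogeneous_def
  proof (intro allI impI)
    fix qs \<beta>s assume "HB \<beta> \<xi> qs \<beta>s \<noteq> 0"
    then have "\<xi> qs (\<beta> # \<beta>s) \<noteq> 0" using \<xi>(1) by (simp add: HB_def iB_def)
    from homogeneousD[OF \<xi>(2) this] show "int (length qs) + 2 * int (length \<beta>s) = d + - 2" by simp
  qed
  assume \<eta>: "\<eta> \<in> GF"
  have "sgn_pow (- 2 * d) = 1"
    using sgn_pow_even[of "- d"] by simp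
  then show "HB \<beta> (\<xi> \<cdot> \<eta>) = HB \<beta> \<xi> \<cdot> \<eta> + sgn_pow (- 2 * d) *\<^sub>R (\<xi> \<cdot> HB \<beta> \<eta>)"
    using \<xi> \<eta> by (simp add: HB_def GF_wedge iB_wedge)
qed (simp_all add: HB_def GF_iB GF_scaleR GF_add iB_linear)

lemma HQ_derivation: "HQ q \<in> derivations S (- 1)"
proof (rule derivationsI)
  fix \<xi> \<eta> d assume \<xi>: "\<xi> \<in> GF" "homogeneous d \<xi>"
  show "homogeneous (d + - 1) (HQ q \<xi>)"
    unfolding homogeneous_def
  proof (intro allI impI)
    fix qs \<beta>s assume "HQ q \<xi> qs \<beta>s \<noteq> 0"
    then have "\<xi> (q # qs) \<beta>s \<noteq> 0" using \<xi>(1) by (simp add: HQ_def iQ_def)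
    from homogeneousD[OF \<xi>(2) this] show "int (length qs) + 2 * int (length \<beta>s) = d + - 1" by simp
  qed
  assume \<eta>: "\<eta> \<in> GF"
  show "HQ q (\<xi> \<cdot> \<eta>) = HQ q \<xi> \<cdot> \<eta> + sgn_pow (- 1 * d) *\<^sub>R (\<xi> \<cdot> HQ q \<eta>)"
    using \<xi> \<eta> sgn_pow_minus[of d]
    by (simp add: HQ_def GF_wedge iQ_wedge parity_homogeneous wedge_scaleR_left)
qed (simp_all add: HQ_def GF_iQ GF_scaleR GF_add iQ_linear)

lemma HB_eval:
  assumes "\<beta> \<in> secBd S"
  shows "f \<in> Cinf S \<Longrightarrow> HB \<beta> (deg0 S f) = 0" "HB \<beta> (genQ S \<tau>) = 0"
    "b \<in> secB S \<Longrightarrow> HB \<beta> (genB S b) = deg0 S \<langle>\<beta>, b\<rangle>"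
  by (rule form_eqI, use assms in \<open>simp add: HB_def iB_def deg0_apply genQ_apply genB_apply form_apply forms_genB\<close>)+

lemma HQ_eval:
  assumes "q \<in> secQ S"
  shows "f \<in> Cinf S \<Longrightarrow> HQ q (deg0 S f) = 0" "\<tau> \<in> secQd S \<Longrightarrow> HQ q (genQ S \<tau>) = deg0 S \<langle>\<tau>, q\<rangle>"
    "HQ q (genB S b) = 0"
  by (rule form_eqI, use assms in \<open>simp add: HQ_def iQ_def deg0_apply genQ_apply genB_apply form_apply forms_genQ\<close>)+

lemma hat_family_HB: "hat_family S (secBd S) (- 2) HB"
  unfolding hat_family_def
proof (intro conjI ballI smod_secBd HB_derivation)
  fix \<beta> assume \<beta>: "\<beta> \<in> secBd S"
  show "HB (\<beta> + \<gamma>) = HB \<beta> + HB \<gamma>" if "\<gamma> \<in> secBd S" for \<gamma>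
  proof (rule ext, rule form_eqI)
    fix \<eta> qs \<beta>s
    show "HB (\<beta> + \<gamma>) \<eta> qs \<beta>s = (HB \<beta> + HB \<gamma>) \<eta> qs \<beta>s"
    proof (cases "\<eta> \<in> GF")
      case True
      note T = tensorialD(3)[OF formsD(1)[OF True[unfolded GF_forms] smod_Cinf], of qs]
      show ?thesis
        using True multilinearD(2)[OF T \<beta> that, of "[]" \<beta>s] by (simp add: HB_def iB_def operator_apply form_apply)
    qed (simp add: HB_def operator_apply)
  qed
  show "HB (f \<odot> \<beta>) = vf_act (deg0 S f) (HB \<beta>)" if "f \<in> Cinf S" for f
  proof (rule ext, rule form_eqI)
    fix \<eta> qs \<beta>s
    show "HB (f \<odot> \<beta>) \<eta> qs \<beta>s = vf_act (deg0 S f) (HB \<beta>) \<eta> qs \<beta>s"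
    proof (cases "\<eta> \<in> GF")
      case True
      note T = tensorialD(3)[OF formsD(1)[OF True[unfolded GF_forms] smod_Cinf], of qs]
      show ?thesis
        using True multilinearD(3)[OF T \<beta> that, of "[]" \<beta>s] by (simp add: HB_def iB_def vf_act_def deg0_wedge)
    qed (simp add: HB_def vf_act_def wedge_zero_right)
  qed
qed

lemma hat_family_HQ: "hat_family S (secQ S) (- 1) HQ"
  unfolding hat_family_def
proof (intro conjI ballI smod_secQ HQ_derivation)
  fix q assume q: "q \<in> secQ S"
  show "HQ (q + r) = HQ q + HQ r" if "r \<in> secQ S" for r
  proof (rule ext, rule form_eqI)
    fix \<eta> qs \<beta>s
    show "HQ (q + r) \<eta> qs \<beta>s = (HQ q + HQ r) \<eta> qs \<beta>s"
    proof (cases "\<eta> \<in> GF")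
      case True
      note T = tensorialD(1)[OF formsD(1)[OF True[unfolded GF_forms] smod_Cinf], of \<beta>s]
      show ?thesis
        using True multilinearD(2)[OF T q that, of "[]" qs] by (simp add: HQ_def iQ_def operator_apply form_apply)
    qed (simp add: HQ_def operator_apply)
  qed
  show "HQ (f \<odot> q) = vf_act (deg0 S f) (HQ q)" if "f \<in> Cinf S" for f
  proof (rule ext, rule form_eqI)
    fix \<eta> qs \<beta>s
    show "HQ (f \<odot> q) \<eta> qs \<beta>s = vf_act (deg0 S f) (HQ q) \<eta> qs \<beta>s"
    proof (cases "\<eta> \<in> GF")
      case True
      note T = tensorialD(1)[OF formsD(1)[OF True[unfolded GF_forms] smod_Cinf], of \<beta>s]
      show ?thesis
        using True multilinearD(3)[OF T q that, of "[]" qs] by (simp add: HQ_def iQ_def vf_act_def deg0_wedge)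
    qed (simp add: HQ_def vf_act_def wedge_zero_right)
  qed
qed

end

locale lie_data_conn = lie_data S
  for S :: "('m::{t2_space,second_countable_topology}, 'q::real_vector, 'b::real_vector) split_data" +
  fixes nab :: "('m, 'q, 'b) conn_pair"
  assumes connections: "connection_pair S nab"
begin

lemmas connQ = connectionD[OF conjunct1[OF connections[unfolded connection_pair_def]]]
  and connB = connectionD[OF conjunct2[OF connections[unfolded connection_pair_def]]]

text \<open>As a function of one list, \<open>HT\<close> is a covariant derivative in that list plus
  a term in which the list is only a parameter. \<open>eqQ\<close> and \<open>eqB\<close> write the
  same formula from these two points of view.\<close>

lemma HT_tensorial:
  assumes X: "X \<in> vfields S" and \<eta>: "\<eta> \<in> GF"
  shows "tensorial S (HT nab X \<eta>)"
proof -
  note E = formsD[OF \<eta>[unfolded GF_forms] smod_Cinf]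
  note T = tensorialD[OF E(1)]
  have d0: "lie_deriv X 0 = 0"
    using vfieldD(4)[OF X const_smooth, of 0 0] by simp
  have d1: "lie_deriv X (f \<odot> s) = f \<odot> lie_deriv X s + lie_deriv X f \<odot> s" if "f \<in> Cinf S" "s \<in> Cinf S" for f s
    using vfieldD(3)[OF X that] by (simp add: fscale_real add.commute)
  have eqQ: "(\<lambda>qs. HT nab X \<eta> qs \<beta>s) = (\<lambda>qs. if set \<beta>s \<subseteq> secBd S then
      (if set qs \<subseteq> secQ S then lie_deriv X (\<eta> qs \<beta>s) - list_deriv (fst nab X) (\<lambda>l. \<eta> l \<beta>s) qs else 0) +
      - 1 *\<^sub>R list_deriv (snd nab X) (\<lambda>l. \<eta> qs l) \<beta>s else 0)" for \<beta>s
  proof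
    fix qs
    \<comment> \<open>The parameter term vanishes for inadmissible \<open>qs\<close>, so the formula
      also yields the prescribed value 0 there.\<close>
    have "list_deriv (snd nab X) (\<eta> qs) \<beta>s = 0" if "\<not> set qs \<subseteq> secQ S"
      by (rule list_deriv_eq_zero) (use multilinearD(1)[OF T(1) that] in simp)
    then show "HT nab X \<eta> qs \<beta>s = (if set \<beta>s \<subseteq> secBd S then
      (if set qs \<subseteq> secQ S then lie_deriv X (\<eta> qs \<beta>s) - list_deriv (fst nab X) (\<lambda>l. \<eta> l \<beta>s) qs else 0) +
      - 1 *\<^sub>R list_deriv (snd nab X) (\<lambda>l. \<eta> qs l) \<beta>s else 0)"
      using \<eta> by (simp add: HT_def args_def)
  qed
  have eqB: "HT nab X \<eta> qs = (\<lambda>\<beta>s. if set qs \<subseteq> secQ S then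
      (if set \<beta>s \<subseteq> secBd S then lie_deriv X (\<eta> qs \<beta>s) - list_deriv (snd nab X) (\<lambda>l. \<eta> qs l) \<beta>s else 0) +
      - 1 *\<^sub>R list_deriv (fst nab X) (\<lambda>l. \<eta> l \<beta>s) qs else 0)" for qs
  proof
    fix \<beta>s
    have "list_deriv (fst nab X) (\<lambda>l. \<eta> l \<beta>s) qs = 0" if "\<not> set \<beta>s \<subseteq> secBd S"
      by (rule list_deriv_eq_zero) (use multilinearD(1)[OF T(3) that] in simp)
    then show "HT nab X \<eta> qs \<beta>s = (if set qs \<subseteq> secQ S then
      (if set \<beta>s \<subseteq> secBd S then lie_deriv X (\<eta> qs \<beta>s) - list_deriv (snd nab X) (\<lambda>l. \<eta> qs l) \<beta>s else 0) +
      - 1 *\<^sub>R list_deriv (fst nab X) (\<lambda>l. \<eta> l \<beta>s) qs else 0)"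
      using \<eta> by (simp add: HT_def args_def)
  qed
  have ml: "multilinear C \<Gamma> (\<lambda>xs. if P then F xs + - 1 *\<^sub>R G xs else 0)"
    if "multilinear C \<Gamma> F" "multilinear C \<Gamma> G" for C and \<Gamma> :: "('m \<Rightarrow> 'x::real_vector) set" and F G :: "_ \<Rightarrow> 'm \<Rightarrow> real" and P
    using that unfolding multilinear_def by (simp add: fscale_add_right fscale_diff_right)
  have al: "alternating (\<lambda>xs. if P then F xs + - 1 *\<^sub>R G xs else 0)"
    if "alternating F" "alternating G" for F G :: "_ \<Rightarrow> 'm \<Rightarrow> real" and P
    using that unfolding alternating_def by simp
  have sy: "symmetric (\<lambda>xs. if P then F xs + - 1 *\<^sub>R G xs else 0)"
    if "symmetric F" "symmetric G" for F G :: "_ \<Rightarrow> 'm \<Rightarrow> real" and P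
    using that unfolding symmetric_def by auto
  show ?thesis
    unfolding tensorial_def
  proof (intro conjI allI)
    show "multilinear (Cinf S) (secQ S) (\<lambda>qs. HT nab X \<eta> qs \<beta>s)" for \<beta>s
      unfolding eqQ
      by (intro ml multilinear_of_list_deriv T(1)
          multilinear_covariant[where F="\<lambda>qs. \<eta> qs \<beta>s" and \<delta>="lie_deriv X" and d="lie_deriv X" and X="Cinf S", OF smod_secQ T(1) E(2) d0 vfieldD(2)[OF X] d1 vfieldD(1)[OF X] connQ(1,3,5)[OF X]])
    show "alternating (\<lambda>qs. HT nab X \<eta> qs \<beta>s)" for \<beta>s
      unfolding eqQ
      by (intro al alternating_of_list_deriv T(2) alternating_covariant[where F="\<lambda>qs. \<eta> qs \<beta>s" and \<delta>="lie_deriv X", OF smod_secQ T(1,2) d0])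
    show "multilinear (Cinf S) (secBd S) (HT nab X \<eta> qs)" for qs
      unfolding eqB
      by (intro ml multilinear_of_list_deriv T(3)
          multilinear_covariant[where F="\<eta> qs" and \<delta>="lie_deriv X" and d="lie_deriv X" and X="Cinf S", OF smod_secBd T(3) E(2) d0 vfieldD(2)[OF X] d1 vfieldD(1)[OF X] connB(1,3,5)[OF X]])
    show "symmetric (HT nab X \<eta> qs)" for qs
      unfolding eqB
      by (intro sy symmetric_of_list_deriv T(4) symmetric_covariant[where F="\<eta> qs" and \<delta>="lie_deriv X"])
  qed
qed

lemma lie_deriv_zero: "X \<in> vfields S \<Longrightarrow> lie_deriv X 0 = 0"
  using vfieldD(4)[OF _ const_smooth, of X 0 0] by simp

lemma HT_eq_zero:
  assumes X: "X \<in> vfields S"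
    and zero: "\<And>l l'. length l = length qs \<Longrightarrow> length l' = length \<beta>s \<Longrightarrow> \<eta> l l' = 0"
  shows "HT nab X \<eta> qs \<beta>s = 0"
proof -
  have "list_deriv (fst nab X) (\<lambda>l. \<eta> l \<beta>s) qs = 0" "list_deriv (snd nab X) (\<lambda>l. \<eta> qs l) \<beta>s = 0"
    by (rule list_deriv_eq_zero, simp add: zero)+
  then show ?thesis
    by (simp add: HT_def zero lie_deriv_zero[OF X] form_apply)
qed

lemma HT_value:
  assumes X: "X \<in> vfields S" and \<eta>: "\<eta> \<in> GF"
  shows "HT nab X \<eta> qs \<beta>s \<in> Cinf S"
proof -
  note V = formsD(2)[OF \<eta>[unfolded GF_forms] smod_Cinf]
  have "lie_deriv X (\<eta> qs \<beta>s) - list_deriv (fst nab X) (\<lambda>l. \<eta> l \<beta>s) qs - list_deriv (snd nab X) (\<lambda>l. \<eta> qs l) \<beta>s \<in> Cinf S"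
    by (intro smod_diff[OF smod_Cinf] list_deriv_closed[OF smod_Cinf] V vfieldD(1)[OF X])
  then show ?thesis
    using \<eta> cmoduleD(1)[OF smod_Cinf] by (simp add: HT_def)
qed

lemma HT_GF:
  assumes X: "X \<in> vfields S" and \<eta>: "\<eta> \<in> GF"
  shows "HT nab X \<eta> \<in> GF"
proof -
  obtain N where N: "bounded_degree N \<eta>"
    using formsD(3)[OF \<eta>[unfolded GF_forms] smod_Cinf] by blast
  have "bounded_degree N (HT nab X \<eta>)"
    unfolding bounded_degree_def
  proof (intro allI impI, rule ccontr)
    fix qs \<beta>s assume "HT nab X \<eta> qs \<beta>s \<noteq> 0" and gt: "\<not> length qs + 2 * length \<beta>s \<le> N"
    moreover have "HT nab X \<eta> qs \<beta>s = 0"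
    proof (rule HT_eq_zero[OF X])
      fix l :: "('m \<Rightarrow> 'q) list" and l' :: "('m \<Rightarrow> 'b \<Rightarrow> real) list"
      assume "length l = length qs" "length l' = length \<beta>s"
      then show "\<eta> l l' = 0" using N gt unfolding bounded_degree_def by metis
    qed
    ultimately show False by simp
  qed
  then show ?thesis
    unfolding GF_forms by (rule formsI[OF smod_Cinf HT_tensorial[OF X \<eta>] HT_value[OF X \<eta>]])
qed

text \<open>The derivative of the values and the two corrections satisfy the Leibniz rule separately
  (\<open>A\<close>, \<open>B\<close>, \<open>C\<close> in the proof). Lists that arise by shuffling
  admissible lists are admissible, so the defining formula applies to both factors.\<close>

lemma HT_wedge:
  assumes X: "X \<in> vfields S" and \<xi>: "\<xi> \<in> GF" and \<eta>: "\<eta> \<in> GF"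
  shows "HT nab X (\<xi> \<cdot> \<eta>) = HT nab X \<xi> \<cdot> \<eta> + \<xi> \<cdot> HT nab X \<eta>"
proof (rule form_eqI)
  fix qs \<beta>s
  note V = formsD(2)[OF \<xi>[unfolded GF_forms] smod_Cinf] and W = formsD(2)[OF \<eta>[unfolded GF_forms] smod_Cinf]
  have \<xi>\<eta>: "\<xi> \<cdot> \<eta> \<in> GF" by (rule GF_wedge[OF \<xi> \<eta>])
  show "HT nab X (\<xi> \<cdot> \<eta>) qs \<beta>s = (HT nab X \<xi> \<cdot> \<eta> + \<xi> \<cdot> HT nab X \<eta>) qs \<beta>s"
  proof (cases "args S qs \<beta>s")
    case True
    define g h where "g = fst nab X" and "h = snd nab X"
    have lie: "lie_deriv X ((\<xi> \<cdot> \<eta>) qs \<beta>s) = shuffle (\<lambda>a b c d. lie_deriv X (\<xi> a b \<odot> \<eta> c d)) qs \<beta>s"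
      unfolding wedge_apply
      by (rule shuffle_closed_hom(2)[OF closed_linear_smod[OF smod_Cinf]])
        (simp_all add: vfieldD(2,4)[OF X] cmoduleD(3)[OF smod_Cinf] V W)
    define A where "A = (\<lambda>a b c d. lie_deriv X (\<xi> a b) \<odot> \<eta> c d + \<xi> a b \<odot> lie_deriv X (\<eta> c d))"
    define B where "B = (\<lambda>a b c d. list_deriv g (\<lambda>l. \<xi> l b) a \<odot> \<eta> c d + \<xi> a b \<odot> list_deriv g (\<lambda>l. \<eta> l d) c)"
    define C where "C = (\<lambda>a b c d. list_deriv h (\<lambda>l. \<xi> a l) b \<odot> \<eta> c d + \<xi> a b \<odot> list_deriv h (\<lambda>l. \<eta> c l) d)"
    have 1: "lie_deriv X ((\<xi> \<cdot> \<eta>) qs \<beta>s) = shuffle A qs \<beta>s"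
      using lie by (simp add: fscale_real vfieldD(3)[OF X] V W A_def)
    have hom_l: "list_deriv k (\<lambda>l. F l \<odot> s) xs = list_deriv k F xs \<odot> s"
      for k :: "'z \<Rightarrow> 'z" and F :: "'z list \<Rightarrow> 'm \<Rightarrow> real" and s :: "'m \<Rightarrow> real" and xs
      by (rule list_deriv_hom[of "\<lambda>f. f \<odot> s", symmetric]) (simp_all add: fscale_add_left)
    have 2: "list_deriv g (\<lambda>l. (\<xi> \<cdot> \<eta>) l \<beta>s) qs = shuffle B qs \<beta>s"
      unfolding wedge_apply list_deriv_shuffle_left hom_l list_deriv_fscale B_def ..
    have 3: "list_deriv h (\<lambda>l. (\<xi> \<cdot> \<eta>) qs l) \<beta>s = shuffle C qs \<beta>s"
      unfolding wedge_apply list_deriv_shuffle_right hom_l list_deriv_fscale C_def ..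
    have "(HT nab X \<xi> \<cdot> \<eta> + \<xi> \<cdot> HT nab X \<eta>) qs \<beta>s =
        shuffle (\<lambda>a b c d. HT nab X \<xi> a b \<odot> \<eta> c d + \<xi> a b \<odot> HT nab X \<eta> c d) qs \<beta>s"
      by (simp add: form_apply wedge_apply shuffle_add)
    also have "\<dots> = shuffle (\<lambda>a b c d. A a b c d + - 1 *\<^sub>R B a b c d + - 1 *\<^sub>R C a b c d) qs \<beta>s"
    proof (rule shuffle_cong, goal_cases)
      case (1 a b c d)
      then have args: "args S a b" "args S c d"
        using True by (auto simp: args_def)
      have diff: "(u - v) \<odot> w = u \<odot> w - v \<odot> w" for u v w :: "'m \<Rightarrow> real"
        by (simp add: fscale_real left_diff_distrib)
      show ?case
        using \<xi> \<eta> args by (simp add: HT_def g_def h_def diff fscale_diff_right A_def B_def C_def)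
    qed
    also have "\<dots> = shuffle A qs \<beta>s - shuffle B qs \<beta>s - shuffle C qs \<beta>s"
      unfolding shuffle_add shuffle_scaleR by simp
    also have "\<dots> = HT nab X (\<xi> \<cdot> \<eta>) qs \<beta>s"
      unfolding 1[symmetric] 2[symmetric] 3[symmetric] using True \<xi>\<eta> by (simp add: HT_def g_def h_def)
    finally show ?thesis by simp
  next
    case False
    have "HT nab X \<xi> \<cdot> \<eta> \<in> GF" "\<xi> \<cdot> HT nab X \<eta> \<in> GF"
      by (intro GF_wedge HT_GF X \<xi> \<eta>)+
    then show ?thesis
      using False by (simp add: HT_def forms_args form_apply GF_forms)
  qed
qed

lemma HT_derivation:
  assumes X: "X \<in> vfields S"
  shows "HT nab X \<in> derivations S 0"
proof (rule derivationsI)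
  show "HT nab X \<xi> = 0" if "\<xi> \<notin> GF" for \<xi>
    using that by (simp add: HT_def)
  show "HT nab X \<xi> \<in> GF" if "\<xi> \<in> GF" for \<xi>
    by (rule HT_GF[OF X that])
  show "HT nab X (c *\<^sub>R \<xi>) = c *\<^sub>R HT nab X \<xi>" if "\<xi> \<in> GF" for c \<xi>
    using that GF_scaleR[OF that]
    by (intro form_eqI) (simp add: HT_def form_apply form_apply_partial list_deriv_scaleR scaleR_right_diff_distrib
        vfieldD(4)[OF X] formsD(2)[OF that[unfolded GF_forms] smod_Cinf])
  show "HT nab X (\<xi> + \<eta>) = HT nab X \<xi> + HT nab X \<eta>" if "\<xi> \<in> GF" "\<eta> \<in> GF" for \<xi> \<eta>
    using that GF_add[OF that]
    by (intro form_eqI) (simp add: HT_def form_apply form_apply_partial list_deriv_add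
        vfieldD(2)[OF X] formsD(2)[OF that(1)[unfolded GF_forms] smod_Cinf] formsD(2)[OF that(2)[unfolded GF_forms] smod_Cinf])
  show "homogeneous (d + 0) (HT nab X \<xi>)" if "\<xi> \<in> GF" "homogeneous d \<xi>" for \<xi> d
    unfolding homogeneous_def
  proof (intro allI impI, rule ccontr)
    fix qs \<beta>s assume "HT nab X \<xi> qs \<beta>s \<noteq> 0" and ne: "int (length qs) + 2 * int (length \<beta>s) \<noteq> d + 0"
    moreover have "HT nab X \<xi> qs \<beta>s = 0"
    proof (rule HT_eq_zero[OF X], rule ccontr)
      fix l :: "('m \<Rightarrow> 'q) list" and l' :: "('m \<Rightarrow> 'b \<Rightarrow> real) list"
      assume "length l = length qs" "length l' = length \<beta>s" "\<xi> l l' \<noteq> 0"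
      then show False using homogeneousD[OF that(2), of l l'] ne by simp
    qed
    ultimately show False by simp
  qed
  show "HT nab X (\<xi> \<cdot> \<eta>) = HT nab X \<xi> \<cdot> \<eta> + sgn_pow (0 * d) *\<^sub>R (\<xi> \<cdot> HT nab X \<eta>)"
    if "\<xi> \<in> GF" "homogeneous d \<xi>" "\<eta> \<in> GF" for \<xi> \<eta> d
    using HT_wedge[OF X that(1,3)] by simp
qed

lemma HT_deg0:
  assumes X: "X \<in> vfields S" and f: "f \<in> Cinf S"
  shows "HT nab X (deg0 S f) = deg0 S (lie_deriv X f)"
proof (rule form_eqI)
  fix qs \<beta>s
  show "HT nab X (deg0 S f) qs \<beta>s = deg0 S (lie_deriv X f) qs \<beta>s"
  proof (cases "qs = [] \<and> \<beta>s = []")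
    case True
    then show ?thesis
      using GF_deg0[OF f] by (simp add: HT_def deg0_apply args_def)
  next
    case False
    then have "HT nab X (deg0 S f) qs \<beta>s = 0"
      by (intro HT_eq_zero[OF X]) (auto simp: deg0_apply)
    then show ?thesis using False by (auto simp: deg0_apply)
  qed
qed

lemma HT_genQ:
  assumes X: "X \<in> vfields S" and \<tau>: "\<tau> \<in> secQd S"
  shows "HT nab X (genQ S \<tau>) qs \<beta>s = (if \<beta>s = [] \<and> length qs = 1 \<and> hd qs \<in> secQ S
    then lie_deriv X \<langle>\<tau>, hd qs\<rangle> - \<langle>\<tau>, fst nab X (hd qs)\<rangle> else 0)"
proof (cases "\<beta>s = [] \<and> length qs = 1")
  case True
  then obtain q where qs: "qs = [q]" by (cases qs) auto
  show ?thesis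
    using True qs forms_genQ[OF \<tau>] connQ(1)[OF X, of q] by (simp add: HT_def genQ_apply args_def)
next
  case False
  then have "HT nab X (genQ S \<tau>) qs \<beta>s = 0"
    by (intro HT_eq_zero[OF X]) (auto simp: genQ_apply)
  then show ?thesis using False by auto
qed

lemma HT_genB:
  assumes X: "X \<in> vfields S" and b: "b \<in> secB S"
  shows "HT nab X (genB S b) qs \<beta>s = (if qs = [] \<and> length \<beta>s = 1 \<and> hd \<beta>s \<in> secBd S
    then lie_deriv X \<langle>hd \<beta>s, b\<rangle> - \<langle>snd nab X (hd \<beta>s), b\<rangle> else 0)"
proof (cases "qs = [] \<and> length \<beta>s = 1")
  case True
  then obtain \<beta> where \<beta>s: "\<beta>s = [\<beta>]" by (cases \<beta>s) auto
  show ?thesis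
    using True \<beta>s forms_genB[OF b] connB(1)[OF X, of \<beta>] by (simp add: HT_def genB_apply args_def)
next
  case False
  then have "HT nab X (genB S b) qs \<beta>s = 0"
    by (intro HT_eq_zero[OF X]) (auto simp: genB_apply)
  then show ?thesis using False by auto
qed

lemma hat_family_HT: "hat_family S (vfields S) 0 (HT nab)"
  unfolding hat_family_def
proof (intro conjI ballI smod_vfields HT_derivation)
  fix X assume X: "X \<in> vfields S"
  show "HT nab (X + Y) = HT nab X + HT nab Y" if Y: "Y \<in> vfields S" for Y
  proof (rule ext, rule form_eqI)
    fix \<eta> qs \<beta>s
    show "HT nab (X + Y) \<eta> qs \<beta>s = (HT nab X + HT nab Y) \<eta> qs \<beta>s"
    proof (cases "\<eta> \<in> GF \<and> args S qs \<beta>s")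
      case True
      note T = tensorialD[OF formsD(1)[OF conjunct1[OF True, unfolded GF_forms] smod_Cinf]]
      have "list_deriv (fst nab (X + Y)) (\<lambda>l. \<eta> l \<beta>s) qs =
          list_deriv (fst nab X) (\<lambda>l. \<eta> l \<beta>s) qs + list_deriv (fst nab Y) (\<lambda>l. \<eta> l \<beta>s) qs"
        by (rule list_deriv_add_arg[OF T(1)]) (use True X Y in \<open>auto simp: args_def connQ\<close>)
      moreover have "list_deriv (snd nab (X + Y)) (\<lambda>l. \<eta> qs l) \<beta>s =
          list_deriv (snd nab X) (\<lambda>l. \<eta> qs l) \<beta>s + list_deriv (snd nab Y) (\<lambda>l. \<eta> qs l) \<beta>s"
        by (rule list_deriv_add_arg[OF T(3)]) (use True X Y in \<open>auto simp: args_def connB\<close>)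
      ultimately show ?thesis
        using True by (simp add: HT_def operator_apply form_apply lie_deriv_linear)
    qed (auto simp: HT_def operator_apply form_apply)
  qed
  show "HT nab (f \<odot> X) = vf_act (deg0 S f) (HT nab X)" if f: "f \<in> Cinf S" for f
  proof (rule ext, rule form_eqI)
    fix \<eta> qs \<beta>s
    show "HT nab (f \<odot> X) \<eta> qs \<beta>s = vf_act (deg0 S f) (HT nab X) \<eta> qs \<beta>s"
    proof (cases "\<eta> \<in> GF \<and> args S qs \<beta>s")
      case True
      note T = tensorialD[OF formsD(1)[OF conjunct1[OF True, unfolded GF_forms] smod_Cinf]]
      have "list_deriv (fst nab (f \<odot> X)) (\<lambda>l. \<eta> l \<beta>s) qs = f \<odot> list_deriv (fst nab X) (\<lambda>l. \<eta> l \<beta>s) qs"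
        by (rule list_deriv_fscale_arg[OF T(1) _ f]) (use True X f in \<open>auto simp: args_def connQ\<close>)
      moreover have "list_deriv (snd nab (f \<odot> X)) (\<lambda>l. \<eta> qs l) \<beta>s = f \<odot> list_deriv (snd nab X) (\<lambda>l. \<eta> qs l) \<beta>s"
        by (rule list_deriv_fscale_arg[OF T(3) _ f]) (use True X f in \<open>auto simp: args_def connB\<close>)
      ultimately show ?thesis
        using True by (simp add: HT_def vf_act_def deg0_wedge lie_deriv_linear fscale_diff_right)
    qed (auto simp: HT_def vf_act_def deg0_wedge form_apply)
  qed
qed

end

section \<open>The module of triples and its graded linear maps\<close>

lemma ext_hat_zero:
  assumes "hat_family S \<Gamma> j H"
  shows "ext_hat H 0 \<eta> = 0"
  by (rule form_eqI) (simp add: ext_hat_def form_apply hat_familyD(5)[OF assms])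

lemma adj_homogeneousD:
  assumes "adj_homogeneous d (\<Phi>T, \<Phi>Q, \<Phi>B)"
  shows "homogeneous d \<Phi>T" "homogeneous (d + 1) \<Phi>Q" "homogeneous (d + 2) \<Phi>B"
  using assms by (simp_all add: adj_homogeneous_def)

context lie_data
begin

abbreviation AM where "AM \<equiv> adj_module S"
abbreviation GVF where "GVF \<equiv> graded_vector_fields S"

lemma pairing_diffQ: "\<tau> \<in> secQd S \<Longrightarrow> q \<in> secQ S \<Longrightarrow> q' \<in> secQ S \<Longrightarrow> \<langle>\<tau>, q - q'\<rangle> = \<langle>\<tau>, q\<rangle> - \<langle>\<tau>, q'\<rangle>"
  using pairing_addQ[of \<tau> "q - q'" q'] smod_diff[OF smod_secQ, of q q'] by simp

lemma pairing_diff_left: "\<langle>\<beta> - \<gamma>, b\<rangle> = \<langle>\<beta>, b\<rangle> - \<langle>\<gamma>, b\<rangle>"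
  using pairing_add_left[of "\<beta> - \<gamma>" \<gamma> b] by simp

lemma pairing_zeroQ: "\<tau> \<in> secQd S \<Longrightarrow> \<langle>\<tau>, 0\<rangle> = 0"
  using pairing_addQ[of \<tau> 0 0] cmoduleD(1)[OF smod_secQ] by simp

lemma pairing_zero_left: "\<langle>0, b\<rangle> = 0"
  using pairing_add_left[of 0 0 b] by simp

text \<open>Contraction shows that the derivation described by \<open>hatQ\<close> exists, and
  values on generators determine it. The other two lifts are treated in the same way.\<close>

lemma hatQ_eq:
  assumes q: "q \<in> secQ S"
  shows "hatQ S q = HQ q"
  unfolding hatQ_def
proof (rule the_equality)
  show "HQ q \<in> derivations S (- 1) \<and> (\<forall>f\<in>Cinf S. HQ q (deg0 S f) = 0) \<and>
     (\<forall>\<tau>\<in>secQd S. HQ q (genQ S \<tau>) = deg0 S \<langle>\<tau>, q\<rangle>) \<and> (\<forall>b\<in>secB S. HQ q (genB S b) = 0)"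
    using HQ_derivation HQ_eval[OF q] by blast
next
  fix D assume "D \<in> derivations S (- 1) \<and> (\<forall>f\<in>Cinf S. D (deg0 S f) = 0) \<and>
     (\<forall>\<tau>\<in>secQd S. D (genQ S \<tau>) = deg0 S \<langle>\<tau>, q\<rangle>) \<and> (\<forall>b\<in>secB S. D (genB S b) = 0)"
  then show "D = HQ q"
    by (intro derivation_eqI[OF _ HQ_derivation]) (simp_all add: HQ_eval[OF q])
qed

lemma hatB_eq:
  assumes \<beta>: "\<beta> \<in> secBd S"
  shows "hatB S \<beta> = HB \<beta>"
  unfolding hatB_def
proof (rule the_equality)
  show "HB \<beta> \<in> derivations S (- 2) \<and> (\<forall>f\<in>Cinf S. HB \<beta> (deg0 S f) = 0) \<and>
     (\<forall>\<tau>\<in>secQd S. HB \<beta> (genQ S \<tau>) = 0) \<and> (\<forall>b\<in>secB S. HB \<beta> (genB S b) = deg0 S \<langle>\<beta>, b\<rangle>)"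
    using HB_derivation HB_eval[OF \<beta>] by blast
next
  fix D assume "D \<in> derivations S (- 2) \<and> (\<forall>f\<in>Cinf S. D (deg0 S f) = 0) \<and>
     (\<forall>\<tau>\<in>secQd S. D (genQ S \<tau>) = 0) \<and> (\<forall>b\<in>secB S. D (genB S b) = deg0 S \<langle>\<beta>, b\<rangle>)"
  then show "D = HB \<beta>"
    by (intro derivation_eqI[OF _ HB_derivation]) (simp_all add: HB_eval[OF \<beta>])
qed

text \<open>Explicit candidate for \<open>mu_nabla\<close>. It is 0 off the module because
  \<open>graded_extension\<close> fixes this value.\<close>

definition adj_map :: "('m, 'q, 'b) conn_pair \<Rightarrow> ('m, 'q, 'b) adj_elem \<Rightarrow> ('m, 'q, 'b) operator" where
  "adj_map nab \<Phi> = (if \<Phi> \<in> AM then (\<lambda>\<eta>. ext_hat (HT nab) (fst \<Phi>) \<eta> + ext_hat HQ (fst (snd \<Phi>)) \<eta> +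
     ext_hat HB (snd (snd \<Phi>)) \<eta>) else 0)"

lemma AM_iff: "(\<Phi>T, \<Phi>Q, \<Phi>B) \<in> AM \<longleftrightarrow>
    \<Phi>T \<in> forms S (vfields S) \<and> \<Phi>Q \<in> forms S (secQ S) \<and> \<Phi>B \<in> forms S (secBd S)"
  by (simp add: adj_module_def)

lemma AM_add: "\<Phi> \<in> AM \<Longrightarrow> \<Psi> \<in> AM \<Longrightarrow> \<Phi> + \<Psi> \<in> AM"
  by (cases \<Phi>; cases \<Psi>) (simp add: AM_iff forms_add smod_vfields smod_secQ smod_secBd)

lemma AM_zero: "0 \<in> AM"
  by (simp add: zero_prod_def AM_iff forms_zero smod_vfields smod_secQ smod_secBd)

lemma AM_scaleR: "\<Phi> \<in> AM \<Longrightarrow> r *\<^sub>R \<Phi> \<in> AM"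
  by (cases \<Phi>) (simp add: AM_iff forms_scaleR smod_vfields smod_secQ smod_secBd)

lemma AM_act: "\<xi> \<in> GF \<Longrightarrow> \<Phi> \<in> AM \<Longrightarrow> adj_act \<xi> \<Phi> \<in> AM"
  by (cases \<Phi>) (simp add: AM_iff adj_act_def forms_wedge smod_vfields smod_secQ smod_secBd)

lemma AM_sum: "(\<And>i. i \<in> I \<Longrightarrow> \<Phi> i \<in> AM) \<Longrightarrow> (\<Sum>i\<in>I. \<Phi> i) \<in> AM"
  by (induction I rule: infinite_finite_induct) (simp_all add: AM_zero AM_add)

lemma adjT_AM: "X \<in> vfields S \<Longrightarrow> adjT S X \<in> AM"
  and adjQ_AM: "q \<in> secQ S \<Longrightarrow> adjQ S q \<in> AM"
  and adjB_AM: "\<beta> \<in> secBd S \<Longrightarrow> adjB S \<beta> \<in> AM"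
  by (simp_all add: AM_iff adjT_def adjQ_def adjB_def forms_deg0 forms_zero smod_vfields smod_secQ smod_secBd)

lemma AM_homogeneous_sum:
  assumes "\<Phi> \<in> AM"
  obtains K \<Phi>' where "finite K" "\<Phi> = (\<Sum>d\<in>K. \<Phi>' d)" "\<And>d. \<Phi>' d \<in> AM" "\<And>d. adj_homogeneous d (\<Phi>' d)"
proof -
  obtain \<Phi>T \<Phi>Q \<Phi>B where \<Phi>: "\<Phi> = (\<Phi>T, \<Phi>Q, \<Phi>B)" by (cases \<Phi>)
  have F: "\<Phi>T \<in> forms S (vfields S)" "\<Phi>Q \<in> forms S (secQ S)" "\<Phi>B \<in> forms S (secBd S)"
    using assms \<Phi> by (simp_all add: AM_iff)
  obtain NT NQ NB where N: "bounded_degree NT \<Phi>T" "bounded_degree NQ \<Phi>Q" "bounded_degree NB \<Phi>B"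
    using formsD(3)[OF F(1) smod_vfields] formsD(3)[OF F(2) smod_secQ] formsD(3)[OF F(3) smod_secBd] by blast
  define N where "N = NT + NQ + NB"
  have bd: "bounded_degree N \<Phi>T" "bounded_degree N \<Phi>Q" "bounded_degree N \<Phi>B"
    using N unfolding bounded_degree_def N_def by (meson le_add1 le_add2 le_trans)+
  define \<Phi>' where "\<Phi>' d = (degree_part d \<Phi>T, degree_part (d + 1) \<Phi>Q, degree_part (d + 2) \<Phi>B)" for d :: int
  \<comment> \<open>A triple of degree \<open>d\<close> has components of degrees \<open>d\<close>,
    \<open>d + 1\<close> and \<open>d + 2\<close>. The summation therefore starts at -2, where the
    third component can already be nonzero.\<close>
  have shift: "(\<Sum>d\<in>{- 2..int N}. degree_part (d + j) \<Psi>) = \<Psi>"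
    if "bounded_degree N \<Psi>" "j \<in> {0, 1, 2}" for \<Psi> :: "('m, 'q, 'b, 'e::real_vector) form" and j :: int
  proof -
    have "(\<Sum>d\<in>{- 2..int N}. degree_part (d + j) \<Psi>) = (\<Sum>d\<in>{- 2 + j..int N + j}. degree_part d \<Psi>)"
      by (rule sum.reindex_bij_witness[of _ "\<lambda>d. d - j" "\<lambda>d. d + j"]) auto
    also have "\<dots> = (\<Sum>d\<in>{0..int N}. degree_part d \<Psi>)"
    proof (rule sum.mono_neutral_right)
      show "{0..int N} \<subseteq> {- 2 + j..int N + j}" using that(2) by auto
      show "\<forall>d\<in>{- 2 + j..int N + j} - {0..int N}. degree_part d \<Psi> = 0"
      proof
        fix d assume d: "d \<in> {- 2 + j..int N + j} - {0..int N}"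
        show "degree_part d \<Psi> = 0"
        proof (rule form_eqI, unfold form_apply, rule ccontr)
          fix qs \<beta>s assume "degree_part d \<Psi> qs \<beta>s \<noteq> 0"
          then have "int (length qs) + 2 * int (length \<beta>s) = d" "\<Psi> qs \<beta>s \<noteq> 0"
            by (auto simp: degree_part_def restrict_degree_def split: if_splits)
          moreover then have "length qs + 2 * length \<beta>s \<le> N"
            using that(1) unfolding bounded_degree_def by blast
          ultimately show False using d by auto
        qed
      qed
    qed simp
    also have "\<dots> = \<Psi>" by (rule sum_degree_part[OF that(1)])
    finally show ?thesis .
  qed
  have "\<Phi> = (\<Sum>d\<in>{- 2..int N}. \<Phi>' d)"
    using shift[OF bd(1), of 0] shift[OF bd(2), of 1] shift[OF bd(3), of 2]
    by (simp add: \<Phi> \<Phi>'_def sum_prod)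
  moreover have "\<Phi>' d \<in> AM" for d
    using F by (simp add: \<Phi>'_def AM_iff degree_part_def forms_restrict_degree smod_vfields smod_secQ smod_secBd)
  moreover have "adj_homogeneous d (\<Phi>' d)" for d
    by (simp add: \<Phi>'_def adj_homogeneous_def homogeneous_degree_part)
  ultimately show ?thesis using that[of "{- 2..int N}" \<Phi>'] by simp
qed

text \<open>Applied with \<open>\<iota>\<close> the inclusion of each of the three summands. The
  hypothesis \<open>loc\<close> says that elements of \<open>N\<close> are determined locally, which
  is what the local case of the induction asks for.\<close>

lemma graded_linear_unique_component:
  assumes h: "graded_linear S N act h" "graded_linear S N act h'"
    and loc: "\<And>n n'. n \<in> N \<Longrightarrow> n' \<in> N \<Longrightarrow>
      (\<And>x. \<exists>f\<in>Cinf S. f x \<noteq> 0 \<and> act (deg0 S f) n = act (deg0 S f) n') \<Longrightarrow> n = n'"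
    and \<Gamma>: "smod \<Gamma>" and \<iota>: "\<And>\<Phi>. \<Phi> \<in> forms S \<Gamma> \<Longrightarrow> \<iota> \<Phi> \<in> AM"
      "\<And>\<Phi> \<Psi>. \<iota> (\<Phi> + \<Psi>) = \<iota> \<Phi> + \<iota> \<Psi>" "\<And>\<xi> \<Phi>. \<iota> (\<xi> \<cdot> \<Phi>) = adj_act \<xi> (\<iota> \<Phi>)"
    and gen: "\<And>s. s \<in> \<Gamma> \<Longrightarrow> h (\<iota> (deg0 S s)) = h' (\<iota> (deg0 S s))" and \<Phi>: "\<Phi> \<in> forms S \<Gamma>"
  shows "h (\<iota> \<Phi>) = h' (\<iota> \<Phi>)"
proof -
  have lin: "h \<Phi> \<in> N" "h' \<Phi> \<in> N" "\<Psi> \<in> AM \<Longrightarrow> h (\<Phi> + \<Psi>) = h \<Phi> + h \<Psi>" "\<Psi> \<in> AM \<Longrightarrow> h' (\<Phi> + \<Psi>) = h' \<Phi> + h' \<Psi>"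
    "\<xi> \<in> GF \<Longrightarrow> h (adj_act \<xi> \<Phi>) = act \<xi> (h \<Phi>)" "\<xi> \<in> GF \<Longrightarrow> h' (adj_act \<xi> \<Phi>) = act \<xi> (h' \<Phi>)"
    if "\<Phi> \<in> AM" for \<Phi> \<Psi> \<xi>
    using h that unfolding graded_linear_def by blast+
  from \<Gamma> \<Phi> show ?thesis
  proof (induction rule: forms_induct)
    case (add \<Phi> \<Psi>)
    then show ?case by (simp add: \<iota> lin(3,4))
  next
    case (deg0 s)
    then show ?case by (rule gen)
  next
    case (genQ \<tau> \<Phi>)
    then show ?case by (simp add: \<iota> lin(5,6) forms_genQ)
  next
    case (genB b \<Phi>)
    then show ?case by (simp add: \<iota> lin(5,6) forms_genB)
  next
    case (local \<Phi>)
    note \<Phi> = \<iota>(1)[OF local(1)]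
    show ?case
    proof (rule loc[OF lin(1)[OF \<Phi>] lin(2)[OF \<Phi>]])
      fix x
      obtain f where "f \<in> Cinf S" "f x \<noteq> 0" "h (\<iota> (deg0 S f \<cdot> \<Phi>)) = h' (\<iota> (deg0 S f \<cdot> \<Phi>))"
        using local(2) by blast
      then show "\<exists>f\<in>Cinf S. f x \<noteq> 0 \<and> act (deg0 S f) (h (\<iota> \<Phi>)) = act (deg0 S f) (h' (\<iota> \<Phi>))"
        by (intro bexI[of _ f]) (simp_all add: \<iota>(3) lin(5,6)[OF \<Phi>] GF_deg0)
    qed
  qed
qed

lemma graded_extension_eq:
  assumes h: "graded_linear S N act h" "\<And>\<Phi>. \<Phi> \<notin> AM \<Longrightarrow> h \<Phi> = 0"
    and loc: "\<And>n n'. n \<in> N \<Longrightarrow> n' \<in> N \<Longrightarrow>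
      (\<And>x. \<exists>f\<in>Cinf S. f x \<noteq> 0 \<and> act (deg0 S f) n = act (deg0 S f) n') \<Longrightarrow> n = n'"
    and gen: "\<And>X. X \<in> vfields S \<Longrightarrow> h (adjT S X) = gT X" "\<And>q. q \<in> secQ S \<Longrightarrow> h (adjQ S q) = gQ q"
      "\<And>\<beta>. \<beta> \<in> secBd S \<Longrightarrow> h (adjB S \<beta>) = gB \<beta>"
  shows "graded_extension S N act gT gQ gB = h"
  unfolding graded_extension_def
proof (rule the_equality)
  show "graded_linear S N act h \<and> (\<forall>\<Phi>. \<Phi> \<notin> AM \<longrightarrow> h \<Phi> = 0) \<and> (\<forall>X\<in>vfields S. h (adjT S X) = gT X) \<and>
      (\<forall>q\<in>secQ S. h (adjQ S q) = gQ q) \<and> (\<forall>\<beta>\<in>secBd S. h (adjB S \<beta>) = gB \<beta>)"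
    using h gen by blast
next
  fix k assume k: "graded_linear S N act k \<and> (\<forall>\<Phi>. \<Phi> \<notin> AM \<longrightarrow> k \<Phi> = 0) \<and> (\<forall>X\<in>vfields S. k (adjT S X) = gT X) \<and>
      (\<forall>q\<in>secQ S. k (adjQ S q) = gQ q) \<and> (\<forall>\<beta>\<in>secBd S. k (adjB S \<beta>) = gB \<beta>)"
  then have kl: "graded_linear S N act k" by blast
  have T: "k (\<Phi>, 0, 0) = h (\<Phi>, 0, 0)" if "\<Phi> \<in> forms S (vfields S)" for \<Phi>
    by (rule graded_linear_unique_component[OF kl h(1) loc smod_vfields, where \<iota>="\<lambda>\<Phi>. (\<Phi>, 0, 0)"])
      (use that k gen(1) in \<open>simp_all add: AM_iff forms_zero smod_secQ smod_secBd adj_act_def wedge_zero_right adjT_def\<close>)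
  have Q: "k (0, \<Phi>, 0) = h (0, \<Phi>, 0)" if "\<Phi> \<in> forms S (secQ S)" for \<Phi>
    by (rule graded_linear_unique_component[OF kl h(1) loc smod_secQ, where \<iota>="\<lambda>\<Phi>. (0, \<Phi>, 0)"])
      (use that k gen(2) in \<open>simp_all add: AM_iff forms_zero smod_vfields smod_secBd adj_act_def wedge_zero_right adjQ_def\<close>)
  have B: "k (0, 0, \<Phi>) = h (0, 0, \<Phi>)" if "\<Phi> \<in> forms S (secBd S)" for \<Phi>
    by (rule graded_linear_unique_component[OF kl h(1) loc smod_secBd, where \<iota>="\<lambda>\<Phi>. (0, 0, \<Phi>)"])
      (use that k gen(3) in \<open>simp_all add: AM_iff forms_zero smod_vfields smod_secQ adj_act_def wedge_zero_right adjB_def\<close>)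
  show "k = h"
  proof
    fix \<Phi>
    show "k \<Phi> = h \<Phi>"
    proof (cases "\<Phi> \<in> AM")
      case True
      obtain \<Phi>T \<Phi>Q \<Phi>B where \<Phi>: "\<Phi> = (\<Phi>T, \<Phi>Q, \<Phi>B)" by (cases \<Phi>)
      have F: "\<Phi>T \<in> forms S (vfields S)" "\<Phi>Q \<in> forms S (secQ S)" "\<Phi>B \<in> forms S (secBd S)"
        using True \<Phi> by (simp_all add: AM_iff)
      have AM: "(\<Phi>T, 0, 0) \<in> AM" "(0, \<Phi>Q, 0) \<in> AM" "(0, 0, \<Phi>B) \<in> AM"
        using F by (simp_all add: AM_iff forms_zero smod_vfields smod_secQ smod_secBd)
      have split: "\<Phi> = (\<Phi>T, 0, 0) + ((0, \<Phi>Q, 0) + (0, 0, \<Phi>B))" by (simp add: \<Phi>)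
      have sp: "l \<Phi> = l (\<Phi>T, 0, 0) + (l (0, \<Phi>Q, 0) + l (0, 0, \<Phi>B))" if l: "graded_linear S N act l" for l
      proof -
        have add: "l (\<Psi> + \<Psi>') = l \<Psi> + l \<Psi>'" if "\<Psi> \<in> AM" "\<Psi>' \<in> AM" for \<Psi> \<Psi>'
          using l that unfolding graded_linear_def by blast
        show ?thesis by (simp only: split add[OF AM(1) AM_add[OF AM(2,3)]] add[OF AM(2,3)])
      qed
      show ?thesis by (simp only: sp[OF kl] sp[OF h(1)] T[OF F(1)] Q[OF F(2)] B[OF F(3)])
    next
      case False
      then have "k \<Phi> = 0" using k by blast
      then show ?thesis by (simp add: h(2)[OF False])
    qed
  qed
qed

text \<open>For fixed arguments \<open>L t\<close> is a functional linear in \<open>t\<close>, hence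
  given by a section. Since pairings separate sections, multilinearity, symmetry and degree of the
  resulting form are inherited from the forms \<open>L t\<close>.\<close>

lemma form_representation:
  assumes P: "dual_pair (Cinf S) F \<Gamma> F' \<Gamma>' pr"
    and L: "\<And>t. t \<in> \<Gamma>' \<Longrightarrow> L t \<in> GF" "\<And>t t'. t \<in> \<Gamma>' \<Longrightarrow> t' \<in> \<Gamma>' \<Longrightarrow> L (t + t') = L t + L t'"
      "\<And>f t. f \<in> Cinf S \<Longrightarrow> t \<in> \<Gamma>' \<Longrightarrow> L (f \<odot> t) = deg0 S f \<cdot> L t"
      "\<And>t. t \<in> \<Gamma>' \<Longrightarrow> homogeneous d (L t)"
  obtains \<Phi> where "\<Phi> \<in> forms S \<Gamma>" "homogeneous d \<Phi>"
    "\<And>t qs \<beta>s. t \<in> \<Gamma>' \<Longrightarrow> (\<lambda>x. pr (\<Phi> qs \<beta>s x) (t x)) = L t qs \<beta>s"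
proof -
  note P1 = local_moduleD[OF dual_pairD(1)[OF P]] and P2 = local_moduleD[OF dual_pairD(2)[OF P]]
  note \<Gamma> = P1(1)
  have "\<exists>s. s \<in> \<Gamma> \<and> (\<forall>t\<in>\<Gamma>'. (\<lambda>x. pr (s x) (t x)) = L t qs \<beta>s)" for qs \<beta>s
  proof -
    have 1: "L t qs \<beta>s \<in> Cinf S" if "t \<in> \<Gamma>'" for t
      using formsD(2)[OF L(1)[OF that, unfolded GF_forms] smod_Cinf] .
    have 2: "L (t + t') qs \<beta>s = L t qs \<beta>s + L t' qs \<beta>s" if "t \<in> \<Gamma>'" "t' \<in> \<Gamma>'" for t t'
      by (simp add: L(2)[OF that] form_apply)
    have 3: "L (f \<odot> t) qs \<beta>s = f * L t qs \<beta>s" if "f \<in> Cinf S" "t \<in> \<Gamma>'" for f t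
      by (simp add: L(3)[OF that] deg0_wedge fscale_real)
    show ?thesis
      by (rule dual_pair_representation[OF P, where L="\<lambda>t. L t qs \<beta>s", OF 1 2 3]) blast+
  qed
  then have ex: "\<forall>qs. \<forall>\<beta>s. \<exists>s. s \<in> \<Gamma> \<and> (\<forall>t\<in>\<Gamma>'. (\<lambda>x. pr (s x) (t x)) = L t qs \<beta>s)" by blast
  have "\<exists>\<Phi>. \<forall>qs \<beta>s. \<Phi> qs \<beta>s \<in> \<Gamma> \<and> (\<forall>t\<in>\<Gamma>'. (\<lambda>x. pr (\<Phi> qs \<beta>s x) (t x)) = L t qs \<beta>s)"
    using ex by (simp only: choice_iff)
  then obtain \<Phi> where \<Phi>: "\<And>qs \<beta>s. \<Phi> qs \<beta>s \<in> \<Gamma>"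
    and pr: "\<And>qs \<beta>s t. t \<in> \<Gamma>' \<Longrightarrow> (\<lambda>x. pr (\<Phi> qs \<beta>s x) (t x)) = L t qs \<beta>s"
    by blast
  have eqI: "s = s'" if "s \<in> \<Gamma>" "s' \<in> \<Gamma>" "\<And>t. t \<in> \<Gamma>' \<Longrightarrow> (\<lambda>x. pr (s x) (t x)) = (\<lambda>x. pr (s' x) (t x))" for s s'
    by (rule dual_pair_eqI[OF P that])
  have pr0: "(\<lambda>x. pr ((0 :: 'm \<Rightarrow> _) x) (t x)) = 0" if "t \<in> \<Gamma>'" for t
  proof
    fix x
    show "pr ((0 :: 'm \<Rightarrow> _) x) (t x) = 0 x"
      using dual_pairD(6)[OF P subspace_0[OF P1(2)] P2(3)[OF that], of 0 x] by (simp add: fun_apply_simps)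
  qed
  have pr_add: "(\<lambda>x. pr ((s + s') x) (t x)) = (\<lambda>x. pr (s x) (t x)) + (\<lambda>x. pr (s' x) (t x))"
    if "s \<in> \<Gamma>" "s' \<in> \<Gamma>" "t \<in> \<Gamma>'" for s s' t
    using that by (simp add: fun_eq_iff fun_apply_simps dual_pairD(5)[OF P P1(3) P1(3) P2(3)])
  have pr_scale: "(\<lambda>x. pr ((f \<odot> s) x) (t x)) = f \<odot> (\<lambda>x. pr (s x) (t x))"
    if "s \<in> \<Gamma>" "t \<in> \<Gamma>'" for f s t
    using that by (simp add: fun_eq_iff fscale_def dual_pairD(6)[OF P P1(3) P2(3)])
  have zero: "\<Phi> qs \<beta>s = 0" if "\<And>t. t \<in> \<Gamma>' \<Longrightarrow> L t qs \<beta>s = 0" for qs \<beta>s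
    using that by (intro eqI \<Phi> cmoduleD(1)[OF \<Gamma>]) (simp add: pr pr0)
  have T: "tensorial S (L t)" if "t \<in> \<Gamma>'" for t
    using formsD(1)[OF L(1)[OF that, unfolded GF_forms] smod_Cinf] .
  note TD = tensorialD[OF T]
  have "tensorial S \<Phi>"
    unfolding tensorial_def multilinear_def alternating_def symmetric_def
  proof (intro conjI allI impI ballI)
    fix qs xs ys \<beta>s p q
    show "\<Phi> qs \<beta>s = 0" if "\<not> set qs \<subseteq> secQ S" using that by (intro zero multilinearD(1)[OF TD(1)])
    show "\<Phi> qs \<beta>s = 0" if "\<not> set \<beta>s \<subseteq> secBd S" using that by (intro zero multilinearD(1)[OF TD(3)])
    show "\<Phi> (xs @ q # q # ys) \<beta>s = 0"
      using TD(2) by (intro zero) (simp add: alternating_def)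
  next
    fix qs xs ys p q
    show "\<Phi> qs (xs @ p # q # ys) = \<Phi> qs (xs @ q # p # ys)"
      using TD(4) by (intro eqI \<Phi>) (simp add: pr symmetric_def)
  next
    fix u v xs ys \<beta>s assume "u \<in> secQ S" "v \<in> secQ S"
    then show "\<Phi> (xs @ (u + v) # ys) \<beta>s = \<Phi> (xs @ u # ys) \<beta>s + \<Phi> (xs @ v # ys) \<beta>s"
      by (intro eqI \<Phi> cmoduleD(2)[OF \<Gamma>]) (simp add: pr_add \<Phi> pr multilinearD(2)[OF TD(1)])
  next
    fix u f xs ys \<beta>s assume "u \<in> secQ S" "f \<in> Cinf S"
    then show "\<Phi> (xs @ (f \<odot> u) # ys) \<beta>s = f \<odot> \<Phi> (xs @ u # ys) \<beta>s"
      by (intro eqI \<Phi> cmoduleD(3)[OF \<Gamma>]) (simp_all add: pr_scale \<Phi> pr multilinearD(3)[OF TD(1)])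
  next
    fix u v xs ys qs assume "u \<in> secBd S" "v \<in> secBd S"
    then show "\<Phi> qs (xs @ (u + v) # ys) = \<Phi> qs (xs @ u # ys) + \<Phi> qs (xs @ v # ys)"
      by (intro eqI \<Phi> cmoduleD(2)[OF \<Gamma>]) (simp add: pr_add \<Phi> pr multilinearD(2)[OF TD(3)])
  next
    fix u f xs ys qs assume "u \<in> secBd S" "f \<in> Cinf S"
    then show "\<Phi> qs (xs @ (f \<odot> u) # ys) = f \<odot> \<Phi> qs (xs @ u # ys)"
      by (intro eqI \<Phi> cmoduleD(3)[OF \<Gamma>]) (simp_all add: pr_scale \<Phi> pr multilinearD(3)[OF TD(3)])
  qed
  moreover have hom: "homogeneous d \<Phi>"
    unfolding homogeneous_def
  proof (intro allI impI, rule ccontr)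
    fix qs \<beta>s assume "\<Phi> qs \<beta>s \<noteq> 0" and ne: "int (length qs) + 2 * int (length \<beta>s) \<noteq> d"
    moreover have "\<Phi> qs \<beta>s = 0"
      using homogeneousD[OF L(4)] ne by (intro zero) blast
    ultimately show False by simp
  qed
  moreover have "bounded_degree (nat d) \<Phi>"
    unfolding bounded_degree_def using homogeneousD[OF hom] by fastforce
  ultimately have "\<Phi> \<in> forms S \<Gamma>" using \<Phi> by (intro formsI[OF \<Gamma>])
  then show ?thesis using hom pr by (rule that)
qed

text \<open>The description in \<open>dual_connection\<close> denotes something because its
  right-hand side is a functional linear over the functions, hence represented by a unique
  section.\<close>

lemma dual_connection_eval:
  fixes nabE :: "'m vfield \<Rightarrow> ('m \<Rightarrow> 'e::real_vector) \<Rightarrow> 'm \<Rightarrow> 'e" and t :: "'m \<Rightarrow> 'f::real_vector"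
  assumes P: "dual_pair (Cinf S) F' \<Gamma>' F \<Gamma> pr" and c: "connection (base S) (vfields S) lie_deriv \<Gamma> nabE"
    and X: "X \<in> vfields S" and t: "t \<in> \<Gamma>'"
  defines "t' \<equiv> dual_connection lie_deriv \<Gamma> \<Gamma>' (\<lambda>t s x. pr (t x) (s x)) nabE X t"
  shows "t' \<in> \<Gamma>'"
    and "s \<in> \<Gamma> \<Longrightarrow> (\<lambda>x. pr (t' x) (s x)) = lie_deriv X (\<lambda>x. pr (t x) (s x)) - (\<lambda>x. pr (t x) (nabE X s x))"
proof -
  note PD = dual_pairD[OF P]
  note L2 = local_moduleD[OF PD(2)] and L1 = local_moduleD[OF PD(1)]
  note cD = connectionD[OF c X]
  define L where "L = (\<lambda>s. lie_deriv X (\<lambda>x. pr (t x) (s x)) - (\<lambda>x. pr (t x) (nabE X s x)))"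
  have sm: "(\<lambda>x. pr (t x) (s x)) \<in> Cinf S" if "s \<in> \<Gamma>" for s by (rule PD(4)[OF t that])
  have pr_add: "(\<lambda>x. pr (t x) ((s + s') x)) = (\<lambda>x. pr (t x) (s x)) + (\<lambda>x. pr (t x) (s' x))"
    if "s \<in> \<Gamma>" "s' \<in> \<Gamma>" for s s'
    by (simp add: fun_eq_iff fun_apply_simps PD(7)[OF L1(3)[OF t] L2(3)[OF that(1)] L2(3)[OF that(2)]])
  have pr_scale: "(\<lambda>x. pr (t x) ((f \<odot> s) x)) = f * (\<lambda>x. pr (t x) (s x))"
    if "s \<in> \<Gamma>" for f s
    by (simp add: fun_eq_iff fun_apply_simps fscale_def PD(8)[OF L1(3)[OF t] L2(3)[OF that]])
  have 1: "L s \<in> Cinf S" if "s \<in> \<Gamma>" for s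
    unfolding L_def by (intro smod_diff[OF smod_Cinf] vfieldD(1)[OF X] sm that cD(1)[OF that])
  have 2: "L (s + s') = L s + L s'" if "s \<in> \<Gamma>" "s' \<in> \<Gamma>" for s s'
    using that by (simp add: L_def cD(3) pr_add cD(1) vfieldD(2)[OF X] sm)
  \<comment> \<open>The derivative of \<open>f\<close> enters once through the Leibniz rule for
    \<open>X\<close> and once through the connection, with opposite signs.\<close>
  have 3: "L (f \<odot> s) = f * L s" if "f \<in> Cinf S" "s \<in> \<Gamma>" for f s
  proof -
    have "(\<lambda>x. pr (t x) (nabE X (f \<odot> s) x)) = f * (\<lambda>x. pr (t x) (nabE X s x)) + lie_deriv X f * (\<lambda>x. pr (t x) (s x))"
      using that by (simp add: cD(5) pr_add pr_scale cD(1) cmoduleD(3)[OF L2(1)] vfieldD(1)[OF X])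
    then show ?thesis
      using that by (simp add: L_def pr_scale vfieldD(3)[OF X] sm algebra_simps)
  qed
  have ex: "\<exists>t'. t' \<in> \<Gamma>' \<and> (\<forall>s\<in>\<Gamma>. (\<lambda>x. pr (t' x) (s x)) = L s)"
    by (rule dual_pair_representation[OF P, where L=L, OF 1 2 3]) blast+
  then obtain u where u: "u \<in> \<Gamma>'" "\<And>s. s \<in> \<Gamma> \<Longrightarrow> (\<lambda>x. pr (u x) (s x)) = L s" by blast
  have "t' = u"
    unfolding t'_def dual_connection_def
  proof (rule the_equality)
    show "u \<in> \<Gamma>' \<and> (\<forall>s\<in>\<Gamma>. (\<lambda>x. pr (u x) (s x)) = lie_deriv X (\<lambda>x. pr (t x) (s x)) - (\<lambda>x. pr (t x) (nabE X s x)))"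
      using u unfolding L_def by blast
    fix v assume v: "v \<in> \<Gamma>' \<and> (\<forall>s\<in>\<Gamma>. (\<lambda>x. pr (v x) (s x)) = lie_deriv X (\<lambda>x. pr (t x) (s x)) - (\<lambda>x. pr (t x) (nabE X s x)))"
    show "v = u"
    proof (rule dual_pair_eqI[OF P])
      show "v \<in> \<Gamma>'" using v by blast
      show "u \<in> \<Gamma>'" by (rule u(1))
      fix s assume s: "s \<in> \<Gamma>"
      show "(\<lambda>x. pr (v x) (s x)) = (\<lambda>x. pr (u x) (s x))"
        unfolding u(2)[OF s] L_def using v s by blast
    qed
  qed
  then show "t' \<in> \<Gamma>'"
    and "s \<in> \<Gamma> \<Longrightarrow> (\<lambda>x. pr (t' x) (s x)) = lie_deriv X (\<lambda>x. pr (t x) (s x)) - (\<lambda>x. pr (t x) (nabE X s x))"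
    using u unfolding L_def by blast+
qed

end

section \<open>The explicit formula as a graded linear map\<close>

context lie_data_conn
begin

lemma dual_connQ:
  assumes X: "X \<in> vfields S" and \<tau>: "\<tau> \<in> secQd S"
  shows "dual_connection lie_deriv (secQ S) (secQd S) pairing (fst nab) X \<tau> \<in> secQd S" (is "?d \<in> _")
    and "q \<in> secQ S \<Longrightarrow> \<langle>dual_connection lie_deriv (secQ S) (secQd S) pairing (fst nab) X \<tau>, q\<rangle> =
      lie_deriv X \<langle>\<tau>, q\<rangle> - \<langle>\<tau>, fst nab X q\<rangle>"
proof -
  note c = conjunct1[OF connections[unfolded connection_pair_def]]
  have p: "pairing = (\<lambda>\<tau> (q :: 'm \<Rightarrow> 'q) x. \<tau> x (q x))" by (simp add: fun_eq_iff pairing_def)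
  note e = dual_connection_eval[OF dual_pair_sym[OF dual_pairQ] c X \<tau>]
  show "?d \<in> secQd S" unfolding p by (rule e(1))
  show "q \<in> secQ S \<Longrightarrow> \<langle>?d, q\<rangle> = lie_deriv X \<langle>\<tau>, q\<rangle> - \<langle>\<tau>, fst nab X q\<rangle>"
    unfolding p by (rule e(2))
qed

lemma dual_connB:
  assumes X: "X \<in> vfields S" and b: "b \<in> secB S"
  shows "dual_connection lie_deriv (secBd S) (secB S) (\<lambda>b \<beta>. \<langle>\<beta>, b\<rangle>) (snd nab) X b \<in> secB S" (is "?d \<in> _")
    and "\<beta> \<in> secBd S \<Longrightarrow> \<langle>\<beta>, dual_connection lie_deriv (secBd S) (secB S) (\<lambda>b \<beta>. \<langle>\<beta>, b\<rangle>) (snd nab) X b\<rangle> =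
      lie_deriv X \<langle>\<beta>, b\<rangle> - \<langle>snd nab X \<beta>, b\<rangle>"
proof -
  note c = conjunct2[OF connections[unfolded connection_pair_def]]
  note e = dual_connection_eval[OF dual_pairB c X b]
  show "?d \<in> secB S" unfolding pairing_def by (rule e(1))
  show "\<beta> \<in> secBd S \<Longrightarrow> \<langle>\<beta>, ?d\<rangle> = lie_deriv X \<langle>\<beta>, b\<rangle> - \<langle>snd nab X \<beta>, b\<rangle>"
    unfolding pairing_def by (rule e(2))
qed

lemma hatT_eq:
  assumes X: "X \<in> vfields S"
  shows "hatT S nab X = HT nab X"
  unfolding hatT_def
proof (rule the_equality)
  have Q: "HT nab X (genQ S \<tau>) = genQ S (dual_connection lie_deriv (secQ S) (secQd S) pairing (fst nab) X \<tau>)"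
    if "\<tau> \<in> secQd S" for \<tau>
    by (rule form_eqI) (simp add: HT_genQ[OF X that] genQ_apply dual_connQ(2)[OF X that])
  have B: "HT nab X (genB S b) =
      genB S (dual_connection lie_deriv (secBd S) (secB S) (\<lambda>b \<beta>. \<langle>\<beta>, b\<rangle>) (snd nab) X b)"
    if "b \<in> secB S" for b
    by (rule form_eqI) (simp add: HT_genB[OF X that] genB_apply dual_connB(2)[OF X that])
  show "HT nab X \<in> derivations S 0 \<and>
     (\<forall>f\<in>Cinf S. HT nab X (deg0 S f) = deg0 S (lie_deriv X f)) \<and>
     (\<forall>\<tau>\<in>secQd S. HT nab X (genQ S \<tau>) =
        genQ S (dual_connection lie_deriv (secQ S) (secQd S) pairing (fst nab) X \<tau>)) \<and>
     (\<forall>b\<in>secB S. HT nab X (genB S b) =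
        genB S (dual_connection lie_deriv (secBd S) (secB S) (\<lambda>b \<beta>. \<langle>\<beta>, b\<rangle>) (snd nab) X b))"
    using HT_derivation[OF X] HT_deg0[OF X] Q B by blast
  fix D assume D: "D \<in> derivations S 0 \<and>
     (\<forall>f\<in>Cinf S. D (deg0 S f) = deg0 S (lie_deriv X f)) \<and>
     (\<forall>\<tau>\<in>secQd S. D (genQ S \<tau>) =
        genQ S (dual_connection lie_deriv (secQ S) (secQd S) pairing (fst nab) X \<tau>)) \<and>
     (\<forall>b\<in>secB S. D (genB S b) =
        genB S (dual_connection lie_deriv (secBd S) (secB S) (\<lambda>b \<beta>. \<langle>\<beta>, b\<rangle>) (snd nab) X b))"
  show "D = HT nab X"
    by (rule derivation_eqI[OF _ HT_derivation[OF X]]) (use D in \<open>simp_all add: HT_deg0[OF X] Q B\<close>)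
qed

abbreviation "hT \<equiv> HT nab"
abbreviation "am \<equiv> adj_map nab"

lemmas ext_hat_derivations = ext_hat_derivation[OF hat_family_HT] ext_hat_derivation[OF hat_family_HQ]
    ext_hat_derivation[OF hat_family_HB]
  and ext_hat_adds = ext_hat_add[OF hat_family_HT] ext_hat_add[OF hat_family_HQ] ext_hat_add[OF hat_family_HB]
  and ext_hat_wedges = ext_hat_wedge[OF hat_family_HT] ext_hat_wedge[OF hat_family_HQ] ext_hat_wedge[OF hat_family_HB]
  and ext_hat_zeros = ext_hat_zero[OF hat_family_HT] ext_hat_zero[OF hat_family_HQ] ext_hat_zero[OF hat_family_HB]
  and ext_hat_deg0s = ext_hat_deg0[OF hat_family_HT] ext_hat_deg0[OF hat_family_HQ] ext_hat_deg0[OF hat_family_HB]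

lemma adj_map_eq:
  assumes "(\<Phi>T, \<Phi>Q, \<Phi>B) \<in> AM"
  shows "am (\<Phi>T, \<Phi>Q, \<Phi>B) = ext_hat hT \<Phi>T + ext_hat HQ \<Phi>Q + ext_hat HB \<Phi>B"
  using assms by (simp add: adj_map_def fun_eq_iff[of "\<lambda>\<eta>. _ \<eta>"] operator_apply)

lemma adj_map_derivation:
  assumes "\<Phi> \<in> AM" "adj_homogeneous d \<Phi>"
  shows "am \<Phi> \<in> derivations S d"
proof -
  obtain \<Phi>T \<Phi>Q \<Phi>B where \<Phi>: "\<Phi> = (\<Phi>T, \<Phi>Q, \<Phi>B)" by (cases \<Phi>)
  note h = adj_homogeneousD[OF assms(2)[unfolded \<Phi>]] and AM = assms(1)[unfolded \<Phi>]
  note F = AM[unfolded AM_iff]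
  have "ext_hat hT \<Phi>T \<in> derivations S d" "ext_hat HQ \<Phi>Q \<in> derivations S d" "ext_hat HB \<Phi>B \<in> derivations S d"
    using ext_hat_derivations(1)[OF _ h(1)] ext_hat_derivations(2)[OF _ h(2)] ext_hat_derivations(3)[OF _ h(3)] F
    by simp_all
  then show ?thesis unfolding \<Phi> adj_map_eq[OF AM] by (intro derivation_add)
qed

lemma adj_map_add:
  assumes "\<Phi> \<in> AM" "\<Psi> \<in> AM"
  shows "am (\<Phi> + \<Psi>) = am \<Phi> + am \<Psi>"
proof
  fix \<eta>
  obtain \<Phi>T \<Phi>Q \<Phi>B where \<Phi>: "\<Phi> = (\<Phi>T, \<Phi>Q, \<Phi>B)" by (cases \<Phi>)
  obtain \<Psi>T \<Psi>Q \<Psi>B where \<Psi>: "\<Psi> = (\<Psi>T, \<Psi>Q, \<Psi>B)" by (cases \<Psi>)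
  note F = assms(1)[unfolded \<Phi> AM_iff] and G = assms(2)[unfolded \<Psi> AM_iff]
  show "am (\<Phi> + \<Psi>) \<eta> = (am \<Phi> + am \<Psi>) \<eta>"
    unfolding adj_map_def using assms AM_add[OF assms] F G
    by (simp add: \<Phi> \<Psi> operator_apply ext_hat_adds)
qed

lemma adj_map_act:
  assumes "\<Phi> \<in> AM" "\<xi> \<in> GF"
  shows "am (adj_act \<xi> \<Phi>) = vf_act \<xi> (am \<Phi>)"
proof
  fix \<eta>
  obtain \<Phi>T \<Phi>Q \<Phi>B where \<Phi>: "\<Phi> = (\<Phi>T, \<Phi>Q, \<Phi>B)" by (cases \<Phi>)
  note F = assms(1)[unfolded \<Phi> AM_iff]
  show "am (adj_act \<xi> \<Phi>) \<eta> = vf_act \<xi> (am \<Phi>) \<eta>"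
    unfolding adj_map_def using assms AM_act[OF assms(2,1)] F
    by (simp add: \<Phi> adj_act_def vf_act_def operator_apply ext_hat_wedges wedge_add_right)
qed

lemma adj_map_zero: "am 0 = 0"
  using adj_map_add[OF AM_zero AM_zero] by simp

lemma adj_map_sum: "(\<And>i. i \<in> I \<Longrightarrow> \<Phi> i \<in> AM) \<Longrightarrow> am (\<Sum>i\<in>I. \<Phi> i) = (\<Sum>i\<in>I. am (\<Phi> i))"
  by (induction I rule: infinite_finite_induct) (simp_all add: adj_map_zero adj_map_add AM_sum)

lemma const_act: "deg0 S (\<lambda>_. r) \<cdot> \<xi> = r *\<^sub>R \<xi>"
  by (rule form_eqI) (simp add: deg0_wedge fscale_const form_apply)

lemma adj_act_const: "adj_act (deg0 S (\<lambda>_. r)) \<Phi> = r *\<^sub>R \<Phi>"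
  by (cases \<Phi>) (simp add: adj_act_def const_act)

lemma vf_act_const: "vf_act (deg0 S (\<lambda>_. r)) D = r *\<^sub>R D"
  by (simp add: vf_act_def const_act scaleR_fun_def fun_eq_iff[of "\<lambda>_. _"])

lemma adj_map_scaleR: "\<Phi> \<in> AM \<Longrightarrow> am (r *\<^sub>R \<Phi>) = r *\<^sub>R am \<Phi>"
  using adj_map_act[of \<Phi> "deg0 S (\<lambda>_. r)"] by (simp add: adj_act_const vf_act_const GF_deg0 const_smooth)

lemma adj_map_generators:
  shows "X \<in> vfields S \<Longrightarrow> am (adjT S X) = hT X" "q \<in> secQ S \<Longrightarrow> am (adjQ S q) = HQ q"
    "\<beta> \<in> secBd S \<Longrightarrow> am (adjB S \<beta>) = HB \<beta>"
  using adjT_AM[of X] adjQ_AM[of q] adjB_AM[of \<beta>]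
  by (simp_all add: adj_map_def adjT_def adjQ_def adjB_def ext_hat_zeros ext_hat_deg0s)

text \<open>The triangular shape behind injectivity and surjectivity: on functions only the
  \<open>TM\<close> component is visible; each of the other two kinds of generators adds exactly one
  further component.\<close>

lemma adj_map_eval:
  assumes AM: "(\<Phi>T, \<Phi>Q, \<Phi>B) \<in> AM"
  shows "f \<in> Cinf S \<Longrightarrow> am (\<Phi>T, \<Phi>Q, \<Phi>B) (deg0 S f) qs \<beta>s = lie_deriv (\<Phi>T qs \<beta>s) f"
    and "\<tau> \<in> secQd S \<Longrightarrow> am (\<Phi>T, \<Phi>Q, \<Phi>B) (genQ S \<tau>) qs \<beta>s = ext_hat hT \<Phi>T (genQ S \<tau>) qs \<beta>s + \<langle>\<tau>, \<Phi>Q qs \<beta>s\<rangle>"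
    and "b \<in> secB S \<Longrightarrow> am (\<Phi>T, \<Phi>Q, \<Phi>B) (genB S b) qs \<beta>s = ext_hat hT \<Phi>T (genB S b) qs \<beta>s + \<langle>\<Phi>B qs \<beta>s, b\<rangle>"
proof -
  note F = AM[unfolded AM_iff]
  note T = ext_hat_eval[OF _ smod_vfields conjunct1[OF F], of hT]
    and Q = ext_hat_eval[OF _ smod_secQ conjunct1[OF conjunct2[OF F]], of HQ]
    and B = ext_hat_eval[OF _ smod_secBd conjunct2[OF conjunct2[OF F]], of HB]
  show "am (\<Phi>T, \<Phi>Q, \<Phi>B) (deg0 S f) qs \<beta>s = lie_deriv (\<Phi>T qs \<beta>s) f" if f: "f \<in> Cinf S"
  proof -
    have "ext_hat hT \<Phi>T (deg0 S f) qs \<beta>s = lie_deriv (\<Phi>T qs \<beta>s) f"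
      by (rule T) (rule HT_deg0[OF _ f])
    moreover have "ext_hat HQ \<Phi>Q (deg0 S f) qs \<beta>s = 0"
      by (rule Q[where g="\<lambda>_. 0"]) (simp add: HQ_eval f deg0_simps)
    moreover have "ext_hat HB \<Phi>B (deg0 S f) qs \<beta>s = 0"
      by (rule B[where g="\<lambda>_. 0"]) (simp add: HB_eval f deg0_simps)
    ultimately show ?thesis by (simp add: adj_map_eq[OF AM] operator_apply form_apply)
  qed
  show "am (\<Phi>T, \<Phi>Q, \<Phi>B) (genQ S \<tau>) qs \<beta>s = ext_hat hT \<Phi>T (genQ S \<tau>) qs \<beta>s + \<langle>\<tau>, \<Phi>Q qs \<beta>s\<rangle>" if \<tau>: "\<tau> \<in> secQd S"
  proof -
    have "ext_hat HQ \<Phi>Q (genQ S \<tau>) qs \<beta>s = \<langle>\<tau>, \<Phi>Q qs \<beta>s\<rangle>"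
      by (rule Q) (simp add: HQ_eval \<tau>)
    moreover have "ext_hat HB \<Phi>B (genQ S \<tau>) qs \<beta>s = 0"
      by (rule B[where g="\<lambda>_. 0"]) (simp add: HB_eval deg0_simps)
    ultimately show ?thesis by (simp add: adj_map_eq[OF AM] operator_apply form_apply)
  qed
  show "am (\<Phi>T, \<Phi>Q, \<Phi>B) (genB S b) qs \<beta>s = ext_hat hT \<Phi>T (genB S b) qs \<beta>s + \<langle>\<Phi>B qs \<beta>s, b\<rangle>" if b: "b \<in> secB S"
  proof -
    have "ext_hat HQ \<Phi>Q (genB S b) qs \<beta>s = 0"
      by (rule Q[where g="\<lambda>_. 0"]) (simp add: HQ_eval deg0_simps)
    moreover have "ext_hat HB \<Phi>B (genB S b) qs \<beta>s = \<langle>\<Phi>B qs \<beta>s, b\<rangle>"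
      by (rule B) (simp add: HB_eval b)
    ultimately show ?thesis by (simp add: adj_map_eq[OF AM] operator_apply form_apply)
  qed
qed

end

section \<open>Every derivation comes from a unique triple\<close>

context lie_data
begin

lemma vfield_eqI: "(\<And>f. lie_deriv X f = lie_deriv Y f) \<Longrightarrow> X = Y"
  by (simp add: fun_eq_iff lie_deriv_def)

lemma form_local_eqI:
  fixes \<Phi> \<Psi> :: "('m, 'q, 'b, 'e::real_vector) form"
  assumes "\<And>x. \<exists>f\<in>Cinf S. f x \<noteq> 0 \<and> deg0 S f \<cdot> \<Phi> = deg0 S f \<cdot> \<Psi>"
  shows "\<Phi> = \<Psi>"
proof (rule form_eqI, rule ext)
  fix qs \<beta>s x
  obtain f where f: "f x \<noteq> 0" "deg0 S f \<cdot> \<Phi> = deg0 S f \<cdot> \<Psi>" using assms by blast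
  have "(deg0 S f \<cdot> \<Phi>) qs \<beta>s x = (deg0 S f \<cdot> \<Psi>) qs \<beta>s x" by (simp only: f(2))
  then show "\<Phi> qs \<beta>s x = \<Psi> qs \<beta>s x" using f(1) by (simp add: deg0_wedge fscale_def)
qed

lemma genQ_linear: "genQ S (\<tau> + \<tau>') = genQ S \<tau> + genQ S \<tau>'" "genQ S (f \<odot> \<tau>) = deg0 S f \<cdot> genQ S \<tau>"
  and genB_linear: "b \<in> secB S \<Longrightarrow> b' \<in> secB S \<Longrightarrow> genB S (b + b') = genB S b + genB S b'"
    "b \<in> secB S \<Longrightarrow> genB S (f \<odot> b) = deg0 S f \<cdot> genB S b"
proof -
  show "genQ S (\<tau> + \<tau>') = genQ S \<tau> + genQ S \<tau>'"
    by (rule form_eqI) (simp add: genQ_apply form_apply pairing_add_left)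
  show "genQ S (f \<odot> \<tau>) = deg0 S f \<cdot> genQ S \<tau>"
    by (rule form_eqI) (simp add: genQ_apply deg0_wedge pairing_scale_left)
  show "genB S (b + b') = genB S b + genB S b'" if "b \<in> secB S" "b' \<in> secB S"
    by (rule form_eqI) (simp add: genB_apply form_apply pairing_addB that)
  show "genB S (f \<odot> b) = deg0 S f \<cdot> genB S b" if "b \<in> secB S"
    by (rule form_eqI) (simp add: genB_apply deg0_wedge pairing_scaleB that)
qed

text \<open>For fixed arguments, \<open>f \<mapsto> D (deg0 S f)\<close> is a derivation of the
  smooth functions, because the sign in the Leibniz rule is trivial on elements of degree 0. Its
  form properties are checked on the values, since a vector field is determined by its action on
  functions.\<close>

lemma derivation_symbol:
  assumes D: "D \<in> derivations S k"
  obtains \<Phi> where "\<Phi> \<in> forms S (vfields S)" "homogeneous k \<Phi>"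
    "\<And>f qs \<beta>s. f \<in> Cinf S \<Longrightarrow> lie_deriv (\<Phi> qs \<beta>s) f = D (deg0 S f) qs \<beta>s"
proof -
  \<comment> \<open>The value 0 off the smooth functions is the convention of
    \<open>tangent_space\<close>; it makes the tangent vectors unique.\<close>
  define \<Phi> where "\<Phi> = (\<lambda>qs \<beta>s x f. if f \<in> Cinf S then D (deg0 S f) qs \<beta>s x else 0)"
  have lie: "lie_deriv (\<Phi> qs \<beta>s) f = (if f \<in> Cinf S then D (deg0 S f) qs \<beta>s else 0)" for qs \<beta>s f
    by (simp add: lie_deriv_def \<Phi>_def fun_eq_iff fun_apply_simps)
  have Df: "D (deg0 S f) \<in> GF" if "f \<in> Cinf S" for f
    using derivationsD(2)[OF D GF_deg0[OF that]] .
  have sm: "D (deg0 S f) qs \<beta>s \<in> Cinf S" if "f \<in> Cinf S" for f qs \<beta>s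
    using formsD(2)[OF Df[OF that, unfolded GF_forms] smod_Cinf] .
  have tens: "tensorial S (D (deg0 S f))" if "f \<in> Cinf S" for f
    using formsD(1)[OF Df[OF that, unfolded GF_forms] smod_Cinf] .
  have Dadd: "D (deg0 S (f + g)) = D (deg0 S f) + D (deg0 S g)" if "f \<in> Cinf S" "g \<in> Cinf S" for f g
    unfolding deg0_simps(1) by (rule derivationsD(4)[OF D GF_deg0[OF that(1)] GF_deg0[OF that(2)]])
  have Dscale: "D (deg0 S (c *\<^sub>R f)) = c *\<^sub>R D (deg0 S f)" if "f \<in> Cinf S" for c f
    unfolding deg0_simps(3) by (rule derivationsD(3)[OF D GF_deg0[OF that]])
  have Dmult: "D (deg0 S (f * g)) qs \<beta>s = D (deg0 S f) qs \<beta>s * g + f * D (deg0 S g) qs \<beta>s"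
    if "f \<in> Cinf S" "g \<in> Cinf S" for f g qs \<beta>s
  proof -
    have "D (deg0 S (f * g)) = D (deg0 S f \<cdot> deg0 S g)"
      by (simp only: fscale_real[symmetric] deg0_simps(4))
    also have "\<dots> = D (deg0 S f) \<cdot> deg0 S g + sgn_pow (k * 0) *\<^sub>R (deg0 S f \<cdot> D (deg0 S g))"
      by (rule derivationsD(6)[OF D GF_deg0[OF that(1)] homogeneous_deg0 GF_deg0[OF that(2)]])
    finally show ?thesis by (simp add: form_apply wedge_deg0 deg0_wedge fscale_real)
  qed
  have val: "\<Phi> qs \<beta>s \<in> vfields S" for qs \<beta>s
    unfolding vector_fields_def mem_Collect_eq
  proof (intro conjI allI ballI)
    fix x
    show "\<Phi> qs \<beta>s x \<in> tangent_space (base S) x"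
      unfolding tangent_space_def mem_Collect_eq
    proof (intro conjI allI ballI impI)
      fix f g assume fg: "f \<in> Cinf S" "g \<in> Cinf S"
      show "\<Phi> qs \<beta>s x (f + g) = \<Phi> qs \<beta>s x f + \<Phi> qs \<beta>s x g"
        using fg by (simp add: \<Phi>_def add_smooth Dadd form_apply fun_apply_simps)
      show "\<Phi> qs \<beta>s x (f * g) = f x * \<Phi> qs \<beta>s x g + \<Phi> qs \<beta>s x f * g x"
        using fg by (simp add: \<Phi>_def mult_smooth Dmult fun_apply_simps)
    next
      fix f c assume f: "f \<in> Cinf S"
      show "\<Phi> qs \<beta>s x (c *\<^sub>R f) = c * \<Phi> qs \<beta>s x f"
      proof -
        have "lie_deriv (\<Phi> qs \<beta>s) (c *\<^sub>R f) = c *\<^sub>R lie_deriv (\<Phi> qs \<beta>s) f"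
          by (simp add: lie f smod_scaleR[OF smod_Cinf] Dscale form_apply)
        then show ?thesis unfolding lie_deriv_def scaleR_fun_def real_scaleR_def by (rule fun_cong)
      qed
    next
      fix f assume "f \<notin> Cinf S"
      then show "\<Phi> qs \<beta>s x f = 0" by (simp add: \<Phi>_def)
    qed
  next
    fix f assume "f \<in> Cinf S"
    then show "lie_deriv (\<Phi> qs \<beta>s) f \<in> Cinf S" by (simp add: lie sm)
  qed
  have "tensorial S \<Phi>"
    unfolding tensorial_def multilinear_def alternating_def symmetric_def
  proof (intro conjI allI impI ballI)
    fix qs xs ys \<beta>s p q
    show "\<Phi> qs \<beta>s = 0" if "\<not> set qs \<subseteq> secQ S"
      using that by (intro vfield_eqI) (simp add: lie lie_deriv_linear multilinearD(1)[OF tensorialD(1)[OF tens]])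
    show "\<Phi> qs \<beta>s = 0" if "\<not> set \<beta>s \<subseteq> secBd S"
      using that by (intro vfield_eqI) (simp add: lie lie_deriv_linear multilinearD(1)[OF tensorialD(3)[OF tens]])
    show "\<Phi> (xs @ q # q # ys) \<beta>s = 0"
      using tensorialD(2)[OF tens] by (intro vfield_eqI) (simp add: lie lie_deriv_linear alternating_def)
  next
    fix qs xs ys p q
    show "\<Phi> qs (xs @ p # q # ys) = \<Phi> qs (xs @ q # p # ys)"
      using tensorialD(4)[OF tens] by (intro vfield_eqI) (simp add: lie symmetric_def)
  next
    fix u v xs ys \<beta>s assume "u \<in> secQ S" "v \<in> secQ S"
    then show "\<Phi> (xs @ (u + v) # ys) \<beta>s = \<Phi> (xs @ u # ys) \<beta>s + \<Phi> (xs @ v # ys) \<beta>s"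
      by (intro vfield_eqI) (simp add: lie lie_deriv_linear multilinearD(2)[OF tensorialD(1)[OF tens]])
  next
    fix u f xs ys \<beta>s assume "u \<in> secQ S" "f \<in> Cinf S"
    then show "\<Phi> (xs @ (f \<odot> u) # ys) \<beta>s = f \<odot> \<Phi> (xs @ u # ys) \<beta>s"
      by (intro vfield_eqI) (simp add: lie lie_deriv_linear multilinearD(3)[OF tensorialD(1)[OF tens]])
  next
    fix u v xs ys qs assume "u \<in> secBd S" "v \<in> secBd S"
    then show "\<Phi> qs (xs @ (u + v) # ys) = \<Phi> qs (xs @ u # ys) + \<Phi> qs (xs @ v # ys)"
      by (intro vfield_eqI) (simp add: lie lie_deriv_linear multilinearD(2)[OF tensorialD(3)[OF tens]])
  next
    fix u f xs ys qs assume "u \<in> secBd S" "f \<in> Cinf S"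
    then show "\<Phi> qs (xs @ (f \<odot> u) # ys) = f \<odot> \<Phi> qs (xs @ u # ys)"
      by (intro vfield_eqI) (simp add: lie lie_deriv_linear multilinearD(3)[OF tensorialD(3)[OF tens]])
  qed
  moreover have hom: "homogeneous k \<Phi>"
    unfolding homogeneous_def
  proof (intro allI impI, rule ccontr)
    fix qs \<beta>s assume nz: "\<Phi> qs \<beta>s \<noteq> 0" and ne: "int (length qs) + 2 * int (length \<beta>s) \<noteq> k"
    have "D (deg0 S f) qs \<beta>s = 0" if "f \<in> Cinf S" for f
      using homogeneousD[OF derivationsD(5)[OF D GF_deg0[OF that] homogeneous_deg0]] ne by fastforce
    then have "\<Phi> qs \<beta>s = 0" by (intro vfield_eqI) (simp add: lie lie_deriv_linear)
    then show False using nz by simp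
  qed
  moreover have "bounded_degree (nat k) \<Phi>"
    unfolding bounded_degree_def using homogeneousD[OF hom] by fastforce
  ultimately have "\<Phi> \<in> forms S (vfields S)" using val by (intro formsI[OF smod_vfields])
  then show ?thesis using hom by (rule that) (simp add: lie)
qed

end

context lie_data_conn
begin

lemma adj_map_surj:
  assumes D: "D \<in> derivations S k"
  obtains \<Phi> where "\<Phi> \<in> AM" "adj_homogeneous k \<Phi>" "am \<Phi> = D"
proof -
  obtain \<Phi>T where T: "\<Phi>T \<in> forms S (vfields S)" "homogeneous k \<Phi>T"
    "\<And>f qs \<beta>s. f \<in> Cinf S \<Longrightarrow> lie_deriv (\<Phi>T qs \<beta>s) f = D (deg0 S f) qs \<beta>s"
    by (rule derivation_symbol[OF D]) (rule that)
  have eT: "ext_hat hT \<Phi>T \<in> derivations S k"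
    using ext_hat_derivations(1)[OF T(1,2)] by simp
  define E where "E = D - ext_hat hT \<Phi>T"
  have E: "E \<in> derivations S k" unfolding E_def by (rule derivation_diff[OF D eT])
  have E0: "E (deg0 S f) = 0" if f: "f \<in> Cinf S" for f
  proof (rule form_eqI)
    fix qs \<beta>s
    have "ext_hat hT \<Phi>T (deg0 S f) qs \<beta>s = lie_deriv (\<Phi>T qs \<beta>s) f"
      by (rule ext_hat_eval[OF _ smod_vfields T(1)]) (rule HT_deg0[OF _ f])
    then show "E (deg0 S f) qs \<beta>s = 0 qs \<beta>s" by (simp add: E_def operator_apply form_apply T(3)[OF f])
  qed
  have E_act: "E (deg0 S f \<cdot> \<xi>) = deg0 S f \<cdot> E \<xi>" if "f \<in> Cinf S" "\<xi> \<in> GF" for f \<xi>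
    using derivationsD(6)[OF E GF_deg0[OF that(1)] homogeneous_deg0 that(2)]
    by (simp add: E0[OF that(1)] wedge_zero_left)
  have LQ: "E (genQ S \<tau>) \<in> GF" "homogeneous (k + 1) (E (genQ S \<tau>))" if "\<tau> \<in> secQd S" for \<tau>
    using derivationsD(2)[OF E forms_genQ[OF that]] derivationsD(5)[OF E forms_genQ[OF that] homogeneous_genQ]
    by (simp_all add: add.commute)
  have LQ_add: "E (genQ S (\<tau> + \<tau>')) = E (genQ S \<tau>) + E (genQ S \<tau>')" if "\<tau> \<in> secQd S" "\<tau>' \<in> secQd S" for \<tau> \<tau>'
    unfolding genQ_linear(1) by (rule derivationsD(4)[OF E forms_genQ[OF that(1)] forms_genQ[OF that(2)]])
  have LQ_act: "E (genQ S (f \<odot> \<tau>)) = deg0 S f \<cdot> E (genQ S \<tau>)" if "f \<in> Cinf S" "\<tau> \<in> secQd S" for f \<tau>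
    unfolding genQ_linear(2) by (rule E_act[OF that(1) forms_genQ[OF that(2)]])
  obtain \<Phi>Q where Q: "\<Phi>Q \<in> forms S (secQ S)" "homogeneous (k + 1) \<Phi>Q"
    "\<And>\<tau> qs \<beta>s. \<tau> \<in> secQd S \<Longrightarrow> (\<lambda>x. \<tau> x (\<Phi>Q qs \<beta>s x)) = E (genQ S \<tau>) qs \<beta>s"
    by (rule form_representation[OF dual_pairQ, where L="\<lambda>\<tau>. E (genQ S \<tau>)" and d="k + 1"],
        rule LQ(1), assumption, rule LQ_add, assumption, assumption,
        rule LQ_act, assumption, assumption, rule LQ(2), assumption, rule that)
  have LB: "E (genB S b) \<in> GF" "homogeneous (k + 2) (E (genB S b))" if "b \<in> secB S" for b
    using derivationsD(2)[OF E forms_genB[OF that]] derivationsD(5)[OF E forms_genB[OF that] homogeneous_genB]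
    by (simp_all add: add.commute)
  have LB_add: "E (genB S (b + b')) = E (genB S b) + E (genB S b')" if "b \<in> secB S" "b' \<in> secB S" for b b'
    unfolding genB_linear(1)[OF that] by (rule derivationsD(4)[OF E forms_genB[OF that(1)] forms_genB[OF that(2)]])
  have LB_act: "E (genB S (f \<odot> b)) = deg0 S f \<cdot> E (genB S b)" if "f \<in> Cinf S" "b \<in> secB S" for f b
    unfolding genB_linear(2)[OF that(2)] by (rule E_act[OF that(1) forms_genB[OF that(2)]])
  \<comment> \<open>The functional is now defined on sections of \<open>B\<close> and represented by
    sections of the dual, so the dual pair is used in the reversed order.\<close>
  obtain \<Phi>B where B: "\<Phi>B \<in> forms S (secBd S)" "homogeneous (k + 2) \<Phi>B"
    "\<And>b qs \<beta>s. b \<in> secB S \<Longrightarrow> (\<lambda>x. \<Phi>B qs \<beta>s x (b x)) = E (genB S b) qs \<beta>s"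
    by (rule form_representation[OF dual_pair_sym[OF dual_pairB], where L="\<lambda>b. E (genB S b)" and d="k + 2"],
        rule LB(1), assumption, rule LB_add, assumption, assumption,
        rule LB_act, assumption, assumption, rule LB(2), assumption, rule that)
  define \<Phi> where "\<Phi> = (\<Phi>T, \<Phi>Q, \<Phi>B)"
  have AM: "(\<Phi>T, \<Phi>Q, \<Phi>B) \<in> AM" using T(1) Q(1) B(1) by (simp add: AM_iff)
  have hom: "adj_homogeneous k (\<Phi>T, \<Phi>Q, \<Phi>B)" using T(2) Q(2) B(2) by (simp add: adj_homogeneous_def)
  note ev = adj_map_eval[OF AM]
  have "am (\<Phi>T, \<Phi>Q, \<Phi>B) = D"
  proof (rule derivation_eqI[OF adj_map_derivation[OF AM hom] D])
    fix f assume f: "f \<in> Cinf S"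
    show "am (\<Phi>T, \<Phi>Q, \<Phi>B) (deg0 S f) = D (deg0 S f)"
      by (rule form_eqI) (simp add: ev(1)[OF f] T(3)[OF f])
  next
    fix \<tau> assume \<tau>: "\<tau> \<in> secQd S"
    show "am (\<Phi>T, \<Phi>Q, \<Phi>B) (genQ S \<tau>) = D (genQ S \<tau>)"
    proof (rule form_eqI)
      fix qs \<beta>s
      have "\<langle>\<tau>, \<Phi>Q qs \<beta>s\<rangle> = E (genQ S \<tau>) qs \<beta>s" unfolding pairing_def by (rule Q(3)[OF \<tau>])
      then show "am (\<Phi>T, \<Phi>Q, \<Phi>B) (genQ S \<tau>) qs \<beta>s = D (genQ S \<tau>) qs \<beta>s"
        by (simp add: ev(2)[OF \<tau>] E_def operator_apply form_apply)
    qed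
  next
    fix b assume b: "b \<in> secB S"
    show "am (\<Phi>T, \<Phi>Q, \<Phi>B) (genB S b) = D (genB S b)"
    proof (rule form_eqI)
      fix qs \<beta>s
      have "\<langle>\<Phi>B qs \<beta>s, b\<rangle> = E (genB S b) qs \<beta>s" unfolding pairing_def by (rule B(3)[OF b])
      then show "am (\<Phi>T, \<Phi>Q, \<Phi>B) (genB S b) qs \<beta>s = D (genB S b) qs \<beta>s"
        by (simp add: ev(3)[OF b] E_def operator_apply form_apply)
    qed
  qed
  with AM hom show ?thesis by (rule that)
qed

text \<open>The \<open>TM\<close> component is killed first, by values on functions. Only then do
  the values on the other generators isolate the remaining components.\<close>

lemma adj_map_eq_zeroD:
  assumes "\<Phi> \<in> AM" "am \<Phi> = 0"
  shows "\<Phi> = 0"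
proof -
  obtain \<Phi>T \<Phi>Q \<Phi>B where \<Phi>: "\<Phi> = (\<Phi>T, \<Phi>Q, \<Phi>B)" by (cases \<Phi>)
  note AM = assms(1)[unfolded \<Phi>] and z = assms(2)[unfolded \<Phi>]
  note F = AM[unfolded AM_iff] and ev = adj_map_eval[OF AM, unfolded z operator_apply form_apply]
  have T: "\<Phi>T = 0"
  proof (rule form_eqI, unfold form_apply, rule vfield_eqI)
    fix qs \<beta>s f
    have X: "\<Phi>T qs \<beta>s \<in> vfields S" using formsD(2)[OF conjunct1[OF F] smod_vfields] .
    show "lie_deriv (\<Phi>T qs \<beta>s) f = lie_deriv 0 f"
      using ev(1)[of f qs \<beta>s] vfieldD(5)[OF X, of f] by (cases "f \<in> Cinf S") (simp_all add: lie_deriv_linear)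
  qed
  have Q: "\<Phi>Q = 0"
  proof (rule form_eqI, unfold form_apply, rule dual_pair_eqI[OF dual_pairQ])
    fix qs \<beta>s
    show "\<Phi>Q qs \<beta>s \<in> secQ S" using formsD(2)[OF conjunct1[OF conjunct2[OF F]] smod_secQ] .
    show "0 \<in> secQ S" by (rule cmoduleD(1)[OF smod_secQ])
    fix \<tau> assume \<tau>: "\<tau> \<in> secQd S"
    have "\<langle>\<tau>, \<Phi>Q qs \<beta>s\<rangle> = \<langle>\<tau>, 0\<rangle>"
      using ev(2)[OF \<tau>, of qs \<beta>s] by (simp add: T ext_hat_zeros form_apply pairing_zeroQ[OF \<tau>])
    then show "(\<lambda>x. \<tau> x (\<Phi>Q qs \<beta>s x)) = (\<lambda>x. \<tau> x ((0 :: 'm \<Rightarrow> 'q) x))" unfolding pairing_def .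
  qed
  have B: "\<Phi>B = 0"
  proof (rule form_eqI, unfold form_apply, rule dual_pair_eqI[OF dual_pair_sym[OF dual_pairB]])
    fix qs \<beta>s
    show "\<Phi>B qs \<beta>s \<in> secBd S" using formsD(2)[OF conjunct2[OF conjunct2[OF F]] smod_secBd] .
    show "0 \<in> secBd S" by (rule cmoduleD(1)[OF smod_secBd])
    fix b assume b: "b \<in> secB S"
    have "\<langle>\<Phi>B qs \<beta>s, b\<rangle> = \<langle>0, b\<rangle>"
      using ev(3)[OF b, of qs \<beta>s] by (simp add: T ext_hat_zeros form_apply pairing_zero_left)
    then show "(\<lambda>x. \<Phi>B qs \<beta>s x (b x)) = (\<lambda>x. (0 :: 'm \<Rightarrow> 'b \<Rightarrow> real) x (b x))" unfolding pairing_def .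
  qed
  show ?thesis by (simp add: \<Phi> T Q B zero_prod_def)
qed

lemma adj_map_inj:
  assumes "\<Phi> \<in> AM" "\<Psi> \<in> AM" "am \<Phi> = am \<Psi>"
  shows "\<Phi> = \<Psi>"
proof -
  have m: "- 1 *\<^sub>R \<Psi> \<in> AM" by (rule AM_scaleR[OF assms(2)])
  have "am (\<Phi> + - 1 *\<^sub>R \<Psi>) = 0"
    unfolding adj_map_add[OF assms(1) m] adj_map_scaleR[OF assms(2)] assms(3) by simp
  then have "\<Phi> + - 1 *\<^sub>R \<Psi> = 0" by (rule adj_map_eq_zeroD[OF AM_add[OF assms(1) m]])
  then show ?thesis by simp
qed

lemma derivation_GVF: "D \<in> derivations S k \<Longrightarrow> D \<in> GVF"
  unfolding graded_vector_fields_def mem_Collect_eq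
  by (intro exI[of _ "{k}"] exI[of _ "\<lambda>_. D"]) simp

text \<open>Preimages and images are found degree by degree; both sides consist of finite sums of
  homogeneous elements.\<close>

lemma GVF_eq: "GVF = am ` AM"
proof
  show "GVF \<subseteq> am ` AM"
  proof
    fix D assume "D \<in> GVF"
    then obtain K F where K: "finite K" "\<forall>k\<in>K. F k \<in> derivations S k" "D = (\<Sum>k\<in>K. F k)"
      unfolding graded_vector_fields_def by blast
    have "\<forall>k\<in>K. \<exists>\<Phi>. \<Phi> \<in> AM \<and> am \<Phi> = F k"
    proof
      fix k assume "k \<in> K"
      then have "F k \<in> derivations S k" using K(2) by blast
      then show "\<exists>\<Phi>. \<Phi> \<in> AM \<and> am \<Phi> = F k" by (rule adj_map_surj) blast
    qed
    then obtain \<Phi> where \<Phi>: "\<forall>k\<in>K. \<Phi> k \<in> AM \<and> am (\<Phi> k) = F k" by (rule bchoice[THEN exE])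
    have "am (\<Sum>k\<in>K. \<Phi> k) = (\<Sum>k\<in>K. am (\<Phi> k))" using \<Phi> by (intro adj_map_sum) blast
    also have "\<dots> = D" unfolding K(3) using \<Phi> by (intro sum.cong) auto
    finally have "D = am (\<Sum>k\<in>K. \<Phi> k)" by (rule sym)
    moreover have "(\<Sum>k\<in>K. \<Phi> k) \<in> AM" using \<Phi> by (intro AM_sum) blast
    ultimately show "D \<in> am ` AM" by (rule image_eqI)
  qed
  show "am ` AM \<subseteq> GVF"
  proof (rule image_subsetI)
    fix \<Phi> assume "\<Phi> \<in> AM"
    then obtain K \<Phi>' where K: "finite K" "\<Phi> = (\<Sum>d\<in>K. \<Phi>' d)" "\<And>d. \<Phi>' d \<in> AM" "\<And>d. adj_homogeneous d (\<Phi>' d)"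
      by (rule AM_homogeneous_sum) (rule that)
    have "am \<Phi> = (\<Sum>d\<in>K. am (\<Phi>' d))" unfolding K(2) by (rule adj_map_sum) (rule K(3))
    moreover have "\<forall>d\<in>K. am (\<Phi>' d) \<in> derivations S d" using adj_map_derivation[OF K(3,4)] by blast
    ultimately show "am \<Phi> \<in> GVF" unfolding graded_vector_fields_def mem_Collect_eq
      using K(1) by (intro exI[of _ K] exI[of _ "\<lambda>d. am (\<Phi>' d)"] conjI)
  qed
qed

lemma adj_map_GVF: "\<Phi> \<in> AM \<Longrightarrow> am \<Phi> \<in> GVF"
  by (simp add: GVF_eq)

lemma GVF_adj_map:
  assumes "D \<in> GVF"
  obtains \<Phi> where "\<Phi> \<in> AM" "am \<Phi> = D"
  using assms unfolding GVF_eq by (elim imageE) (rule that, simp_all)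

lemma GVF_add: "D \<in> GVF \<Longrightarrow> D' \<in> GVF \<Longrightarrow> D + D' \<in> GVF"
proof (elim GVF_adj_map)
  fix \<Phi> \<Psi> assume *: "\<Phi> \<in> AM" "\<Psi> \<in> AM" "am \<Phi> = D" "am \<Psi> = D'"
  show "D + D' \<in> GVF"
    using adj_map_GVF[OF AM_add[OF *(1,2)]] by (simp only: adj_map_add[OF *(1,2)] *(3,4))
qed

lemma mu_nabla_eq: "mu_nabla S nab = am"
  unfolding mu_nabla_def
proof (rule graded_extension_eq)
  show "graded_linear S GVF vf_act am"
    unfolding graded_linear_def by (intro ballI conjI adj_map_GVF adj_map_add adj_map_act)
  show "am \<Phi> = 0" if "\<Phi> \<notin> AM" for \<Phi> using that by (simp add: adj_map_def)
  \<comment> \<open>The locality required for uniqueness of the extension: operators agree if their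
    values do, and values may be compared after multiplication by a function that is nonzero at the
    given point.\<close>
  show "D = D'" if l: "\<And>x. \<exists>f\<in>Cinf S. f x \<noteq> 0 \<and> vf_act (deg0 S f) D = vf_act (deg0 S f) D'" for D D'
  proof
    fix \<eta>
    show "D \<eta> = D' \<eta>"
    proof (rule form_local_eqI)
      fix x
      obtain f where f: "f \<in> Cinf S" "f x \<noteq> 0" "vf_act (deg0 S f) D = vf_act (deg0 S f) D'" using l by blast
      show "\<exists>f\<in>Cinf S. f x \<noteq> 0 \<and> deg0 S f \<cdot> D \<eta> = deg0 S f \<cdot> D' \<eta>"
        using f(1,2) fun_cong[OF f(3), of \<eta>] unfolding vf_act_def by blast
    qed
  qed
qed (simp_all add: adj_map_generators hatT_eq hatQ_eq hatB_eq)

end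

section \<open>The adjoint representation\<close>

lemma homogeneous_mk_form: "d = int p + 2 * int k \<Longrightarrow> homogeneous d (mk_form S p k g)"
  by (auto simp: homogeneous_def mk_form_def)

context lie_data_conn
begin

lemma GVF_value:
  assumes "D \<in> GVF"
  shows "D \<xi> \<in> GF" "\<xi> \<notin> GF \<Longrightarrow> D \<xi> = 0" "D 0 = 0"
proof -
  obtain K F where K: "finite K" "\<And>k. k \<in> K \<Longrightarrow> F k \<in> derivations S k" "D = (\<Sum>k\<in>K. F k)"
    using assms unfolding graded_vector_fields_def by blast
  have D: "D \<xi> = (\<Sum>k\<in>K. F k \<xi>)" for \<xi>
    unfolding K(3) by (induction K rule: infinite_finite_induct) (simp_all add: operator_apply)
  have off: "F k \<xi> = 0" if "k \<in> K" "\<xi> \<notin> GF" for k \<xi> using derivationsD(1)[OF K(2)[OF that(1)] that(2)] .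
  have on: "F k \<xi> \<in> GF" if "k \<in> K" for k \<xi>
    using derivationsD(2)[OF K(2)[OF that]] off[OF that] by (cases "\<xi> \<in> GF") (simp_all add: GF_zero)
  show "D \<xi> \<in> GF" unfolding D by (intro GF_sum on)
  show "D \<xi> = 0" if "\<xi> \<notin> GF" unfolding D using off[OF _ that] by (intro sum.neutral ballI)
  show "D 0 = 0" unfolding D using derivation_zero[OF K(2)] by (intro sum.neutral ballI)
qed

text \<open>Surjectivity provides a preimage that is homogeneous of degree \<open>d\<close>, and
  injectivity identifies it with \<open>\<Phi>\<close>. Degrees of triples can thus be read off from
  their derivations.\<close>

lemma adj_map_homogeneousD:
  assumes "\<Phi> \<in> AM" "am \<Phi> \<in> derivations S d"
  shows "adj_homogeneous d \<Phi>"
proof -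
  obtain \<Psi> where \<Psi>: "\<Psi> \<in> AM" "adj_homogeneous d \<Psi>" "am \<Psi> = am \<Phi>" by (rule adj_map_surj[OF assms(2)]) (rule that)
  then have "\<Psi> = \<Phi>" using assms(1) by (intro adj_map_inj)
  then show ?thesis using \<Psi>(2) by simp
qed

section \<open>The graded commutator with a derivation of square zero\<close>

context
  fixes V :: "('m, 'q, 'b) operator"
  assumes V: "V \<in> derivations S 1" and VV: "\<forall>\<xi>\<in>GF. V (V \<xi>) = 0"
begin

lemmas V_value = GVF_value[OF derivation_GVF[OF V]]

lemma commutator_homogeneous:
  assumes D: "D \<in> derivations S k"
  shows "commutator V D \<xi> = V (D \<xi>) - sgn_pow k *\<^sub>R D (V \<xi>)"
  unfolding commutator_def derivation_parity[OF D V_value(1)] by (simp only: parity_linear)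

text \<open>The mixed products of \<open>V \<xi>\<close> with \<open>D \<eta>\<close> and of
  \<open>D \<xi>\<close> with \<open>V \<eta>\<close> occur in both compositions. After
  multiplication by \<open>sgn_pow k\<close>, whose square is 1, their coefficients coincide and
  they cancel.\<close>

lemma commutator_derivation:
  assumes D: "D \<in> derivations S k"
  shows "commutator V D \<in> derivations S (k + 1)"
proof (rule derivationsI)
  note DV = derivationsD[OF V] and DD = derivationsD[OF D]
  note D_value = GVF_value[OF derivation_GVF[OF D]]
  note c = commutator_homogeneous[OF D]
  show "commutator V D \<xi> = 0" if "\<xi> \<notin> GF" for \<xi>
    by (simp add: c V_value(2)[OF that] D_value(2)[OF that] V_value(3) D_value(3))
  show "commutator V D \<xi> \<in> GF" for \<xi>
    unfolding c by (intro GF_diff GF_scaleR V_value(1) D_value(1))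
  show "commutator V D (r *\<^sub>R \<xi>) = r *\<^sub>R commutator V D \<xi>" if "\<xi> \<in> GF" for r \<xi>
    unfolding c DD(3)[OF that] DV(3)[OF that] DD(3)[OF V_value(1)] DV(3)[OF D_value(1)]
    by (simp add: scaleR_diff_right)
  show "commutator V D (\<xi> + \<eta>) = commutator V D \<xi> + commutator V D \<eta>" if "\<xi> \<in> GF" "\<eta> \<in> GF" for \<xi> \<eta>
    unfolding c DD(4)[OF that] DV(4)[OF that] DD(4)[OF V_value(1) V_value(1)] DV(4)[OF D_value(1) D_value(1)]
    by (simp add: scaleR_add_right)
  show "homogeneous (d + (k + 1)) (commutator V D \<xi>)" if "\<xi> \<in> GF" "homogeneous d \<xi>" for d \<xi>
  proof -
    have "homogeneous (d + k + 1) (V (D \<xi>))" "homogeneous (d + 1 + k) (D (V \<xi>))"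
      by (rule DV(5)[OF D_value(1) DD(5)[OF that]], rule DD(5)[OF V_value(1) DV(5)[OF that]])
    then show ?thesis unfolding c by (intro homogeneous_diff homogeneous_scaleR) (simp_all add: ac_simps)
  qed
  show "commutator V D (\<xi> \<cdot> \<eta>) = commutator V D \<xi> \<cdot> \<eta> + sgn_pow ((k + 1) * d) *\<^sub>R (\<xi> \<cdot> commutator V D \<eta>)"
    if \<xi>: "\<xi> \<in> GF" and d: "homogeneous d \<xi>" and \<eta>: "\<eta> \<in> GF" for \<xi> \<eta> d
  proof -
    define a b c where "a = sgn_pow k" and "b = sgn_pow d" and "c = sgn_pow (k * d)"
    have s: "sgn_pow (1 * (d + k)) = a * b" "sgn_pow (k * (d + 1)) = a * c" "sgn_pow ((k + 1) * d) = b * c"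
      "sgn_pow (1 * d) = b" by (simp_all add: a_def b_def c_def sgn_pow_add algebra_simps)
    have aa: "a * (a * x) = x" for x
      using sgn_pow_square[of k] by (simp add: a_def mult.assoc[symmetric])
    have V_lin: "V (\<xi>' + r *\<^sub>R \<eta>') = V \<xi>' + r *\<^sub>R V \<eta>'" and D_lin: "D (\<xi>' + r *\<^sub>R \<eta>') = D \<xi>' + r *\<^sub>R D \<eta>'"
      if "\<xi>' \<in> GF" "\<eta>' \<in> GF" for \<xi>' \<eta>' r
      using that by (simp_all add: DV(3,4) DD(3,4) GF_scaleR)
    have VD: "V (D (\<xi> \<cdot> \<eta>)) = V (D \<xi>) \<cdot> \<eta> + (a * b) *\<^sub>R (D \<xi> \<cdot> V \<eta>) +
        c *\<^sub>R (V \<xi> \<cdot> D \<eta> + b *\<^sub>R (\<xi> \<cdot> V (D \<eta>)))"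
      unfolding DD(6)[OF \<xi> d \<eta>] V_lin[OF GF_wedge[OF D_value(1) \<eta>] GF_wedge[OF \<xi> D_value(1)]]
        DV(6)[OF D_value(1) DD(5)[OF \<xi> d] \<eta>] DV(6)[OF \<xi> d D_value(1)] s c_def[symmetric] ..
    have DV: "D (V (\<xi> \<cdot> \<eta>)) = D (V \<xi>) \<cdot> \<eta> + (a * c) *\<^sub>R (V \<xi> \<cdot> D \<eta>) +
        b *\<^sub>R (D \<xi> \<cdot> V \<eta> + c *\<^sub>R (\<xi> \<cdot> D (V \<eta>)))"
      unfolding DV(6)[OF \<xi> d \<eta>] D_lin[OF GF_wedge[OF V_value(1) \<eta>] GF_wedge[OF \<xi> V_value(1)]]
        DD(6)[OF V_value(1) DV(5)[OF \<xi> d] \<eta>] DD(6)[OF \<xi> d V_value(1)] s c_def[symmetric] ..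
    show ?thesis
      unfolding commutator_homogeneous[OF D] VD DV s a_def[symmetric]
      by (simp add: wedge_diff_left wedge_diff_right wedge_scaleR_left wedge_scaleR_right
          scaleR_add_right scaleR_diff_right aa mult.left_commute mult.commute)
  qed
qed

lemma commutator_add:
  assumes D: "D \<in> GVF" and D': "D' \<in> GVF"
  shows "commutator V (D + D') = commutator V D + commutator V D'"
proof
  fix \<xi>
  show "commutator V (D + D') \<xi> = (commutator V D + commutator V D') \<xi>"
    by (simp add: commutator_def operator_apply parity_linear
        derivationsD(4)[OF V GVF_value(1)[OF D] GVF_value(1)[OF D']])
qed

lemma commutator_scaleR:
  assumes D: "D \<in> GVF"
  shows "commutator V (r *\<^sub>R D) = r *\<^sub>R commutator V D"
proof
  fix \<xi>
  have s: "(r *\<^sub>R E) \<eta> = r *\<^sub>R E \<eta>" for E :: "('m, 'q, 'b) operator" and \<eta>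
    by (rule form_eqI) (simp add: scaleR_fun_def)
  show "commutator V (r *\<^sub>R D) \<xi> = (r *\<^sub>R commutator V D) \<xi>"
    unfolding s by (simp add: commutator_def s parity_linear scaleR_diff_right
        derivationsD(3)[OF V GVF_value(1)[OF D]])
qed

text \<open>Conjugation with \<open>parity\<close> turns multiplication by \<open>\<xi>\<close> into
  multiplication by \<open>sgn_pow d *\<^sub>R \<xi>\<close>. This is the sign that the Leibniz rule
  of \<open>V\<close> produces in its second term, so the two combine to a commutator.\<close>

lemma commutator_act:
  assumes D: "D \<in> GVF" and \<xi>: "\<xi> \<in> GF" "homogeneous d \<xi>"
  shows "commutator V (vf_act \<xi> D) = vf_act (V \<xi>) D + sgn_pow d *\<^sub>R vf_act \<xi> (commutator V D)"
proof
  fix \<eta>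
  have s: "(r *\<^sub>R E) \<eta> = r *\<^sub>R E \<eta>" for r and E :: "('m, 'q, 'b) operator" and \<eta>
    by (rule form_eqI) (simp add: scaleR_fun_def)
  show "commutator V (vf_act \<xi> D) \<eta> = (vf_act (V \<xi>) D + sgn_pow d *\<^sub>R vf_act \<xi> (commutator V D)) \<eta>"
    unfolding operator_apply s commutator_def vf_act_def derivationsD(6)[OF V \<xi> GVF_value(1)[OF D]]
      parity_wedge parity_homogeneous[OF \<xi>(2)]
    by (simp add: wedge_diff_right wedge_scaleR_left scaleR_diff_right)
qed

text \<open>Of the four terms of the iterated commutator, two contain \<open>V\<close> twice in a
  row, one of them after \<open>V\<close> is moved past \<open>parity\<close>. The other two cancel
  because \<open>V\<close> anticommutes with \<open>parity\<close>.\<close>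

lemma commutator_square:
  assumes D: "D \<in> GVF"
  shows "commutator V (commutator V D) = 0"
proof
  fix \<xi>
  note D_value = GVF_value[OF D]
  have VV0: "V (V \<eta>) = 0" for \<eta>
    using VV V_value(2)[of \<eta>] V_value(3) by (cases "\<eta> \<in> GF") simp_all
  have Vp: "V (parity \<eta>) = - parity (V \<eta>)" if "\<eta> \<in> GF" for \<eta>
    using derivation_parity[OF V that] by simp
  have pg: "parity (D \<eta>) \<in> GF" for \<eta> by (rule parity_GF[OF D_value(1)])
  have "V (parity (V \<xi>)) = 0"
    unfolding Vp[OF V_value(1)] VV0 by (simp add: parity_linear)
  moreover have "V (V (D \<xi>) - parity (D (parity (V \<xi>)))) = - V (parity (D (parity (V \<xi>))))"
    using derivationsD(4)[OF V V_value(1) GF_minus[OF pg], of "D \<xi>" "parity (V \<xi>)"]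
      derivationsD(3)[OF V pg, of "- 1" "parity (V \<xi>)"] by (simp add: VV0)
  ultimately show "commutator V (commutator V D) \<xi> = 0 \<xi>"
    unfolding commutator_def operator_apply
    by (simp add: Vp[OF D_value(1)] D_value(3) parity_linear)
qed

lemma commutator_GVF:
  assumes "D \<in> GVF"
  shows "commutator V D \<in> GVF"
proof -
  obtain K F where K: "finite K" "\<forall>k\<in>K. F k \<in> derivations S k" "D = (\<Sum>k\<in>K. F k)"
    using assms unfolding graded_vector_fields_def by blast
  have zero: "(0 :: ('m, 'q, 'b) operator) \<in> GVF" by (rule derivation_GVF[OF derivation_zero_op])
  have "(\<Sum>k\<in>K. F k) \<in> GVF \<and> commutator V (\<Sum>k\<in>K. F k) \<in> GVF"
    using K(1,2)
  proof (induction K rule: finite_induct)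
    case empty
    have "commutator V 0 = 0"
      using commutator_scaleR[OF zero, of 0] by simp
    then show ?case by (simp add: zero)
  next
    case (insert k K)
    then have F: "F k \<in> derivations S k" and IH: "(\<Sum>k\<in>K. F k) \<in> GVF" "commutator V (\<Sum>k\<in>K. F k) \<in> GVF"
      by blast+
    note G = derivation_GVF[OF F] derivation_GVF[OF commutator_derivation[OF F]]
    show ?case
      unfolding sum.insert[OF insert(1,2)] commutator_add[OF G(1) IH(1)]
      using GVF_add[OF G(1) IH(1)] GVF_add[OF G(2) IH(2)] by blast
  qed
  then show ?thesis unfolding K(3) by blast
qed

abbreviation "ad \<equiv> ad_operator S V nab"

lemma ad_AM: "\<Phi> \<in> AM \<Longrightarrow> ad \<Phi> \<in> AM"
  and ad_eval: "\<Phi> \<in> AM \<Longrightarrow> am (ad \<Phi>) = commutator V (am \<Phi>)"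
proof -
  assume "\<Phi> \<in> AM"
  then have c: "commutator V (am \<Phi>) \<in> am ` AM"
    using commutator_GVF[OF adj_map_GVF] unfolding GVF_eq by blast
  have ad: "ad \<Phi> = inv_into AM am (commutator V (am \<Phi>))"
    unfolding ad_operator_def mu_nabla_eq by simp
  show "ad \<Phi> \<in> AM" unfolding ad by (rule inv_into_into[OF c])
  show "am (ad \<Phi>) = commutator V (am \<Phi>)" unfolding ad by (rule f_inv_into_f[OF c])
qed

text \<open>Every clause is an equation or a degree statement in the module, and holds because
  \<open>am\<close> is injective and the graded commutator satisfies the corresponding clause among
  graded vector fields.\<close>

lemma rep_up_to_homotopy_ad: "rep_up_to_homotopy S V ad"
  unfolding rep_up_to_homotopy_def
proof (intro ballI allI impI conjI)
  fix \<Phi> assume \<Phi>: "\<Phi> \<in> AM"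
  note G = adj_map_GVF[OF \<Phi>]
  show adAM: "ad \<Phi> \<in> AM" by (rule ad_AM[OF \<Phi>])
  show "ad (ad \<Phi>) = 0"
  proof (rule adj_map_eq_zeroD[OF ad_AM[OF adAM]])
    show "am (ad (ad \<Phi>)) = 0"
      unfolding ad_eval[OF adAM] ad_eval[OF \<Phi>] by (rule commutator_square[OF G])
  qed
  show "ad (r *\<^sub>R \<Phi>) = r *\<^sub>R ad \<Phi>" for r
  proof (rule adj_map_inj[OF ad_AM[OF AM_scaleR[OF \<Phi>]] AM_scaleR[OF adAM]])
    show "am (ad (r *\<^sub>R \<Phi>)) = am (r *\<^sub>R ad \<Phi>)"
      unfolding ad_eval[OF AM_scaleR[OF \<Phi>]] adj_map_scaleR[OF \<Phi>] adj_map_scaleR[OF adAM] ad_eval[OF \<Phi>]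
      by (rule commutator_scaleR[OF G])
  qed
  show "ad (\<Phi> + \<Psi>) = ad \<Phi> + ad \<Psi>" if \<Psi>: "\<Psi> \<in> AM" for \<Psi>
  proof (rule adj_map_inj[OF ad_AM[OF AM_add[OF \<Phi> \<Psi>]] AM_add[OF adAM ad_AM[OF \<Psi>]]])
    show "am (ad (\<Phi> + \<Psi>)) = am (ad \<Phi> + ad \<Psi>)"
      unfolding ad_eval[OF AM_add[OF \<Phi> \<Psi>]] adj_map_add[OF \<Phi> \<Psi>] adj_map_add[OF adAM ad_AM[OF \<Psi>]]
        ad_eval[OF \<Phi>] ad_eval[OF \<Psi>] by (rule commutator_add[OF G adj_map_GVF[OF \<Psi>]])
  qed
  show "adj_homogeneous (d + 1) (ad \<Phi>)" if "adj_homogeneous d \<Phi>" for d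
    by (rule adj_map_homogeneousD[OF adAM])
      (unfold ad_eval[OF \<Phi>], rule commutator_derivation[OF adj_map_derivation[OF \<Phi> that]])
  fix \<xi> d assume \<xi>: "\<xi> \<in> GF" "homogeneous d \<xi>"
  note a = AM_act[OF \<xi>(1) \<Phi>] and b = AM_act[OF V_value(1)[of \<xi>] \<Phi>] and c = AM_act[OF \<xi>(1) adAM]
  show "ad (adj_act \<xi> \<Phi>) = adj_act (V \<xi>) \<Phi> + sgn_pow d *\<^sub>R adj_act \<xi> (ad \<Phi>)"
  proof (rule adj_map_inj[OF ad_AM[OF a] AM_add[OF b AM_scaleR[OF c]]])
    show "am (ad (adj_act \<xi> \<Phi>)) = am (adj_act (V \<xi>) \<Phi> + sgn_pow d *\<^sub>R adj_act \<xi> (ad \<Phi>))"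
      unfolding ad_eval[OF a] adj_map_act[OF \<Phi> \<xi>(1)] adj_map_add[OF b AM_scaleR[OF c]] adj_map_scaleR[OF c]
        adj_map_act[OF \<Phi> V_value(1)] adj_map_act[OF adAM \<xi>(1)] ad_eval[OF \<Phi>]
      by (rule commutator_act[OF G \<xi>])
  qed
qed

end

end

section \<open>Changing the pair of connections\<close>

locale lie_data_conn2 = A: lie_data_conn S nab + B: lie_data_conn S nab'
  for S :: "('m::{t2_space,second_countable_topology}, 'q::real_vector, 'b::real_vector) split_data"
    and nab nab' :: "('m, 'q, 'b) conn_pair"
begin

abbreviation "triple X \<equiv> (deg0 S X, mu1 S nab nab' X, mu0b S nab nab' X)"

lemma triple_AM:
  assumes X: "X \<in> vfields S"
  shows "triple X \<in> adj_module S"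
proof -
  have "mk_form S (Suc 0) 0 (\<lambda>qs _. (\<lambda>q. fst nab' X q - fst nab X q) (qs ! 0)) \<in> forms S (secQ S)"
    by (rule A.forms_mk_form_10[OF A.smod_secQ])
      (simp_all add: A.smod_diff[OF A.smod_secQ] A.connQ[OF X] B.connQ[OF X] fscale_diff_right)
  moreover have "mk_form S 0 (Suc 0) (\<lambda>_ \<beta>s. (\<lambda>\<beta>. snd nab' X \<beta> - snd nab X \<beta>) (\<beta>s ! 0)) \<in> forms S (secBd S)"
    by (rule A.forms_mk_form_01[OF A.smod_secBd])
      (simp_all add: A.smod_diff[OF A.smod_secBd] A.connB[OF X] B.connB[OF X] fscale_diff_right)
  ultimately show ?thesis
    by (simp add: A.AM_iff A.forms_deg0[OF A.smod_vfields X] mu1_def mu0b_def)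
qed

lemma triple_apply:
  shows "mu1 S nab nab' X qs \<beta>s =
      (if \<beta>s = [] \<and> length qs = 1 \<and> hd qs \<in> secQ S then fst nab' X (hd qs) - fst nab X (hd qs) else 0)"
    and "mu0b S nab nab' X qs \<beta>s =
      (if qs = [] \<and> length \<beta>s = 1 \<and> hd \<beta>s \<in> secBd S then snd nab' X (hd \<beta>s) - snd nab X (hd \<beta>s) else 0)"
  using mk_form_10[of S "\<lambda>q. fst nab' X q - fst nab X q" qs \<beta>s]
    mk_form_01[of S "\<lambda>\<beta>. snd nab' X \<beta> - snd nab X \<beta>" qs \<beta>s] by (simp_all add: mu1_def mu0b_def)

text \<open>The two lifts of \<open>X\<close> differ by the derivation that the difference of the connections induces.\<close>

lemma adj_map_triple:
  assumes X: "X \<in> vfields S"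
  shows "A.adj_map nab' (triple X) = A.HT nab X"
proof (rule A.derivation_eqI[OF B.adj_map_derivation A.HT_derivation[OF X]])
  note AM = triple_AM[OF X]
  show "triple X \<in> adj_module S" by (rule AM)
  show "adj_homogeneous 0 (triple X)"
    by (simp add: adj_homogeneous_def homogeneous_deg0 mu1_def mu0b_def homogeneous_mk_form)
  note ev = B.adj_map_eval[OF AM, unfolded B.ext_hat_deg0s]
  show "A.adj_map nab' (triple X) (deg0 S f) = A.HT nab X (deg0 S f)" if f: "f \<in> Cinf S" for f
    by (rule form_eqI) (simp add: ev(1)[OF f] A.HT_deg0[OF X f] deg0_apply A.lie_deriv_linear)
  show "A.adj_map nab' (triple X) (genQ S \<tau>) = A.HT nab X (genQ S \<tau>)" if \<tau>: "\<tau> \<in> secQd S" for \<tau>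
    by (rule form_eqI) (simp add: ev(2)[OF \<tau>] A.HT_genQ[OF X \<tau>] B.HT_genQ[OF X \<tau>] triple_apply
        A.pairing_diffQ[OF \<tau>] A.connQ[OF X] B.connQ[OF X] A.pairing_zeroQ[OF \<tau>])
  show "A.adj_map nab' (triple X) (genB S b) = A.HT nab X (genB S b)" if b: "b \<in> secB S" for b
    by (rule form_eqI) (simp add: ev(3)[OF b] A.HT_genB[OF X b] B.HT_genB[OF X b] triple_apply
        A.pairing_diff_left A.pairing_zero_left)
qed

text \<open>With this definition, linearity, invertibility and compatibility with the operators are
  formal. The difference of the connections enters only through the values on generators, which
  identify this map with \<open>mu_change\<close>.\<close>

definition change :: "('m, 'q, 'b) adj_elem \<Rightarrow> ('m, 'q, 'b) adj_elem" where
  "change \<Phi> = (if \<Phi> \<in> adj_module S then inv_into (adj_module S) (A.adj_map nab') (A.adj_map nab \<Phi>) else 0)"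

lemma change_AM: "\<Phi> \<in> adj_module S \<Longrightarrow> change \<Phi> \<in> adj_module S"
  and adj_map_change: "\<Phi> \<in> adj_module S \<Longrightarrow> A.adj_map nab' (change \<Phi>) = A.adj_map nab \<Phi>"
proof -
  assume \<Phi>: "\<Phi> \<in> adj_module S"
  then have m: "A.adj_map nab \<Phi> \<in> A.adj_map nab' ` adj_module S"
    using A.adj_map_GVF unfolding B.GVF_eq by blast
  have c: "change \<Phi> = inv_into (adj_module S) (A.adj_map nab') (A.adj_map nab \<Phi>)"
    using \<Phi> by (simp add: change_def)
  show "change \<Phi> \<in> adj_module S" unfolding c by (rule inv_into_into[OF m])
  show "A.adj_map nab' (change \<Phi>) = A.adj_map nab \<Phi>" unfolding c by (rule f_inv_into_f[OF m])
qed

text \<open>The image of a triple is recognised by its derivation with respect to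
  \<open>nab'\<close>; all computations with \<open>change\<close> go through this
  criterion.\<close>

lemma change_eqI: "\<Phi> \<in> adj_module S \<Longrightarrow> \<Psi> \<in> adj_module S \<Longrightarrow> A.adj_map nab' \<Psi> = A.adj_map nab \<Phi> \<Longrightarrow> change \<Phi> = \<Psi>"
  by (rule B.adj_map_inj[OF change_AM]) (simp_all add: adj_map_change)

lemma change_generators:
  shows "X \<in> vfields S \<Longrightarrow> change (adjT S X) = triple X" "q \<in> secQ S \<Longrightarrow> change (adjQ S q) = adjQ S q"
    "\<beta> \<in> secBd S \<Longrightarrow> change (adjB S \<beta>) = adjB S \<beta>"
  by (rule change_eqI; simp add: A.adjT_AM A.adjQ_AM A.adjB_AM triple_AM adj_map_triple
      A.adj_map_generators B.adj_map_generators)+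

lemma change_linear: "graded_linear S (adj_module S) adj_act change"
  unfolding graded_linear_def
proof (intro ballI conjI change_AM)
  fix \<Phi> assume \<Phi>: "\<Phi> \<in> adj_module S"
  note c = change_AM[OF \<Phi>]
  show "change (\<Phi> + \<Psi>) = change \<Phi> + change \<Psi>" if \<Psi>: "\<Psi> \<in> adj_module S" for \<Psi>
    by (rule change_eqI[OF A.AM_add[OF \<Phi> \<Psi>] A.AM_add[OF c change_AM[OF \<Psi>]]])
      (simp only: A.adj_map_add[OF \<Phi> \<Psi>] B.adj_map_add[OF c change_AM[OF \<Psi>]] adj_map_change[OF \<Phi>] adj_map_change[OF \<Psi>])
  show "change (adj_act \<xi> \<Phi>) = adj_act \<xi> (change \<Phi>)" if \<xi>: "\<xi> \<in> graded_functions S" for \<xi>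
    by (rule change_eqI[OF A.AM_act[OF \<xi> \<Phi>] A.AM_act[OF \<xi> c]])
      (simp only: A.adj_map_act[OF \<Phi> \<xi>] B.adj_map_act[OF c \<xi>] adj_map_change[OF \<Phi>])
qed

lemma mu_change_eq: "mu_change S nab nab' = change"
  unfolding mu_change_def
proof (rule A.graded_extension_eq)
  show "graded_linear S (adj_module S) adj_act change" by (rule change_linear)
  show "change \<Phi> = 0" if "\<Phi> \<notin> adj_module S" for \<Phi> using that by (simp add: change_def)
  fix \<Phi> \<Psi> :: "('m, 'q, 'b) adj_elem"
  assume l: "\<And>x. \<exists>f\<in>Cinf S. f x \<noteq> 0 \<and> adj_act (deg0 S f) \<Phi> = adj_act (deg0 S f) \<Psi>"
  obtain \<Phi>T \<Phi>Q \<Phi>B where \<Phi>: "\<Phi> = (\<Phi>T, \<Phi>Q, \<Phi>B)" by (cases \<Phi>)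
  obtain \<Psi>T \<Psi>Q \<Psi>B where \<Psi>: "\<Psi> = (\<Psi>T, \<Psi>Q, \<Psi>B)" by (cases \<Psi>)
  have l': "\<exists>f\<in>Cinf S. f x \<noteq> 0 \<and> deg0 S f \<cdot> \<Phi>T = deg0 S f \<cdot> \<Psi>T \<and> deg0 S f \<cdot> \<Phi>Q = deg0 S f \<cdot> \<Psi>Q \<and>
      deg0 S f \<cdot> \<Phi>B = deg0 S f \<cdot> \<Psi>B" for x
    using l[of x] by (simp add: \<Phi> \<Psi> adj_act_def)
  have "\<Phi>T = \<Psi>T" by (rule A.form_local_eqI) (use l' in blast)
  moreover have "\<Phi>Q = \<Psi>Q" by (rule A.form_local_eqI) (use l' in blast)
  moreover have "\<Phi>B = \<Psi>B" by (rule A.form_local_eqI) (use l' in blast)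
  ultimately show "\<Phi> = \<Psi>" by (simp add: \<Phi> \<Psi>)
qed (simp_all add: change_generators)

lemma rep_morphism_change:
  assumes V: "V \<in> derivations S 1" and VV: "\<forall>\<xi>\<in>graded_functions S. V (V \<xi>) = 0"
  shows "rep_morphism S (ad_operator S V nab) (ad_operator S V nab') (mu_change S nab nab')"
  unfolding rep_morphism_def mu_change_eq
proof (intro conjI ballI allI impI)
  show "graded_linear S (adj_module S) adj_act change" by (rule change_linear)
  fix \<Phi> assume \<Phi>: "\<Phi> \<in> adj_module S"
  note adA = A.ad_AM[OF V VV] A.ad_eval[OF V VV] and adB = B.ad_AM[OF V VV] B.ad_eval[OF V VV]
  note c = change_AM[OF \<Phi>]
  show "change (ad_operator S V nab \<Phi>) = ad_operator S V nab' (change \<Phi>)"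
  proof (rule change_eqI)
    show "ad_operator S V nab \<Phi> \<in> adj_module S" by (rule adA(1)[OF \<Phi>])
    show "ad_operator S V nab' (change \<Phi>) \<in> adj_module S" by (rule adB(1)[OF c])
    have "A.adj_map nab' (ad_operator S V nab' (change \<Phi>)) = commutator V (A.adj_map nab' (change \<Phi>))"
      by (rule adB(2)[OF c])
    also have "\<dots> = commutator V (A.adj_map nab \<Phi>)" unfolding adj_map_change[OF \<Phi>] ..
    also have "\<dots> = A.adj_map nab (ad_operator S V nab \<Phi>)" by (rule adA(2)[OF \<Phi>, symmetric])
    finally show "A.adj_map nab' (ad_operator S V nab' (change \<Phi>)) = A.adj_map nab (ad_operator S V nab \<Phi>)" .
  qed
  \<comment> \<open>Degree preservation is tested on derivations: \<open>change \<Phi>\<close> and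
    \<open>\<Phi>\<close> have the same derivation, with respect to their own pairs of
    connections.\<close>
  fix d assume "adj_homogeneous d \<Phi>"
  then have "A.adj_map nab' (change \<Phi>) \<in> derivations S d"
    unfolding adj_map_change[OF \<Phi>] by (rule A.adj_map_derivation[OF \<Phi>])
  then show "adj_homogeneous d (change \<Phi>)" by (rule B.adj_map_homogeneousD[OF c])
qed

end

theorem proposition6p5p2:
  fixes S :: "('m::{t2_space,second_countable_topology}, 'q::real_vector, 'b::real_vector) split_data"
    and V :: "('m, 'q, 'b) operator"
    and nab nab' :: "('m, 'q, 'b) conn_pair"
  assumes "split_lie_2_algebroid S"
    and "homological_vector_field S V"
    and "connection_pair S nab"
    and "connection_pair S nab'"
  shows "rep_isomorphism S V (ad_operator S V nab) (ad_operator S V nab') (mu_change S nab nab') \<and>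
    (\<forall>X\<in>vfields S. mu_change S nab nab' (adjT S X) =
       (deg0 S X, mu1 S nab nab' X, mu0b S nab nab' X)) \<and>
    (\<forall>q\<in>secQ S. mu_change S nab nab' (adjQ S q) = adjQ S q) \<and>
    (\<forall>\<beta>\<in>secBd S. mu_change S nab nab' (adjB S \<beta>) = adjB S \<beta>)"
proof -
  have data: "lie_data S"
    using assms(1) unfolding split_lie_2_algebroid_def lie_data_def by blast
  have conn: "lie_data_conn S nab" "lie_data_conn S nab'"
    using data assms(3,4) unfolding lie_data_conn_def lie_data_conn_axioms_def by blast+
  interpret A: lie_data_conn S nab by (rule conn(1))
  interpret B: lie_data_conn S nab' by (rule conn(2))
  interpret AB: lie_data_conn2 S nab nab' unfolding lie_data_conn2_def using conn by blast
  \<comment> \<open>The same theory with the two pairs exchanged supplies the inverse: going back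
    returns the triple whose derivation with respect to \<open>nab\<close> is the one at the
    start.\<close>
  interpret BA: lie_data_conn2 S nab' nab unfolding lie_data_conn2_def using conn by blast
  have V: "V \<in> derivations S 1" and VV: "\<forall>\<xi>\<in>graded_functions S. V (V \<xi>) = 0"
    using assms(2) unfolding homological_vector_field_def by blast+
  have AB: "BA.change (AB.change \<Phi>) = \<Phi>" if "\<Phi> \<in> adj_module S" for \<Phi>
    using that by (intro BA.change_eqI AB.change_AM AB.adj_map_change[symmetric])
  have BA: "AB.change (BA.change \<Phi>) = \<Phi>" if "\<Phi> \<in> adj_module S" for \<Phi>
    using that by (intro AB.change_eqI BA.change_AM BA.adj_map_change[symmetric])
  have "rep_isomorphism S V (ad_operator S V nab) (ad_operator S V nab') (mu_change S nab nab')"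
    unfolding rep_isomorphism_def
  proof (intro conjI exI[of _ "mu_change S nab' nab"] ballI)
    show "rep_up_to_homotopy S V (ad_operator S V nab)" by (rule A.rep_up_to_homotopy_ad[OF V VV])
    show "rep_up_to_homotopy S V (ad_operator S V nab')" by (rule B.rep_up_to_homotopy_ad[OF V VV])
    show "rep_morphism S (ad_operator S V nab) (ad_operator S V nab') (mu_change S nab nab')"
      by (rule AB.rep_morphism_change[OF V VV])
    show "rep_morphism S (ad_operator S V nab') (ad_operator S V nab) (mu_change S nab' nab)"
      by (rule BA.rep_morphism_change[OF V VV])
    fix \<Phi> assume "\<Phi> \<in> adj_module S"
    then show "mu_change S nab' nab (mu_change S nab nab' \<Phi>) = \<Phi>"
      "mu_change S nab nab' (mu_change S nab' nab \<Phi>) = \<Phi>"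
      by (simp_all only: AB.mu_change_eq BA.mu_change_eq AB BA)
  qed
  then show ?thesis using AB.change_generators by (simp only: AB.mu_change_eq) blast
qed

end
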